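(* Let $P$ be a simple $\mathcal{K}_d$-module which is a finitely generated $U(\mathfrak{h})$-module of rank $r$. Then: (1) $\operatorname{rank}\mathfrak{L}_d(P,i)=\operatorname{rank}\tilde{\mathfrak{L}}_d(P,i)=r\binom{d-1}{i-1}$ for all $i=1,2,\dots,d$; (2) $\dim\big(\mathfrak{L}_d(P,i)/I_0\mathfrak{L}_d(P,i)\big)=r\binom{d}{i-1}$ for all $i=1,2,\dots,d$; (3) $\mathfrak{L}_d(P,1)\cong\mathcal{F}(P,V(\delta_0,0))$ is a free $U(\mathfrak{h})$-module; (4) $\mathfrak{L}_d(P,i)$ is not a free $U(\mathfrak{h})$-module for $i=2,3,\dots,d$.
   Context: All algebras and vector spaces are over $\mathbb{C}$, and $d\ge 1$ is a fixed integer. Let $A_d=\mathbb{C}[x_1^{\pm1},\dots,x_d^{\pm1}]$, $x^r=x_1^{r_1}\cdots x_d^{r_d}$ for $r\in\mathbb{Z}^d$, $\partial_i=x_i\frac{\partial}{\partial x_i}$, $(u|v)=u^Tv$ for $u,v\in\mathbb{C}^d$, and $e_1,\dots,e_d$ the standard basis of $\mathbb{C}^d$. The Witt algebra $W_d$ is the Lie algebra of derivations of $A_d$. It is spanned by $D(u,r)=x^r\sum_{i=1}^d u_i\partial_i$ ($u\in\mathbb{C}^d$, $r\in\mathbb{Z}^d$), with $[D(u,r),D(v,s)]=D(w,r+s)$, $w=(u|s)v-(v|r)u$. $\mathfrak{h}=\mathrm{span}\{\partial_1,\dots,\partial_d\}$, $U(\mathfrak{h})=\mathbb{C}[\partial_1,\dots,\partial_d]$,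 and $I_0$ is the maximal ideal of $U(\mathfrak{h})$ generated by $\partial_1,\dots,\partial_d$. For a finitely generated torsion-free $U(\mathfrak{h})$-module $M$, $\operatorname{rank}M=\dim_H(H\otimes_{U(\mathfrak{h})}M)$, where $H$ is the fraction field of $U(\mathfrak{h})$. $\mathcal{K}_d=\mathbb{C}[x_1^{\pm1},\dots,x_d^{\pm1},\partial_1,\dots,\partial_d]$ is the Weyl algebra (unital associative algebra of differential operators on $A_d$), which contains $W_d$ as the Lie subalgebra spanned by all $x^r\partial_i$. For a $\mathfrak{gl}_d$-module $V$ and a $\mathcal{K}_d$-module $P$, $\mathcal{F}(P,V)=P\otimes V$ is the $W_d$-module with $$D(u,r)(z\otimes y)=D(u,r)z\otimes y+x^rz\otimes (ru^T)y.$$ For $0\le k\le d$, $V(\delta_k,k)=\bigwedge^k(\mathbb{C}^d)$ is the $k$-th exterior power of the natural $\mathfrak{gl}_d$-module ($V(\delta_0,0)=\mathbb{C}$ is the trivial module, and $v\wedge a=av$ for $v\in\mathbb{C}^d$, $a\in\mathbb{C}$). For $k=1,\dots,d$ there is a $W_d$-module homomorphism $$\pi_{k-1}:\mathcal{F}(P,V(\delta_{k-1},k-1))\to\mathcal{F}(P,V(\delta_k,k)),\quad y\otimes v\mapsto\sum_{j=1}^d\partial_jy\otimes (e_j\wedge v),$$ and $\pi_d=0$ on $\mathcal{F}(P,V(\delta_d,d))$. Put $\mathfrak{L}_d(P,k)=\operatorname{Im}\pi_{k-1}$ and $\tilde{\mathfrak{L}}_d(P,k)=\operatorname{Ker}\pi_k$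 for $k=1,\dots,d$. *)

theory Defs
  imports
    "HOL-Analysis.Finite_Cartesian_Product"
    "HOL-Library.Poly_Mapping"
    "HOL-Computational_Algebra.Fraction_Field"
    "HOL-Algebra.Ideal"
    "HOL-Algebra.Generated_Groups"
    "HOL-Algebra.Free_Abelian_Groups"
    "Jordan_Normal_Form.Missing_VectorSpace"
begin

text \<open>
  The integer \<open>d \<ge> 1\<close> is the cardinality of a finite index type \<open>'d\<close>. Its linear order plays the role of
  \<open>1 < \<dots> < d\<close>: it orders the factors of the standard basis vectors of the exterior powers.
  Modules are records of \<open>HOL-Algebra\<close>; their ring multiplication and unit fields carry no meaning.
\<close>

abbreviation type_ring :: "'a::{times,plus,one,zero} ring" where
  "type_ring \<equiv> \<lparr>carrier = UNIV, monoid.mult = (*), one = 1, ring.zero = 0, ring.add = (+)\<rparr>"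


section \<open>Modules\<close>

text \<open>The library's \<^locale>\<open>Module.module\<close> requires a commutative ring.\<close>

locale left_module = R?: ring R + M?: abelian_group M
  for R :: "('a, 'e) ring_scheme" (structure) and M :: "('a, 'b, 'f) module_scheme" (structure) +
  assumes smult_closed:
      "\<lbrakk>a \<in> carrier R; x \<in> carrier M\<rbrakk> \<Longrightarrow> a \<odot>\<^bsub>M\<^esub> x \<in> carrier M"
    and smult_l_distr:
      "\<lbrakk>a \<in> carrier R; b \<in> carrier R; x \<in> carrier M\<rbrakk>
        \<Longrightarrow> (a \<oplus>\<^bsub>R\<^esub> b) \<odot>\<^bsub>M\<^esub> x = a \<odot>\<^bsub>M\<^esub> x \<oplus>\<^bsub>M\<^esub> b \<odot>\<^bsub>M\<^esub> x"
    and smult_r_distr: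
      "\<lbrakk>a \<in> carrier R; x \<in> carrier M; y \<in> carrier M\<rbrakk>
        \<Longrightarrow> a \<odot>\<^bsub>M\<^esub> (x \<oplus>\<^bsub>M\<^esub> y) = a \<odot>\<^bsub>M\<^esub> x \<oplus>\<^bsub>M\<^esub> a \<odot>\<^bsub>M\<^esub> y"
    and smult_assoc:
      "\<lbrakk>a \<in> carrier R; b \<in> carrier R; x \<in> carrier M\<rbrakk>
        \<Longrightarrow> (a \<otimes>\<^bsub>R\<^esub> b) \<odot>\<^bsub>M\<^esub> x = a \<odot>\<^bsub>M\<^esub> (b \<odot>\<^bsub>M\<^esub> x)"
    and smult_one:
      "x \<in> carrier M \<Longrightarrow> \<one>\<^bsub>R\<^esub> \<odot>\<^bsub>M\<^esub> x = x"

definition simple_left_module ::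
    "('a, 'e) ring_scheme \<Rightarrow> ('a, 'b, 'f) module_scheme \<Rightarrow> bool" where
  "simple_left_module R M \<longleftrightarrow>
     left_module R M \<and> carrier M \<noteq> {\<zero>\<^bsub>M\<^esub>} \<and>
     (\<forall>N. additive_subgroup N M \<and> (\<forall>a\<in>carrier R. \<forall>x\<in>N. a \<odot>\<^bsub>M\<^esub> x \<in> N)
        \<longrightarrow> N = {\<zero>\<^bsub>M\<^esub>} \<or> N = carrier M)"

definition finitely_generated ::
    "('a, 'e) ring_scheme \<Rightarrow> ('a, 'b, 'f) module_scheme \<Rightarrow> bool" where
  "finitely_generated R M \<longleftrightarrow>
     (\<exists>B. finite B \<and> B \<subseteq> carrier M \<and> module.span R M B = carrier M)"

definition free_module ::
    "('a, 'e) ring_scheme \<Rightarrow> ('a, 'b, 'f) module_scheme \<Rightarrow> bool" where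
  "free_module R M \<longleftrightarrow>
     (\<exists>B. B \<subseteq> carrier M \<and> \<not> module.lin_dep R M B \<and> module.span R M B = carrier M)"

text \<open>The conjunct \<^const>\<open>vectorspace.fin_dim\<close> is needed because \<^const>\<open>vectorspace.dim\<close> is an
  unspecified number for an infinite-dimensional space.\<close>

definition has_dim ::
    "('a, 'e) ring_scheme \<Rightarrow> ('a, 'b, 'f) module_scheme \<Rightarrow> nat \<Rightarrow> bool" where
  "has_dim K V n \<longleftrightarrow>
     vectorspace K V \<and> vectorspace.fin_dim K V \<and> vectorspace.dim K V = n"

definition with_smult ::
    "('c \<Rightarrow> 'b \<Rightarrow> 'b) \<Rightarrow> ('a, 'b, 'f) module_scheme \<Rightarrow> ('c, 'b) module" where
  "with_smult s M =
     \<lparr>carrier = carrier M, monoid.mult = monoid.mult M, one = one M, ring.zero = ring.zero M,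
      ring.add = ring.add M, smult = s\<rparr>"

definition ideal_times ::
    "'a set \<Rightarrow> ('a, 'b, 'f) module_scheme \<Rightarrow> 'b set" where
  "ideal_times I M = generate (add_monoid M) {a \<odot>\<^bsub>M\<^esub> x | a x. a \<in> I \<and> x \<in> carrier M}"

definition quotient_module ::
    "('a, 'b, 'f) module_scheme \<Rightarrow> 'b set \<Rightarrow> ('a, 'b set) module" where
  "quotient_module M N =
     \<lparr>carrier = a_rcosets\<^bsub>M\<^esub> N, monoid.mult = undefined, one = undefined, ring.zero = N,
      ring.add = set_add M, smult = (\<lambda>a X. \<Union>x\<in>X. N +>\<^bsub>M\<^esub> (a \<odot>\<^bsub>M\<^esub> x))\<rparr>"


section \<open>Tensor products\<close>

text \<open>The tensor product of two modules over a commutative ring is the free abelian group on the pairs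
  modulo the bilinearity relations, so \<open>x \<otimes> y\<close> is the coset of \<open>frag_of (x, y)\<close>.\<close>

definition tensor_relators ::
    "('a, 'e) ring_scheme \<Rightarrow> ('a, 'b, 'f) module_scheme \<Rightarrow> ('a, 'c, 'g) module_scheme
      \<Rightarrow> ('b \<times> 'c \<Rightarrow>\<^sub>0 int) set" where
  "tensor_relators R M N =
     {frag_of (x \<oplus>\<^bsub>M\<^esub> x', y) - frag_of (x, y) - frag_of (x', y) | x x' y.
        x \<in> carrier M \<and> x' \<in> carrier M \<and> y \<in> carrier N} \<union>
     {frag_of (x, y \<oplus>\<^bsub>N\<^esub> y') - frag_of (x, y) - frag_of (x, y') | x y y'.
        x \<in> carrier M \<and> y \<in> carrier N \<and> y' \<in> carrier N} \<union>
     {frag_of (a \<odot>\<^bsub>M\<^esub> x, y) - frag_of (x, a \<odot>\<^bsub>N\<^esub> y) | a x y.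
        a \<in> carrier R \<and> x \<in> carrier M \<and> y \<in> carrier N}"

definition tensor_group ::
    "('a, 'e) ring_scheme \<Rightarrow> ('a, 'b, 'f) module_scheme \<Rightarrow> ('a, 'c, 'g) module_scheme
      \<Rightarrow> ('b \<times> 'c \<Rightarrow>\<^sub>0 int) set monoid" where
  "tensor_group R M N =
     free_Abelian_group (carrier M \<times> carrier N) Mod
       generate (free_Abelian_group (carrier M \<times> carrier N)) (tensor_relators R M N)"

definition tensor_class ::
    "('a, 'e) ring_scheme \<Rightarrow> ('a, 'b, 'f) module_scheme \<Rightarrow> ('a, 'c, 'g) module_scheme
      \<Rightarrow> ('b \<times> 'c \<Rightarrow>\<^sub>0 int) \<Rightarrow> ('b \<times> 'c \<Rightarrow>\<^sub>0 int) set" where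
  "tensor_class R M N c =
     generate (free_Abelian_group (carrier M \<times> carrier N)) (tensor_relators R M N)
       #>\<^bsub>free_Abelian_group (carrier M \<times> carrier N)\<^esub> c"

text \<open>The additive map into \<open>M \<otimes> N\<close> that sends \<open>x \<otimes> y\<close> to the class of \<open>b (x, y)\<close>. It is independent of
  the chosen representative whenever the class of \<open>b (x, y)\<close> is bilinear in \<open>(x, y)\<close>.\<close>

definition tensor_map ::
    "('a, 'e) ring_scheme \<Rightarrow> ('a, 'b, 'f) module_scheme \<Rightarrow> ('a, 'c, 'g) module_scheme
      \<Rightarrow> ('x \<Rightarrow> ('b \<times> 'c \<Rightarrow>\<^sub>0 int)) \<Rightarrow> ('x \<Rightarrow>\<^sub>0 int) set \<Rightarrow> ('b \<times> 'c \<Rightarrow>\<^sub>0 int) set" where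
  "tensor_map R M N b X = tensor_class R M N (frag_extend b (SOME c. c \<in> X))"

definition tensor ::
    "('a, 'e) ring_scheme \<Rightarrow> ('a, 'b, 'f) module_scheme \<Rightarrow> ('a, 'c, 'g) module_scheme
      \<Rightarrow> ('a, ('b \<times> 'c \<Rightarrow>\<^sub>0 int) set) module" where
  "tensor R M N =
     \<lparr>carrier = carrier (tensor_group R M N), monoid.mult = undefined, one = undefined,
      ring.zero = one (tensor_group R M N), ring.add = monoid.mult (tensor_group R M N),
      smult = (\<lambda>a. tensor_map R M N (\<lambda>(x, y). frag_of (a \<odot>\<^bsub>M\<^esub> x, y)))\<rparr>"


section \<open>Laurent polynomials and the Weyl algebra\<close>

type_synonym 'd laurent = "(int ^ 'd) \<Rightarrow>\<^sub>0 complex"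

definition x_pow :: "int ^ 'd \<Rightarrow> 'd::finite laurent" where
  "x_pow r = Poly_Mapping.single r 1"

definition const_laurent :: "complex \<Rightarrow> 'd::finite laurent" where
  "const_laurent c = Poly_Mapping.single 0 c"

text \<open>\<open>\<partial>\<^sub>i = x\<^sub>i \<partial>/\<partial>x\<^sub>i\<close>, hence \<open>\<partial>\<^sub>i x\<^sup>s = s\<^sub>i x\<^sup>s\<close>.\<close>

definition partial :: "'d \<Rightarrow> 'd::finite laurent \<Rightarrow> 'd laurent" where
  "partial i = Poly_Mapping.mapp (\<lambda>s c. of_int (s $ i) * c)"

inductive_set weyl_operators :: "('d::finite laurent \<Rightarrow> 'd laurent) set" where
  laurent: "(\<lambda>a. f * a) \<in> weyl_operators"
| partial: "partial i \<in> weyl_operators"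
| add: "\<lbrakk>S \<in> weyl_operators; T \<in> weyl_operators\<rbrakk> \<Longrightarrow> (\<lambda>a. S a + T a) \<in> weyl_operators"
| comp: "\<lbrakk>S \<in> weyl_operators; T \<in> weyl_operators\<rbrakk> \<Longrightarrow> S \<circ> T \<in> weyl_operators"

definition weyl_algebra :: "('d::finite laurent \<Rightarrow> 'd laurent) ring" where
  "weyl_algebra =
     \<lparr>carrier = weyl_operators, monoid.mult = (\<circ>), one = id, ring.zero = (\<lambda>_. 0),
      ring.add = (\<lambda>S T a. S a + T a)\<rparr>"

definition witt_D :: "complex ^ 'd \<Rightarrow> int ^ 'd \<Rightarrow> 'd::finite laurent \<Rightarrow> 'd laurent" where
  "witt_D u r = (\<lambda>a. x_pow r * (\<Sum>i\<in>UNIV. const_laurent (u $ i) * partial i a))"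


section \<open>Modules over the Witt algebra and over $U(\mathfrak h)$\<close>

text \<open>Since \<open>W\<^sub>d\<close> is spanned by the \<open>D(u,r)\<close>, its action on a complex space is recorded by the
  operators \<open>act M u r\<close> through which the \<open>D(u,r)\<close> act.\<close>

record ('d, 'm) witt_module = "(complex, 'm) module" +
  act :: "complex ^ 'd \<Rightarrow> int ^ 'd \<Rightarrow> 'm \<Rightarrow> 'm"

definition make_witt_module ::
    "(complex, 'm, 'f) module_scheme \<Rightarrow> (complex ^ 'd \<Rightarrow> int ^ 'd \<Rightarrow> 'm \<Rightarrow> 'm)
      \<Rightarrow> ('d::finite, 'm) witt_module" where
  "make_witt_module M a =
     \<lparr>carrier = carrier M, monoid.mult = monoid.mult M, one = one M, ring.zero = ring.zero M,
      ring.add = ring.add M, smult = smult M, act = a\<rparr>"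

definition witt_isomorphic ::
    "('d::finite, 'm) witt_module \<Rightarrow> ('d, 'n) witt_module \<Rightarrow> bool" where
  "witt_isomorphic M N \<longleftrightarrow>
     (\<exists>f \<in> module_hom type_ring M N.
        bij_betw f (carrier M) (carrier N) \<and>
        (\<forall>u r. \<forall>x\<in>carrier M. f (act M u r x) = act N u r (f x)))"

text \<open>Restriction of a module over the Weyl algebra to the complex numbers and to \<open>W\<^sub>d\<close>.\<close>

definition weyl_to_witt ::
    "('d::finite laurent \<Rightarrow> 'd laurent, 'p) module \<Rightarrow> ('d, 'p) witt_module" where
  "weyl_to_witt P =
     make_witt_module (with_smult (\<lambda>c z. (\<lambda>a. const_laurent c * a) \<odot>\<^bsub>P\<^esub> z) P)
       (\<lambda>u r z. witt_D u r \<odot>\<^bsub>P\<^esub> z)"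

text \<open>\<open>U(\<hh>) = \<complex>[\<partial>\<^sub>1,\<dots>,\<partial>\<^sub>d]\<close> as a polynomial ring. A \<open>W\<^sub>d\<close>-module is a \<open>U(\<hh>)\<close>-module
  with \<open>\<partial>\<^sub>i\<close> acting as \<open>D(e\<^sub>i, 0)\<close>; these operators commute, so the order of the factors in
  \<open>h_monomial\<close> does not matter.\<close>

type_synonym 'd Uh = "('d \<Rightarrow>\<^sub>0 nat) \<Rightarrow>\<^sub>0 complex"

definition h_monomial ::
    "('d::{finite,linorder}, 'm) witt_module \<Rightarrow> ('d \<Rightarrow>\<^sub>0 nat) \<Rightarrow> 'm \<Rightarrow> 'm" where
  "h_monomial M m =
     foldr (\<lambda>i. act M (axis i 1) 0 ^^ Poly_Mapping.lookup m i) (sorted_list_of_set UNIV)"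

definition Uh_module ::
    "('d::{finite,linorder}, 'm) witt_module \<Rightarrow> ('d Uh, 'm) module" where
  "Uh_module M =
     with_smult
       (\<lambda>f z. \<Oplus>\<^bsub>M\<^esub>m\<in>Poly_Mapping.keys f. Poly_Mapping.lookup f m \<odot>\<^bsub>M\<^esub> h_monomial M m z) M"

definition I0 :: "'d::{finite,linorder} Uh set" where
  "I0 = genideal type_ring (range (\<lambda>i. Poly_Mapping.single (Poly_Mapping.single i 1) 1))"

definition H_module :: "('d::{finite,linorder} Uh, 'd Uh fract) module" where
  "H_module =
     \<lparr>carrier = UNIV, monoid.mult = undefined, one = undefined, ring.zero = 0, ring.add = (+),
      smult = (\<lambda>f g. Fract f 1 * g)\<rparr>"

definition H_tensor ::
    "('d::{finite,linorder} Uh, 'm) module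
      \<Rightarrow> ('d Uh fract, ('d Uh fract \<times> 'm \<Rightarrow>\<^sub>0 int) set) module" where
  "H_tensor M =
     with_smult (\<lambda>h. tensor_map type_ring H_module M (\<lambda>(g, x). frag_of (h * g, x)))
       (tensor type_ring H_module M)"

definition has_rank :: "('d::{finite,linorder} Uh, 'm) module \<Rightarrow> nat \<Rightarrow> bool" where
  "has_rank M n \<longleftrightarrow> has_dim type_ring (H_tensor M) n"


section \<open>The modules $\mathcal F(P,V)$\<close>

record ('d, 'v) gl_module = "(complex, 'v) module" +
  gl_act :: "complex ^ 'd ^ 'd \<Rightarrow> 'v \<Rightarrow> 'v"

definition outer :: "int ^ 'd \<Rightarrow> complex ^ 'd \<Rightarrow> complex ^ 'd ^ 'd::finite" where
  "outer r u = (\<chi> i j. of_int (r $ i) * u $ j)"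

definition F_module ::
    "('d::finite laurent \<Rightarrow> 'd laurent, 'p) module \<Rightarrow> ('d, 'v) gl_module
      \<Rightarrow> ('d, ('p \<times> 'v \<Rightarrow>\<^sub>0 int) set) witt_module" where
  "F_module P V =
     make_witt_module (tensor type_ring (weyl_to_witt P) V)
       (\<lambda>u r. tensor_map type_ring (weyl_to_witt P) V
          (\<lambda>(z, y). frag_of (witt_D u r \<odot>\<^bsub>P\<^esub> z, y)
                    + frag_of ((\<lambda>a. x_pow r * a) \<odot>\<^bsub>P\<^esub> z, gl_act V (outer r u) y)))"


section \<open>Exterior powers\<close>

text \<open>An element of the exterior algebra of \<open>\<complex>\<^sup>d\<close> is given by its coordinates in the basis \<open>e\<^sub>S\<close>,
  \<open>S \<subseteq> {1,\<dots>,d}\<close>, where \<open>e\<^sub>S\<close> is the wedge product of the \<open>e\<^sub>s\<close>, \<open>s \<in> S\<close>, in increasing order.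
  For disjoint \<open>T\<close> and \<open>U\<close>, \<open>e\<^sub>T \<and> e\<^sub>U = (-1)\<^sup>n e\<^bsub>T\<union>U\<^esub>\<close> where \<open>n\<close> is the number of pairs
  \<open>t \<in> T\<close>, \<open>u \<in> U\<close> with \<open>u < t\<close>.\<close>

type_synonym 'd exterior = "'d set \<Rightarrow> complex"

definition wedge :: "'d::{finite,linorder} exterior \<Rightarrow> 'd exterior \<Rightarrow> 'd exterior" where
  "wedge v w =
     (\<lambda>S. \<Sum>T\<in>Pow S. (-1) ^ card {(t, u). t \<in> T \<and> u \<in> S - T \<and> u < t} * v T * w (S - T))"

definition ext_scalar :: "complex \<Rightarrow> 'd::{finite,linorder} exterior" where
  "ext_scalar c = (\<lambda>S. if S = {} then c else 0)"

definition ext_vec :: "complex ^ 'd::{finite,linorder} \<Rightarrow> 'd exterior" where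
  "ext_vec v = (\<lambda>S. \<Sum>i\<in>UNIV. if S = {i} then v $ i else 0)"

definition wedge_list :: "(complex ^ 'd::{finite,linorder}) list \<Rightarrow> 'd exterior" where
  "wedge_list vs = foldr (\<lambda>v. wedge (ext_vec v)) vs (ext_scalar 1)"

text \<open>\<open>A (v\<^sub>1 \<and> \<dots> \<and> v\<^sub>k) = \<Sum>\<^sub>m v\<^sub>1 \<and> \<dots> \<and> A v\<^sub>m \<and> \<dots> \<and> v\<^sub>k\<close> on the basis vectors \<open>e\<^sub>S\<close>, extended linearly.\<close>

definition ext_gl_act ::
    "complex ^ ('d::{finite,linorder}) ^ ('d::{finite,linorder}) \<Rightarrow> 'd exterior \<Rightarrow> 'd exterior" where
  "ext_gl_act A w =
     (\<lambda>T. \<Sum>S\<in>UNIV. w S *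
        (let s = sorted_list_of_set S; es = map (\<lambda>i. axis i 1) s
         in \<Sum>m<length s. wedge_list (es[m := A *v (es ! m)]) T))"

definition ext_power :: "nat \<Rightarrow> ('d::{finite,linorder}, 'd exterior) gl_module" where
  "ext_power k =
     \<lparr>carrier = {w. \<forall>S. w S \<noteq> 0 \<longrightarrow> card S = k}, monoid.mult = undefined, one = undefined,
      ring.zero = (\<lambda>_. 0), ring.add = (\<lambda>v w S. v S + w S), smult = (\<lambda>c w S. c * w S),
      gl_act = ext_gl_act\<rparr>"


section \<open>The complex and its images and kernels\<close>

type_synonym ('d, 'p) F_elem = "('p \<times> 'd exterior \<Rightarrow>\<^sub>0 int) set"

definition F_ext ::
    "('d::{finite,linorder} laurent \<Rightarrow> 'd laurent, 'p) module \<Rightarrow> nat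
      \<Rightarrow> ('d, ('d, 'p) F_elem) witt_module" where
  "F_ext P k = F_module P (ext_power k)"

definition diff_pi ::
    "('d::{finite,linorder} laurent \<Rightarrow> 'd laurent, 'p) module \<Rightarrow> nat
      \<Rightarrow> ('d, 'p) F_elem \<Rightarrow> ('d, 'p) F_elem" where
  "diff_pi P k X =
     (if k < CARD('d)
      then tensor_map type_ring (weyl_to_witt P) (ext_power (Suc k))
             (\<lambda>(y, v). \<Sum>j\<in>UNIV. frag_of (partial j \<odot>\<^bsub>P\<^esub> y, wedge (ext_vec (axis j 1)) v)) X
      else \<zero>\<^bsub>F_ext P (Suc k)\<^esub>)"

definition L_mod ::
    "('d::{finite,linorder} laurent \<Rightarrow> 'd laurent, 'p) module \<Rightarrow> nat
      \<Rightarrow> ('d, ('d, 'p) F_elem) witt_module" where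
  "L_mod P k = (F_ext P k)\<lparr>carrier := diff_pi P (k - 1) ` carrier (F_ext P (k - 1))\<rparr>"

definition L_tilde_mod ::
    "('d::{finite,linorder} laurent \<Rightarrow> 'd laurent, 'p) module \<Rightarrow> nat
      \<Rightarrow> ('d, ('d, 'p) F_elem) witt_module" where
  "L_tilde_mod P k =
     (F_ext P k)\<lparr>carrier := {X \<in> carrier (F_ext P k). diff_pi P k X = \<zero>\<^bsub>F_ext P (Suc k)\<^esub>}\<rparr>"

end

theory Submission
  imports Defs "HOL-Library.Function_Algebras" "HOL-Computational_Algebra.Polynomial"
begin

text \<open>
  On \<open>P\<close> the operators \<open>x\<^sub>i\<close> are invertible and semilinear over \<open>U(\<hh>)\<close> with respect to the shifts
  \<open>\<partial>\<^sub>i \<mapsto> \<partial>\<^sub>i - 1\<close>. A nonzero ideal of \<open>U(\<hh>)\<close> that is invariant under all shifts is \<open>U(\<hh>)\<close>, so \<open>P\<close> is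
  torsion-free. It is even free, by induction on the number of variables. Let \<open>t\<close> be one of them. If
  \<open>a \<noteq> 0\<close> is free of \<open>t\<close> and \<open>P\<^sub>a\<close> is free, then \<open>D = a \<partial>/\<partial>t\<close>, suitably scaled, acts on \<open>P\<close>, is locally
  nilpotent, and \<open>exp(sD)\<close> is an automorphism of \<open>P[s]\<close> over \<open>t \<mapsto> t + sa\<close>. The \<open>c\<close> such that \<open>P[s]\<close> has an
  automorphism over \<open>t \<mapsto> t + sbc\<close> for each \<open>b\<close> form a nonzero shift invariant ideal, hence \<open>c = 1\<close> occurs.
  Setting \<open>s = -t\<close> there identifies \<open>P\<close> with \<open>(P / tP)[t]\<close>, and \<open>P / tP\<close> has one variable fewer.

  In a basis of \<open>P\<close> the maps \<open>\<pi>\<^sub>k\<close> become the Koszul differential of \<open>U(\<hh>)\<close> on \<open>r\<close> copies. Over \<open>H\<close> it is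
  exact, and a closed form is determined by its components at the \<open>e\<^sub>S\<close> with \<open>S\<close> containing a fixed index;
  there are \<open>(d-1 choose k-1)\<close> of them. A closed form of degree less than \<open>d\<close> vanishes at the origin, so
  \<open>\<pi>\<^sub>i\<^sub>-\<^sub>1 \<eta> \<mapsto> \<eta>(0)\<close> is well defined and computes the fibre of \<open>L\<^sub>d(P,i)\<close> at the origin. The rank and the
  dimension of the fibre of a free module agree, which fails for \<open>i \<ge> 2\<close>.
\<close>

section \<open>The polynomial ring $U(\mathfrak h)$ and its shifts\<close>

text \<open>A finitely generated torsion-free \<open>U(h)\<close>-module need not be free, as part
  (4) shows, so freeness of \<open>P\<close> has to come from the operators \<open>x_j\<close>. The
  derivation \<open>a d/dt\<close> exists because \<open>P\<close> becomes free over polynomials in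
  \<open>t\<close> once enough elements free of \<open>t\<close> are inverted; the obstacle is to
  get rid of \<open>a\<close>. Derivations themselves cannot be collected for this purpose, since a
  sum of locally nilpotent derivations need not be locally nilpotent. Their exponentials can:
  automorphisms of \<open>P[s]\<close> compose, and composition adds the coefficients
  \<open>c\<close>. Conjugation by \<open>x_j\<close> shifts \<open>c\<close>. The parameter
  \<open>s\<close> stays independent of \<open>t\<close> until \<open>c = 1\<close>; only then does
  \<open>s = -t\<close> turn \<open>t + s\<close> into \<open>0\<close>. The induction reaches
  \<open>P / tP\<close> because the \<open>x_j\<close> of the remaining variables commute with
  \<open>t\<close>. To stay within one type, every module is a submodule of a space of functions
  with values in \<open>U(h)\<close>, the quotient is the image of an additive map from
  \<open>P\<close> to itself, and rings in fewer variables are the subrings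
  \<open>vars_in J\<close>.\<close>

definition hvar :: "'d \<Rightarrow> 'd::{finite,linorder} Uh" where
  "hvar i = Poly_Mapping.single (Poly_Mapping.single i 1) 1"

definition hconst :: "complex \<Rightarrow> 'd::{finite,linorder} Uh" where
  "hconst c = Poly_Mapping.single 0 c"

lemma hconst_0 [simp]: "hconst 0 = 0" and hconst_1 [simp]: "hconst 1 = 1"
  by (simp_all add: hconst_def)

lemma hconst_add: "hconst (a + b) = hconst a + hconst b"
  by (simp add: hconst_def single_add)

lemma hconst_mult: "hconst (a * b) = hconst a * hconst b"
  by (simp add: hconst_def mult_single)

lemma hconst_of_int: "hconst (of_int n) = of_int n"
  by (simp add: hconst_def)

lemma hconst_of_nat: "hconst (of_nat n) = of_nat n"
  by (simp add: hconst_def)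

lemma hconst_eq_0_iff [simp]: "hconst c = 0 \<longleftrightarrow> c = 0"
  by (metis hconst_def lookup_single_eq lookup_zero single_zero)

lemma poly_mapping_sum_singles:
  "f = (\<Sum>m\<in>Poly_Mapping.keys f. Poly_Mapping.single m (Poly_Mapping.lookup f m))"
  by (rule poly_mapping_eqI) (auto simp: lookup_sum lookup_single when_def in_keys_iff)

lemma poly_mapping_single_induct [case_names zero single add]:
  fixes P :: "('k \<Rightarrow>\<^sub>0 'b::comm_monoid_add) \<Rightarrow> bool"
  assumes "P 0" "\<And>m c. P (Poly_Mapping.single m c)" "\<And>f g. P f \<Longrightarrow> P g \<Longrightarrow> P (f + g)"
  shows "P f"
proof -
  have "P (\<Sum>m\<in>A. Poly_Mapping.single m (Poly_Mapping.lookup f m))" if "finite A" for A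
    using that by induction (auto intro: assms)
  then show ?thesis using poly_mapping_sum_singles[of f] finite_keys[of f] by metis
qed

lemma hvar_power: "hvar i ^ k = Poly_Mapping.single (Poly_Mapping.single i k) 1"
  by (induction k) (auto simp: hvar_def mult_single simp flip: single_add)

lemma single_one_prod:
  "(\<Prod>i\<in>A. Poly_Mapping.single (g i) 1) = Poly_Mapping.single (\<Sum>i\<in>A. g i) (1::complex)"
  for g :: "'i \<Rightarrow> 'd::{finite,linorder} \<Rightarrow>\<^sub>0 nat"
  by (induction A rule: infinite_finite_induct) (auto simp: mult_single)

lemma poly_mapping_sum_UNIV:
  "(\<Sum>i\<in>UNIV. Poly_Mapping.single i (Poly_Mapping.lookup m i)) = m"
  for m :: "'d::finite \<Rightarrow>\<^sub>0 nat"
  by (rule poly_mapping_eqI) (auto simp: lookup_sum lookup_single when_def)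

lemma single_eq_monomial:
  "Poly_Mapping.single m c = hconst c * (\<Prod>i\<in>UNIV. hvar i ^ Poly_Mapping.lookup m i)"
  unfolding hvar_power single_one_prod poly_mapping_sum_UNIV hconst_def by (simp add: mult_single)

text \<open>Polynomial rings in fewer variables are kept as subrings of one type, so that the
  induction on the number of variables never leaves it.\<close>

definition vars_in :: "'d set \<Rightarrow> 'd::{finite,linorder} Uh set" where
  "vars_in J = {f. \<forall>m\<in>Poly_Mapping.keys f. Poly_Mapping.keys m \<subseteq> J}"

lemma vars_in_UNIV [simp]: "vars_in UNIV = UNIV"
  by (simp add: vars_in_def)

lemma vars_in_mono: "J \<subseteq> J' \<Longrightarrow> vars_in J \<subseteq> vars_in J'"
  by (auto simp: vars_in_def)

lemma vars_in_const [simp]: "hconst c \<in> vars_in J"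
  by (auto simp: vars_in_def hconst_def)

lemma vars_in_0 [simp]: "0 \<in> vars_in J" and vars_in_1 [simp]: "1 \<in> vars_in J"
  using vars_in_const[of 0] vars_in_const[of 1] by simp_all

lemma vars_in_hvar: "i \<in> J \<Longrightarrow> hvar i \<in> vars_in J"
  by (auto simp: vars_in_def hvar_def)

lemma vars_in_add [simp]: "f \<in> vars_in J \<Longrightarrow> g \<in> vars_in J \<Longrightarrow> f + g \<in> vars_in J"
  using keys_add[of f g] by (auto simp: vars_in_def)

lemma vars_in_uminus [simp]: "f \<in> vars_in J \<Longrightarrow> - f \<in> vars_in J"
  by (auto simp: vars_in_def in_keys_iff)

lemma vars_in_diff [simp]: "f \<in> vars_in J \<Longrightarrow> g \<in> vars_in J \<Longrightarrow> f - g \<in> vars_in J"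
  using vars_in_add[of f J "- g"] by simp

lemma keys_add_nat: "Poly_Mapping.keys (m + n) = Poly_Mapping.keys m \<union> Poly_Mapping.keys n"
  for m n :: "'d \<Rightarrow>\<^sub>0 nat"
  by (auto simp: in_keys_iff lookup_add)

lemma vars_in_mult [simp]: "f \<in> vars_in J \<Longrightarrow> g \<in> vars_in J \<Longrightarrow> f * g \<in> vars_in J"
  using keys_mult[of f g] by (fastforce simp: vars_in_def keys_add_nat)

lemma vars_in_power [simp]: "f \<in> vars_in J \<Longrightarrow> f ^ n \<in> vars_in J"
  by (induction n) auto

lemma vars_in_sum [simp]: "(\<And>x. x \<in> X \<Longrightarrow> g x \<in> vars_in J) \<Longrightarrow> sum g X \<in> vars_in J"
  by (induction X rule: infinite_finite_induct) auto

lemma vars_in_induct [consumes 1, case_names const var add mult]: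
  assumes f: "f \<in> vars_in J"
    and const: "\<And>c. P (hconst c)" and var: "\<And>i. i \<in> J \<Longrightarrow> P (hvar i)"
    and add: "\<And>f g. f \<in> vars_in J \<Longrightarrow> g \<in> vars_in J \<Longrightarrow> P f \<Longrightarrow> P g \<Longrightarrow> P (f + g)"
    and mult: "\<And>f g. f \<in> vars_in J \<Longrightarrow> g \<in> vars_in J \<Longrightarrow> P f \<Longrightarrow> P g \<Longrightarrow> P (f * g)"
  shows "P f"
proof -
  have pw: "P (hvar i ^ k)" if "i \<in> J \<or> k = 0" for i k
    using that
  proof (induction k)
    case 0 then show ?case using const[of 1] by simp
  next
    case (Suc k) then show ?case using var mult by (auto simp: vars_in_hvar)
  qed
  have single: "P (Poly_Mapping.single m c)" if m: "Poly_Mapping.keys m \<subseteq> J" for m c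
  proof -
    have "P (\<Prod>i\<in>B. hvar i ^ Poly_Mapping.lookup m i) \<and>
      (\<Prod>i\<in>B. hvar i ^ Poly_Mapping.lookup m i) \<in> vars_in J" if "finite B" for B
      using that
    proof (induction B)
      case empty then show ?case using const[of 1] by simp
    next
      case (insert i B)
      have "i \<in> J \<or> Poly_Mapping.lookup m i = 0" using m by (auto simp: in_keys_iff)
      then have "P (hvar i ^ Poly_Mapping.lookup m i)" "hvar i ^ Poly_Mapping.lookup m i \<in> vars_in J"
        using pw by (auto simp: vars_in_hvar)
      then show ?case using insert mult by simp
    qed
    then show ?thesis unfolding single_eq_monomial using const mult by simp
  qed
  have "P (\<Sum>m\<in>X. Poly_Mapping.single m (Poly_Mapping.lookup f m)) \<and>
    (\<Sum>m\<in>X. Poly_Mapping.single m (Poly_Mapping.lookup f m)) \<in> vars_in J"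
    if "finite X" "X \<subseteq> Poly_Mapping.keys f" for X
    using that
  proof (induction X)
    case empty then show ?case using const[of 0] by simp
  next
    case (insert m X)
    have "Poly_Mapping.keys m \<subseteq> J" using insert f by (auto simp: vars_in_def)
    then have "P (Poly_Mapping.single m (Poly_Mapping.lookup f m))"
      "Poly_Mapping.single m (Poly_Mapping.lookup f m) \<in> vars_in J"
      using single by (auto simp: vars_in_def)
    then show ?case using insert add by simp
  qed
  then show ?thesis using poly_mapping_sum_singles[of f] finite_keys[of f] by (metis order_refl)
qed

lemma Uh_induct [case_names const var add mult]:
  assumes "\<And>c. P (hconst c)" "\<And>i. P (hvar i)" "\<And>f g. P f \<Longrightarrow> P g \<Longrightarrow> P (f + g)"
    "\<And>f g. P f \<Longrightarrow> P g \<Longrightarrow> P (f * g)"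
  shows "P f"
proof -
  have "f \<in> vars_in UNIV" by simp
  then show ?thesis by (induction rule: vars_in_induct) (auto intro: assms)
qed

lemma vars_in_empty: "vars_in {} = range hconst"
proof -
  have "f \<in> range hconst" if "f \<in> vars_in {}" for f
    using that by (induction rule: vars_in_induct) (auto simp flip: hconst_add hconst_mult)
  then show ?thesis by auto
qed

text \<open>Instantiated twice: with values in \<open>Uh\<close> itself for substitutions such as
  the shifts, and with values in the complex numbers for evaluation at a point.\<close>

locale scalar_hom =
  fixes \<phi> :: "complex \<Rightarrow> 'b::comm_ring_1"
  assumes hom_add: "\<phi> (a + b) = \<phi> a + \<phi> b" and hom_mult: "\<phi> (a * b) = \<phi> a * \<phi> b"
    and hom_one: "\<phi> 1 = 1"
begin

lemma hom_zero: "\<phi> 0 = 0"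
  using hom_add[of 0 0] by simp

definition peval :: "('d \<Rightarrow> 'b) \<Rightarrow> 'd::{finite,linorder} Uh \<Rightarrow> 'b" where
  "peval h f = (\<Sum>m\<in>Poly_Mapping.keys f. \<phi> (Poly_Mapping.lookup f m) * (\<Prod>i\<in>UNIV. h i ^ Poly_Mapping.lookup m i))"

lemma peval_superset:
  assumes "finite X" "Poly_Mapping.keys f \<subseteq> X"
  shows "peval h f = (\<Sum>m\<in>X. \<phi> (Poly_Mapping.lookup f m) * (\<Prod>i\<in>UNIV. h i ^ Poly_Mapping.lookup m i))"
  unfolding peval_def
  by (rule sum.mono_neutral_left) (use assms in \<open>auto simp: in_keys_iff hom_zero\<close>)

lemma peval_single:
  "peval h (Poly_Mapping.single m c) = \<phi> c * (\<Prod>i\<in>UNIV. h i ^ Poly_Mapping.lookup m i)"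
  by (subst peval_superset[of "{m}"]) auto

lemma peval_add: "peval h (f + g) = peval h f + peval h g"
  by (subst (1 2 3) peval_superset[of "Poly_Mapping.keys f \<union> Poly_Mapping.keys g"])
    (use keys_add[of f g] in \<open>auto simp: lookup_add hom_add algebra_simps sum.distrib\<close>)

lemma peval_0 [simp]: "peval h 0 = 0"
  by (simp add: peval_def)

lemma peval_mult: "peval h (f * g) = peval h f * peval h g"
proof (induction f rule: poly_mapping_single_induct)
  case (single m c)
  show ?case
  proof (induction g rule: poly_mapping_single_induct)
    case (single n d)
    show ?case
      by (simp add: mult_single peval_single lookup_add power_add prod.distrib hom_mult mult_ac)
  qed (simp_all add: peval_add distrib_left)
qed (simp_all add: peval_add distrib_right)

lemma peval_hconst [simp]: "peval h (hconst c) = \<phi> c"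
  unfolding hconst_def by (simp add: peval_single)

lemma peval_1 [simp]: "peval h 1 = 1"
  using peval_hconst[of h 1] by (simp add: hom_one)

lemma peval_hvar [simp]: "peval h (hvar i) = h i"
proof -
  have "(\<Prod>j\<in>UNIV. h j ^ Poly_Mapping.lookup (Poly_Mapping.single i 1) j)
    = (\<Prod>j\<in>UNIV. if j = i then h j else 1)"
    by (rule prod.cong) (auto simp: lookup_single when_def)
  then show ?thesis unfolding hvar_def by (simp add: peval_single hom_one)
qed

lemma peval_uminus: "peval h (- f) = - peval h f"
  using peval_add[of h f "- f"] by (simp add: eq_neg_iff_add_eq_0 add.commute)

lemma peval_diff: "peval h (f - g) = peval h f - peval h g"
  using peval_add[of h f "- g"] by (simp add: peval_uminus)

lemma peval_power: "peval h (f ^ n) = peval h f ^ n"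
  by (induction n) (auto simp: peval_mult)

lemma peval_sum: "peval h (sum F X) = (\<Sum>x\<in>X. peval h (F x))"
  by (induction X rule: infinite_finite_induct) (auto simp: peval_add)

end

interpretation Uh_hom: scalar_hom "hconst :: complex \<Rightarrow> 'd::{finite,linorder} Uh"
  by standard (auto simp: hconst_add hconst_mult)

interpretation complex_hom: scalar_hom "\<lambda>c::complex. c"
  by standard auto

abbreviation heval :: "('d \<Rightarrow> complex) \<Rightarrow> 'd::{finite,linorder} Uh \<Rightarrow> complex" where
  "heval \<equiv> complex_hom.peval"

text \<open>The minus sign is dictated by the Weyl algebra:
  \<open>x^r f(\<partial>) = f(\<partial> - r) x^r\<close>, because \<open>\<partial>_j\<close>
  multiplies \<open>x^s\<close> by \<open>s_j\<close>.\<close>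

definition shift_poly :: "int ^ ('d::{finite,linorder}) \<Rightarrow> 'd::{finite,linorder} Uh \<Rightarrow> 'd Uh" where
  "shift_poly r = Uh_hom.peval (\<lambda>j. hvar j - of_int (r $ j))"

lemma shift_poly_simps [simp]:
  "shift_poly r (hconst c) = hconst c" "shift_poly r (hvar i) = hvar i - of_int (r $ i)"
  "shift_poly r 0 = 0" "shift_poly r 1 = 1"
  by (simp_all add: shift_poly_def)

lemma shift_poly_hom:
  "shift_poly r (f + g) = shift_poly r f + shift_poly r g"
  "shift_poly r (f * g) = shift_poly r f * shift_poly r g"
  "shift_poly r (f - g) = shift_poly r f - shift_poly r g"
  "shift_poly r (f ^ n) = shift_poly r f ^ n"
  "shift_poly r (sum F X) = (\<Sum>x\<in>X. shift_poly r (F x))"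
  by (simp_all add: shift_poly_def Uh_hom.peval_add Uh_hom.peval_mult Uh_hom.peval_diff
      Uh_hom.peval_power Uh_hom.peval_sum)

lemma shift_poly_of_int [simp]: "shift_poly r (of_int n) = of_int n"
  by (metis hconst_of_int shift_poly_simps(1))

lemma shift_poly_shift_poly: "shift_poly r (shift_poly s f) = shift_poly (r + s) f"
  by (induction f rule: Uh_induct) (auto simp: shift_poly_hom)

lemma shift_poly_zero [simp]: "shift_poly 0 f = f"
  by (induction f rule: Uh_induct) (auto simp: shift_poly_hom)

lemma shift_poly_inverse [simp]:
  "shift_poly r (shift_poly (- r) f) = f" "shift_poly (- r) (shift_poly r f) = f"
  by (simp_all add: shift_poly_shift_poly)

lemma shift_poly_eq_0_iff [simp]: "shift_poly r f = 0 \<longleftrightarrow> f = 0"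
  by (metis shift_poly_inverse(2) shift_poly_simps(3))

lemma shift_poly_vars_in: "f \<in> vars_in J \<Longrightarrow> shift_poly r f \<in> vars_in J"
  by (induction rule: vars_in_induct)
    (auto simp: shift_poly_hom vars_in_hvar simp flip: hconst_of_int)

lemma heval_shift_poly: "heval h (shift_poly r f) = heval (\<lambda>i. h i - of_int (r $ i)) f"
proof (induction f rule: Uh_induct)
  case (var i)
  have "heval h (of_int (r $ i)) = of_int (r $ i)"
    by (metis complex_hom.peval_hconst hconst_of_int)
  then show ?case by (simp add: complex_hom.peval_diff)
qed (auto simp: shift_poly_hom complex_hom.peval_add complex_hom.peval_mult)

subsection \<open>Separating one variable\<close>

text \<open>The subring of coefficients is a predicate and not a type: \<open>poly\<close> over the
  integral domain \<open>Uh\<close> keeps degrees and the finiteness of root sets at hand.\<close>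

definition coeffs_in :: "'a set \<Rightarrow> 'a::zero poly \<Rightarrow> bool" where
  "coeffs_in A p \<longleftrightarrow> (\<forall>k. coeff p k \<in> A)"

lemma coeffs_in_0 [simp]: "coeffs_in (vars_in J) 0"
  by (simp add: coeffs_in_def)

lemma coeffs_in_pCons [simp]:
  "coeffs_in (vars_in J) (pCons a p) \<longleftrightarrow> a \<in> vars_in J \<and> coeffs_in (vars_in J) p"
  unfolding coeffs_in_def coeff_pCons by (auto split: nat.splits)

lemma coeffs_in_add [simp]:
  "coeffs_in (vars_in J) p \<Longrightarrow> coeffs_in (vars_in J) q \<Longrightarrow> coeffs_in (vars_in J) (p + q)"
  by (auto simp: coeffs_in_def)

lemma coeffs_in_diff [simp]:
  "coeffs_in (vars_in J) p \<Longrightarrow> coeffs_in (vars_in J) q \<Longrightarrow> coeffs_in (vars_in J) (p - q)"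
  by (auto simp: coeffs_in_def)

lemma coeffs_in_smult [simp]:
  "a \<in> vars_in J \<Longrightarrow> coeffs_in (vars_in J) p \<Longrightarrow> coeffs_in (vars_in J) (smult a p)"
  by (auto simp: coeffs_in_def)

lemma coeffs_in_mult [simp]:
  "coeffs_in (vars_in J) p \<Longrightarrow> coeffs_in (vars_in J) q \<Longrightarrow> coeffs_in (vars_in J) (p * q)"
  by (auto simp: coeffs_in_def coeff_mult)

lemma coeffs_in_monom [simp]: "a \<in> vars_in J \<Longrightarrow> coeffs_in (vars_in J) (monom a n)"
  by (auto simp: coeffs_in_def)

lemma coeffs_in_sum [simp]:
  "(\<And>x. x \<in> X \<Longrightarrow> coeffs_in (vars_in J) (g x)) \<Longrightarrow> coeffs_in (vars_in J) (sum g X)"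
  by (induction X rule: infinite_finite_induct) auto

lemma coeffs_in_pderiv [simp]: "coeffs_in (vars_in J) p \<Longrightarrow> coeffs_in (vars_in J) (pderiv p)"
  unfolding coeffs_in_def coeff_pderiv by (metis hconst_of_nat vars_in_const vars_in_mult)

lemma poly_vars_in:
  assumes "coeffs_in (vars_in J) p" "x \<in> vars_in J'" "J \<subseteq> J'"
  shows "poly p x \<in> vars_in J'"
  using assms(1) by (induction p) (use assms(2) vars_in_mono[OF assms(3)] in auto)

text \<open>Together with \<open>poly_hvar_eq_0\<close> this identifies
  \<open>vars_in (insert i J)\<close>, for \<open>i\<close> outside \<open>J\<close>, with the
  polynomial ring in one variable over \<open>vars_in J\<close>.\<close>

lemma vars_in_insert_poly:
  assumes "f \<in> vars_in (insert i J)"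
  obtains p where "coeffs_in (vars_in J) p" "f = poly p (hvar i)"
proof -
  have "\<exists>p. coeffs_in (vars_in J) p \<and> f = poly p (hvar i)"
    using assms
  proof (induction rule: vars_in_induct)
    case (const c) show ?case by (rule exI[of _ "[:hconst c:]"]) auto
  next
    case (var j)
    show ?case
    proof (cases "j = i")
      case True then show ?thesis by (intro exI[of _ "[:0, 1:]"]) auto
    next
      case False then show ?thesis using var
        by (intro exI[of _ "[:hvar j:]"]) (auto simp: vars_in_hvar)
    qed
  next
    case (add f g) then show ?case by (metis coeffs_in_add poly_add)
  next
    case (mult f g) then show ?case by (metis coeffs_in_mult poly_mult)
  qed
  then show ?thesis using that by auto
qed

lemma shift_poly_poly:
  assumes "coeffs_in (vars_in J) p" "\<And>j. j \<in> J \<Longrightarrow> r $ j = 0"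
  shows "shift_poly r (poly p x) = poly p (shift_poly r x)"
proof -
  have "shift_poly r f = f" if "f \<in> vars_in J" for f
    using that by (induction rule: vars_in_induct) (auto simp: shift_poly_hom assms(2))
  then show ?thesis using assms(1) by (induction p) (auto simp: shift_poly_hom)
qed

text \<open>Applying all shifts of the variable \<open>t\<^sub>i\<close> to a relation \<open>p(t\<^sub>i) = 0\<close> gives \<open>p\<close>
  infinitely many roots.\<close>

lemma poly_hvar_eq_0:
  assumes "coeffs_in (vars_in J) p" "i \<notin> J" "poly p (hvar i) = 0"
  shows "p = 0"
proof (rule ccontr)
  assume "p \<noteq> 0"
  have "poly p (hvar i - of_nat n) = 0" for n
  proof -
    have "shift_poly (axis i (of_nat n)) (poly p (hvar i)) = poly p (hvar i - of_nat n)"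
      by (subst shift_poly_poly[OF assms(1)]) (use assms(2) in \<open>auto simp: axis_def\<close>)
    then show ?thesis using assms(3) by simp
  qed
  then have "range (\<lambda>n::nat. hvar i - of_nat n) \<subseteq> {x. poly p x = 0}" by auto
  moreover have "infinite (range (\<lambda>n::nat. hvar i - of_nat n))"
    by (rule range_inj_infinite) (auto intro: injI)
  ultimately show False using poly_roots_finite[OF \<open>p \<noteq> 0\<close>] finite_subset by blast
qed

text \<open>The leading terms of \<open>p(x - 1)\<close> and \<open>p(x)\<close> cancel, which
  lowers the degree. A polynomial fixed by \<open>x \<mapsto> x - 1\<close> takes the same value at
  \<open>0, -1, -2, ...\<close>, hence is constant in characteristic zero.\<close>

lemma degree_shift_diff:
  fixes p :: "'a::{idom,ring_char_0} poly"
  defines "q \<equiv> pcompose p [:-1, 1:] - p"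
  assumes "degree p > 0"
  shows "q \<noteq> 0" "degree q < degree p"
proof -
  show "q \<noteq> 0"
  proof
    assume "q = 0"
    then have "pcompose p [:-1, 1:] = p" by (simp add: q_def)
    then have eq: "poly p (x - 1) = poly p x" for x
      using poly_pcompose[of p "[:-1, 1:]" x] by simp
    have "poly p (- of_nat n) = poly p 0" for n
    proof (induction n)
      case (Suc n)
      have "- of_nat (Suc n) = - of_nat n - (1::'a)" by simp
      then show ?case using eq[of "- of_nat n"] Suc by metis
    qed simp
    then have "range (\<lambda>n::nat. - of_nat n) \<subseteq> {x. poly (p - [:poly p 0:]) x = 0}" by auto
    moreover have "infinite (range (\<lambda>n::nat. - of_nat n :: 'a))"
      by (rule range_inj_infinite) (auto intro: injI)
    ultimately have "p - [:poly p 0:] = 0"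
      using poly_roots_finite finite_subset by blast
    then have "p = [:poly p 0:]" by simp
    then have "degree p = 0" by (metis degree_pCons_0)
    then show False using assms by simp
  qed
  have d: "degree (pcompose p [:-1, 1:]) = degree p" by (simp add: degree_pcompose)
  have "lead_coeff (pcompose p [:-1, 1:]) = lead_coeff p"
    by (subst lead_coeff_comp) auto
  then have "coeff q (degree p) = 0" using d by (simp add: q_def)
  moreover have "degree q \<le> degree p" unfolding q_def
    by (rule order.trans[OF degree_diff_le_max]) (simp add: d)
  ultimately show "degree q < degree p"
    using \<open>q \<noteq> 0\<close> by (metis leading_coeff_0_iff order_le_less)
qed

text \<open>Among the nonzero elements of a shift invariant ideal, one of least degree in \<open>t\<^sub>i\<close> is fixed
  by the shift of \<open>t\<^sub>i\<close>, hence does not involve \<open>t\<^sub>i\<close>.\<close>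

lemma shift_invariant_ideal:
  assumes "finite J"
    and "\<And>f g. f \<in> I \<Longrightarrow> g \<in> I \<Longrightarrow> f + g \<in> I"
    and "\<And>f g. f \<in> vars_in J \<Longrightarrow> g \<in> I \<Longrightarrow> f * g \<in> I"
    and "\<And>i f. i \<in> J \<Longrightarrow> f \<in> I \<Longrightarrow> shift_poly (axis i 1) f \<in> I"
    and "f \<in> I" "f \<in> vars_in J" "f \<noteq> 0"
  shows "1 \<in> I"
  using assms
proof (induction J arbitrary: f rule: finite_induct)
  case empty
  then obtain c where c: "f = hconst c" using vars_in_empty by blast
  then have "hconst (1 / c) * f \<in> I" using empty by (auto simp: vars_in_empty)
  moreover have "hconst (1 / c) * f = 1" using c empty by (auto simp flip: hconst_mult)
  ultimately show ?case by simp
next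
  case (insert i J)
  note i = insert(2) and IH = insert(3) and add = insert(4) and mult = insert(5) and shift = insert(6)
  define D where "D n \<longleftrightarrow> (\<exists>p. coeffs_in (vars_in J) p \<and> p \<noteq> 0 \<and> poly p (hvar i) \<in> I \<and> degree p = n)" for n
  obtain p where "coeffs_in (vars_in J) p" "f = poly p (hvar i)"
    using vars_in_insert_poly insert.prems by metis
  then have "D (degree p)" using insert.prems D_def by fastforce
  then have "D (LEAST n. D n)" by (rule LeastI)
  then obtain p where p: "coeffs_in (vars_in J) p" "p \<noteq> 0" "poly p (hvar i) \<in> I"
    and deg: "degree p = (LEAST n. D n)" using D_def by auto
  have "degree p = 0"
  proof (rule ccontr)
    assume dp: "degree p \<noteq> 0"
    define q where "q = pcompose p [:-1, 1:] - p"
    have cq: "coeffs_in (vars_in J) (pcompose p [:-1, 1:])"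
      using p(1)
    proof (induction p)
      case (pCons a p)
      have "-1 \<in> vars_in J" using vars_in_1 vars_in_uminus by blast
      then show ?case using pCons by (simp add: pcompose_pCons)
    qed simp
    then have "coeffs_in (vars_in J) q" using p by (simp add: q_def)
    moreover have "poly q (hvar i) \<in> I"
    proof -
      have "shift_poly (axis i 1) (poly p (hvar i)) = poly p (hvar i - 1)"
        by (subst shift_poly_poly[OF p(1)]) (use i in \<open>auto simp: axis_def\<close>)
      then have "poly p (hvar i - 1) \<in> I" using shift[of i, OF _ p(3)] by auto
      moreover have "- 1 * poly p (hvar i) \<in> I" by (rule mult[OF _ p(3)]) simp
      ultimately have "poly p (hvar i - 1) + - 1 * poly p (hvar i) \<in> I" by (rule add)
      then show ?thesis by (simp add: q_def poly_pcompose)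
    qed
    ultimately have "D (degree q)"
      using degree_shift_diff(1)[of p] dp by (auto simp: D_def q_def)
    then show False using degree_shift_diff(2)[of p] dp deg not_less_Least[of "degree q" D]
      by (auto simp: q_def)
  qed
  then obtain a where a: "p = [:a:]" by (metis degree_eq_zeroE)
  \<comment> \<open>The element of least degree is its own constant term \<open>a\<close>, a nonzero
    element of the same \<open>I\<close> that is free of the variable \<open>i\<close>.\<close>
  show ?case
  proof (rule IH[of a])
    show "f + g \<in> I" if "f \<in> I" "g \<in> I" for f g using that by (rule add)
    show "f * g \<in> I" if "f \<in> vars_in J" "g \<in> I" for f g
      using that mult vars_in_mono[of J "insert i J"] by auto
    show "shift_poly (axis j 1) f \<in> I" if "j \<in> J" "f \<in> I" for j f using that shift by auto
  qed (use p a in auto)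
qed

section \<open>Submodules of modules of functions\<close>

text \<open>As simplification rules these apply also below an abstraction and turn \<open>u + v\<close> into
  \<open>\<lambda>k. u k + v k\<close>.\<close>

declare plus_fun_apply [simp del] zero_fun_apply [simp del]

lemmas fun_apply = plus_fun_apply zero_fun_apply

definition fscale :: "'a::times \<Rightarrow> ('i \<Rightarrow> 'a) \<Rightarrow> 'i \<Rightarrow> 'a" (infixr \<open>\<star>\<close> 75) where
  "f \<star> v = (\<lambda>k. f * v k)"

lemma fscale_apply: "(f \<star> v) k = f * v k"
  by (simp add: fscale_def)

lemma fscale_simps [simp]:
  fixes v w :: "'i \<Rightarrow> 'a::comm_ring_1"
  shows "f \<star> (v + w) = f \<star> v + f \<star> w" "(f + g) \<star> v = f \<star> v + g \<star> v"
    "f \<star> (v - w) = f \<star> v - f \<star> w" "(f - g) \<star> v = f \<star> v - g \<star> v" "f \<star> (- v) = - (f \<star> v)"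
    "(- f) \<star> v = - (f \<star> v)" "f \<star> g \<star> v = (f * g) \<star> v" "1 \<star> v = v" "0 \<star> v = 0" "f \<star> (0 :: 'i \<Rightarrow> 'a) = 0"
  by (auto simp: fun_eq_iff fscale_apply fun_apply algebra_simps)

lemma sum_fun_apply: "(\<Sum>x\<in>X. g x) k = (\<Sum>x\<in>X. g x k)"
  for g :: "'x \<Rightarrow> 'k \<Rightarrow> 'a::comm_monoid_add"
  by (induction X rule: infinite_finite_induct) (simp_all add: fun_apply)

lemma fscale_sum:
  fixes f :: "'a::comm_ring_1" and g :: "'x \<Rightarrow> 'i \<Rightarrow> 'a"
  shows "f \<star> sum g X = (\<Sum>x\<in>X. f \<star> g x)"
  by (rule ext) (simp add: fscale_apply sum_fun_apply sum_distrib_left)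

lemma sum_fscale:
  fixes g :: "'x \<Rightarrow> 'a::comm_ring_1" and v :: "'i \<Rightarrow> 'a"
  shows "sum g X \<star> v = (\<Sum>x\<in>X. g x \<star> v)"
  by (rule ext) (simp add: fscale_apply sum_fun_apply sum_distrib_right)

lemma fscale_eq_0_iff [simp]: "f \<star> v = 0 \<longleftrightarrow> f = 0 \<or> v = 0" for f :: "'a::idom" and v :: "'i \<Rightarrow> 'a"
  by (auto simp: fun_eq_iff fscale_apply fun_apply)

definition lcomb :: "'l set \<Rightarrow> ('l \<Rightarrow> 'a) \<Rightarrow> ('l \<Rightarrow> 'i \<Rightarrow> 'a) \<Rightarrow> 'i \<Rightarrow> 'a::comm_ring_1" where
  "lcomb L f m = (\<Sum>l\<in>L. f l \<star> m l)"

lemma lcomb_add: "lcomb L (\<lambda>l. f l + g l) m = lcomb L f m + lcomb L g m"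
  by (simp add: lcomb_def sum.distrib)

lemma lcomb_diff: "lcomb L (\<lambda>l. f l - g l) m = lcomb L f m - lcomb L g m"
  by (simp add: lcomb_def sum_subtractf)

lemma lcomb_scale: "lcomb L (\<lambda>l. c * f l) m = c \<star> lcomb L f m"
  by (simp add: lcomb_def fscale_sum)

lemma lcomb_0 [simp]: "lcomb L (\<lambda>l. 0) m = 0"
  by (simp add: lcomb_def)

lemma lcomb_cong: "(\<And>l. l \<in> L \<Longrightarrow> f l = g l) \<Longrightarrow> lcomb L f m = lcomb L g m"
  by (auto simp: lcomb_def intro: sum.cong)

definition submod :: "'a set \<Rightarrow> ('i \<Rightarrow> 'a::comm_ring_1) set \<Rightarrow> bool" where
  "submod A M \<longleftrightarrow> 0 \<in> M \<and> (\<forall>x\<in>M. \<forall>y\<in>M. x + y \<in> M) \<and> (\<forall>f\<in>A. \<forall>x\<in>M. f \<star> x \<in> M)"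

lemma submodD:
  assumes "submod A M"
  shows "0 \<in> M" "x \<in> M \<Longrightarrow> y \<in> M \<Longrightarrow> x + y \<in> M" "f \<in> A \<Longrightarrow> x \<in> M \<Longrightarrow> f \<star> x \<in> M"
  using assms by (auto simp: submod_def)

lemma submod_sum: "submod A M \<Longrightarrow> (\<And>x. x \<in> X \<Longrightarrow> g x \<in> M) \<Longrightarrow> sum g X \<in> M"
  by (induction X rule: infinite_finite_induct) (auto simp: submodD)

lemma submod_lcomb:
  "submod A M \<Longrightarrow> (\<And>l. l \<in> L \<Longrightarrow> f l \<in> A) \<Longrightarrow> m ` L \<subseteq> M \<Longrightarrow> lcomb L f m \<in> M"
  unfolding lcomb_def by (auto intro!: submod_sum submodD)

text \<open>Generators form a family over a finite set of numbers and not a set of vectors, so that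
  one member can be replaced or dropped without regard to coincidences.\<close>

definition spans :: "'a set \<Rightarrow> ('i \<Rightarrow> 'a::comm_ring_1) set \<Rightarrow> nat set \<Rightarrow> (nat \<Rightarrow> 'i \<Rightarrow> 'a) \<Rightarrow> bool" where
  "spans A M L m \<longleftrightarrow> finite L \<and> m ` L \<subseteq> M \<and> (\<forall>x\<in>M. \<exists>f. (\<forall>l\<in>L. f l \<in> A) \<and> x = lcomb L f m)"

definition indep :: "'a set \<Rightarrow> nat set \<Rightarrow> (nat \<Rightarrow> 'i \<Rightarrow> 'a::comm_ring_1) \<Rightarrow> bool" where
  "indep A L m \<longleftrightarrow> (\<forall>f. (\<forall>l\<in>L. f l \<in> A) \<and> lcomb L f m = 0 \<longrightarrow> (\<forall>l\<in>L. f l = 0))"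

lemma indepD: "indep A L m \<Longrightarrow> (\<And>l. l \<in> L \<Longrightarrow> f l \<in> A) \<Longrightarrow> lcomb L f m = 0 \<Longrightarrow> l \<in> L \<Longrightarrow> f l = 0"
  unfolding indep_def by blast

text \<open>Over $k[t]$ with $k$ the fraction field of \<open>vars_in J\<close> this is the freeness of a finitely
  generated torsion-free module. Denominators are cleared throughout: a generating family of least
  size and a relation of least degree are shortened by a pseudo-division step.\<close>

lemma generic_basis:
  fixes M :: "('i \<Rightarrow> 'd::{finite,linorder} Uh) set"
  assumes i: "i \<notin> J" and M: "submod (vars_in (insert i J)) M"
    and fg: "spans (vars_in (insert i J)) M L0 g0"
  obtains L m a where "finite L" "m ` L \<subseteq> M" "a \<in> vars_in J" "a \<noteq> 0"
    "\<And>x. x \<in> M \<Longrightarrow> \<exists>f. (\<forall>l\<in>L. f l \<in> vars_in (insert i J)) \<and> a \<star> x = lcomb L f m"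
    "indep (vars_in (insert i J)) L m"
proof -
  let ?A = "vars_in J" and ?B = "vars_in (insert i J)" and ?t = "hvar i"
  have AB: "?A \<subseteq> ?B" by (rule vars_in_mono) auto
  have t: "?t \<in> ?B" by (simp add: vars_in_hvar)
  \<comment> \<open>The family \<open>m\<close> generates \<open>M\<close> after inverting
    \<open>a\<close>. The least size is taken over all families and all denominators at once, so
    steps that enlarge the denominator remain harmless.\<close>
  define G where "G L m a \<longleftrightarrow> finite L \<and> m ` L \<subseteq> M \<and> a \<in> ?A \<and> a \<noteq> 0 \<and>
    (\<forall>x\<in>M. \<exists>f. (\<forall>l\<in>L. f l \<in> ?B) \<and> a \<star> x = lcomb L f m)" for L :: "nat set" and m a
  define N where "N = (LEAST n. \<exists>L m a. G L m a \<and> card L = n)"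
  have "\<exists>f. (\<forall>l\<in>L0. f l \<in> ?B) \<and> 1 \<star> x = lcomb L0 f g0" if "x \<in> M" for x
    using fg that unfolding spans_def fscale_simps(8) by blast
  then have "G L0 g0 1" unfolding G_def using fg[unfolded spans_def] vars_in_1 one_neq_zero
    by (intro conjI ballI) simp_all
  then have "\<exists>n. \<exists>L m a. G L m a \<and> card L = n" by blast
  then have "\<exists>L m a. G L m a \<and> card L = N" unfolding N_def by (rule LeastI_ex)
  then obtain L m0 a0 where G0: "G L m0 a0" and cardL: "card L = N" by blast
  have minimal: "N \<le> card L'" if "G L' m a" for L' m a
    unfolding N_def by (rule Least_le) (use that in blast)
  \<comment> \<open>Through \<open>Suc\<close>, replacing a nonzero constant coefficient by zero
    also counts as progress.\<close>
  define \<mu> where "\<mu> p = (\<Sum>l\<in>L. if p l = 0 then 0 else Suc (degree (p l)))" for p :: "nat \<Rightarrow> 'd Uh poly"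
  have no_relation: False if "G L m a" "\<And>l. l \<in> L \<Longrightarrow> coeffs_in ?A (p l)" "\<exists>l\<in>L. p l \<noteq> 0"
    "lcomb L (\<lambda>l. poly (p l) ?t) m = 0" for m a p
    using that
  proof (induction "\<mu> p" arbitrary: m a p rule: less_induct)
    case less
    have fin: "finite L" and mM: "m ` L \<subseteq> M" and a: "a \<in> ?A" "a \<noteq> 0"
      and sp: "\<And>x. x \<in> M \<Longrightarrow> \<exists>f. (\<forall>l\<in>L. f l \<in> ?B) \<and> a \<star> x = lcomb L f m"
      using less.prems(1) by (auto simp: G_def)
    obtain j where j: "j \<in> L" "p j \<noteq> 0" using less.prems by auto
    show False
    proof (cases "\<exists>k\<in>L. k \<noteq> j \<and> p k \<noteq> 0")
      case False
      have "lcomb L (\<lambda>l. poly (p l) ?t) m = poly (p j) ?t \<star> m j"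
        unfolding lcomb_def using False by (subst sum.remove[OF fin j(1)]) (auto intro!: sum.neutral)
      then have mj: "m j = 0"
        using less.prems(4) poly_hvar_eq_0[OF less.prems(2)[OF j(1)] i] j by auto
      have "lcomb (L - {j}) f m = lcomb L f m" for f
        unfolding lcomb_def using sum.remove[OF fin j(1), of "\<lambda>l. f l \<star> m l"] mj by simp
      then have "G (L - {j}) m a" unfolding G_def using fin mM a sp by (metis DiffD1 Diff_subset finite_Diff image_mono order_trans)
      then show False using minimal cardL j fin by (metis card_Diff1_less not_less)
    next
      case True
      then obtain h k where hk: "h \<in> L" "k \<in> L" "h \<noteq> k" "p h \<noteq> 0" "p k \<noteq> 0" "degree (p k) \<le> degree (p h)"
        using j by (metis nat_le_linear)
      define c where "c = lead_coeff (p k)"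
      define e where "e = degree (p h) - degree (p k)"
      define c' where "c' = lead_coeff (p h)"
      have c: "c \<in> ?A" "c \<noteq> 0" "c' \<in> ?A" "c' \<noteq> 0"
        using less.prems(2) hk by (auto simp: c_def c'_def coeffs_in_def)
      have cB: "c \<in> ?B" "c' \<in> ?B" using c AB by auto
      \<comment> \<open>\<open>ph\<close> is the pseudo-remainder of \<open>p h\<close> by
        \<open>p k\<close>. The relation, multiplied by \<open>c\<close>, survives because
        \<open>c p_h m_h + c p_k m_k = ph m_h + p_k (c m_k + c' t^e m_h)\<close>, and the last
        bracket becomes the new \<open>k\<close>-th generator.\<close>
      define ph where "ph = smult c (p h) - monom c' e * p k"
      define p' where "p' = (\<lambda>l. if l = h then ph else if l = k then p k else smult c (p l))"
      define m' where "m' = m (k := c \<star> m k + (c' * ?t ^ e) \<star> m h)"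
      have split: "sum g L = g h + g k + sum g (L - {h, k})" for g :: "nat \<Rightarrow> 'x::comm_monoid_add"
        using fin hk by (simp add: sum.remove[of L h] sum.remove[of "L - {h}" k] insert_commute
            add.assoc Diff_insert2[symmetric])
      have ph: "ph = 0 \<or> degree ph < degree (p h)"
      proof -
        have d: "degree (monom c' e * p k) = degree (p h)" "degree (smult c (p h)) = degree (p h)"
          using c hk by (auto simp: degree_mult_eq degree_monom_eq e_def)
        have "lead_coeff (monom c' e * p k) = c' * c"
          using c by (simp add: lead_coeff_mult c_def degree_monom_eq)
        then have "coeff ph (degree (p h)) = 0"
          using d by (simp add: ph_def c'_def mult.commute)
        moreover have "degree ph \<le> degree (p h)"
          unfolding ph_def using d by (metis degree_diff_le order_refl)
        ultimately show ?thesis by (metis leading_coeff_0_iff order_le_less)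
      qed
      have "\<mu> p' < \<mu> p"
      proof -
        have "(\<Sum>l\<in>L - {h, k}. if p' l = 0 then 0 else Suc (degree (p' l)))
          = (\<Sum>l\<in>L - {h, k}. if p l = 0 then 0 else Suc (degree (p l)))"
          by (rule sum.cong) (use c in \<open>auto simp: p'_def\<close>)
        then show ?thesis unfolding \<mu>_def split using ph hk by (auto simp: p'_def)
      qed
      moreover have "G L m' (c * a)"
        unfolding G_def
      proof (intro conjI ballI)
        show "m' ` L \<subseteq> M"
        proof -
          have "c \<star> m k + (c' * ?t ^ e) \<star> m h \<in> M"
            using hk mM cB t by (intro submodD(2,3)[OF M]) auto
          then show ?thesis using mM by (auto simp: m'_def)
        qed
        fix x assume "x \<in> M"
        then obtain f where f: "\<forall>l\<in>L. f l \<in> ?B" "a \<star> x = lcomb L f m" using sp by blast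
        \<comment> \<open>The old generators are recovered from the new ones up to the factor
          \<open>c\<close>:
          \<open>c (f_h m_h + f_k m_k) = (c f_h - f_k c' t^e) m_h + f_k m'_k\<close>. Hence the
          denominator grows to \<open>c * a\<close>.\<close>
        define f' where "f' = (\<lambda>l. if l = h then c * f h - f k * (c' * ?t ^ e) else if l = k then f k else c * f l)"
        have "f' l \<in> ?B" if "l \<in> L" for l using f(1) hk cB t that by (auto simp: f'_def)
        moreover have "(c * a) \<star> x = lcomb L f' m'"
        proof -
          have "(c * a) \<star> x = c \<star> lcomb L f m" using f(2) by (metis fscale_simps(7))
          also have "\<dots> = lcomb L f' m'"
          proof -
            have "(\<Sum>l\<in>L - {h, k}. f' l \<star> m' l) = (\<Sum>l\<in>L - {h, k}. c \<star> f l \<star> m l)"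
              by (rule sum.cong) (auto simp: f'_def m'_def)
            then show ?thesis unfolding lcomb_def split
              using hk by (simp add: f'_def m'_def fscale_sum algebra_simps)
          qed
          finally show ?thesis .
        qed
        ultimately show "\<exists>f. (\<forall>l\<in>L. f l \<in> ?B) \<and> (c * a) \<star> x = lcomb L f m'" by blast
      qed (use fin a c in auto)
      moreover have "coeffs_in ?A (p' l)" if "l \<in> L" for l
        using less.prems(2) that hk c by (auto simp: p'_def ph_def)
      moreover have "\<exists>l\<in>L. p' l \<noteq> 0" using hk by (auto simp: p'_def)
      moreover have "lcomb L (\<lambda>l. poly (p' l) ?t) m' = 0"
      proof -
        have "(\<Sum>l\<in>L - {h, k}. poly (p' l) ?t \<star> m' l) = (\<Sum>l\<in>L - {h, k}. c \<star> poly (p l) ?t \<star> m l)"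
          by (rule sum.cong) (auto simp: p'_def m'_def)
        then have "lcomb L (\<lambda>l. poly (p' l) ?t) m' = c \<star> lcomb L (\<lambda>l. poly (p l) ?t) m"
          unfolding lcomb_def split
          using hk by (simp add: p'_def m'_def ph_def poly_monom fscale_sum algebra_simps)
        then show ?thesis using less.prems(4) by simp
      qed
      ultimately show False using less.hyps by blast
    qed
  qed
  have "indep ?B L m0" unfolding indep_def
  proof (intro allI impI, elim conjE)
    fix f assume f: "\<forall>l\<in>L. f l \<in> ?B" "lcomb L f m0 = 0"
    have "\<forall>l\<in>L. \<exists>p. coeffs_in ?A p \<and> f l = poly p ?t" using f(1) vars_in_insert_poly by metis
    then obtain p where p: "\<And>l. l \<in> L \<Longrightarrow> coeffs_in ?A (p l)" "\<And>l. l \<in> L \<Longrightarrow> f l = poly (p l) ?t"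
      by metis
    have "lcomb L (\<lambda>l. poly (p l) ?t) m0 = 0"
      using f(2) p(2) unfolding lcomb_def by simp
    then have "\<forall>l\<in>L. p l = 0" using no_relation[OF G0, of p] p(1) by blast
    then show "\<forall>l\<in>L. f l = 0" using p(2) by simp
  qed
  then show ?thesis using G0 that by (auto simp: G_def)
qed

section \<open>Freeness of shift equivariant modules\<close>

lemma hconst_sum: "hconst (sum g X) = (\<Sum>x\<in>X. hconst (g x))"
  by (induction X rule: infinite_finite_induct) (auto simp: hconst_add)

text \<open>\<open>D\<close> is \<open>a b \<partial>/\<partial>t\<^sub>i\<close> in the coordinates given by the family \<open>m\<close>; the factor \<open>a\<close> keeps it inside \<open>M\<close>.\<close>

lemma span_derivation:
  fixes M :: "('i \<Rightarrow> 'd::{finite,linorder} Uh) set"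
  assumes i: "i \<notin> J" and M: "submod (vars_in (insert i J)) M"
    and fin: "finite L" and mM: "m ` L \<subseteq> M" and a: "a \<in> vars_in J" "a \<noteq> 0"
    and sp: "\<And>x. x \<in> M \<Longrightarrow> \<exists>f. (\<forall>l\<in>L. f l \<in> vars_in (insert i J)) \<and> a \<star> x = lcomb L f m"
    and ind: "indep (vars_in (insert i J)) L m" and b: "b \<in> vars_in J"
  obtains D where "\<And>x. x \<in> M \<Longrightarrow> D x \<in> M" "\<And>x y. x \<in> M \<Longrightarrow> y \<in> M \<Longrightarrow> D (x + y) = D x + D y"
    "\<And>f x. f \<in> vars_in J \<Longrightarrow> x \<in> M \<Longrightarrow> D (f \<star> x) = f \<star> D x"
    "\<And>x. x \<in> M \<Longrightarrow> D (hvar i \<star> x) = hvar i \<star> D x + (b * a) \<star> x"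
    "\<And>x. x \<in> M \<Longrightarrow> \<exists>n. (D ^^ n) x = 0"
proof -
  let ?A = "vars_in J" and ?B = "vars_in (insert i J)" and ?t = "hvar i"
  have AB: "?A \<subseteq> ?B" by (rule vars_in_mono) auto
  define ev where "ev p = lcomb L (\<lambda>l. poly (p l) ?t) m" for p
  \<comment> \<open>Only \<open>a \<star> x\<close> is certain to have coordinates in the family
    \<open>m\<close>. They are polynomials in \<open>t\<close>, unique by \<open>indep\<close>;
    differentiating them instead of those of \<open>x\<close> is what brings in the factor
    \<open>a\<close>.\<close>
  define C where "C x p \<longleftrightarrow> (\<forall>l\<in>L. coeffs_in ?A (p l)) \<and> a \<star> x = ev p" for x p
  have ex: "\<exists>p. C x p" if x: "x \<in> M" for x
  proof -
    obtain f where f: "\<forall>l\<in>L. f l \<in> ?B" "a \<star> x = lcomb L f m" using sp[OF x] by blast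
    have "\<forall>l\<in>L. \<exists>p. coeffs_in ?A p \<and> f l = poly p ?t" using f(1) vars_in_insert_poly by metis
    then obtain p where p: "\<And>l. l \<in> L \<Longrightarrow> coeffs_in ?A (p l)" "\<And>l. l \<in> L \<Longrightarrow> f l = poly (p l) ?t"
      by metis
    have "a \<star> x = ev p" unfolding ev_def f(2) by (rule lcomb_cong) (rule p(2))
    then show ?thesis using p(1) unfolding C_def by blast
  qed
  have uniq: "p l = q l" if "C x p" "C x q" "l \<in> L" for x p q l
  proof -
    have c: "coeffs_in ?A (p l - q l)" if "l \<in> L" for l
      using \<open>C x p\<close> \<open>C x q\<close> that by (simp add: C_def)
    have "lcomb L (\<lambda>l. poly (p l - q l) ?t) m = 0"
      using that unfolding C_def ev_def by (simp add: lcomb_diff)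
    moreover have "poly (p l - q l) ?t \<in> ?B" if "l \<in> L" for l
      by (rule poly_vars_in[OF c[OF that]]) (auto simp: vars_in_hvar)
    ultimately have "poly (p l - q l) ?t = 0"
      using indepD[OF ind, of "\<lambda>l. poly (p l - q l) ?t"] \<open>l \<in> L\<close> by blast
    then show ?thesis using poly_hvar_eq_0[OF c i] \<open>l \<in> L\<close> by auto
  qed
  define D where "D x = b \<star> ev (\<lambda>l. pderiv ((SOME p. C x p) l))" for x
  have D: "D x = b \<star> ev (\<lambda>l. pderiv (p l))" if "C x p" for x p
  proof -
    have "C x (SOME p. C x p)" using someI[of "C x", OF that] .
    then have "(SOME p. C x p) l = p l" if "l \<in> L" for l using uniq \<open>C x p\<close> that by blast
    then show ?thesis unfolding D_def ev_def lcomb_def by simp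
  qed
  have ev_M: "ev p \<in> M" if "\<And>l. l \<in> L \<Longrightarrow> coeffs_in ?A (p l)" for p
    unfolding ev_def using that
    by (intro submod_lcomb[OF M _ mM] poly_vars_in[of J]) (auto simp: vars_in_hvar)
  have ev_add: "ev (\<lambda>l. p l + q l) = ev p + ev q" for p q
    by (simp add: ev_def lcomb_add)
  have ev_smult: "ev (\<lambda>l. smult c (p l)) = c \<star> ev p" for c p
    by (simp add: ev_def lcomb_scale)
  have ev_X: "ev (\<lambda>l. pCons 0 (p l)) = ?t \<star> ev p" for p
    by (simp add: ev_def lcomb_scale)
  have C_add: "C (x + y) (\<lambda>l. p l + q l)" if "C x p" "C y q" for x y p q
    using that by (simp add: C_def ev_add)
  have C_scale: "C (f \<star> x) (\<lambda>l. smult f (p l))" if "C x p" "f \<in> ?A" for f x p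
    using that unfolding C_def ev_smult by (metis coeffs_in_smult fscale_simps(7) mult.commute)
  have C_X: "C (?t \<star> x) (\<lambda>l. pCons 0 (p l))" if "C x p" for x p
    using that unfolding C_def ev_X by (metis coeffs_in_pCons fscale_simps(7) mult.commute vars_in_0)
  have C_D: "C (D x) (\<lambda>l. smult (a * b) (pderiv (p l)))" if "C x p" for x p
    using that a b unfolding C_def ev_smult by (simp add: D[OF that])
  show ?thesis
  proof (rule that)
    fix x assume x: "x \<in> M"
    then obtain p where p: "C x p" using ex by blast
    show "D x \<in> M" unfolding D[OF p] using p b AB
      by (intro submodD(3)[OF M] ev_M) (auto simp: C_def)
    show "D (f \<star> x) = f \<star> D x" if "f \<in> ?A" for f
      unfolding D[OF p] D[OF C_scale[OF p that]]
      by (simp add: pderiv_smult ev_smult mult.commute)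
    show "D (?t \<star> x) = ?t \<star> D x + (b * a) \<star> x"
    proof -
      have "D (?t \<star> x) = b \<star> (?t \<star> ev (\<lambda>l. pderiv (p l)) + ev p)"
        unfolding D[OF C_X[OF p]] pderiv_pCons using ev_add[of p "\<lambda>l. pCons 0 (pderiv (p l))"]
        by (simp add: ev_X add.commute)
      also have "ev p = a \<star> x" using p by (simp add: C_def)
      finally show ?thesis unfolding D[OF p] by (simp add: mult.commute)
    qed
    show "D (x + y) = D x + D y" if y: "y \<in> M" for y
    proof -
      obtain q where q: "C y q" using ex[OF y] by blast
      show ?thesis unfolding D[OF p] D[OF q] D[OF C_add[OF p q]] by (simp add: pderiv_add ev_add)
    qed
    \<comment> \<open>Each application of \<open>D\<close> differentiates all coordinates once, up
      to a factor free of \<open>t\<close>, so a bound on their degrees bounds the order of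
      nilpotency.\<close>
    have "(D ^^ n) x = 0" if "C x p" "\<forall>l\<in>L. p l = 0 \<or> degree (p l) < n" for n x p
      using that
    proof (induction n arbitrary: x p)
      case 0
      then have "a \<star> x = 0" by (simp add: C_def ev_def lcomb_def)
      then show ?case using a by simp
    next
      case (Suc n)
      have "(D ^^ n) (D x) = 0"
      proof (rule Suc.IH[OF C_D[OF Suc.prems(1)]], rule ballI)
        fix l assume l: "l \<in> L"
        show "smult (a * b) (pderiv (p l)) = 0 \<or> degree (smult (a * b) (pderiv (p l))) < n"
        proof (cases "degree (p l) = 0")
          case True
          then show ?thesis by (metis pderiv_eq_0_iff smult_0_right)
        next
          case False
          then have "degree (p l) < Suc n" using Suc.prems l by auto
          then have "degree (pderiv (p l)) < n" using False by (simp add: degree_pderiv)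
          then show ?thesis using degree_smult_le[of "a * b" "pderiv (p l)"] by linarith
        qed
      qed
      then show ?case by (simp add: funpow_swap1)
    qed
    moreover have "\<forall>l\<in>L. p l = 0 \<or> degree (p l) < Suc (\<Sum>l\<in>L. degree (p l))"
      using fin by (auto simp: less_Suc_eq_le intro: member_le_sum)
    ultimately show "\<exists>n. (D ^^ n) x = 0" using p by blast
  qed
qed

subsection \<open>Sequences, that is, polynomials in a parameter \<open>s\<close> with coefficients in a module\<close>

definition seqs :: "('v::zero) set \<Rightarrow> (nat \<Rightarrow> 'v) set" where
  "seqs M = {p. (\<forall>k. p k \<in> M) \<and> (\<exists>N. \<forall>k\<ge>N. p k = 0)}"

definition sshift :: "(nat \<Rightarrow> 'v::zero) \<Rightarrow> nat \<Rightarrow> 'v" where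
  "sshift p = (\<lambda>k. case k of 0 \<Rightarrow> 0 | Suc k \<Rightarrow> p k)"

definition sscale :: "'a::times \<Rightarrow> (nat \<Rightarrow> 'i \<Rightarrow> 'a) \<Rightarrow> nat \<Rightarrow> 'i \<Rightarrow> 'a" where
  "sscale f p = (\<lambda>k. f \<star> p k)"

definition sconst :: "'v::zero \<Rightarrow> nat \<Rightarrow> 'v" where
  "sconst x = (\<lambda>k. if k = 0 then x else 0)"

lemma sshift_0 [simp]: "sshift p 0 = 0" and sshift_Suc [simp]: "sshift p (Suc k) = p k"
  by (simp_all add: sshift_def)

lemma sscale_apply [simp]: "sscale f p k = f \<star> p k"
  by (simp add: sscale_def)

lemma sconst_0 [simp]: "sconst x 0 = x" and sconst_Suc [simp]: "sconst x (Suc k) = 0"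
  by (simp_all add: sconst_def)

lemma seqsI: "(\<And>k. p k \<in> M) \<Longrightarrow> (\<And>k. k \<ge> N \<Longrightarrow> p k = 0) \<Longrightarrow> p \<in> seqs M"
  unfolding seqs_def by blast

lemma seqs_mem: "p \<in> seqs M \<Longrightarrow> p k \<in> M"
  by (simp add: seqs_def)

lemma seqs_bound: "p \<in> seqs M \<Longrightarrow> \<exists>N. \<forall>k\<ge>N. p k = 0"
  by (simp add: seqs_def)

lemma seqs_add: "submod A M \<Longrightarrow> p \<in> seqs M \<Longrightarrow> q \<in> seqs M \<Longrightarrow> p + q \<in> seqs M"
proof -
  assume a: "submod A M" "p \<in> seqs M" "q \<in> seqs M"
  then obtain N N' where "\<And>k. k \<ge> N \<Longrightarrow> p k = 0" "\<And>k. k \<ge> N' \<Longrightarrow> q k = 0"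
    using seqs_bound by metis
  then show ?thesis using a by (intro seqsI[of _ _ "max N N'"]) (auto simp: seqs_mem submodD(2) fun_apply)
qed

lemma seqs_scale: "submod A M \<Longrightarrow> f \<in> A \<Longrightarrow> p \<in> seqs M \<Longrightarrow> sscale f p \<in> seqs M"
proof -
  assume a: "submod A M" "f \<in> A" "p \<in> seqs M"
  then obtain N where "\<And>k. k \<ge> N \<Longrightarrow> p k = 0" using seqs_bound by metis
  then show ?thesis using a by (intro seqsI[of _ _ N]) (auto simp: seqs_mem submodD(3))
qed

lemma seqs_shift: "submod A M \<Longrightarrow> p \<in> seqs M \<Longrightarrow> sshift p \<in> seqs M"
proof -
  assume a: "submod A M" "p \<in> seqs M"
  then obtain N where N: "\<And>k. k \<ge> N \<Longrightarrow> p k = 0" using seqs_bound by metis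
  show ?thesis
  proof (rule seqsI[of _ _ "Suc N"])
    fix k
    show "sshift p k \<in> M" using a by (cases k) (auto simp: seqs_mem submodD)
    show "sshift p k = 0" if "k \<ge> Suc N" using that N by (cases k) auto
  qed
qed

lemma seqs_const: "submod A M \<Longrightarrow> x \<in> M \<Longrightarrow> sconst x \<in> seqs M"
  by (rule seqsI[of _ _ 1]) (auto simp: sconst_def submodD(1))

text \<open>\<open>exp(\<sigma>sD)\<close>, where \<open>s\<close> acts as \<^const>\<open>sshift\<close>.\<close>

definition seq_exp :: "complex \<Rightarrow> (('i \<Rightarrow> 'd Uh) \<Rightarrow> 'i \<Rightarrow> 'd Uh) \<Rightarrow> (nat \<Rightarrow> 'i \<Rightarrow> 'd Uh) \<Rightarrow> nat \<Rightarrow> 'i \<Rightarrow> 'd::{finite,linorder} Uh" where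
  "seq_exp \<sigma> D p n = (\<Sum>k\<le>n. hconst (\<sigma> ^ k / fact k) \<star> (D ^^ k) (p (n - k)))"

section \<open>Exponentials of locally nilpotent endomorphisms\<close>

locale module_endo =
  fixes M :: "('i \<Rightarrow> 'd::{finite,linorder} Uh) set" and J :: "'d set" and D
  assumes M: "submod (vars_in J) M" and D_closed: "x \<in> M \<Longrightarrow> D x \<in> M"
    and D_add: "x \<in> M \<Longrightarrow> y \<in> M \<Longrightarrow> D (x + y) = D x + D y"
    and D_scale: "f \<in> vars_in J \<Longrightarrow> x \<in> M \<Longrightarrow> D (f \<star> x) = f \<star> D x"
begin

lemma D_0: "D 0 = 0"
  using D_scale[of 0 0] M by (simp add: submodD)

lemma D_sum: "(\<And>x. x \<in> X \<Longrightarrow> g x \<in> M) \<Longrightarrow> D (sum g X) = (\<Sum>x\<in>X. D (g x))"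
proof (induction X rule: infinite_finite_induct)
  case (insert x F)
  then show ?case using submod_sum[OF M, of F g] by (simp add: D_add)
qed (simp_all add: D_0)

lemma pow: "module_endo M J (D ^^ k)"
proof (induction k)
  case 0 show ?case by unfold_locales (use M in auto)
next
  case (Suc k)
  then interpret k: module_endo M J "D ^^ k" .
  show ?case by unfold_locales (auto simp: M k.D_closed k.D_add k.D_scale D_closed D_add D_scale)
qed

lemmas pow_closed = module_endo.D_closed[OF pow] and pow_add = module_endo.D_add[OF pow]
  and pow_scale = module_endo.D_scale[OF pow] and pow_0 = module_endo.D_0[OF pow]
  and pow_sum = module_endo.D_sum[OF pow]

lemma seq_exp_mem: "p \<in> seqs M \<Longrightarrow> seq_exp \<sigma> D p n \<in> M"
  unfolding seq_exp_def
  by (rule submod_sum[OF M], rule submodD(3)[OF M], simp, rule pow_closed, rule seqs_mem)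

lemma seq_exp_closed:
  assumes nil: "\<And>x. x \<in> M \<Longrightarrow> \<exists>n. (D ^^ n) x = 0" and p: "p \<in> seqs M"
  shows "seq_exp \<sigma> D p \<in> seqs M"
proof -
  obtain N where N: "\<And>k. k \<ge> N \<Longrightarrow> p k = 0" using seqs_bound[OF p] by metis
  have "\<forall>k. \<exists>n. (D ^^ n) (p k) = 0" using nil seqs_mem[OF p] by blast
  from choice[OF this] obtain h where h: "(D ^^ h k) (p k) = 0" for k by blast
  have h': "(D ^^ n) (p k) = 0" if "n \<ge> h k" for n k
  proof -
    have "(D ^^ n) (p k) = (D ^^ (n - h k)) ((D ^^ h k) (p k))" using that
      by (metis add.commute comp_apply funpow_add le_add_diff_inverse)
    then show ?thesis by (simp add: h pow_0)
  qed
  \<comment> \<open>For \<open>n \<ge> K\<close> and \<open>k \<le> n\<close>, either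
    \<open>n - k\<close> is beyond the support of \<open>p\<close>, or \<open>k\<close> exceeds the
    order of nilpotency of \<open>D\<close> on \<open>p (n - k)\<close>, which the sum of all orders
    dominates.\<close>
  define K where "K = N + (\<Sum>k<N. h k)"
  show ?thesis
  proof (rule seqsI[of _ _ K])
    show "seq_exp \<sigma> D p n = 0" if n: "n \<ge> K" for n
      unfolding seq_exp_def
    proof (rule sum.neutral, rule ballI)
      fix k assume k: "k \<in> {..n}"
      have "(D ^^ k) (p (n - k)) = 0"
      proof (cases "n - k \<ge> N")
        case True then show ?thesis by (simp add: N pow_0)
      next
        case False
        then have "h (n - k) \<le> (\<Sum>k<N. h k)" by (intro member_le_sum) auto
        moreover have "k \<ge> (\<Sum>k<N. h k)" using False n k by (auto simp: K_def)
        ultimately show ?thesis by (intro h') simp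
      qed
      then show "hconst (\<sigma> ^ k / fact k) \<star> (D ^^ k) (p (n - k)) = 0" by simp
    qed
  qed (simp add: seq_exp_mem p)
qed

text \<open>Both factors are power series in the same operator, so by the binomial theorem the
  coefficient of \<open>D^q\<close> in the product is \<open>(\<sigma> + \<tau>)^q / q!\<close>,
  which is zero for \<open>q > 0\<close>.\<close>

lemma seq_exp_inverse:
  assumes p: "p \<in> seqs M" and \<sigma>: "\<sigma> + \<tau> = 0"
  shows "seq_exp \<sigma> D (seq_exp \<tau> D p) = p"
proof
  fix n
  define c where "c k l = \<sigma> ^ k / fact k * (\<tau> ^ l / fact l)" for k l
  have "seq_exp \<sigma> D (seq_exp \<tau> D p) n
    = (\<Sum>k\<le>n. \<Sum>l\<le>n - k. hconst (c k l) \<star> (D ^^ (k + l)) (p (n - (k + l))))"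
    unfolding seq_exp_def[of \<sigma>]
  proof (rule sum.cong[OF refl])
    fix k assume "k \<in> {..n}"
    have "(D ^^ k) (seq_exp \<tau> D p (n - k))
      = (\<Sum>l\<le>n - k. (D ^^ k) (hconst (\<tau> ^ l / fact l) \<star> (D ^^ l) (p (n - k - l))))"
      unfolding seq_exp_def
      by (rule pow_sum, rule submodD(3)[OF M], simp, rule pow_closed, rule seqs_mem[OF p])
    also have "\<dots> = (\<Sum>l\<le>n - k. hconst (\<tau> ^ l / fact l) \<star> (D ^^ (k + l)) (p (n - (k + l))))"
      by (rule sum.cong) (auto simp: pow_scale pow_closed seqs_mem[OF p] funpow_add)
    finally show "hconst (\<sigma> ^ k / fact k) \<star> (D ^^ k) (seq_exp \<tau> D p (n - k))
      = (\<Sum>l\<le>n - k. hconst (c k l) \<star> (D ^^ (k + l)) (p (n - (k + l))))"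
      by (simp add: fscale_sum c_def flip: hconst_mult)
  qed
  also have "\<dots> = (\<Sum>(k, l)\<in>{(k, l). k + l \<le> n}. hconst (c k l) \<star> (D ^^ (k + l)) (p (n - (k + l))))"
    by (subst sum.Sigma) (auto intro: sum.cong)
  also have "\<dots> = (\<Sum>q\<le>n. \<Sum>k\<le>q. hconst (c k (q - k)) \<star> (D ^^ q) (p (n - q)))"
    by (subst sum.triangle_reindex_eq) (auto intro!: sum.cong)
  also have "\<dots> = (\<Sum>q\<le>n. hconst (if q = 0 then 1 else 0) \<star> (D ^^ q) (p (n - q)))"
  proof (rule sum.cong[OF refl])
    fix q
    have "(\<Sum>k\<le>q. c k (q - k)) = (\<Sum>k\<le>q. of_nat (q choose k) * \<sigma> ^ k * \<tau> ^ (q - k)) / fact q"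
      unfolding sum_divide_distrib
      by (rule sum.cong) (auto simp: c_def binomial_fact)
    also have "\<dots> = (if q = 0 then 1 else 0)"
      by (simp add: binomial_ring[symmetric] \<sigma>)
    finally have *: "(\<Sum>k\<le>q. c k (q - k)) = (if q = 0 then 1 else 0)" .
    show "(\<Sum>k\<le>q. hconst (c k (q - k)) \<star> (D ^^ q) (p (n - q)))
      = hconst (if q = 0 then 1 else 0) \<star> (D ^^ q) (p (n - q))"
      unfolding *[symmetric] by (simp add: hconst_sum sum_fscale)
  qed
  also have "\<dots> = (\<Sum>q\<le>n. if q = 0 then p n else 0)"
    by (rule sum.cong) auto
  also have "\<dots> = p n" by simp
  finally show "seq_exp \<sigma> D (seq_exp \<tau> D p) n = p n" .
qed

lemma seq_exp_add:
  "p \<in> seqs M \<Longrightarrow> q \<in> seqs M \<Longrightarrow> seq_exp \<sigma> D (p + q) = seq_exp \<sigma> D p + seq_exp \<sigma> D q"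
  by (rule ext) (simp add: seq_exp_def fun_apply pow_add seqs_mem sum.distrib)

lemma seq_exp_scale:
  "f \<in> vars_in J \<Longrightarrow> p \<in> seqs M \<Longrightarrow> seq_exp \<sigma> D (sscale f p) = sscale f (seq_exp \<sigma> D p)"
  by (rule ext) (simp add: seq_exp_def pow_scale seqs_mem fscale_sum mult.commute)

lemma seq_exp_shift: "p \<in> seqs M \<Longrightarrow> seq_exp \<sigma> D (sshift p) = sshift (seq_exp \<sigma> D p)"
proof (rule ext)
  fix n assume p: "p \<in> seqs M"
  show "seq_exp \<sigma> D (sshift p) n = sshift (seq_exp \<sigma> D p) n"
  proof (cases n)
    case 0 then show ?thesis by (simp add: seq_exp_def)
  next
    case (Suc j)
    have "(\<Sum>k\<le>j. hconst (\<sigma> ^ k / fact k) \<star> (D ^^ k) (sshift p (Suc j - k))) = seq_exp \<sigma> D p j"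
      unfolding seq_exp_def by (rule sum.cong) (auto simp: Suc_diff_le)
    then show ?thesis by (simp add: Suc seq_exp_def[of _ _ "sshift p"] pow_0 del: funpow.simps)
  qed
qed

text \<open>By the Leibniz rule \<open>D^(k+1) t = t D^(k+1) + (k+1) c D^k\<close>; division by
  \<open>(k+1)!\<close> turns the extra terms into \<open>c\<close> times the exponential, moved up
  by one power of \<open>s\<close>. So \<open>exp(sD)\<close> is semilinear over
  \<open>t \<mapsto> t + c s\<close>.\<close>

lemma seq_exp_derivation:
  assumes t: "\<And>x. x \<in> M \<Longrightarrow> t \<star> x \<in> M" and c: "c \<in> vars_in J"
    and der: "\<And>x. x \<in> M \<Longrightarrow> D (t \<star> x) = t \<star> D x + c \<star> x" and p: "p \<in> seqs M"
  shows "seq_exp 1 D (sscale t p) = sscale t (seq_exp 1 D p) + sscale c (sshift (seq_exp 1 D p))"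
proof (rule ext)
  fix n
  have der_pow: "(D ^^ Suc k) (t \<star> x) = t \<star> (D ^^ Suc k) x + (of_nat (Suc k) * c) \<star> (D ^^ k) x"
    if "x \<in> M" for k x
  proof (induction k)
    case 0 then show ?case using der that by simp
  next
    case (Suc k)
    have "of_nat (Suc k) * c \<in> vars_in J" using c by (metis hconst_of_nat vars_in_const vars_in_mult)
    moreover have mem: "(D ^^ k) x \<in> M" "(D ^^ Suc k) x \<in> M" using that pow_closed by blast+
    ultimately have "(D ^^ Suc (Suc k)) (t \<star> x)
      = t \<star> (D ^^ Suc (Suc k)) x + c \<star> (D ^^ Suc k) x + (of_nat (Suc k) * c) \<star> (D ^^ Suc k) x"
      using Suc submodD(3)[OF M] t by (simp add: D_add D_scale der)
    then show ?case by (rule trans) (rule ext, simp add: fun_apply fscale_apply algebra_simps)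
  qed
  show "seq_exp 1 D (sscale t p) n = (sscale t (seq_exp 1 D p) + sscale c (sshift (seq_exp 1 D p))) n"
  proof (cases n)
    case 0 then show ?thesis by (simp add: seq_exp_def fun_apply)
  next
    case (Suc j)
    have "hconst (1 / fact (Suc k)) * (of_nat (Suc k) * c) = c * hconst (1 / fact k)" for k
    proof -
      have "hconst (1 / fact (Suc k)) * (of_nat (Suc k) * c) = hconst (1 / fact (Suc k) * of_nat (Suc k)) * c"
        by (simp only: hconst_mult hconst_of_nat mult.assoc)
      also have "1 / fact (Suc k) * of_nat (Suc k) = (1 / fact k :: complex)"
        by (simp del: of_nat_Suc)
      finally show ?thesis by (simp only: mult.commute)
    qed
    then have *: "hconst (1 / fact (Suc k)) \<star> (D ^^ Suc k) (t \<star> p (j - k))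
      = t \<star> hconst (1 / fact (Suc k)) \<star> (D ^^ Suc k) (p (j - k)) + c \<star> hconst (1 / fact k) \<star> (D ^^ k) (p (j - k))" for k
      unfolding der_pow[OF seqs_mem[OF p]] by (simp only: fscale_simps mult.commute mult.left_commute)
    show ?thesis
      unfolding Suc seq_exp_def sscale_apply sshift_Suc power_one
        plus_fun_apply[where f = "sscale _ _"]
      unfolding sum.atMost_Suc_shift diff_Suc_Suc * fscale_simps(1) fscale_sum sum.distrib
      by (simp only: diff_zero funpow_0 fscale_simps mult.commute add.assoc)
  qed
qed

end

section \<open>Flows: automorphisms of \<open>M[s]\<close> that translate one variable
  \<open>t\<close>\<close>

locale shift_step =
  fixes i :: "'d::{finite,linorder}" and J :: "'d set" and M :: "('i \<Rightarrow> 'd Uh) set"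
    and X :: "'d \<Rightarrow> ('i \<Rightarrow> 'd Uh) \<Rightarrow> 'i \<Rightarrow> 'd Uh"
  assumes i: "i \<notin> J" and M: "submod (vars_in (insert i J)) M"
    and X_bij: "j \<in> J \<Longrightarrow> bij_betw (X j) M M"
    and X_add: "j \<in> J \<Longrightarrow> x \<in> M \<Longrightarrow> y \<in> M \<Longrightarrow> X j (x + y) = X j x + X j y"
    and X_scale: "j \<in> J \<Longrightarrow> f \<in> vars_in (insert i J) \<Longrightarrow> x \<in> M
      \<Longrightarrow> X j (f \<star> x) = shift_poly (axis j 1) f \<star> X j x"
begin

abbreviation "A \<equiv> vars_in J"
abbreviation "B \<equiv> vars_in (insert i J)"
abbreviation "t \<equiv> hvar i"

lemma AB: "f \<in> A \<Longrightarrow> f \<in> B"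
  using vars_in_mono[of J "insert i J"] by auto

lemma t_B: "t \<in> B"
  by (simp add: vars_in_hvar)

lemma M_A: "submod A M"
  using M AB by (auto simp: submod_def)

lemmas M_add = submodD(2)[OF M] and M_scale = submodD(3)[OF M] and M_0 = submodD(1)[OF M]
  and S_add = seqs_add[OF M] and S_scale = seqs_scale[OF M] and S_shift = seqs_shift[OF M]
  and S_const = seqs_const[OF M]

text \<open>The known object is an automorphism of \<open>M[s]\<close> that is semilinear over the
  automorphism \<open>t \<mapsto> t + c s\<close> of \<open>A[t, s]\<close> fixing \<open>A\<close>
  and \<open>s\<close>. The clause on \<open>sshift\<close> is linearity over
  \<open>s\<close>.\<close>

definition flow :: "'d Uh \<Rightarrow> ((nat \<Rightarrow> 'i \<Rightarrow> 'd Uh) \<Rightarrow> nat \<Rightarrow> 'i \<Rightarrow> 'd Uh) \<Rightarrow> bool" where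
  "flow c E \<longleftrightarrow> bij_betw E (seqs M) (seqs M) \<and>
    (\<forall>p\<in>seqs M. \<forall>q\<in>seqs M. E (p + q) = E p + E q) \<and>
    (\<forall>f\<in>A. \<forall>p\<in>seqs M. E (sscale f p) = sscale f (E p)) \<and>
    (\<forall>p\<in>seqs M. E (sshift p) = sshift (E p)) \<and>
    (\<forall>p\<in>seqs M. E (sscale t p) = sscale t (E p) + sscale c (sshift (E p)))"

lemma flowD:
  assumes "flow c E"
  shows "p \<in> seqs M \<Longrightarrow> E p \<in> seqs M" "p \<in> seqs M \<Longrightarrow> q \<in> seqs M \<Longrightarrow> E (p + q) = E p + E q"
    "f \<in> A \<Longrightarrow> p \<in> seqs M \<Longrightarrow> E (sscale f p) = sscale f (E p)"
    "p \<in> seqs M \<Longrightarrow> E (sshift p) = sshift (E p)"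
    "p \<in> seqs M \<Longrightarrow> E (sscale t p) = sscale t (E p) + sscale c (sshift (E p))"
    "bij_betw E (seqs M) (seqs M)"
  using assms bij_betwE[of E "seqs M" "seqs M"] unfolding flow_def by blast+

text \<open>As \<open>c'\<close> is free of \<open>t\<close>, the outer map \<open>E\<close> is
  linear over it, so the second translation passes through the first unchanged and the two add up.
  This gives closure of the admissible coefficients under addition.\<close>

lemma flow_comp:
  assumes c: "c \<in> A" "c' \<in> A" and E: "flow c E" and E': "flow c' E'"
  shows "flow (c + c') (E \<circ> E')"
  unfolding flow_def
proof (intro conjI ballI)
  show "bij_betw (E \<circ> E') (seqs M) (seqs M)"
    using flowD(6)[OF E'] flowD(6)[OF E] by (rule bij_betw_trans)
  fix p assume p: "p \<in> seqs M"
  note p' = flowD(1)[OF E' p]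
  show "(E \<circ> E') (p + q) = (E \<circ> E') p + (E \<circ> E') q" if "q \<in> seqs M" for q
    using p that by (simp add: flowD(1,2)[OF E] flowD(1,2)[OF E'])
  show "(E \<circ> E') (sscale f p) = sscale f ((E \<circ> E') p)" if "f \<in> A" for f
    using p that by (simp add: flowD(1,3)[OF E] flowD(1,3)[OF E'])
  show "(E \<circ> E') (sshift p) = sshift ((E \<circ> E') p)"
    using p by (simp add: flowD(1,4)[OF E] flowD(1,4)[OF E'])
  have "E (E' (sscale t p)) = E (sscale t (E' p)) + E (sscale c' (sshift (E' p)))"
    using flowD(5)[OF E' p] flowD(2)[OF E S_scale[OF t_B p'] S_scale[OF AB[OF c(2)] S_shift[OF p']]] by simp
  also have "\<dots> = (sscale t (E (E' p)) + sscale c (sshift (E (E' p)))) + sscale c' (sshift (E (E' p)))"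
    using flowD(5)[OF E p'] flowD(3)[OF E c(2) S_shift[OF p']] flowD(4)[OF E p'] by simp
  also have "\<dots> = sscale t (E (E' p)) + sscale (c + c') (sshift (E (E' p)))"
    by (rule ext) (simp add: plus_fun_apply[where f = "_ :: nat \<Rightarrow> _"] add.assoc)
  finally show "(E \<circ> E') (sscale t p) = sscale t ((E \<circ> E') p) + sscale (c + c') (sshift ((E \<circ> E') p))"
    by simp
qed

lemma X_0: "j \<in> J \<Longrightarrow> X j 0 = 0"
  using X_scale[of j 0 0] M_0 by simp

text \<open>\<open>X j\<close> acts on \<open>M[s]\<close> coefficientwise and fixes
  \<open>t\<close>, because \<open>i\<close> is not in \<open>J\<close>. Conjugation therefore keeps
  the shape of a flow and only shifts its coefficient. This is the point where the equivariance of
  \<open>M\<close> is used.\<close>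

lemma flow_conj:
  assumes j: "j \<in> J" and c: "c \<in> A" and E: "flow c E"
  shows "flow (shift_poly (axis j 1) c) (\<lambda>p. X j \<circ> E (inv_into M (X j) \<circ> p))"
proof -
  let ?\<sigma> = "shift_poly (axis j 1)" and ?\<sigma>' = "shift_poly (- axis j 1)"
  define Y where "Y = inv_into M (X j)"
  have Xc: "X j x \<in> M" if "x \<in> M" for x using X_bij[OF j] that bij_betwE by blast
  have Yb: "bij_betw Y M M" unfolding Y_def by (rule bij_betw_inv_into[OF X_bij[OF j]])
  then have Yc: "Y x \<in> M" if "x \<in> M" for x using that bij_betwE by blast
  have XY: "X j (Y x) = x" if "x \<in> M" for x
    unfolding Y_def using X_bij[OF j] that by (rule bij_betw_inv_into_right)
  have YX: "Y (X j x) = x" if "x \<in> M" for x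
    unfolding Y_def using X_bij[OF j] that by (rule bij_betw_inv_into_left)
  have Y_add: "Y (x + y) = Y x + Y y" if "x \<in> M" "y \<in> M" for x y
    using YX[OF M_add[OF Yc[OF that(1)] Yc[OF that(2)]]] that by (simp add: X_add[OF j] Yc XY)
  have Y_scale: "Y (f \<star> x) = ?\<sigma>' f \<star> Y x" if "f \<in> B" "x \<in> M" for f x
  proof -
    have "?\<sigma>' f \<in> B" using that by (intro shift_poly_vars_in)
    then have "X j (?\<sigma>' f \<star> Y x) = f \<star> x" using X_scale[OF j] Yc XY that by simp
    then show ?thesis using YX[OF M_scale[OF \<open>?\<sigma>' f \<in> B\<close> Yc[OF that(2)]]] by simp
  qed
  have Y_0: "Y 0 = 0" using Y_scale[of 0 0] M_0 by simp
  have St: "?\<sigma> t = t" "?\<sigma>' t = t" using i j by (auto simp: axis_def)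
  have Xs: "X j \<circ> p \<in> seqs M" if p: "p \<in> seqs M" for p
  proof -
    obtain N where "\<And>k. k \<ge> N \<Longrightarrow> p k = 0" using seqs_bound[OF p] by metis
    then show ?thesis by (intro seqsI[of _ _ N]) (auto simp: Xc seqs_mem[OF p] X_0[OF j])
  qed
  have Ys: "Y \<circ> p \<in> seqs M" if p: "p \<in> seqs M" for p
  proof -
    obtain N where "\<And>k. k \<ge> N \<Longrightarrow> p k = 0" using seqs_bound[OF p] by metis
    then show ?thesis by (intro seqsI[of _ _ N]) (auto simp: Yc seqs_mem[OF p] Y_0)
  qed
  have Xs_add: "X j \<circ> (p + q) = (X j \<circ> p) + (X j \<circ> q)" if "p \<in> seqs M" "q \<in> seqs M" for p q
    using seqs_mem[OF that(1)] seqs_mem[OF that(2)] by (intro ext) (simp add: plus_fun_apply[where f = "_ :: nat \<Rightarrow> _"] X_add[OF j])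
  have Ys_add: "Y \<circ> (p + q) = (Y \<circ> p) + (Y \<circ> q)" if "p \<in> seqs M" "q \<in> seqs M" for p q
    using seqs_mem[OF that(1)] seqs_mem[OF that(2)] by (intro ext) (simp add: plus_fun_apply[where f = "_ :: nat \<Rightarrow> _"] Y_add)
  have Xs_scale: "X j \<circ> sscale f p = sscale (?\<sigma> f) (X j \<circ> p)" if "f \<in> B" "p \<in> seqs M" for f p
    using seqs_mem[OF that(2)] that(1) by (intro ext) (simp add: X_scale[OF j])
  have Ys_scale: "Y \<circ> sscale f p = sscale (?\<sigma>' f) (Y \<circ> p)" if "f \<in> B" "p \<in> seqs M" for f p
    using seqs_mem[OF that(2)] that(1) by (intro ext) (simp add: Y_scale)
  have Xs_shift: "X j \<circ> sshift p = sshift (X j \<circ> p)" for p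
    by (rule ext) (simp add: sshift_def X_0[OF j] split: nat.split)
  have Ys_shift: "Y \<circ> sshift p = sshift (Y \<circ> p)" for p
    by (rule ext) (simp add: sshift_def Y_0 split: nat.split)
  show ?thesis unfolding flow_def Y_def[symmetric]
  proof (intro conjI ballI)
    have inv: "X j \<circ> (Y \<circ> p) = p" "Y \<circ> (X j \<circ> p) = p" if "p \<in> seqs M" for p
      using seqs_mem[OF that] by (auto intro!: ext simp only: comp_def XY YX)
    have "bij_betw ((\<circ>) Y) (seqs M) (seqs M)"
      by (rule bij_betw_byWitness[of _ "(\<circ>) (X j)"]) (use inv Xs Ys in blast)+
    moreover have "bij_betw ((\<circ>) (X j)) (seqs M) (seqs M)"
      by (rule bij_betw_byWitness[of _ "(\<circ>) Y"]) (use inv Xs Ys in blast)+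
    ultimately     have "bij_betw ((\<circ>) (X j) \<circ> (E \<circ> (\<circ>) Y)) (seqs M) (seqs M)"
      using flowD(6)[OF E] by (intro bij_betw_trans)
    then show "bij_betw (\<lambda>p. X j \<circ> E (Y \<circ> p)) (seqs M) (seqs M)" by (simp add: comp_def)
    fix p assume p: "p \<in> seqs M"
    note Yp = Ys[OF p] note EYp = flowD(1)[OF E Yp]
    show "X j \<circ> E (Y \<circ> (p + q)) = (X j \<circ> E (Y \<circ> p)) + (X j \<circ> E (Y \<circ> q))" if q: "q \<in> seqs M" for q
      unfolding Ys_add[OF p q] flowD(2)[OF E Yp Ys[OF q]]
      by (rule Xs_add[OF EYp flowD(1)[OF E Ys[OF q]]])
    show "X j \<circ> E (Y \<circ> sscale f p) = sscale f (X j \<circ> E (Y \<circ> p))" if f: "f \<in> A" for f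
      unfolding Ys_scale[OF AB[OF f] p] flowD(3)[OF E shift_poly_vars_in[OF f] Yp]
        Xs_scale[OF AB[OF shift_poly_vars_in[OF f]] EYp] by simp
    show "X j \<circ> E (Y \<circ> sshift p) = sshift (X j \<circ> E (Y \<circ> p))"
      unfolding Ys_shift flowD(4)[OF E Yp] Xs_shift ..
    show "X j \<circ> E (Y \<circ> sscale t p) = sscale t (X j \<circ> E (Y \<circ> p)) + sscale (?\<sigma> c) (sshift (X j \<circ> E (Y \<circ> p)))"
      unfolding Ys_scale[OF t_B p] St flowD(5)[OF E Yp]
        Xs_add[OF S_scale[OF t_B EYp] S_scale[OF AB[OF c] S_shift[OF EYp]]]
        Xs_scale[OF t_B EYp] Xs_scale[OF AB[OF c] S_shift[OF EYp]] Xs_shift ..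
  qed
qed

lemma flow_one:
  assumes fg: "spans B M L0 g0"
  shows "\<exists>E. flow 1 E"
proof -
  obtain L m a where basis: "finite L" "m ` L \<subseteq> M" and a: "a \<in> A" "a \<noteq> 0"
    and sp: "\<And>x. x \<in> M \<Longrightarrow> \<exists>f. (\<forall>l\<in>L. f l \<in> B) \<and> a \<star> x = lcomb L f m"
    and ind: "indep B L m"
    using generic_basis[OF i M fg] by blast
  \<comment> \<open>The quantifier over \<open>b\<close> builds closure under multiplication by
    \<open>A\<close> into the definition; a flow for \<open>c\<close> alone gives no evident flow
    for \<open>b * c\<close>.\<close>
  define I where "I = {c \<in> A. \<forall>b\<in>A. \<exists>E. flow (b * c) E}"
  have "\<exists>E. flow (b * a) E" if b: "b \<in> A" for b
  proof -
    obtain D where D: "\<And>x. x \<in> M \<Longrightarrow> D x \<in> M" "\<And>x y. x \<in> M \<Longrightarrow> y \<in> M \<Longrightarrow> D (x + y) = D x + D y"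
      "\<And>f x. f \<in> A \<Longrightarrow> x \<in> M \<Longrightarrow> D (f \<star> x) = f \<star> D x"
      "\<And>x. x \<in> M \<Longrightarrow> D (t \<star> x) = t \<star> D x + (b * a) \<star> x"
      "\<And>x. x \<in> M \<Longrightarrow> \<exists>n. (D ^^ n) x = 0"
      using span_derivation[OF i M basis a sp ind b] by blast
    interpret D: module_endo M J D
      by unfold_locales (use M_A D in auto)
    have "bij_betw (seq_exp 1 D) (seqs M) (seqs M)"
      by (rule bij_betw_byWitness[of _ "seq_exp (-1) D"])
        (use D.seq_exp_inverse[of _ "-1" 1] D.seq_exp_inverse[of _ 1 "-1"] D.seq_exp_closed D(5) in auto)
    then have "flow (b * a) (seq_exp 1 D)" unfolding flow_def
      using D.seq_exp_add D.seq_exp_scale D.seq_exp_shift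
        D.seq_exp_derivation[OF M_scale[OF t_B] _ D(4)] a b by auto
    then show ?thesis by blast
  qed
  then have aI: "a \<in> I" using a by (simp add: I_def)
  have "1 \<in> I"
  proof (rule shift_invariant_ideal[of J I a])
    show "finite J" by simp
    show "f + g \<in> I" if "f \<in> I" "g \<in> I" for f g
    proof -
      have "\<exists>E. flow (b * (f + g)) E" if b: "b \<in> A" for b
      proof -
        obtain E E' where "flow (b * f) E" "flow (b * g) E'" using \<open>f \<in> I\<close> \<open>g \<in> I\<close> b unfolding I_def by blast
        then have "flow (b * f + b * g) (E \<circ> E')"
          using b \<open>f \<in> I\<close> \<open>g \<in> I\<close> by (intro flow_comp) (auto simp: I_def)
        then show ?thesis by (metis distrib_left)
      qed
      then show ?thesis using that by (simp add: I_def)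
    qed
    show "f * g \<in> I" if "f \<in> A" "g \<in> I" for f g
    proof -
      have "\<exists>E. flow (b * (f * g)) E" if b: "b \<in> A" for b
      proof -
        have "b * f \<in> A" using b \<open>f \<in> A\<close> by simp
        then have "\<exists>E. flow (b * f * g) E" using \<open>g \<in> I\<close> unfolding I_def by blast
        then show ?thesis by (simp only: mult.assoc)
      qed
      then show ?thesis using that by (simp add: I_def)
    qed
    show "shift_poly (axis j 1) f \<in> I" if j: "j \<in> J" and f: "f \<in> I" for j f
    proof -
      have "\<exists>E. flow (b * shift_poly (axis j 1) f) E" if b: "b \<in> A" for b
      proof -
        \<comment> \<open>Conjugation shifts the whole product, so the factor \<open>b\<close> is
          shifted back beforehand.\<close>
        have b': "shift_poly (- axis j 1) b \<in> A" by (rule shift_poly_vars_in[OF b])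
        then obtain E where E: "flow (shift_poly (- axis j 1) b * f) E" using f unfolding I_def by blast
        have "shift_poly (- axis j 1) b * f \<in> A" using b' f by (simp add: I_def)
        from flow_conj[OF j this E] show ?thesis by (auto simp: shift_poly_hom)
      qed
      then show ?thesis using f by (simp add: I_def shift_poly_vars_in)
    qed
  qed (use a aI in auto)
  then have "\<forall>b\<in>A. \<exists>E. flow (b * 1) E" unfolding I_def by blast
  then show ?thesis using vars_in_1 by (metis mult_1)
qed

end

section \<open>Evaluation at \<open>s = u\<close> and division by \<open>s - u\<close>\<close>

definition seq_eval :: "'a \<Rightarrow> (nat \<Rightarrow> 'i \<Rightarrow> 'a) \<Rightarrow> 'i \<Rightarrow> 'a::comm_ring_1" where
  "seq_eval u p = (\<Sum>k | p k \<noteq> 0. u ^ k \<star> p k)"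

lemma seq_eval_bound: "(\<And>k. k \<ge> N \<Longrightarrow> p k = 0) \<Longrightarrow> seq_eval u p = (\<Sum>k<N. u ^ k \<star> p k)"
  unfolding seq_eval_def by (rule sum.mono_neutral_left) (auto simp: not_less[symmetric])

lemma seq_eval_add:
  assumes "p \<in> seqs M" "q \<in> seqs M"
  shows "seq_eval u (p + q) = seq_eval u p + seq_eval u q"
proof -
  obtain N N' where N: "\<And>k. k \<ge> N \<Longrightarrow> p k = 0" "\<And>k. k \<ge> N' \<Longrightarrow> q k = 0"
    using assms seqs_bound by metis
  show ?thesis
    using seq_eval_bound[of "max N N'" p u] seq_eval_bound[of "max N N'" q u]
      seq_eval_bound[of "max N N'" "p + q" u] N
    by (simp add: plus_fun_apply[where f = "p :: nat \<Rightarrow> _"] sum.distrib)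
qed

lemma seq_eval_scale: "p \<in> seqs M \<Longrightarrow> seq_eval u (sscale f p) = f \<star> seq_eval u p"
proof -
  assume p: "p \<in> seqs M"
  obtain N where N: "\<And>k. k \<ge> N \<Longrightarrow> p k = 0" using p seqs_bound by metis
  show ?thesis
    using seq_eval_bound[of N p u] seq_eval_bound[of N "sscale f p" u] N
    by (simp add: fscale_sum mult.commute)
qed

lemma seq_eval_shift: "p \<in> seqs M \<Longrightarrow> seq_eval u (sshift p) = u \<star> seq_eval u p"
proof -
  assume p: "p \<in> seqs M"
  obtain N where N: "\<And>k. k \<ge> N \<Longrightarrow> p k = 0" using p seqs_bound by metis
  have "sshift p k = 0" if "k \<ge> Suc N" for k using that N by (cases k) auto
  then have "seq_eval u (sshift p) = (\<Sum>k<Suc N. u ^ k \<star> sshift p k)" by (rule seq_eval_bound)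
  also have "\<dots> = u \<star> (\<Sum>k<N. u ^ k \<star> p k)"
    by (simp add: sum.lessThan_Suc_shift fscale_sum del: sum.lessThan_Suc)
  finally show ?thesis using seq_eval_bound[of N p u] N by simp
qed

lemma seq_eval_const [simp]: "seq_eval u (sconst x) = x"
  by (subst seq_eval_bound[of 1]) (auto simp: sconst_def)

lemma seq_eval_mem: "submod A M \<Longrightarrow> u \<in> A \<Longrightarrow> (\<And>n. u ^ n \<in> A) \<Longrightarrow> p \<in> seqs M \<Longrightarrow> seq_eval u p \<in> M"
  unfolding seq_eval_def by (rule submod_sum, assumption, rule submodD(3)) (simp_all add: seqs_mem)

text \<open>Division by \<open>s - u\<close>, that is \<open>p = p(u) + (s - u) q\<close>, by
  Horner's scheme. The equation is arranged without a difference, since submodules are only assumed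
  to be closed under sums and multiples.\<close>

lemma seqs_division:
  assumes M: "submod A M" and u: "u \<in> A" "\<And>n. u ^ n \<in> A" and p: "p \<in> seqs M"
  shows "\<exists>q\<in>seqs M. p + sscale u q = sconst (seq_eval u p) + sshift q"
proof -
  obtain N where N: "\<And>k. k \<ge> N \<Longrightarrow> p k = 0" using p seqs_bound by metis
  show ?thesis using p N
  proof (induction N arbitrary: p)
    case 0
    then have "p = 0" by (intro ext) (simp add: fun_apply)
    then have "p + sscale u 0 = sconst (seq_eval u p) + sshift 0"
      by (intro ext) (auto simp: fun_apply seq_eval_def sconst_def sshift_def fscale_apply split: nat.split)
    moreover have "0 \<in> seqs M" using M by (intro seqsI[of _ _ 0]) (auto simp: submodD zero_fun_apply)
    ultimately show ?case by blast
  next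
    case (Suc N)
    define p' where "p' = (\<lambda>k. p (Suc k))"
    have p': "p' \<in> seqs M"
      by (rule seqsI[of _ _ N]) (use Suc.prems in \<open>auto simp: p'_def seqs_mem\<close>)
    obtain q' where q': "q' \<in> seqs M" "p' + sscale u q' = sconst (seq_eval u p') + sshift q'"
      using Suc.IH[OF p'] Suc.prems(2) unfolding p'_def by blast
    have pp: "p = sconst (p 0) + sshift p'"
    proof
      show "p k = (sconst (p 0) + sshift p') k" for k
        by (cases k) (auto simp: plus_fun_apply[where f = "sconst _"] p'_def)
    qed
    have "seq_eval u p = p 0 + u \<star> seq_eval u p'"
      using seq_eval_add[OF seqs_const[OF M] seqs_shift[OF M p'], of "p 0" u] Suc.prems pp
        seq_eval_shift[OF p', of u] by (simp add: seqs_mem)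
    moreover have "p' k + u \<star> q' k = sconst (seq_eval u p') k + sshift q' k" for k
      using fun_cong[OF q'(2), of k] by (simp add: plus_fun_apply[where f = p'] plus_fun_apply[where f = "sconst _"])
    ultimately have "(p + sscale u (sconst (seq_eval u p') + sshift q')) k
      = (sconst (seq_eval u p) + sshift (sconst (seq_eval u p') + sshift q')) k" for k
      by (cases k) (simp_all add: plus_fun_apply[where f = p] plus_fun_apply[where f = "sconst _"] p'_def)
    then have "p + sscale u (sconst (seq_eval u p') + sshift q')
      = sconst (seq_eval u p) + sshift (sconst (seq_eval u p') + sshift q')" by (rule ext)
    moreover have "sconst (seq_eval u p') + sshift q' \<in> seqs M"
      by (intro seqs_add[OF M] seqs_const[OF M] seqs_shift[OF M] q'(1) seq_eval_mem[OF M u p'])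
    ultimately show ?case by blast
  qed
qed

lemma seq_zero_apply [simp]: "(0 :: nat \<Rightarrow> 'v::zero) k = 0"
  by (simp add: zero_fun_apply)

lemma hvar_neq_0 [simp]: "hvar i \<noteq> 0"
  by (metis hvar_def lookup_single_eq lookup_zero zero_neq_one)

section \<open>From a flow with coefficient one to \<open>M = (M / tM)[t]\<close>\<close>

locale flow_step = shift_step i J M X
  for i :: "'d::{finite,linorder}" and J :: "'d set" and M :: "('i \<Rightarrow> 'd Uh) set" and X +
  fixes E
  assumes E: "flow 1 E"
begin

lemmas E_closed = flowD(1)[OF E] and E_add = flowD(2)[OF E] and E_scale = flowD(3)[OF E]
  and E_shift = flowD(4)[OF E] and E_bij = flowD(6)[OF E]

lemma E_t: "p \<in> seqs M \<Longrightarrow> E (sscale t p) = sscale t (E p) + sshift (E p)"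
  using flowD(5)[OF E, of p] by (simp add: sscale_def)

lemma E_inv: "p \<in> seqs M \<Longrightarrow> \<exists>q\<in>seqs M. p = E q"
  using E_bij by (auto simp: bij_betw_def)

lemma E_inj: "p \<in> seqs M \<Longrightarrow> q \<in> seqs M \<Longrightarrow> E p = E q \<Longrightarrow> p = q"
  using E_bij by (auto simp: bij_betw_def inj_on_def)

lemma sconst_zero [simp]: "sconst 0 k = 0"
  by (simp add: sconst_def)

lemma sconst_add: "sconst (x + y) = sconst x + sconst y" for x y :: "'v::comm_monoid_add"
  by (rule ext) (simp add: sconst_def plus_fun_apply[where f = "\<lambda>k. if k = 0 then x else 0"])

lemma sconst_scale: "sconst (f \<star> x) = sscale f (sconst x)" for f :: "'a::comm_ring_1"
  by (rule ext) (simp add: sconst_def)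

lemma t_pow_B: "t ^ n \<in> B" and minus_t_B: "- t \<in> B" and minus_t_pow_B: "(- t) ^ n \<in> B"
  using t_B by auto

text \<open>At \<open>s = -t\<close> the twisted multiplication by \<open>t + s\<close> becomes
  zero, so \<open>e\<close> kills \<open>tM\<close>; by \<open>e_ker\<close> it kills nothing else.
  Its image, inside the same function space, serves as \<open>M / tM\<close>.\<close>

definition e :: "('i \<Rightarrow> 'd Uh) \<Rightarrow> 'i \<Rightarrow> 'd Uh" where
  "e x = seq_eval (- t) (E (sconst x))"

lemma e_add: "x \<in> M \<Longrightarrow> y \<in> M \<Longrightarrow> e (x + y) = e x + e y"
  unfolding e_def sconst_add
  by (subst E_add) (auto intro!: seq_eval_add[OF E_closed E_closed] S_const)

lemma e_scale: "f \<in> A \<Longrightarrow> x \<in> M \<Longrightarrow> e (f \<star> x) = f \<star> e x"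
  unfolding e_def sconst_scale
  by (subst E_scale) (auto intro!: seq_eval_scale[OF E_closed] S_const)

lemma e_t: "x \<in> M \<Longrightarrow> e (t \<star> x) = 0"
proof -
  assume x: "x \<in> M"
  note Ex = E_closed[OF S_const[OF x]]
  have "e (t \<star> x) = seq_eval (- t) (sscale t (E (sconst x)) + sshift (E (sconst x)))"
    unfolding e_def sconst_scale E_t[OF S_const[OF x]] ..
  also have "\<dots> = t \<star> seq_eval (- t) (E (sconst x)) + (- t) \<star> seq_eval (- t) (E (sconst x))"
    unfolding seq_eval_add[OF S_scale[OF t_B Ex] S_shift[OF Ex]] seq_eval_scale[OF Ex] seq_eval_shift[OF Ex] ..
  finally show ?thesis by simp
qed

lemma e_0: "e 0 = 0"
  using e_scale[of 0 0] M_0 by simp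

text \<open>If \<open>E x\<close> vanishes at \<open>s = -t\<close>, division gives
  \<open>E x = (t + s) q\<close>. Writing \<open>q = E q'\<close> and using
  \<open>(t + s) E q' = E (t q')\<close>, injectivity of \<open>E\<close> yields
  \<open>x = t q'\<close>, and the coefficient of \<open>s^0\<close> is the claim.\<close>

lemma e_ker:
  assumes x: "x \<in> M" and "e x = 0"
  shows "\<exists>y\<in>M. x = t \<star> y"
proof -
  note Ex = E_closed[OF S_const[OF x]]
  obtain q where q: "q \<in> seqs M" "E (sconst x) + sscale (- t) q = sconst 0 + sshift q"
    using seqs_division[OF M minus_t_B minus_t_pow_B Ex] assms(2) unfolding e_def by auto
  obtain q' where q': "q' \<in> seqs M" "q = E q'" using E_inv[OF q(1)] by blast
  have "E (sconst x) = sscale t q + sshift q"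
  proof
    fix k
    have "E (sconst x) k - t \<star> q k = sshift q k"
      using fun_cong[OF q(2), of k] by (simp add: plus_fun_apply[where f = "E _"]
          plus_fun_apply[where f = "sconst _"] algebra_simps)
    then show "E (sconst x) k = (sscale t q + sshift q) k"
      by (simp add: plus_fun_apply[where f = "sscale t q"] plus_fun_apply[where f = "sshift q"] algebra_simps)
  qed
  also have "\<dots> = E (sscale t q')" using E_t[OF q'(1)] q'(2) by simp
  finally have "sconst x = sscale t q'" by (rule E_inj[OF S_const[OF x] S_scale[OF t_B q'(1)]])
  then have "x = t \<star> q' 0" by (metis sconst_0 sscale_apply)
  then show ?thesis using seqs_mem[OF q'(1)] by blast
qed

lemma e_eq:
  assumes "x \<in> M" "y \<in> M" "e x = e y"
  shows "\<exists>z\<in>M. x = y + t \<star> z"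
proof -
  have m: "- 1 \<in> A" by simp
  have my: "(- 1) \<star> y \<in> M" by (rule M_scale[OF AB[OF m] assms(2)])
  have "e (x + (- 1) \<star> y) = 0"
    unfolding e_add[OF assms(1) my] e_scale[OF m assms(2)] assms(3) by simp
  then obtain z where z: "z \<in> M" "x + (- 1) \<star> y = t \<star> z"
    using e_ker[OF M_add[OF assms(1) my]] by blast
  then have "x = y + t \<star> z" by (simp add: algebra_simps)
  then show ?thesis using z by blast
qed

lemma e_add_t: "y \<in> M \<Longrightarrow> z \<in> M \<Longrightarrow> e (y + t \<star> z) = e y"
  by (simp add: e_add M_scale[OF t_B] e_t)

text \<open>\<open>E\<close> followed by reduction of all coefficients modulo \<open>t\<close>.
  Since \<open>t + s\<close> reduces to \<open>s\<close>, this maps \<open>M\<close> to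
  \<open>(M / tM)[s]\<close> and carries multiplication by \<open>t\<close> to multiplication by
  \<open>s\<close>.\<close>

definition \<Psi> :: "('i \<Rightarrow> 'd Uh) \<Rightarrow> nat \<Rightarrow> 'i \<Rightarrow> 'd Uh" where
  "\<Psi> x = e \<circ> E (sconst x)"

lemma e_comp_add: "p \<in> seqs M \<Longrightarrow> q \<in> seqs M \<Longrightarrow> e \<circ> (p + q) = (e \<circ> p) + (e \<circ> q)"
  by (rule ext) (simp add: plus_fun_apply[where f = "_ :: nat \<Rightarrow> _"] e_add seqs_mem)

lemma e_comp_scale: "f \<in> A \<Longrightarrow> p \<in> seqs M \<Longrightarrow> e \<circ> sscale f p = sscale f (e \<circ> p)"
  by (rule ext) (simp add: e_scale seqs_mem)

lemma e_comp_t: "p \<in> seqs M \<Longrightarrow> e \<circ> sscale t p = 0"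
  by (rule ext) (simp add: e_t seqs_mem)

lemma e_comp_shift: "e \<circ> sshift p = sshift (e \<circ> p)"
  by (rule ext) (simp add: sshift_def e_0 split: nat.split)

lemma \<Psi>_closed: "x \<in> M \<Longrightarrow> \<Psi> x \<in> seqs (e ` M)"
proof -
  assume x: "x \<in> M"
  note Ex = E_closed[OF S_const[OF x]]
  obtain N where "\<And>k. k \<ge> N \<Longrightarrow> E (sconst x) k = 0" using seqs_bound[OF Ex] by metis
  then show ?thesis unfolding \<Psi>_def
    by (intro seqsI[of _ _ N]) (auto simp: e_0 seqs_mem[OF Ex])
qed

lemma \<Psi>_add: "x \<in> M \<Longrightarrow> y \<in> M \<Longrightarrow> \<Psi> (x + y) = \<Psi> x + \<Psi> y"
  unfolding \<Psi>_def sconst_add by (simp add: E_add e_comp_add S_const E_closed)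

lemma \<Psi>_scale: "f \<in> A \<Longrightarrow> x \<in> M \<Longrightarrow> \<Psi> (f \<star> x) = sscale f (\<Psi> x)"
  unfolding \<Psi>_def sconst_scale by (simp add: E_scale e_comp_scale S_const E_closed)

lemma \<Psi>_t: "x \<in> M \<Longrightarrow> \<Psi> (t \<star> x) = sshift (\<Psi> x)"
  unfolding \<Psi>_def sconst_scale
  by (simp add: E_t e_comp_add e_comp_t e_comp_shift S_const E_closed S_scale[OF t_B] S_shift)

lemma \<Psi>_0: "\<Psi> 0 = 0"
  using \<Psi>_scale[of 0 0] M_0 by (auto simp: sscale_def zero_fun_def)

text \<open>If all coefficients of \<open>E x\<close> are divisible by \<open>t\<close>, then
  \<open>E x = t E q'\<close> for some \<open>q'\<close>. Adding \<open>s E q'\<close> gives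
  \<open>E (x + s q') = E (t q')\<close>, so \<open>x = (t - s) q'\<close>, and the substitution
  \<open>s = t\<close> leaves \<open>x = 0\<close>.\<close>

lemma \<Psi>_ker:
  assumes x: "x \<in> M" and "\<Psi> x = 0"
  shows "x = 0"
proof -
  note Ex = E_closed[OF S_const[OF x]]
  have "\<exists>y\<in>M. E (sconst x) k = t \<star> y" for k
    using e_ker[OF seqs_mem[OF Ex]] fun_cong[OF assms(2), of k]
    by (simp add: \<Psi>_def)
  then obtain q where q: "\<And>k. q k \<in> M" "\<And>k. E (sconst x) k = t \<star> q k" by metis
  obtain N where N: "\<And>k. k \<ge> N \<Longrightarrow> E (sconst x) k = 0" using seqs_bound[OF Ex] by metis
  have qS: "q \<in> seqs M"
  proof (rule seqsI[of _ _ N])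
    show "q k = 0" if "k \<ge> N" for k using N[OF that] q(2)[of k] by simp
  qed (rule q)
  obtain q' where q': "q' \<in> seqs M" "q = E q'" using E_inv[OF qS] by blast
  have "E (sconst x) = sscale t (E q')" using q(2) q'(2) by (auto simp: sscale_def)
  then have "E (sconst x + sshift q') = E (sscale t q')"
    using E_add[OF S_const[OF x] S_shift[OF q'(1)]] E_t[OF q'(1)] E_shift[OF q'(1)] by simp
  then have eq: "sconst x + sshift q' = sscale t q'"
    by (rule E_inj[OF S_add[OF S_const[OF x] S_shift[OF q'(1)]] S_scale[OF t_B q'(1)]])
  have "x + t \<star> seq_eval t q' = t \<star> seq_eval t q'"
    using seq_eval_add[OF S_const[OF x] S_shift[OF q'(1)], of t] seq_eval_shift[OF q'(1), of t]
      seq_eval_scale[OF q'(1), of t t] eq by simp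
  then show ?thesis by simp
qed

lemma \<Psi>_inj:
  assumes "x \<in> M" "y \<in> M" "\<Psi> x = \<Psi> y"
  shows "x = y"
proof -
  have m: "- 1 \<in> A" by simp
  have my: "(- 1) \<star> y \<in> M" by (rule M_scale[OF AB[OF m] assms(2)])
  have "\<Psi> (x + (- 1) \<star> y) = 0"
    unfolding \<Psi>_add[OF assms(1) my] \<Psi>_scale[OF m assms(2)] assms(3)
    by (rule ext) (simp add: plus_fun_apply[where f = "_ :: nat \<Rightarrow> _"])
  then have "x + (- 1) \<star> y = 0" by (rule \<Psi>_ker[OF M_add[OF assms(1) my]])
  then show ?thesis by simp
qed

text \<open>Lift \<open>w\<close> to \<open>p\<close> in \<open>M[s]\<close>, write
  \<open>p = E q\<close> and put \<open>x = q(t)\<close>. Division gives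
  \<open>q + t q1 = x + s q1\<close>. Applying \<open>E\<close> to both sides, the terms
  \<open>s E q1\<close> cancel and \<open>E x = p + t E q1\<close>, which reduces to
  \<open>w\<close> modulo \<open>t\<close>.\<close>

lemma \<Psi>_surj:
  assumes w: "w \<in> seqs (e ` M)"
  shows "\<exists>x\<in>M. \<Psi> x = w"
proof -
  have "\<exists>y\<in>M. w k = e y" for k using seqs_mem[OF w, of k] by blast
  then obtain p0 where p0: "\<And>k. p0 k \<in> M" "\<And>k. w k = e (p0 k)" by metis
  obtain N where N: "\<And>k. k \<ge> N \<Longrightarrow> w k = 0" using seqs_bound[OF w] by metis
  \<comment> \<open>The chosen lifts of zero need not be zero, so they are cut off to keep the
    support finite.\<close>
  define p where "p = (\<lambda>k. if k \<ge> N then 0 else p0 k)"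
  have p: "p \<in> seqs M" by (rule seqsI[of _ _ N]) (auto simp: p_def p0 M_0)
  have wp: "w = e \<circ> p" using p0(2) N by (intro ext) (simp add: p_def e_0)
  obtain q where q: "q \<in> seqs M" "p = E q" using E_inv[OF p] by blast
  define x where "x = seq_eval t q"
  have x: "x \<in> M" unfolding x_def by (rule seq_eval_mem[OF M t_B t_pow_B q(1)])
  obtain q1 where q1: "q1 \<in> seqs M" "q + sscale t q1 = sconst x + sshift q1"
    using seqs_division[OF M t_B t_pow_B q(1)] unfolding x_def by blast
  note Eq1 = E_closed[OF q1(1)]
  have "E q + (sscale t (E q1) + sshift (E q1)) = E (sconst x) + sshift (E q1)"
    using E_add[OF q(1) S_scale[OF t_B q1(1)]] E_add[OF S_const[OF x] S_shift[OF q1(1)]]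
      E_t[OF q1(1)] E_shift[OF q1(1)] q1(2) by simp
  then have "p + sscale t (E q1) = E (sconst x)" using q(2) by (simp add: add.assoc[symmetric])
  then have "\<Psi> x = (e \<circ> p) + (e \<circ> sscale t (E q1))"
    unfolding \<Psi>_def using e_comp_add[OF p S_scale[OF t_B Eq1]] by simp
  then show ?thesis using wp x e_comp_t[OF Eq1] by auto
qed

lemma \<Psi>_poly:
  assumes x: "x \<in> M" and p: "coeffs_in A p" and z: "\<Psi> x = sconst z"
  shows "poly p t \<star> x \<in> M \<and> \<Psi> (poly p t \<star> x) = (\<lambda>k. coeff p k \<star> z)"
  using p
proof (induction p)
  case 0
  have "(\<lambda>k. coeff 0 k \<star> z) = (0 :: nat \<Rightarrow> 'i \<Rightarrow> 'd Uh)" by (rule ext) simp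
  then show ?case by (simp add: M_0 \<Psi>_0)
next
  case (pCons a p)
  then have a: "a \<in> A" and y: "poly p t \<star> x \<in> M" and IH: "\<Psi> (poly p t \<star> x) = (\<lambda>k. coeff p k \<star> z)" by auto
  have eq: "poly (pCons a p) t \<star> x = a \<star> x + t \<star> (poly p t \<star> x)" by simp
  show ?case unfolding eq
  proof
    show "a \<star> x + t \<star> poly p t \<star> x \<in> M" by (rule M_add[OF M_scale[OF AB[OF a] x] M_scale[OF t_B y]])
    have "\<Psi> (a \<star> x + t \<star> poly p t \<star> x) = sscale a (sconst z) + sshift (\<lambda>k. coeff p k \<star> z)"
      unfolding \<Psi>_add[OF M_scale[OF AB[OF a] x] M_scale[OF t_B y]] \<Psi>_scale[OF a x] \<Psi>_t[OF y] IH z ..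
    also have "\<dots> = (\<lambda>k. coeff (pCons a p) k \<star> z)"
    proof
      show "(sscale a (sconst z) + sshift (\<lambda>k. coeff p k \<star> z)) k = coeff (pCons a p) k \<star> z" for k
        by (cases k) (simp_all add: plus_fun_apply[where f = "sscale _ _"])
    qed
    finally show "\<Psi> (a \<star> x + t \<star> poly p t \<star> x) = (\<lambda>k. coeff (pCons a p) k \<star> z)" .
  qed
qed

lemma \<Psi>_sum: "(\<And>l. l \<in> L \<Longrightarrow> g l \<in> M) \<Longrightarrow> \<Psi> (sum g L) k = (\<Sum>l\<in>L. \<Psi> (g l) k)"
proof (induction L rule: infinite_finite_induct)
  case (insert x F)
  then show ?case using submod_sum[OF M, of F g]
    by (simp add: \<Psi>_add plus_fun_apply[where f = "\<Psi> _"])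
qed (simp_all add: \<Psi>_0)

text \<open>Thus \<open>M\<close> is isomorphic to \<open>M\<^sub>0[t]\<close> with \<open>M\<^sub>0 = M / t M\<close> realized as the image of \<open>e\<close>.\<close>

lemma basis_lift:
  assumes sp: "spans A (e ` M) L m0" and ind: "indep A L m0"
  obtains m where "spans B M L m" "indep B L m"
proof -
  have fin: "finite L" and m0: "m0 l \<in> e ` M" if "l \<in> L" for l using sp that by (auto simp: spans_def)
  have "\<exists>x\<in>M. \<Psi> x = sconst (m0 l)" if "l \<in> L" for l
    by (rule \<Psi>_surj, rule seqsI[of _ _ 1]) (use m0[OF that] e_0 M_0 in \<open>auto simp: sconst_def image_iff\<close>)
  then obtain m where m: "\<And>l. l \<in> L \<Longrightarrow> m l \<in> M" "\<And>l. l \<in> L \<Longrightarrow> \<Psi> (m l) = sconst (m0 l)" by metis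
  have key: "lcomb L (\<lambda>l. poly (p l) t) m \<in> M \<and> \<Psi> (lcomb L (\<lambda>l. poly (p l) t) m) = (\<lambda>k. lcomb L (\<lambda>l. coeff (p l) k) m0)"
    if "\<And>l. l \<in> L \<Longrightarrow> coeffs_in A (p l)" for p
  proof -
    have *: "poly (p l) t \<star> m l \<in> M" "\<Psi> (poly (p l) t \<star> m l) = (\<lambda>k. coeff (p l) k \<star> m0 l)" if "l \<in> L" for l
      using \<Psi>_poly[OF m(1)[OF that] \<open>\<And>l. l \<in> L \<Longrightarrow> coeffs_in A (p l)\<close>[OF that] m(2)[OF that]] by auto
    have "\<Psi> (lcomb L (\<lambda>l. poly (p l) t) m) k = lcomb L (\<lambda>l. coeff (p l) k) m0" for k
      unfolding lcomb_def by (subst \<Psi>_sum) (use * in auto)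
    then show ?thesis using submod_sum[OF M, of L "\<lambda>l. poly (p l) t \<star> m l"] * by (auto simp: lcomb_def)
  qed
  have "spans B M L m" unfolding spans_def
  proof (intro conjI ballI)
    show "finite L" using sp by (simp add: spans_def)
    show "m ` L \<subseteq> M" using m by auto
    fix x assume x: "x \<in> M"
    note w = \<Psi>_closed[OF x]
    obtain N where N: "\<And>k. k \<ge> N \<Longrightarrow> \<Psi> x k = 0" using seqs_bound[OF w] by metis
    have "\<exists>f. (\<forall>l\<in>L. f l \<in> A) \<and> \<Psi> x k = lcomb L f m0" for k
      using sp seqs_mem[OF w, of k] unfolding spans_def by blast
    then obtain f where f: "\<And>k l. l \<in> L \<Longrightarrow> f k l \<in> A" "\<And>k. \<Psi> x k = lcomb L (f k) m0" by metis
    \<comment> \<open>The coordinates of the \<open>s^k\<close>-coefficients of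
      \<open>\<Psi> x\<close> become the \<open>t^k\<close>-coefficients of the coordinates of
      \<open>x\<close>.\<close>
    define p where "p l = (\<Sum>k<N. monom (f k l) k)" for l
    have cp: "coeff (p l) k = (if k < N then f k l else 0)" for l k
      by (simp add: p_def coeff_sum)
    have pA: "coeffs_in A (p l)" if "l \<in> L" for l using f(1)[OF that] by (simp add: p_def)
    have "\<Psi> (lcomb L (\<lambda>l. poly (p l) t) m) k = \<Psi> x k" for k
    proof (cases "k < N")
      case True then show ?thesis using key[of p, OF pA] f(2)[of k] by (simp add: cp)
    next
      case False then show ?thesis using key[of p, OF pA] N[of k] by (simp add: cp)
    qed
    then have "\<Psi> x = \<Psi> (lcomb L (\<lambda>l. poly (p l) t) m)" by (intro ext[of "\<Psi> x"]) simp
    then have "x = lcomb L (\<lambda>l. poly (p l) t) m"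
      using \<Psi>_inj[OF x] key[of p, OF pA] by blast
    moreover have "poly (p l) t \<in> B" if "l \<in> L" for l
      by (rule poly_vars_in[OF pA[OF that] t_B]) auto
    ultimately show "\<exists>f. (\<forall>l\<in>L. f l \<in> B) \<and> x = lcomb L f m"
      by (intro exI[of _ "\<lambda>l. poly (p l) t"]) simp
  qed
  moreover have "indep B L m" unfolding indep_def
  proof (intro allI impI, elim conjE)
    fix f assume f: "\<forall>l\<in>L. f l \<in> B" "lcomb L f m = 0"
    have "\<forall>l\<in>L. \<exists>p. coeffs_in A p \<and> f l = poly p t" using f(1) vars_in_insert_poly by metis
    then obtain p where p: "\<And>l. l \<in> L \<Longrightarrow> coeffs_in A (p l)" "\<And>l. l \<in> L \<Longrightarrow> f l = poly (p l) t"
      by metis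
    have "lcomb L (\<lambda>l. poly (p l) t) m = 0" using f(2) p(2) unfolding lcomb_def by simp
    then have z: "lcomb L (\<lambda>l. coeff (p l) k) m0 = 0" for k
      using fun_cong[OF conjunct2[OF key[of p, OF p(1)]], of k] \<Psi>_0 by simp
    have "coeff (p l) k = 0" if "l \<in> L" for l k
      using indepD[OF ind, of "\<lambda>l. coeff (p l) k"] p(1) z that by (simp add: coeffs_in_def)
    then have "p l = 0" if "l \<in> L" for l using that by (simp add: poly_eq_iff)
    then show "\<forall>l\<in>L. f l = 0" using p(2) by simp
  qed
  ultimately show ?thesis using that by blast
qed

lemma e_submod: "submod A (e ` M)"
  unfolding submod_def
proof (intro conjI ballI)
  show "0 \<in> e ` M" using e_0 M_0 by (metis image_eqI)
  show "x + y \<in> e ` M" if "x \<in> e ` M" "y \<in> e ` M" for x y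
    using that by (auto simp: e_add[symmetric] M_add)
  show "f \<star> x \<in> e ` M" if "f \<in> A" "x \<in> e ` M" for f x
    using that by (auto simp: e_scale[symmetric] M_scale AB)
qed

lemma e_poly:
  assumes x: "x \<in> M" and p: "coeffs_in A p"
  shows "poly p t \<star> x \<in> M \<and> e (poly p t \<star> x) = coeff p 0 \<star> e x"
  using p
proof (cases p)
  case (pCons a q)
  have q: "poly q t \<in> B" and a: "a \<in> A" using p pCons poly_vars_in[OF _ t_B, of J q] by auto
  have eq: "poly p t \<star> x = a \<star> x + t \<star> (poly q t \<star> x)" by (simp add: pCons)
  show ?thesis unfolding eq using M_scale[OF AB[OF a] x] M_scale[OF q x]
    by (simp add: e_add_t e_scale[OF a x] pCons M_add M_scale[OF t_B] del: fscale_simps(7))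
qed

text \<open>Modulo \<open>t\<close> each coefficient is replaced by its constant term in
  \<open>t\<close>, so finite generation passes to the quotient.\<close>

lemma e_spans:
  assumes "spans B M L g"
  shows "spans A (e ` M) L (e \<circ> g)"
  unfolding spans_def
proof (intro conjI ballI)
  show "finite L" "(e \<circ> g) ` L \<subseteq> e ` M" using assms by (auto simp: spans_def)
  have g: "g l \<in> M" if "l \<in> L" for l using assms that by (auto simp: spans_def)
  fix y assume "y \<in> e ` M"
  then obtain x where x: "x \<in> M" "y = e x" by blast
  then obtain f where f: "\<forall>l\<in>L. f l \<in> B" "x = lcomb L f g" using assms unfolding spans_def by blast
  have "\<forall>l\<in>L. \<exists>p. coeffs_in A p \<and> f l = poly p t" using f(1) vars_in_insert_poly by metis
  then obtain p where p: "\<And>l. l \<in> L \<Longrightarrow> coeffs_in A (p l)" "\<And>l. l \<in> L \<Longrightarrow> f l = poly (p l) t"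
    by metis
  have e_sum: "e (sum h L') = (\<Sum>l\<in>L'. e (h l))" if "\<And>l. l \<in> L' \<Longrightarrow> h l \<in> M" for h :: "nat \<Rightarrow> _" and L'
    using that
  proof (induction L' rule: infinite_finite_induct)
    case (insert x F)
    then show ?case using submod_sum[OF M, of F h] by (simp add: e_add)
  qed (simp_all add: e_0)
  have "y = (\<Sum>l\<in>L. e (poly (p l) t \<star> g l))"
    unfolding x(2) f(2) lcomb_def using e_poly[OF g p(1)] p(2) by (subst e_sum) auto
  also have "\<dots> = lcomb L (\<lambda>l. coeff (p l) 0) (e \<circ> g)"
    unfolding lcomb_def using e_poly[OF g p(1)] by (auto intro: sum.cong)
  finally show "\<exists>f. (\<forall>l\<in>L. f l \<in> A) \<and> y = lcomb L f (e \<circ> g)"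
    using p(1) by (intro exI[of _ "\<lambda>l. coeff (p l) 0"]) (simp add: coeffs_in_def)
qed

text \<open>The operator induced by \<open>X j\<close> on \<open>M / tM\<close>. The choice of a
  preimage does not matter, because \<open>X j\<close> commutes with \<open>t\<close> and so
  preserves \<open>tM\<close>.\<close>

definition X0 :: "'d \<Rightarrow> ('i \<Rightarrow> 'd Uh) \<Rightarrow> 'i \<Rightarrow> 'd Uh" where
  "X0 j y = e (X j (SOME x. x \<in> M \<and> e x = y))"

lemma X_closed: "j \<in> J \<Longrightarrow> x \<in> M \<Longrightarrow> X j x \<in> M"
  using X_bij bij_betwE by blast

lemma X_t: "j \<in> J \<Longrightarrow> y \<in> M \<Longrightarrow> z \<in> M \<Longrightarrow> X j (y + t \<star> z) = X j y + t \<star> X j z"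
proof -
  assume a: "j \<in> J" "y \<in> M" "z \<in> M"
  then have "shift_poly (axis j 1) t = t" using i by (auto simp: axis_def)
  then show ?thesis using a by (simp add: X_add X_scale t_B M_scale)
qed

lemma X0_e: "j \<in> J \<Longrightarrow> x \<in> M \<Longrightarrow> X0 j (e x) = e (X j x)"
proof -
  assume j: "j \<in> J" and x: "x \<in> M"
  define x' where "x' = (SOME x'. x' \<in> M \<and> e x' = e x)"
  have x': "x' \<in> M" "e x' = e x" unfolding x'_def using someI[of "\<lambda>x'. x' \<in> M \<and> e x' = e x" x] x by auto
  obtain z where z: "z \<in> M" "x' = x + t \<star> z" using e_eq[OF x'(1) x x'(2)] by blast
  then show ?thesis unfolding X0_def x'_def[symmetric] using X_t[OF j x z(1)] x
    by (simp add: e_add_t X_closed j)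
qed

lemma X0_bij: "j \<in> J \<Longrightarrow> bij_betw (X0 j) (e ` M) (e ` M)"
proof -
  assume j: "j \<in> J"
  show ?thesis unfolding bij_betw_def
  proof
    show "inj_on (X0 j) (e ` M)"
    proof (rule inj_onI)
      fix y y' assume "y \<in> e ` M" "y' \<in> e ` M" and eq: "X0 j y = X0 j y'"
      then obtain x x' where x: "x \<in> M" "y = e x" "x' \<in> M" "y' = e x'" by blast
      then have "e (X j x) = e (X j x')" using eq X0_e j by simp
      then obtain z where z: "z \<in> M" "X j x = X j x' + t \<star> z"
        using e_eq[OF X_closed[OF j x(1)] X_closed[OF j x(3)]] by blast
      obtain z' where z': "z' \<in> M" "z = X j z'" using X_bij[OF j] z(1) by (auto simp: bij_betw_def)
      have "X j x = X j (x' + t \<star> z')" using X_t[OF j x(3) z'(1)] z z' by simp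
      then have "x = x' + t \<star> z'"
        using X_bij[OF j] x z' M_add[OF x(3) M_scale[OF t_B z'(1)]] by (auto simp: bij_betw_def inj_on_def)
      then show "y = y'" using x e_add_t[OF x(3) z'(1)] by simp
    qed
    have "X0 j ` e ` M = e ` X j ` M" unfolding image_image by (rule image_cong) (auto simp: X0_e j)
    then show "X0 j ` e ` M = e ` M" using X_bij[OF j] by (simp add: bij_betw_def)
  qed
qed

lemma X0_add: "j \<in> J \<Longrightarrow> x \<in> e ` M \<Longrightarrow> y \<in> e ` M \<Longrightarrow> X0 j (x + y) = X0 j x + X0 j y"
  by (auto simp: e_add[symmetric] X0_e M_add X_add X_closed)

lemma X0_scale: "j \<in> J \<Longrightarrow> f \<in> A \<Longrightarrow> x \<in> e ` M \<Longrightarrow> X0 j (f \<star> x) = shift_poly (axis j 1) f \<star> X0 j x"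
  by (auto simp: e_scale[symmetric] X0_e M_scale X_scale X_closed AB shift_poly_vars_in)

end

text \<open>Finite generation and the semilinear operators pass from \<open>M\<close> to the image
  of \<open>e\<close>, with \<open>X0\<close> in place of \<open>X\<close>. The induction hypothesis
  then applies with one variable fewer, and \<open>basis_lift\<close> brings the basis back to
  \<open>M\<close>.\<close>

theorem equivariant_module_free:
  fixes M :: "('i \<Rightarrow> 'd::{finite,linorder} Uh) set"
  assumes "submod (vars_in J) M" "spans (vars_in J) M L0 g0"
    and "\<And>j. j \<in> J \<Longrightarrow> bij_betw (X j) M M"
    and "\<And>j x y. j \<in> J \<Longrightarrow> x \<in> M \<Longrightarrow> y \<in> M \<Longrightarrow> X j (x + y) = X j x + X j y"
    and "\<And>j f x. j \<in> J \<Longrightarrow> f \<in> vars_in J \<Longrightarrow> x \<in> M \<Longrightarrow> X j (f \<star> x) = shift_poly (axis j 1) f \<star> X j x"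
  shows "\<exists>L m. spans (vars_in J) M L m \<and> indep (vars_in J) L m"
proof -
  have "finite J" by simp
  then show ?thesis using assms
  proof (induction J arbitrary: M X L0 g0 rule: finite_induct)
    case empty
    \<comment> \<open>Without variables the coefficients are the constants, a field, and a
      generating family of least size is a basis.\<close>
    define Q where "Q n \<longleftrightarrow> (\<exists>L m. spans (vars_in {}) M L m \<and> card L = n)" for n
    have "Q (card L0)" using empty by (auto simp: Q_def)
    then have "Q (LEAST n. Q n)" by (rule LeastI)
    then obtain L m where sp: "spans (vars_in {}) M L m" and card: "card L = (LEAST n. Q n)"
      by (auto simp: Q_def)
    have fin: "finite L" using sp by (simp add: spans_def)
    have "indep (vars_in {}) L m" unfolding indep_def
    proof (intro allI impI ballI, elim conjE, rule ccontr)
      fix f l assume f: "\<forall>l\<in>L. f l \<in> vars_in {}" "lcomb L f m = 0" and l: "l \<in> L" "f l \<noteq> 0"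
      obtain c where c: "f l = hconst c" "c \<noteq> 0" using f(1) l vars_in_empty by fastforce
      have split: "sum g L = g l + sum g (L - {l})" for g :: "nat \<Rightarrow> 'i \<Rightarrow> 'd Uh"
        using fin l by (simp add: sum.remove)
      have "spans (vars_in {}) M (L - {l}) m" unfolding spans_def
      proof (intro conjI ballI)
        fix x assume "x \<in> M"
        then obtain g where g: "\<forall>k\<in>L. g k \<in> vars_in {}" "x = lcomb L g m" using sp unfolding spans_def by blast
        define h where "h k = g k - g l * hconst (1 / c) * f k" for k
        have hl: "h l = 0" using c by (simp add: h_def mult.assoc flip: hconst_mult)
        have "x = lcomb L h m"
          using f(2) g(2) lcomb_scale[of L "g l * hconst (1 / c)" f m]
          by (simp add: h_def[abs_def] lcomb_diff)
        then have "x = lcomb (L - {l}) h m" by (simp add: lcomb_def split hl)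
        moreover have "h k \<in> vars_in {}" if "k \<in> L - {l}" for k
          using that f(1) g(1) l by (simp add: h_def)
        ultimately show "\<exists>f. (\<forall>k\<in>L - {l}. f k \<in> vars_in {}) \<and> x = lcomb (L - {l}) f m" by blast
      qed (use sp in \<open>auto simp: spans_def\<close>)
      then have "Q (card (L - {l}))" by (auto simp: Q_def)
      then have "(LEAST n. Q n) \<le> card (L - {l})" by (rule Least_le)
      then show False using card l fin by (metis card_Diff1_less not_less)
    qed
    then show ?case using sp by blast
  next
    case (insert i J)
    interpret shift_step i J M X
      by unfold_locales (use insert in auto)
    obtain E where "flow 1 E" using flow_one insert.prems(2) by blast
    then interpret flow_step i J M X E by unfold_locales
    have "\<exists>L m0. spans A (e ` M) L m0 \<and> indep A L m0"
      by (rule insert.IH[OF e_submod e_spans[OF insert.prems(2)], of X0]) (rule X0_bij X0_add X0_scale; assumption)+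
    then show ?case using basis_lift by metis
  qed
qed

section \<open>Modules given by coordinates\<close>

lemma cring_type_ring: "cring (type_ring :: 'a::comm_ring_1 ring)"
proof (rule cringI)
  show "abelian_group (type_ring :: 'a ring)"
    by (rule abelian_groupI) (auto simp: algebra_simps intro: exI[of _ "- _"] left_minus)
  show "comm_monoid (type_ring :: 'a ring)"
    by (rule comm_monoidI) (auto simp: algebra_simps)
qed (auto simp: algebra_simps)

lemma field_type_ring: "Ring.field (type_ring :: 'a::field ring)"
proof -
  interpret cring "type_ring :: 'a ring" by (rule cring_type_ring)
  have "x \<in> Units (type_ring :: 'a ring)" if "x \<noteq> 0" for x
    using that by (auto simp: Units_def intro!: exI[of _ "inverse x"])
  then have "Units (type_ring :: 'a ring) = carrier type_ring - {\<zero>\<^bsub>type_ring\<^esub>}"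
    by (auto simp: Units_def)
  then show ?thesis by (rule cring_fieldI)
qed

text \<open>An injective coordinate map lets all module axioms be checked in the function space. Its
  image may be any submodule, so free modules, lattices and modules of closed forms are all
  covered.\<close>

locale coord_module =
  fixes Q :: "('a::comm_ring_1, 'm, 'z) module_scheme" (structure) and K :: "'m \<Rightarrow> 'i \<Rightarrow> 'a"
  assumes K_inj: "inj_on K (carrier Q)"
    and zero_closed: "\<zero> \<in> carrier Q" and K_zero: "K \<zero> = 0"
    and add_closed: "x \<in> carrier Q \<Longrightarrow> y \<in> carrier Q \<Longrightarrow> x \<oplus> y \<in> carrier Q"
    and K_add: "x \<in> carrier Q \<Longrightarrow> y \<in> carrier Q \<Longrightarrow> K (x \<oplus> y) = K x + K y"
    and smult_closed: "x \<in> carrier Q \<Longrightarrow> f \<odot>\<^bsub>Q\<^esub> x \<in> carrier Q"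
    and K_smult: "x \<in> carrier Q \<Longrightarrow> K (f \<odot>\<^bsub>Q\<^esub> x) = f \<star> K x"
begin

lemma K_eq: "x \<in> carrier Q \<Longrightarrow> y \<in> carrier Q \<Longrightarrow> K x = K y \<Longrightarrow> x = y"
  using K_inj by (auto simp: inj_on_def)

lemma abelian_group: "abelian_group Q"
proof (rule abelian_groupI)
  fix x assume x: "x \<in> carrier Q"
  have "(- 1) \<odot>\<^bsub>Q\<^esub> x \<oplus> x = \<zero>"
    by (rule K_eq) (auto simp: x K_add K_smult K_zero smult_closed add_closed zero_closed)
  then show "\<exists>y\<in>carrier Q. y \<oplus> x = \<zero>" using x smult_closed by blast
qed (auto intro!: K_eq simp: zero_closed add_closed K_zero K_add add_ac)

lemma module: "Module.module type_ring Q"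
proof (rule module_criteria)
  show "cring (type_ring :: 'a ring)" by (rule cring_type_ring)
  show "\<forall>v\<in>carrier Q. \<exists>neg_v\<in>carrier Q. v \<oplus> neg_v = \<zero>"
  proof
    fix v assume v: "v \<in> carrier Q"
    have "v \<oplus> (- 1) \<odot>\<^bsub>Q\<^esub> v = \<zero>"
      by (rule K_eq) (auto simp: v K_add K_smult K_zero smult_closed add_closed zero_closed)
    then show "\<exists>neg_v\<in>carrier Q. v \<oplus> neg_v = \<zero>" using v smult_closed by blast
  qed
qed (auto intro!: K_eq simp: zero_closed add_closed smult_closed K_zero K_add K_smult add_ac)

lemma finsum: "(\<And>x. x \<in> X \<Longrightarrow> g x \<in> carrier Q) \<Longrightarrow> finsum Q g X \<in> carrier Q \<and> K (finsum Q g X) = (\<Sum>x\<in>X. K (g x))"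
proof -
  interpret abelian_group Q by (rule abelian_group)
  show "(\<And>x. x \<in> X \<Longrightarrow> g x \<in> carrier Q) \<Longrightarrow> finsum Q g X \<in> carrier Q \<and> K (finsum Q g X) = (\<Sum>x\<in>X. K (g x))"
  proof (induction X rule: infinite_finite_induct)
    case (insert x F)
    then have "g \<in> F \<rightarrow> carrier Q" "g x \<in> carrier Q" by auto
    then show ?case using insert by (simp add: K_add add_closed)
  qed (auto simp: finsum_infinite K_zero)
qed

lemma lincomb: "A \<subseteq> carrier Q \<Longrightarrow> K (module.lincomb Q a A) = (\<Sum>v\<in>A. a v \<star> K v)"
proof -
  interpret Module.module type_ring Q by (rule module)
  assume A: "A \<subseteq> carrier Q"
  have "K (finsum Q (\<lambda>v. a v \<odot>\<^bsub>Q\<^esub> v) A) = (\<Sum>v\<in>A. K (a v \<odot>\<^bsub>Q\<^esub> v))"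
    using A smult_closed by (intro conjunct2[OF finsum]) auto
  then show ?thesis using A by (auto simp: lincomb_def K_smult intro!: sum.cong)
qed

lemma indep_iff:
  assumes A: "A \<subseteq> carrier Q" "finite A"
  shows "\<not> module.lin_dep type_ring Q A \<longleftrightarrow> (\<forall>a. (\<Sum>v\<in>A. a v \<star> K v) = 0 \<longrightarrow> (\<forall>v\<in>A. a v = 0))"
proof -
  interpret Module.module type_ring Q by (rule module)
  have z: "lincomb a A' = \<zero> \<longleftrightarrow> (\<Sum>v\<in>A'. a v \<star> K v) = 0" if "A' \<subseteq> carrier Q" for a A'
  proof -
    have "lincomb a A' \<in> carrier Q" using lincomb_closed[OF that, of a] by (simp add: Pi_def)
    then show ?thesis using lincomb[OF that, of a] K_eq[of "lincomb a A'" "\<zero>"] K_zero zero_closed by metis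
  qed
  show ?thesis
  proof
    assume "\<not> lin_dep A"
    then show "\<forall>a. (\<Sum>v\<in>A. a v \<star> K v) = 0 \<longrightarrow> (\<forall>v\<in>A. a v = 0)"
      unfolding lin_dep_def using z[OF A(1)] A by auto
  next
    assume *: "\<forall>a. (\<Sum>v\<in>A. a v \<star> K v) = 0 \<longrightarrow> (\<forall>v\<in>A. a v = 0)"
    show "\<not> lin_dep A"
    proof
      assume "lin_dep A"
      then obtain A' a v where a: "finite A'" "A' \<subseteq> A" "lincomb a A' = \<zero>" "v \<in> A'" "a v \<noteq> 0"
        unfolding lin_dep_def by auto
      define a' where "a' = (\<lambda>v. if v \<in> A' then a v else 0)"
      have "(\<Sum>v\<in>A. a' v \<star> K v) = (\<Sum>v\<in>A'. a' v \<star> K v)"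
        by (rule sum.mono_neutral_right) (use A a in \<open>auto simp: a'_def\<close>)
      also have "\<dots> = (\<Sum>v\<in>A'. a v \<star> K v)" by (rule sum.cong) (auto simp: a'_def)
      also have "\<dots> = 0" using z[of A' a] a A by auto
      finally have "a' v = 0" using * a by blast
      then show False using a by (simp add: a'_def)
    qed
  qed
qed

lemma span_finite_iff:
  assumes A: "A \<subseteq> carrier Q" "finite A" and x: "x \<in> carrier Q"
  shows "x \<in> module.span type_ring Q A \<longleftrightarrow> (\<exists>a. K x = (\<Sum>v\<in>A. a v \<star> K v))"
proof -
  interpret Module.module type_ring Q by (rule module)
  have "span A = {lincomb a A | a. a \<in> A \<rightarrow> carrier type_ring}" by (rule finite_span[OF A(2,1)])
  then show ?thesis
    using lincomb[OF A(1)] K_eq[OF x lincomb_closed[OF A(1)]] by (auto simp: Pi_def)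
qed

end

lemma delta_sum:
  fixes f :: "'i \<Rightarrow> 'a::comm_ring_1"
  assumes "finite I" "\<And>i. i \<notin> I \<Longrightarrow> f i = 0"
  shows "(\<Sum>i\<in>I. f i \<star> (\<lambda>k. if k = i then 1 else 0)) = f"
proof
  fix k
  have "(\<Sum>i\<in>I. f i * (if k = i then 1 else 0)) = (\<Sum>i\<in>I. if k = i then f k else 0)"
    by (rule sum.cong) auto
  then show "(\<Sum>i\<in>I. f i \<star> (\<lambda>k. if k = i then 1 else 0)) k = f k"
    using assms by (auto simp: sum_fun_apply fscale_apply)
qed

lemma (in coord_module) standard_basis:
  fixes I :: "'i set"
  assumes I: "finite I" and supp: "\<And>x i. x \<in> carrier Q \<Longrightarrow> i \<notin> I \<Longrightarrow> K x i = 0"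
    and unit: "\<And>i. i \<in> I \<Longrightarrow> \<exists>x\<in>carrier Q. K x = (\<lambda>k. if k = i then 1 else 0)"
  obtains B where "B \<subseteq> carrier Q" "finite B" "card B = card I"
    "\<not> module.lin_dep type_ring Q B" "module.span type_ring Q B = carrier Q"
proof -
  interpret Module.module type_ring Q by (rule module)
  obtain e where e: "\<And>i. i \<in> I \<Longrightarrow> e i \<in> carrier Q" "\<And>i. i \<in> I \<Longrightarrow> K (e i) = (\<lambda>k. if k = i then 1 else 0)"
    using unit by metis
  have inj: "inj_on e I"
  proof (rule inj_onI)
    fix i j assume "i \<in> I" "j \<in> I" "e i = e j"
    then have "(\<lambda>k. if k = i then 1 else 0) = (\<lambda>k. if k = j then 1 else (0::'a))" using e by metis
    from fun_cong[OF this, of i] show "i = j" by (auto split: if_splits)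
  qed
  have B: "e ` I \<subseteq> carrier Q" "finite (e ` I)" using e I by auto
  have sum_B: "(\<Sum>v\<in>e ` I. a v \<star> K v) = (\<Sum>i\<in>I. a (e i) \<star> (\<lambda>k. if k = i then 1 else 0))" for a
    unfolding sum.reindex[OF inj] by (rule sum.cong) (auto simp: e)
  have "\<not> lin_dep (e ` I)" unfolding indep_iff[OF B]
  proof (intro allI impI ballI)
    fix a v assume a: "(\<Sum>v\<in>e ` I. a v \<star> K v) = 0" and v: "v \<in> e ` I"
    define f where "f i = (if i \<in> I then a (e i) else 0)" for i
    have "(\<Sum>i\<in>I. f i \<star> (\<lambda>k. if k = i then 1 else 0)) = (\<Sum>i\<in>I. a (e i) \<star> (\<lambda>k. if k = i then 1 else 0))"
      by (rule sum.cong) (auto simp: f_def)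
    moreover have "(\<Sum>i\<in>I. f i \<star> (\<lambda>k. if k = i then 1 else 0)) = f"
      by (rule delta_sum[OF I]) (simp add: f_def)
    ultimately have "f = 0" using a sum_B by simp
    obtain i where i: "i \<in> I" "v = e i" using v by blast
    have "f i = 0" using \<open>f = 0\<close> by (simp add: zero_fun_apply)
    then show "a v = 0" using i by (simp add: f_def)
  qed
  moreover have "span (e ` I) = carrier Q"
  proof
    show "span (e ` I) \<subseteq> carrier Q" using span_is_subset2[OF B(1)] .
    show "carrier Q \<subseteq> span (e ` I)"
    proof
      fix x assume x: "x \<in> carrier Q"
      define a where "a v = K x (inv_into I e v)" for v
      have "(\<Sum>i\<in>I. a (e i) \<star> (\<lambda>k. if k = i then 1 else 0)) = (\<Sum>i\<in>I. K x i \<star> (\<lambda>k. if k = i then 1 else 0))"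
        by (rule sum.cong) (auto simp: a_def inv_into_f_f[OF inj])
      also have "\<dots> = K x" by (rule delta_sum[OF I]) (use supp x in auto)
      finally show "x \<in> span (e ` I)" unfolding span_finite_iff[OF B x] sum_B
        by (intro exI[of _ a]) (rule sym)
    qed
  qed
  ultimately show ?thesis using B card_image[OF inj] that by blast
qed

lemma has_dim_coords:
  fixes W :: "('k::field, 'm, 'z) module_scheme" and K :: "'m \<Rightarrow> 'i \<Rightarrow> 'k"
  assumes "coord_module W K" "finite I"
    and "\<And>x i. x \<in> carrier W \<Longrightarrow> i \<notin> I \<Longrightarrow> K x i = 0"
    and "\<And>i. i \<in> I \<Longrightarrow> \<exists>x\<in>carrier W. K x = (\<lambda>k. if k = i then 1 else 0)"
  shows "has_dim type_ring W (card I)"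
proof -
  interpret coord_module W K by fact
  obtain B where B: "B \<subseteq> carrier W" "finite B" "card B = card I"
    "\<not> module.lin_dep type_ring W B" "module.span type_ring W B = carrier W"
    using standard_basis[OF assms(2-4)] .
  have vs: "vectorspace type_ring W"
    by (intro vectorspace.intro module field_type_ring)
  interpret vectorspace type_ring W by (rule vs)
  have "fin_dim" unfolding fin_dim_def using B by blast
  moreover have "dim = card I" using dim_basis[of B] B by (auto simp: basis_def)
  ultimately show ?thesis using vs by (simp add: has_dim_def)
qed

lemma has_dim_unique: "has_dim k V n \<Longrightarrow> has_dim k V n' \<Longrightarrow> n = n'"
  by (simp add: has_dim_def)

section \<open>Coordinates on tensor products\<close>

text \<open>The homomorphism on the free abelian group that extends \<open>b\<close>. It is defined
  with values in functions, so that it can carry coordinates.\<close>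

definition frag_eval :: "('x \<Rightarrow> 'i \<Rightarrow> 'a::comm_ring_1) \<Rightarrow> ('x \<Rightarrow>\<^sub>0 int) \<Rightarrow> 'i \<Rightarrow> 'a" where
  "frag_eval b c = (\<Sum>k\<in>Poly_Mapping.keys c. of_int (Poly_Mapping.lookup c k) \<star> b k)"

lemma frag_eval_superset:
  "finite X \<Longrightarrow> Poly_Mapping.keys c \<subseteq> X \<Longrightarrow> frag_eval b c = (\<Sum>k\<in>X. of_int (Poly_Mapping.lookup c k) \<star> b k)"
  unfolding frag_eval_def by (rule sum.mono_neutral_left) (auto simp: in_keys_iff)

lemma frag_eval_0 [simp]: "frag_eval b 0 = 0"
  by (simp add: frag_eval_def)

lemma frag_eval_of [simp]: "frag_eval b (frag_of x) = b x"
  by (simp add: frag_eval_def keys_frag_of)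

lemma frag_eval_diff: "frag_eval b (c - d) = frag_eval b c - frag_eval b d"
  by (subst (1 2 3) frag_eval_superset[of "Poly_Mapping.keys c \<union> Poly_Mapping.keys d"])
    (use keys_diff[of c d] in \<open>auto simp: lookup_minus sum_subtractf\<close>)

lemma frag_eval_uminus: "frag_eval b (- c) = - frag_eval b c"
  using frag_eval_diff[of b 0 c] by simp

lemma frag_eval_add: "frag_eval b (c + d) = frag_eval b c + frag_eval b d"
  using frag_eval_diff[of b c "- d"] by (simp add: frag_eval_uminus)

lemma frag_eval_sum: "frag_eval b (sum g X) = (\<Sum>x\<in>X. frag_eval b (g x))"
  by (induction X rule: infinite_finite_induct) (simp_all add: frag_eval_add)

section \<open>Tensor products as quotients of free abelian groups\<close>

locale tensor_ctx =
  fixes R :: "('a, 'e) ring_scheme" and M :: "('a, 'b, 'f) module_scheme"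
    and N :: "('a, 'c, 'g) module_scheme"
  assumes M_add: "x \<in> carrier M \<Longrightarrow> x' \<in> carrier M \<Longrightarrow> x \<oplus>\<^bsub>M\<^esub> x' \<in> carrier M"
    and N_add: "y \<in> carrier N \<Longrightarrow> y' \<in> carrier N \<Longrightarrow> y \<oplus>\<^bsub>N\<^esub> y' \<in> carrier N"
    and M_smult: "a \<in> carrier R \<Longrightarrow> x \<in> carrier M \<Longrightarrow> a \<odot>\<^bsub>M\<^esub> x \<in> carrier M"
    and N_smult: "a \<in> carrier R \<Longrightarrow> y \<in> carrier N \<Longrightarrow> a \<odot>\<^bsub>N\<^esub> y \<in> carrier N"
begin

abbreviation "G \<equiv> free_Abelian_group (carrier M \<times> carrier N)"

definition rel where "rel = generate G (tensor_relators R M N)"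

lemma relators_closed: "tensor_relators R M N \<subseteq> carrier G"
proof -
  have *: "frag_of p - frag_of q - frag_of q' \<in> carrier G"
    "frag_of p - frag_of q \<in> carrier G" if "{p, q, q'} \<subseteq> carrier M \<times> carrier N" for p q q'
    using that keys_diff[of "frag_of p - frag_of q" "frag_of q'"] keys_diff[of "frag_of p" "frag_of q"]
    by (auto simp: keys_frag_of)
  show ?thesis unfolding tensor_relators_def
    using *(1) *(2)[where q' = "_"] M_add N_add M_smult N_smult by (fastforce intro!: *(1) *(2))
qed

lemma group_G: "group G" and comm_group_G: "comm_group G"
  by (simp_all add: abelian_free_Abelian_group)

lemma rel_subgroup: "subgroup rel G"
  unfolding rel_def by (rule group.generate_is_subgroup[OF group_G relators_closed])

lemma rel_normal: "rel \<lhd> G"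
  by (rule comm_group.normal_iff_subgroup[OF comm_group_G, THEN iffD2, OF rel_subgroup])

lemma rel_closed: "c \<in> rel \<Longrightarrow> c \<in> carrier G"
  using subgroup.subset[OF rel_subgroup] by blast

lemma rel_0: "0 \<in> rel"
  using subgroup.one_closed[OF rel_subgroup] by simp

lemma rel_add: "c \<in> rel \<Longrightarrow> d \<in> rel \<Longrightarrow> c + d \<in> rel"
  using subgroup.m_closed[OF rel_subgroup] by simp

lemma rel_uminus: "c \<in> rel \<Longrightarrow> - c \<in> rel"
  using subgroup.m_inv_closed[OF rel_subgroup, of c] rel_closed[of c] by simp

lemma rel_diff: "c \<in> rel \<Longrightarrow> d \<in> rel \<Longrightarrow> c - d \<in> rel"
  using rel_add[of c "- d"] rel_uminus[of d] by simp

lemma rel_sum: "(\<And>x. x \<in> X \<Longrightarrow> g x \<in> rel) \<Longrightarrow> sum g X \<in> rel"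
  by (induction X rule: infinite_finite_induct) (auto simp: rel_0 rel_add)

lemma rel_relators: "c \<in> tensor_relators R M N \<Longrightarrow> c \<in> rel"
  unfolding rel_def by (rule generate.incl)

lemma rel_left: "x \<in> carrier M \<Longrightarrow> x' \<in> carrier M \<Longrightarrow> y \<in> carrier N
    \<Longrightarrow> frag_of (x \<oplus>\<^bsub>M\<^esub> x', y) - frag_of (x, y) - frag_of (x', y) \<in> rel"
  and rel_right: "x \<in> carrier M \<Longrightarrow> y \<in> carrier N \<Longrightarrow> y' \<in> carrier N
    \<Longrightarrow> frag_of (x, y \<oplus>\<^bsub>N\<^esub> y') - frag_of (x, y) - frag_of (x, y') \<in> rel"
  and rel_smult: "a \<in> carrier R \<Longrightarrow> x \<in> carrier M \<Longrightarrow> y \<in> carrier N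
    \<Longrightarrow> frag_of (a \<odot>\<^bsub>M\<^esub> x, y) - frag_of (x, a \<odot>\<^bsub>N\<^esub> y) \<in> rel"
  by (rule rel_relators, unfold tensor_relators_def, blast)+

abbreviation "cls \<equiv> tensor_class R M N"

lemma cls_def: "cls c = rel #>\<^bsub>G\<^esub> c"
  by (simp add: tensor_class_def rel_def)

lemma carrier_tensor: "carrier (tensor R M N) = cls ` carrier G"
  by (auto simp: tensor_def tensor_group_def FactGroup_def RCOSETS_def cls_def rel_def)

lemma cls_eq_iff:
  assumes "c \<in> carrier G" "d \<in> carrier G"
  shows "cls c = cls d \<longleftrightarrow> c - d \<in> rel"
proof -
  have "c \<in> rel #>\<^bsub>G\<^esub> d \<longleftrightarrow> c - d \<in> rel"
    unfolding r_coset_def by (auto simp: algebra_simps) (metis add.commute diff_add_cancel)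
  moreover have "cls c = cls d \<longleftrightarrow> c \<in> rel #>\<^bsub>G\<^esub> d"
    unfolding cls_def
    using group.repr_independence[OF group_G _ assms(2) rel_subgroup] group.rcos_self[OF group_G assms(1) rel_subgroup]
    by blast
  ultimately show ?thesis by blast
qed

lemma cls_add: "c \<in> carrier G \<Longrightarrow> d \<in> carrier G \<Longrightarrow> cls c \<oplus>\<^bsub>tensor R M N\<^esub> cls d = cls (c + d)"
  using normal.rcos_sum[OF rel_normal, of c d]
  by (simp add: tensor_def tensor_group_def FactGroup_def cls_def rel_def)

lemma cls_zero: "\<zero>\<^bsub>tensor R M N\<^esub> = cls 0"
  using group.coset_mult_one[OF group_G subgroup.subset[OF rel_subgroup]]
  by (simp add: tensor_def tensor_group_def FactGroup_def cls_def rel_def)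

lemma some_in_cls:
  assumes "c \<in> carrier G"
  shows "(SOME d. d \<in> cls c) \<in> carrier G" "cls (SOME d. d \<in> cls c) = cls c"
proof -
  have "c \<in> cls c" unfolding cls_def by (rule group.rcos_self[OF group_G assms rel_subgroup])
  then have d: "(SOME d. d \<in> cls c) \<in> cls c" by (rule someI)
  then show "(SOME d. d \<in> cls c) \<in> carrier G"
    using monoid.r_coset_subset_G[OF group.is_monoid[OF group_G] subgroup.subset[OF rel_subgroup] assms] unfolding cls_def by blast
  show "cls (SOME d. d \<in> cls c) = cls c"
    using group.repr_independence[OF group_G d[unfolded cls_def] assms rel_subgroup] unfolding cls_def by simp
qed

lemma carrier_G_add: "c \<in> carrier G \<Longrightarrow> d \<in> carrier G \<Longrightarrow> c + d \<in> carrier G"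
  using keys_add[of c d] by auto

lemma carrier_G_diff: "c \<in> carrier G \<Longrightarrow> d \<in> carrier G \<Longrightarrow> c - d \<in> carrier G"
  using keys_diff[of c d] by auto

lemma carrier_G_sum: "(\<And>x. x \<in> X \<Longrightarrow> g x \<in> carrier G) \<Longrightarrow> sum g X \<in> carrier G"
proof (induction X rule: infinite_finite_induct)
  case (insert x F)
  then show ?case using carrier_G_add[of "g x" "sum g F"] by simp
qed simp_all

end

locale tensor_bilinear = tensor_ctx R M N
  for R :: "('a, 'e) ring_scheme" and M :: "('a, 'b, 'f) module_scheme"
    and N :: "('a, 'c, 'g) module_scheme" +
  fixes \<beta> :: "'b \<times> 'c \<Rightarrow> 'i \<Rightarrow> 'k::comm_ring_1"
  assumes \<beta>_left: "x \<in> carrier M \<Longrightarrow> x' \<in> carrier M \<Longrightarrow> y \<in> carrier N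
      \<Longrightarrow> \<beta> (x \<oplus>\<^bsub>M\<^esub> x', y) = \<beta> (x, y) + \<beta> (x', y)"
    and \<beta>_right: "x \<in> carrier M \<Longrightarrow> y \<in> carrier N \<Longrightarrow> y' \<in> carrier N
      \<Longrightarrow> \<beta> (x, y \<oplus>\<^bsub>N\<^esub> y') = \<beta> (x, y) + \<beta> (x, y')"
    and \<beta>_smult: "a \<in> carrier R \<Longrightarrow> x \<in> carrier M \<Longrightarrow> y \<in> carrier N
      \<Longrightarrow> \<beta> (a \<odot>\<^bsub>M\<^esub> x, y) = \<beta> (x, a \<odot>\<^bsub>N\<^esub> y)"
begin

lemma frag_eval_rel: "c \<in> rel \<Longrightarrow> frag_eval \<beta> c = 0"
  unfolding rel_def
proof (induction rule: generate.induct)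
  case (incl h)
  then show ?case by (auto simp: tensor_relators_def frag_eval_diff \<beta>_left \<beta>_right \<beta>_smult)
next
  case (inv h)
  have "h \<in> carrier G" using inv relators_closed by blast
  moreover have "frag_eval \<beta> h = 0"
    using inv by (auto simp: tensor_relators_def frag_eval_diff \<beta>_left \<beta>_right \<beta>_smult)
  ultimately show ?case by (simp add: frag_eval_uminus del: uminus_apply)
qed (auto simp: frag_eval_add)

end

text \<open>Bilinearity makes \<open>\<beta>\<close> descend to the tensor product;
  \<open>\<beta>_kernel\<close> is the substantial half, injectivity. In each instance it is proved
  by reducing an arbitrary element, modulo the relators, to a normal form whose coordinates are
  visible.\<close>

locale tensor_coords = tensor_bilinear R M N \<beta>
  for R :: "('a, 'e) ring_scheme" and M :: "('a, 'b, 'f) module_scheme"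
    and N :: "('a, 'c, 'g) module_scheme" and \<beta> :: "'b \<times> 'c \<Rightarrow> 'i \<Rightarrow> 'k::comm_ring_1" +
  assumes \<beta>_kernel: "c \<in> carrier G \<Longrightarrow> frag_eval \<beta> c = 0 \<Longrightarrow> c \<in> rel"
begin

definition KT :: "('b \<times> 'c \<Rightarrow>\<^sub>0 int) set \<Rightarrow> 'i \<Rightarrow> 'k" where
  "KT X = frag_eval \<beta> (SOME c. c \<in> X)"

lemma KT_cls: "c \<in> carrier G \<Longrightarrow> KT (cls c) = frag_eval \<beta> c"
proof -
  assume c: "c \<in> carrier G"
  have "(SOME d. d \<in> cls c) - c \<in> rel" using cls_eq_iff[OF some_in_cls(1)[OF c] c] some_in_cls(2)[OF c] by simp
  from frag_eval_rel[OF this] show ?thesis by (simp add: KT_def frag_eval_diff)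
qed

lemma KT_inj: "inj_on KT (carrier (tensor R M N))"
proof (rule inj_onI)
  fix X Y assume XY: "X \<in> carrier (tensor R M N)" "Y \<in> carrier (tensor R M N)" and eq: "KT X = KT Y"
  then obtain c d where cd: "c \<in> carrier G" "d \<in> carrier G" "X = cls c" "Y = cls d"
    unfolding carrier_tensor by blast
  then have "frag_eval \<beta> (c - d) = 0" using eq by (simp add: KT_cls frag_eval_diff)
  then have "c - d \<in> rel" by (rule \<beta>_kernel[OF carrier_G_diff[OF cd(1,2)]])
  then show "X = Y" using cls_eq_iff[OF cd(1,2)] cd by simp
qed

lemma KT_zero: "\<zero>\<^bsub>tensor R M N\<^esub> \<in> carrier (tensor R M N)" "KT \<zero>\<^bsub>tensor R M N\<^esub> = 0"
proof -
  have "0 \<in> carrier G" by simp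
  then show "\<zero>\<^bsub>tensor R M N\<^esub> \<in> carrier (tensor R M N)" "KT \<zero>\<^bsub>tensor R M N\<^esub> = 0"
    unfolding cls_zero carrier_tensor using KT_cls by auto
qed

lemma KT_add:
  assumes "X \<in> carrier (tensor R M N)" "Y \<in> carrier (tensor R M N)"
  shows "X \<oplus>\<^bsub>tensor R M N\<^esub> Y \<in> carrier (tensor R M N)" "KT (X \<oplus>\<^bsub>tensor R M N\<^esub> Y) = KT X + KT Y"
proof -
  obtain c d where cd: "c \<in> carrier G" "d \<in> carrier G" "X = cls c" "Y = cls d"
    using assms unfolding carrier_tensor by blast
  note s = carrier_G_add[OF cd(1,2)]
  show "X \<oplus>\<^bsub>tensor R M N\<^esub> Y \<in> carrier (tensor R M N)"
    unfolding cd(3,4) cls_add[OF cd(1,2)] carrier_tensor using s by blast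
  show "KT (X \<oplus>\<^bsub>tensor R M N\<^esub> Y) = KT X + KT Y"
    unfolding cd(3,4) cls_add[OF cd(1,2)] KT_cls[OF s] KT_cls[OF cd(1)] KT_cls[OF cd(2)] by (rule frag_eval_add)
qed

lemma KT_image: "KT ` carrier (tensor R M N) = frag_eval \<beta> ` carrier G"
  unfolding carrier_tensor image_image by (rule image_cong) (auto simp: KT_cls)

end

text \<open>Additivity of \<open>\<Delta>\<close> is asked for only on values of
  \<open>frag_eval\<close>. Operators that lift coordinates back to the module, as the Witt action
  will, are meaningful only there.\<close>

lemma (in tensor_coords) KT_tensor_map:
  fixes b :: "'y \<Rightarrow> ('b \<times> 'c \<Rightarrow>\<^sub>0 int)" and \<beta>' :: "'y \<Rightarrow> 'j \<Rightarrow> 'l::comm_ring_1"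
  assumes c: "Poly_Mapping.keys c \<subseteq> S"
    and b: "\<And>y. y \<in> S \<Longrightarrow> b y \<in> carrier G" "\<And>y. y \<in> S \<Longrightarrow> frag_eval \<beta> (b y) = \<Delta> (\<beta>' y)"
    and \<Delta>: "\<Delta> 0 = 0" "\<And>c d. Poly_Mapping.keys c \<subseteq> S \<Longrightarrow> Poly_Mapping.keys d \<subseteq> S \<Longrightarrow>
      \<Delta> (frag_eval \<beta>' c - frag_eval \<beta>' d) = \<Delta> (frag_eval \<beta>' c) - \<Delta> (frag_eval \<beta>' d)"
  shows "frag_extend b c \<in> carrier G" "frag_eval \<beta> (frag_extend b c) = \<Delta> (frag_eval \<beta>' c)"
proof -
  have "Poly_Mapping.keys c \<subseteq> S \<and> frag_extend b c \<in> carrier G \<and> frag_eval \<beta> (frag_extend b c) = \<Delta> (frag_eval \<beta>' c)"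
    using c
  proof (induction c rule: frag_induction)
    case zero then show ?case by (simp add: \<Delta>)
  next
    case (one x) then show ?case using b by (simp add: keys_frag_of)
  next
    case (diff x y)
    then have eq: "\<Delta> (frag_eval \<beta>' x - frag_eval \<beta>' y) = \<Delta> (frag_eval \<beta>' x) - \<Delta> (frag_eval \<beta>' y)"
      by (intro \<Delta>(2)) auto
    have "Poly_Mapping.keys (x - y) \<subseteq> S" using diff keys_diff[of x y] by auto
    moreover have "frag_extend b x - frag_extend b y \<in> carrier G"
      using diff by (intro carrier_G_diff) auto
    ultimately show ?case using diff
      unfolding frag_extend_diff frag_eval_diff eq by presburger
  qed
  then show "frag_extend b c \<in> carrier G" "frag_eval \<beta> (frag_extend b c) = \<Delta> (frag_eval \<beta>' c)" by auto
qed

text \<open>Over the fraction field a nonzero multiple of a unit vector is as good as the unit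
  vector: if \<open>K x\<close> is \<open>c\<close> at \<open>i\<close> and zero elsewhere, then
  \<open>1/c \<otimes> x\<close> has unit coordinates. Injectivity survives the extension of scalars
  because every tensor is pure.\<close>

lemma has_rank_coords:
  fixes Q :: "('d::{finite,linorder} Uh, 'm) module" and K :: "'m \<Rightarrow> 'i \<Rightarrow> 'd Uh"
  assumes Q: "coord_module Q K" and I: "finite I"
    and supp: "\<And>x i. x \<in> carrier Q \<Longrightarrow> i \<notin> I \<Longrightarrow> K x i = 0"
    and unit: "\<And>i. i \<in> I \<Longrightarrow> \<exists>x\<in>carrier Q. \<exists>c. c \<noteq> 0 \<and> K x = (\<lambda>k. if k = i then c else 0)"
  shows "has_rank Q (card I)"
proof -
  interpret Q: coord_module Q K by fact
  define \<beta> where "\<beta> = (\<lambda>(h, x) i. h * Fract (K x i) 1)"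
  have \<beta>: "\<beta> (h, x) = (\<lambda>i. h * Fract (K x i) 1)" for h x by (simp add: \<beta>_def)
  interpret T: tensor_ctx type_ring H_module Q
    by unfold_locales (auto simp: H_module_def Q.add_closed Q.smult_closed)
  have H: "carrier H_module = UNIV" "g \<oplus>\<^bsub>H_module\<^esub> g' = g + g'" "f \<odot>\<^bsub>H_module\<^esub> g = Fract f 1 * g"
    for g g' and f :: "'d Uh" by (simp_all add: H_module_def)
  have right: "frag_of (h, x \<oplus>\<^bsub>Q\<^esub> x') - frag_of (h, x) - frag_of (h, x') \<in> T.rel"
    if "x \<in> carrier Q" "x' \<in> carrier Q" for h x x'
    using T.rel_right[of h x x'] that by (simp add: H)
  have smult: "frag_of (Fract f 1 * h, x) - frag_of (h, f \<odot>\<^bsub>Q\<^esub> x) \<in> T.rel" if "x \<in> carrier Q" for f h x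
    using T.rel_smult[of f h x] that by (simp add: H)
  have rel0: "frag_of (h, \<zero>\<^bsub>Q\<^esub>) \<in> T.rel" for h
  proof -
    have "\<zero>\<^bsub>Q\<^esub> \<oplus>\<^bsub>Q\<^esub> \<zero>\<^bsub>Q\<^esub> = \<zero>\<^bsub>Q\<^esub>"
      by (rule Q.K_eq) (auto simp: Q.zero_closed Q.add_closed Q.K_add Q.K_zero)
    then show ?thesis using T.rel_uminus[OF right[OF Q.zero_closed Q.zero_closed, of h]] by simp
  qed
  have neg: "frag_of (h, (- 1) \<odot>\<^bsub>Q\<^esub> x) + frag_of (h, x) \<in> T.rel" if x: "x \<in> carrier Q" for h x
  proof -
    have "(- 1) \<odot>\<^bsub>Q\<^esub> x \<oplus>\<^bsub>Q\<^esub> x = \<zero>\<^bsub>Q\<^esub>"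
      by (rule Q.K_eq) (auto simp: x Q.zero_closed Q.add_closed Q.smult_closed Q.K_add Q.K_smult Q.K_zero)
    then have "frag_of (h, \<zero>\<^bsub>Q\<^esub>) - frag_of (h, (- 1) \<odot>\<^bsub>Q\<^esub> x) - frag_of (h, x) \<in> T.rel"
      using right[OF Q.smult_closed[OF x] x, of h "- 1"] by simp
    from T.rel_diff[OF rel0[of h] this] show ?thesis by (simp add: algebra_simps)
  qed
  \<comment> \<open>All elements are brought to \<open>1/b \<otimes> x\<close>. If the coordinates
    of such a tensor vanish, then \<open>K x = 0\<close> and hence \<open>x = 0\<close>, which gives
    \<open>\<beta>_kernel\<close>.\<close>
  have normal_form: "\<exists>b x. b \<noteq> 0 \<and> x \<in> carrier Q \<and> c - frag_of (Fract 1 b, x) \<in> T.rel"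
    if "Poly_Mapping.keys c \<subseteq> UNIV \<times> carrier Q" for c
    using that
  proof (induction c rule: frag_induction)
    case zero
    show ?case using Q.zero_closed T.rel_uminus[OF rel0, of "Fract 1 1"] by (intro exI[of _ 1] exI[of _ "\<zero>\<^bsub>Q\<^esub>"]) simp
  next
    case (one p)
    obtain h x where p: "p = (h, x)" "x \<in> carrier Q" using one by (cases p) auto
    obtain a b where h: "h = Fract a b" "b \<noteq> 0" by (cases h) auto
    have "h = Fract a 1 * Fract 1 b" using h by simp
    then show ?case using smult[OF p(2), of a "Fract 1 b"] p h Q.smult_closed[OF p(2)] by blast
  next
    case (diff c d)
    then obtain b x b' x' where 1: "b \<noteq> 0" "x \<in> carrier Q" "c - frag_of (Fract 1 b, x) \<in> T.rel"
      and 2: "b' \<noteq> 0" "x' \<in> carrier Q" "d - frag_of (Fract 1 b', x') \<in> T.rel" by blast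
    \<comment> \<open>Common denominator: \<open>1/b \<otimes> x - 1/b' \<otimes> x'\<close> equals
      \<open>1/(b b') \<otimes> (b' x - b x')\<close>. The long combination below is the certificate
      of this modulo \<open>rel\<close>.\<close>
    let ?h = "Fract 1 (b * b')" and ?x = "b' \<odot>\<^bsub>Q\<^esub> x" and ?x' = "b \<odot>\<^bsub>Q\<^esub> x'"
    have e: "Fract b' 1 * ?h = Fract 1 b" "Fract b 1 * ?h = Fract 1 b'"
      using 1 2 by (simp_all add: eq_fract)
    note r = smult[OF 1(2), of b' ?h, unfolded e] smult[OF 2(2), of b ?h, unfolded e]
      neg[OF Q.smult_closed[OF 2(2)], of ?h b]
      right[OF Q.smult_closed[OF 1(2)] Q.smult_closed[OF Q.smult_closed[OF 2(2)]], of ?h b' "-1" b]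
    have "(c - frag_of (Fract 1 b, x)) - (d - frag_of (Fract 1 b', x'))
      + (frag_of (Fract 1 b, x) - frag_of (?h, ?x)) - (frag_of (Fract 1 b', x') - frag_of (?h, ?x'))
      - (frag_of (?h, (- 1) \<odot>\<^bsub>Q\<^esub> ?x') + frag_of (?h, ?x'))
      - (frag_of (?h, ?x \<oplus>\<^bsub>Q\<^esub> (- 1) \<odot>\<^bsub>Q\<^esub> ?x') - frag_of (?h, ?x) - frag_of (?h, (- 1) \<odot>\<^bsub>Q\<^esub> ?x')) \<in> T.rel"
      by (intro T.rel_diff T.rel_add 1(3) 2(3) r)
    then have "(c - d) - frag_of (?h, ?x \<oplus>\<^bsub>Q\<^esub> (- 1) \<odot>\<^bsub>Q\<^esub> ?x') \<in> T.rel" by (simp add: algebra_simps)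
    moreover have "?x \<oplus>\<^bsub>Q\<^esub> (- 1) \<odot>\<^bsub>Q\<^esub> ?x' \<in> carrier Q"
      using 1 2 by (simp add: Q.add_closed Q.smult_closed)
    moreover have "b * b' \<noteq> 0" using 1 2 by simp
    ultimately show ?case by blast
  qed
  interpret TB: tensor_bilinear type_ring H_module Q \<beta>
  proof
    show "\<beta> (g \<oplus>\<^bsub>H_module\<^esub> g', y) = \<beta> (g, y) + \<beta> (g', y)" for g g' y
      by (rule ext) (simp add: \<beta> H plus_fun_apply distrib_right)
    show "\<beta> (g, y \<oplus>\<^bsub>Q\<^esub> y') = \<beta> (g, y) + \<beta> (g, y')" if "y \<in> carrier Q" "y' \<in> carrier Q" for g y y'
      by (rule ext) (simp add: \<beta> H plus_fun_apply Q.K_add that distrib_left[symmetric])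
    show "\<beta> (a \<odot>\<^bsub>H_module\<^esub> g, y) = \<beta> (g, a \<odot>\<^bsub>Q\<^esub> y)" if "y \<in> carrier Q" for a g y
    proof
      have F: "Fract (a * b) 1 = Fract a 1 * Fract b (1 :: 'd Uh)" for b by simp
      show "\<beta> (a \<odot>\<^bsub>H_module\<^esub> g, y) i = \<beta> (g, a \<odot>\<^bsub>Q\<^esub> y) i" for i
        unfolding \<beta> H Q.K_smult[OF that] fscale_apply F by (simp only: mult_ac)
    qed
  qed
  interpret TC: tensor_coords type_ring H_module Q \<beta>
  proof
    fix c :: "'d Uh fract \<times> 'm \<Rightarrow>\<^sub>0 int"
    assume c: "c \<in> carrier T.G" "frag_eval \<beta> c = 0"
    obtain b x where b: "b \<noteq> 0" "x \<in> carrier Q" "c - frag_of (Fract 1 b, x) \<in> T.rel"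
      using normal_form[of c] c(1) by (auto simp: H)
    from TB.frag_eval_rel[OF b(3)] c(2) have z: "\<beta> (Fract 1 b, x) = 0" by (simp add: frag_eval_diff del: minus_apply)
    have "K x = 0"
    proof
      fix i
      have "Fract 1 b * Fract (K x i) 1 = 0" using fun_cong[OF z, of i] by (simp only: \<beta> zero_fun_apply)
      then show "K x i = 0 i" using b(1) by (simp add: zero_fun_apply Zero_fract_def eq_fract)
    qed
    then have "x = \<zero>\<^bsub>Q\<^esub>" using b(2) Q.K_eq Q.zero_closed Q.K_zero by metis
    then show "c \<in> T.rel" using T.rel_add[OF b(3) rel0[of "Fract 1 b"]] by simp
  qed
  have smult_H: "h \<odot>\<^bsub>H_tensor Q\<^esub> X = T.cls (frag_extend (\<lambda>(g, x). frag_of (h * g, x)) (SOME c. c \<in> X))" for h X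
    by (simp add: H_tensor_def with_smult_def tensor_map_def)
  have H_tensor: "carrier (H_tensor Q) = carrier (tensor type_ring H_module Q)"
    "\<zero>\<^bsub>H_tensor Q\<^esub> = \<zero>\<^bsub>tensor type_ring H_module Q\<^esub>" "(\<oplus>\<^bsub>H_tensor Q\<^esub>) = (\<oplus>\<^bsub>tensor type_ring H_module Q\<^esub>)"
    by (simp_all add: H_tensor_def with_smult_def)
  have map: "h \<odot>\<^bsub>H_tensor Q\<^esub> X \<in> carrier (H_tensor Q) \<and> TC.KT (h \<odot>\<^bsub>H_tensor Q\<^esub> X) = h \<star> TC.KT X"
    if X: "X \<in> carrier (H_tensor Q)" for h X
  proof -
    obtain c where c: "c \<in> carrier T.G" "X = T.cls c" using X unfolding H_tensor T.carrier_tensor by blast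
    let ?c = "SOME c. c \<in> X" and ?b = "\<lambda>(g, x). frag_of (h * g, x)"
    have k: "Poly_Mapping.keys ?c \<subseteq> UNIV \<times> carrier Q" using T.some_in_cls(1)[OF c(1)] c(2) by (simp add: H)
    have *: "frag_extend ?b ?c \<in> carrier T.G" "frag_eval \<beta> (frag_extend ?b ?c) = h \<star> frag_eval \<beta> ?c"
      by (rule TC.KT_tensor_map[where \<beta>' = \<beta> and \<Delta> = "\<lambda>u. h \<star> u", OF k];
          auto simp: keys_frag_of H \<beta> fun_eq_iff fscale_apply mult_ac zero_fun_apply right_diff_distrib)+
    show ?thesis unfolding smult_H TC.KT_cls[OF *(1)] *(2) H_tensor T.carrier_tensor
      using *(1) by (simp add: TC.KT_def)
  qed
  have coords: "coord_module (H_tensor Q) TC.KT"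
    by unfold_locales (use map TC.KT_inj TC.KT_zero TC.KT_add in \<open>auto simp: H_tensor\<close>)
  have "has_dim type_ring (H_tensor Q) (card I)"
  proof (rule has_dim_coords[OF coords I])
    have "frag_eval \<beta> c i = 0" if "c \<in> carrier T.G" "i \<notin> I" for c i
      using that(1) unfolding frag_eval_def sum_fun_apply fscale_apply
      by (intro sum.neutral ballI) (use that(2) supp in \<open>force simp: \<beta>_def Zero_fract_def\<close>)
    then show "TC.KT X i = 0" if "X \<in> carrier (H_tensor Q)" "i \<notin> I" for X i
      using that TC.KT_cls unfolding H_tensor T.carrier_tensor by auto
    fix i assume "i \<in> I"
    then obtain x c where x: "x \<in> carrier Q" "c \<noteq> 0" "K x = (\<lambda>k. if k = i then c else 0)" using unit by blast
    have g: "frag_of (Fract 1 c, x) \<in> carrier T.G" using x by (simp add: keys_frag_of H)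
    have "TC.KT (T.cls (frag_of (Fract 1 c, x))) = (\<lambda>k. if k = i then 1 else 0)"
      unfolding TC.KT_cls[OF g] using x by (auto simp: \<beta> fun_eq_iff One_fract_def Zero_fract_def eq_fract)
    then show "\<exists>X\<in>carrier (H_tensor Q). TC.KT X = (\<lambda>k. if k = i then 1 else 0)"
      unfolding H_tensor T.carrier_tensor using g by blast
  qed
  then show ?thesis by (simp add: has_rank_def)
qed

section \<open>Modules over the Weyl algebra\<close>

definition lmul :: "'d::finite laurent \<Rightarrow> 'd laurent \<Rightarrow> 'd laurent" where
  "lmul f = (\<lambda>a. f * a)"

definition heval_int :: "int ^ ('d::{finite,linorder}) \<Rightarrow> 'd::{finite,linorder} Uh \<Rightarrow> complex" where
  "heval_int s = heval (\<lambda>i. of_int (s $ i))"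

text \<open>\<open>h_op f\<close> is \<open>f(\<partial>\<^sub>1, \<dots>, \<partial>\<^sub>d)\<close>, which acts on \<open>x\<^sup>s\<close> as the scalar \<open>f(s)\<close>.\<close>

definition h_op :: "'d::{finite,linorder} Uh \<Rightarrow> 'd laurent \<Rightarrow> 'd laurent" where
  "h_op f = Poly_Mapping.mapp (\<lambda>s c. heval_int s f * c)"

lemma lookup_h_op: "Poly_Mapping.lookup (h_op f a) s = heval_int s f * Poly_Mapping.lookup a s"
  by (simp add: h_op_def lookup_mapp when_def in_keys_iff)

lemma lookup_const_laurent_mult:
  "Poly_Mapping.lookup (const_laurent c * a) s = c * Poly_Mapping.lookup a s"
proof -
  have "const_laurent c * a = Poly_Mapping.map ((*) c) a"
    unfolding const_laurent_def by (simp add: mult_map_scale_conv_mult)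
  then show ?thesis by (simp add: map.rep_eq when_def)
qed

lemma heval_int_simps [simp]:
  "heval_int s (hconst c) = c" "heval_int s (hvar i) = of_int (s $ i)"
  "heval_int s 0 = 0" "heval_int s 1 = 1"
  "heval_int s (f + g) = heval_int s f + heval_int s g"
  "heval_int s (f * g) = heval_int s f * heval_int s g"
  by (simp_all add: heval_int_def complex_hom.peval_add complex_hom.peval_mult)

lemma h_op_hconst: "h_op (hconst c) = lmul (const_laurent c)"
  by (rule ext, rule poly_mapping_eqI) (simp add: lmul_def lookup_h_op lookup_const_laurent_mult)

lemma h_op_hvar: "h_op (hvar i) = partial i"
  by (rule ext, rule poly_mapping_eqI) (simp add: lookup_h_op partial_def lookup_mapp when_def in_keys_iff)

lemma h_op_add: "h_op (f + g) = (\<lambda>a. h_op f a + h_op g a)"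
  by (rule ext, rule poly_mapping_eqI) (simp add: lookup_h_op lookup_add distrib_right)

lemma h_op_mult: "h_op (f * g) = h_op f \<circ> h_op g"
  by (rule ext, rule poly_mapping_eqI) (simp add: lookup_h_op)

lemma h_op_weyl: "h_op f \<in> weyl_operators"
proof (induction f rule: Uh_induct)
  case (const c) show ?case unfolding h_op_hconst lmul_def by (rule weyl_operators.laurent)
next
  case (var i) show ?case unfolding h_op_hvar by (rule weyl_operators.partial)
next
  case (add f g) then show ?case unfolding h_op_add by (rule weyl_operators.add)
next
  case (mult f g) then show ?case unfolding h_op_mult by (rule weyl_operators.comp)
qed

lemma lmul_weyl: "lmul f \<in> weyl_operators"
  unfolding lmul_def by (rule weyl_operators.laurent)

lemma lmul_mult: "lmul (f * g) = lmul f \<circ> lmul g"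
  by (auto simp: lmul_def mult.assoc)

lemma lmul_add: "lmul (f + g) = (\<lambda>a. lmul f a + lmul g a)"
  by (auto simp: lmul_def distrib_right)

lemma x_pow_add: "x_pow (r + s) = x_pow r * x_pow s"
  by (simp add: x_pow_def mult_single)

lemma x_pow_0 [simp]: "x_pow 0 = 1"
  by (simp add: x_pow_def)

lemma lookup_x_pow_mult: "Poly_Mapping.lookup (x_pow r * a) s = Poly_Mapping.lookup a (s - r)"
proof (induction a rule: poly_mapping_single_induct)
  case (single k c)
  then show ?case by (auto simp: x_pow_def mult_single lookup_single when_def algebra_simps)
qed (simp_all add: distrib_left lookup_add)

text \<open>Compare coefficients at \<open>x^s\<close>: on the left \<open>f\<close> acts on the
  exponent \<open>s - r\<close> before multiplication by \<open>x^r\<close>, on the right the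
  shifted polynomial acts on the exponent \<open>s\<close>.\<close>

lemma x_pow_h_op: "lmul (x_pow r) \<circ> h_op f = h_op (shift_poly r f) \<circ> lmul (x_pow r)"
proof (rule ext, rule poly_mapping_eqI)
  fix a s
  have "heval_int s (shift_poly r f) = heval_int (s - r) f"
    by (simp add: heval_int_def heval_shift_poly)
  then show "Poly_Mapping.lookup ((lmul (x_pow r) \<circ> h_op f) a) s
    = Poly_Mapping.lookup ((h_op (shift_poly r f) \<circ> lmul (x_pow r)) a) s"
    by (simp add: lmul_def lookup_x_pow_mult lookup_h_op)
qed

definition witt_poly :: "complex ^ ('d::{finite,linorder}) \<Rightarrow> 'd::{finite,linorder} Uh" where
  "witt_poly u = (\<Sum>i\<in>UNIV. hconst (u $ i) * hvar i)"

lemma witt_D_eq: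
  fixes u :: "complex ^ ('d::{finite,linorder})"
  shows "witt_D u r = lmul (x_pow r) \<circ> h_op (witt_poly u)"
proof
  fix a :: "'d laurent"
  have "(\<Sum>i\<in>X. const_laurent (u $ i) * partial i a) = h_op (\<Sum>i\<in>X. hconst (u $ i) * hvar i) a" for X
  proof (induction X rule: infinite_finite_induct)
    case (insert i F)
    then show ?case by (simp add: h_op_add h_op_mult h_op_hconst h_op_hvar lmul_def)
  qed (simp_all add: h_op_def, (rule poly_mapping_eqI, simp add: lookup_mapp when_def)+)
  then show "witt_D u r a = (lmul (x_pow r) \<circ> h_op (witt_poly u)) a"
    by (simp add: witt_D_def witt_poly_def lmul_def)
qed

lemma witt_poly_axis: "witt_poly (axis i 1) = hvar i"
proof -
  have "witt_poly (axis i 1) = (\<Sum>j\<in>UNIV. if j = i then hvar j else 0)"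
    unfolding witt_poly_def by (rule sum.cong) (auto simp: axis_def)
  then show ?thesis by simp
qed

text \<open>\<open>Uh_module\<close> is defined monomial by monomial through iterated operators.
  This replaces that definition by any ring action \<open>\<rho>\<close> with the right values on
  constants and variables.\<close>

lemma Uh_module_smult:
  fixes W :: "('d::{finite,linorder}, 'm) witt_module" and \<rho> :: "'d Uh \<Rightarrow> 'm \<Rightarrow> 'm"
  assumes W: "abelian_group W"
    and closed: "\<And>f z. z \<in> carrier W \<Longrightarrow> \<rho> f z \<in> carrier W"
    and add: "\<And>f g z. z \<in> carrier W \<Longrightarrow> \<rho> (f + g) z = \<rho> f z \<oplus>\<^bsub>W\<^esub> \<rho> g z"
    and mult: "\<And>f g z. z \<in> carrier W \<Longrightarrow> \<rho> (f * g) z = \<rho> f (\<rho> g z)"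
    and const: "\<And>c z. z \<in> carrier W \<Longrightarrow> \<rho> (hconst c) z = c \<odot>\<^bsub>W\<^esub> z"
    and one: "\<And>z. z \<in> carrier W \<Longrightarrow> \<rho> 1 z = z"
    and var: "\<And>i z. z \<in> carrier W \<Longrightarrow> \<rho> (hvar i) z = act W (axis i 1) 0 z"
    and z: "z \<in> carrier W"
  shows "f \<odot>\<^bsub>Uh_module W\<^esub> z = \<rho> f z"
proof -
  interpret abelian_group W by (rule W)
  have pow: "(act W (axis i 1) 0 ^^ k) y = \<rho> (hvar i ^ k) y" if "y \<in> carrier W" for i k y
    by (induction k) (auto simp: that one mult var closed)
  have fold: "foldr (\<lambda>i. act W (axis i 1) 0 ^^ Poly_Mapping.lookup m i) xs z
    = \<rho> (prod_list (map (\<lambda>i. hvar i ^ Poly_Mapping.lookup m i) xs)) z" for m xs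
    by (induction xs) (auto simp: one mult z pow closed)
  have mono: "Poly_Mapping.lookup f m \<odot>\<^bsub>W\<^esub> h_monomial W m z = \<rho> (Poly_Mapping.single m (Poly_Mapping.lookup f m)) z" for m
  proof -
    have "prod_list (map (\<lambda>i. hvar i ^ Poly_Mapping.lookup m i) (sorted_list_of_set (UNIV :: 'd set)))
      = (\<Prod>i\<in>UNIV. hvar i ^ Poly_Mapping.lookup m i)"
      by (subst prod.distinct_set_conv_list[symmetric]) simp_all
    then show ?thesis unfolding h_monomial_def fold single_eq_monomial
      by (simp add: mult[OF z] const closed z)
  qed
  have zero: "\<rho> 0 z = \<zero>\<^bsub>W\<^esub>"
    using add[OF z, of 0 0] closed[OF z, of 0] by (metis add.r_cancel_one' add_0)
  have "(\<Oplus>\<^bsub>W\<^esub>m\<in>X. \<rho> (Poly_Mapping.single m (Poly_Mapping.lookup f m)) z)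
    = \<rho> (\<Sum>m\<in>X. Poly_Mapping.single m (Poly_Mapping.lookup f m)) z" if "finite X" for X
    using that
  proof (induction X)
    case (insert m F)
    have "(\<lambda>m. \<rho> (Poly_Mapping.single m (Poly_Mapping.lookup f m)) z) \<in> F \<rightarrow> carrier W"
      using closed z by auto
    then show ?case using insert closed z by (simp add: add[OF z])
  qed (simp add: zero)
  from this[OF finite_keys[of f]]
  have "(\<Oplus>\<^bsub>W\<^esub>m\<in>Poly_Mapping.keys f. \<rho> (Poly_Mapping.single m (Poly_Mapping.lookup f m)) z) = \<rho> f z"
    using poly_mapping_sum_singles[of f] by simp
  then show ?thesis by (simp add: Uh_module_def with_smult_def mono)
qed

lemma Uh_module_fields [simp]:
  "carrier (Uh_module W) = carrier W" "\<zero>\<^bsub>Uh_module W\<^esub> = \<zero>\<^bsub>W\<^esub>" "(\<oplus>\<^bsub>Uh_module W\<^esub>) = (\<oplus>\<^bsub>W\<^esub>)"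
  by (simp_all add: Uh_module_def with_smult_def)

section \<open>The operators \<open>f(\<partial>)\<close> and \<open>x^r\<close> on
  \<open>P\<close>\<close>

locale weyl_module =
  fixes P :: "('d::{finite,linorder} laurent \<Rightarrow> 'd laurent, 'p) module"
  assumes left_module: "left_module weyl_algebra P"
begin

sublocale abelian_group P
  using left_module by (simp add: left_module_def)

lemma weyl_carrier: "carrier weyl_algebra = weyl_operators"
  by (simp add: weyl_algebra_def)

lemma op_closed: "T \<in> weyl_operators \<Longrightarrow> z \<in> carrier P \<Longrightarrow> T \<odot>\<^bsub>P\<^esub> z \<in> carrier P"
  using left_module.smult_closed[OF left_module] by (simp add: weyl_carrier)

lemma op_add: "S \<in> weyl_operators \<Longrightarrow> T \<in> weyl_operators \<Longrightarrow> z \<in> carrier P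
    \<Longrightarrow> (\<lambda>a. S a + T a) \<odot>\<^bsub>P\<^esub> z = S \<odot>\<^bsub>P\<^esub> z \<oplus>\<^bsub>P\<^esub> T \<odot>\<^bsub>P\<^esub> z"
  using left_module.smult_l_distr[OF left_module, of S T z] by (simp add: weyl_algebra_def)

lemma op_comp: "S \<in> weyl_operators \<Longrightarrow> T \<in> weyl_operators \<Longrightarrow> z \<in> carrier P
    \<Longrightarrow> (S \<circ> T) \<odot>\<^bsub>P\<^esub> z = S \<odot>\<^bsub>P\<^esub> (T \<odot>\<^bsub>P\<^esub> z)"
  using left_module.smult_assoc[OF left_module, of S T z] by (simp add: weyl_algebra_def)

lemma op_one: "z \<in> carrier P \<Longrightarrow> id \<odot>\<^bsub>P\<^esub> z = z"
  using left_module.smult_one[OF left_module, of z] by (simp add: weyl_algebra_def)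

lemma op_sum: "T \<in> weyl_operators \<Longrightarrow> y \<in> carrier P \<Longrightarrow> z \<in> carrier P
    \<Longrightarrow> T \<odot>\<^bsub>P\<^esub> (y \<oplus>\<^bsub>P\<^esub> z) = T \<odot>\<^bsub>P\<^esub> y \<oplus>\<^bsub>P\<^esub> T \<odot>\<^bsub>P\<^esub> z"
  using left_module.smult_r_distr[OF left_module, of T y z] by (simp add: weyl_carrier)

lemma op_zero: "T \<in> weyl_operators \<Longrightarrow> T \<odot>\<^bsub>P\<^esub> \<zero>\<^bsub>P\<^esub> = \<zero>\<^bsub>P\<^esub>"
  using op_sum[of T "\<zero>\<^bsub>P\<^esub>" "\<zero>\<^bsub>P\<^esub>"] op_closed[of T "\<zero>\<^bsub>P\<^esub>"] by (metis add.r_cancel_one' l_zero zero_closed)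

definition ha :: "'d Uh \<Rightarrow> 'p \<Rightarrow> 'p" where "ha f z = h_op f \<odot>\<^bsub>P\<^esub> z"

definition xa :: "(int, 'd) vec \<Rightarrow> 'p \<Rightarrow> 'p" where "xa r z = lmul (x_pow r) \<odot>\<^bsub>P\<^esub> z"

lemma ha_closed: "z \<in> carrier P \<Longrightarrow> ha f z \<in> carrier P"
  by (simp add: ha_def op_closed h_op_weyl)

lemma ha_add: "z \<in> carrier P \<Longrightarrow> ha (f + g) z = ha f z \<oplus>\<^bsub>P\<^esub> ha g z"
  by (simp add: ha_def h_op_add op_add h_op_weyl)

lemma ha_mult: "z \<in> carrier P \<Longrightarrow> ha (f * g) z = ha f (ha g z)"
  by (simp add: ha_def h_op_mult op_comp h_op_weyl)

lemma ha_one: "z \<in> carrier P \<Longrightarrow> ha 1 z = z"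
proof -
  have "h_op (1 :: 'd Uh) = id" by (rule ext, rule poly_mapping_eqI) (simp add: lookup_h_op)
  then show "z \<in> carrier P \<Longrightarrow> ha 1 z = z" by (simp add: ha_def op_one)
qed

lemma ha_sum: "y \<in> carrier P \<Longrightarrow> z \<in> carrier P \<Longrightarrow> ha f (y \<oplus>\<^bsub>P\<^esub> z) = ha f y \<oplus>\<^bsub>P\<^esub> ha f z"
  by (simp add: ha_def op_sum h_op_weyl)

lemma ha_zero: "ha f \<zero>\<^bsub>P\<^esub> = \<zero>\<^bsub>P\<^esub>"
  by (simp add: ha_def op_zero h_op_weyl)

lemma ha_0: "z \<in> carrier P \<Longrightarrow> ha 0 z = \<zero>\<^bsub>P\<^esub>"
  using ha_add[of z 0 0] ha_closed[of z 0] by (metis add.r_cancel_one' add_0)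

lemma ha_minus: "z \<in> carrier P \<Longrightarrow> ha (- 1) z = \<ominus>\<^bsub>P\<^esub> z"
proof -
  assume z: "z \<in> carrier P"
  have "ha (- 1) z \<oplus>\<^bsub>P\<^esub> z = \<zero>\<^bsub>P\<^esub>" using ha_add[OF z, of "- 1" 1] by (simp add: ha_one ha_0 z)
  then show ?thesis using z ha_closed minus_equality by metis
qed

lemma xa_closed: "z \<in> carrier P \<Longrightarrow> xa r z \<in> carrier P"
  by (simp add: xa_def op_closed lmul_weyl)

lemma xa_sum: "y \<in> carrier P \<Longrightarrow> z \<in> carrier P \<Longrightarrow> xa r (y \<oplus>\<^bsub>P\<^esub> z) = xa r y \<oplus>\<^bsub>P\<^esub> xa r z"
  by (simp add: xa_def op_sum lmul_weyl)

lemma xa_zero: "xa r \<zero>\<^bsub>P\<^esub> = \<zero>\<^bsub>P\<^esub>"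
  by (simp add: xa_def op_zero lmul_weyl)

lemma xa_xa: "z \<in> carrier P \<Longrightarrow> xa r (xa s z) = xa (r + s) z"
  unfolding xa_def x_pow_add lmul_mult by (simp add: op_comp lmul_weyl)

lemma xa_0: "z \<in> carrier P \<Longrightarrow> xa 0 z = z"
proof -
  have "lmul (1 :: 'd laurent) = id" by (auto simp: lmul_def)
  then show "z \<in> carrier P \<Longrightarrow> xa 0 z = z" by (simp add: xa_def op_one)
qed

lemma xa_ha: "z \<in> carrier P \<Longrightarrow> xa r (ha f z) = ha (shift_poly r f) (xa r z)"
proof -
  assume z: "z \<in> carrier P"
  have "(lmul (x_pow r) \<circ> h_op f) \<odot>\<^bsub>P\<^esub> z = (h_op (shift_poly r f) \<circ> lmul (x_pow r)) \<odot>\<^bsub>P\<^esub> z"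
    by (simp only: x_pow_h_op)
  then show ?thesis using z by (simp add: xa_def ha_def op_comp lmul_weyl h_op_weyl del: o_apply)
qed

abbreviation "W \<equiv> weyl_to_witt P"
abbreviation "Q \<equiv> Uh_module W"

lemma W_fields [simp]: "carrier W = carrier P" "\<zero>\<^bsub>W\<^esub> = \<zero>\<^bsub>P\<^esub>" "(\<oplus>\<^bsub>W\<^esub>) = (\<oplus>\<^bsub>P\<^esub>)"
  "c \<odot>\<^bsub>W\<^esub> z = ha (hconst c) z"
  by (simp_all add: weyl_to_witt_def make_witt_module_def with_smult_def ha_def h_op_hconst lmul_def)

lemma act_W: "z \<in> carrier P \<Longrightarrow> act W u r z = xa r (ha (witt_poly u) z)"
  by (simp add: weyl_to_witt_def make_witt_module_def witt_D_eq xa_def ha_def op_comp lmul_weyl h_op_weyl)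

lemma witt_D_act: "z \<in> carrier P \<Longrightarrow> witt_D u r \<odot>\<^bsub>P\<^esub> z = xa r (ha (witt_poly u) z)"
  by (simp add: witt_D_eq xa_def ha_def op_comp lmul_weyl h_op_weyl)

lemma abelian_group_W: "abelian_group W"
proof (rule abelian_groupI)
  fix x assume "x \<in> carrier W"
  then show "\<exists>y\<in>carrier W. y \<oplus>\<^bsub>W\<^esub> x = \<zero>\<^bsub>W\<^esub>" using l_neg a_inv_closed by auto
qed (auto simp: a_ac)

lemma Q_smult: "z \<in> carrier P \<Longrightarrow> f \<odot>\<^bsub>Q\<^esub> z = ha f z"
  by (rule Uh_module_smult[OF abelian_group_W])
    (simp_all add: ha_closed ha_add ha_mult ha_one act_W witt_poly_axis xa_0)

lemma module_Q: "Module.module type_ring Q"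
proof (rule module_criteria)
  show "cring (type_ring :: 'd Uh ring)" by (rule cring_type_ring)
  show "\<forall>v\<in>carrier Q. \<exists>neg_v\<in>carrier Q. v \<oplus>\<^bsub>Q\<^esub> neg_v = \<zero>\<^bsub>Q\<^esub>"
    using r_neg a_inv_closed by auto
qed (auto simp: Q_smult ha_closed ha_add ha_mult ha_one ha_sum a_ac)

end

section \<open>Torsion-freeness of \<open>P\<close>\<close>

locale simple_weyl_module = weyl_module P
  for P :: "('d::{finite,linorder} laurent \<Rightarrow> 'd laurent, 'p) module" +
  assumes simple: "simple_left_module weyl_algebra P"
    and fg: "finitely_generated type_ring (Uh_module (weyl_to_witt P))"
begin

text \<open>An annihilator \<open>f\<close> of \<open>z\<close> becomes the annihilator
  \<open>shift_poly r f\<close> of \<open>x^r z\<close>; it remains one for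
  \<open>\<partial>_i z\<close>; and the product of two annihilators serves for a sum. So the
  torsion elements are stable under the Weyl algebra, and simplicity of \<open>P\<close>
  applies.\<close>

lemma torsion_weyl_closed:
  assumes "T \<in> weyl_operators" "z \<in> carrier P" "f \<noteq> 0" "ha f z = \<zero>\<^bsub>P\<^esub>"
  shows "\<exists>g. g \<noteq> 0 \<and> ha g (T \<odot>\<^bsub>P\<^esub> z) = \<zero>\<^bsub>P\<^esub>"
  using assms
proof (induction arbitrary: z f rule: weyl_operators.induct)
  case (laurent h)
  have "\<exists>g. g \<noteq> 0 \<and> ha g (lmul h \<odot>\<^bsub>P\<^esub> z) = \<zero>\<^bsub>P\<^esub>"
  proof (induction h rule: poly_mapping_single_induct)
    case zero
    have "lmul (0 :: 'd laurent) = h_op 0"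
      by (rule ext, rule poly_mapping_eqI) (simp add: lmul_def lookup_h_op)
    then show ?case using ha_0[OF laurent(1)] ha_zero by (metis ha_def one_neq_zero)
  next
    case (single r c)
    have "Poly_Mapping.single r c = x_pow r * const_laurent c"
      by (simp add: x_pow_def const_laurent_def mult_single)
    then have "lmul (Poly_Mapping.single r c) \<odot>\<^bsub>P\<^esub> z = xa r (ha (hconst c) z)"
      using laurent(1) by (simp add: lmul_mult op_comp lmul_weyl xa_def ha_def h_op_hconst)
    moreover have "ha f (ha (hconst c) z) = \<zero>\<^bsub>P\<^esub>"
      using ha_mult[OF laurent(1), of f "hconst c"] ha_mult[OF laurent(1), of "hconst c" f] laurent(3)
      by (simp add: mult.commute ha_zero)
    then have "ha (shift_poly r f) (xa r (ha (hconst c) z)) = \<zero>\<^bsub>P\<^esub>"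
      using xa_ha[of "ha (hconst c) z" r f] laurent(1) by (simp add: ha_closed xa_zero)
    ultimately show ?case using laurent(2) by (intro exI[of _ "shift_poly r f"]) simp
  next
    case (add h h')
    then obtain g g' where g: "g \<noteq> 0" "ha g (lmul h \<odot>\<^bsub>P\<^esub> z) = \<zero>\<^bsub>P\<^esub>" "g' \<noteq> 0" "ha g' (lmul h' \<odot>\<^bsub>P\<^esub> z) = \<zero>\<^bsub>P\<^esub>"
      by blast
    note c = op_closed[OF lmul_weyl[of h] laurent(1)] op_closed[OF lmul_weyl[of h'] laurent(1)]
    have "ha (g * g') (lmul (h + h') \<odot>\<^bsub>P\<^esub> z) = ha (g * g') (lmul h \<odot>\<^bsub>P\<^esub> z) \<oplus>\<^bsub>P\<^esub> ha (g * g') (lmul h' \<odot>\<^bsub>P\<^esub> z)"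
      using c laurent(1) by (simp add: lmul_add op_add lmul_weyl ha_sum)
    also have "ha (g * g') (lmul h \<odot>\<^bsub>P\<^esub> z) = \<zero>\<^bsub>P\<^esub>"
      using ha_mult[OF c(1), of g' g] g by (simp add: mult.commute ha_zero)
    also have "ha (g * g') (lmul h' \<odot>\<^bsub>P\<^esub> z) = \<zero>\<^bsub>P\<^esub>"
      using ha_mult[OF c(2), of g g'] g by (simp add: ha_zero)
    finally show ?case using g by (intro exI[of _ "g * g'"]) simp
  qed
  then show ?case by (simp add: lmul_def)
next
  case (partial i)
  have "ha f (ha (hvar i) z) = \<zero>\<^bsub>P\<^esub>"
    using ha_mult[OF partial(1), of f "hvar i"] ha_mult[OF partial(1), of "hvar i" f] partial(3)
    by (simp add: mult.commute ha_zero)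
  then show ?case using partial(2) by (metis ha_def h_op_hvar)
next
  case (add S T)
  then obtain g g' where g: "g \<noteq> 0" "ha g (S \<odot>\<^bsub>P\<^esub> z) = \<zero>\<^bsub>P\<^esub>" "g' \<noteq> 0" "ha g' (T \<odot>\<^bsub>P\<^esub> z) = \<zero>\<^bsub>P\<^esub>"
    by metis
  note c = op_closed[OF add(1,5)] op_closed[OF add(2,5)]
  have "ha (g * g') ((\<lambda>a. S a + T a) \<odot>\<^bsub>P\<^esub> z) = ha (g * g') (S \<odot>\<^bsub>P\<^esub> z) \<oplus>\<^bsub>P\<^esub> ha (g * g') (T \<odot>\<^bsub>P\<^esub> z)"
    using c by (simp add: op_add[OF add(1,2,5)] ha_sum)
  also have "ha (g * g') (S \<odot>\<^bsub>P\<^esub> z) = \<zero>\<^bsub>P\<^esub>"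
    using ha_mult[OF c(1), of g' g] g by (simp add: mult.commute ha_zero)
  also have "ha (g * g') (T \<odot>\<^bsub>P\<^esub> z) = \<zero>\<^bsub>P\<^esub>"
    using ha_mult[OF c(2), of g g'] g by (simp add: ha_zero)
  finally show ?case using g by (intro exI[of _ "g * g'"]) simp
next
  case (comp S T)
  obtain g where g: "g \<noteq> 0" "ha g (T \<odot>\<^bsub>P\<^esub> z) = \<zero>\<^bsub>P\<^esub>" using comp.IH(2) comp.prems by metis
  from comp.IH(1)[OF op_closed[OF comp.hyps(2) comp.prems(1)] g] show ?case
    unfolding op_comp[OF comp.hyps comp.prems(1)] .
qed

text \<open>If the torsion submodule were everything, the annihilator would be a nonzero ideal that is
  invariant under all shifts.\<close>

lemma torsion_free:
  assumes "z \<in> carrier P" "f \<noteq> 0" "ha f z = \<zero>\<^bsub>P\<^esub>"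
  shows "z = \<zero>\<^bsub>P\<^esub>"
proof (rule ccontr)
  assume z0: "z \<noteq> \<zero>\<^bsub>P\<^esub>"
  define T where "T = {z \<in> carrier P. \<exists>f. f \<noteq> 0 \<and> ha f z = \<zero>\<^bsub>P\<^esub>}"
  have zT: "z \<in> T" using assms by (auto simp: T_def)
  have mT: "ha g y \<in> T" if y: "y \<in> T" for g y
  proof -
    obtain h where h: "y \<in> carrier P" "h \<noteq> 0" "ha h y = \<zero>\<^bsub>P\<^esub>" using y by (auto simp: T_def)
    have "ha h (ha g y) = \<zero>\<^bsub>P\<^esub>"
      using ha_mult[OF h(1), of h g] ha_mult[OF h(1), of g h] h(3) by (simp add: mult.commute ha_zero)
    then show ?thesis using h ha_closed by (auto simp: T_def)
  qed
  have "additive_subgroup T P"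
  proof (rule additive_subgroup.intro, rule group.subgroupI[OF a_group])
    show "T \<subseteq> carrier (add_monoid P)" by (auto simp: T_def)
    show "T \<noteq> {}" using zT by auto
    fix y assume y: "y \<in> T"
    then show "inv\<^bsub>add_monoid P\<^esub> y \<in> T" using mT[OF y, of "- 1"] ha_minus[of y] by (simp add: T_def a_inv_def)
    fix y' assume y': "y' \<in> T"
    obtain h h' where h: "y \<in> carrier P" "h \<noteq> 0" "ha h y = \<zero>\<^bsub>P\<^esub>" "y' \<in> carrier P" "h' \<noteq> 0" "ha h' y' = \<zero>\<^bsub>P\<^esub>"
      using y y' by (auto simp: T_def)
    have "ha (h * h') y = \<zero>\<^bsub>P\<^esub>" using ha_mult[OF h(1), of h' h] h by (simp add: mult.commute ha_zero)
    moreover have "ha (h * h') y' = \<zero>\<^bsub>P\<^esub>" using ha_mult[OF h(4), of h h'] h by (simp add: ha_zero)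
    ultimately have "ha (h * h') (y \<oplus>\<^bsub>P\<^esub> y') = \<zero>\<^bsub>P\<^esub>" using h by (simp add: ha_sum)
    then show "y \<otimes>\<^bsub>add_monoid P\<^esub> y' \<in> T" using h by (auto simp: T_def intro!: exI[of _ "h * h'"])
  qed
  moreover have "\<forall>a\<in>carrier weyl_algebra. \<forall>x\<in>T. a \<odot>\<^bsub>P\<^esub> x \<in> T"
    unfolding weyl_carrier T_def using torsion_weyl_closed op_closed by blast
  ultimately have "T = {\<zero>\<^bsub>P\<^esub>} \<or> T = carrier P"
    using simple unfolding simple_left_module_def by blast
  then have T: "T = carrier P" using zT z0 by auto
  interpret Qm: Module.module type_ring Q by (rule module_Q)
  obtain G where G: "finite G" "G \<subseteq> carrier P" "Qm.span G = carrier P"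
    using fg by (auto simp: finitely_generated_def)
  have "\<forall>y\<in>G. \<exists>f. f \<noteq> 0 \<and> ha f y = \<zero>\<^bsub>P\<^esub>" using G T by (auto simp: T_def)
  then obtain h where h: "\<And>y. y \<in> G \<Longrightarrow> h y \<noteq> 0 \<and> ha (h y) y = \<zero>\<^bsub>P\<^esub>" by metis
  \<comment> \<open>The product of annihilators of finitely many generators annihilates all of
    \<open>P\<close>.\<close>
  define F where "F = prod h G"
  have F0: "F \<noteq> 0" unfolding F_def using G(1) h by (simp add: prod_zero_iff)
  have FG: "ha F y = \<zero>\<^bsub>P\<^esub>" if "y \<in> G" for y
  proof -
    have y: "y \<in> carrier P" using that G by auto
    have "F = prod h (G - {y}) * h y" unfolding F_def using G(1) that by (simp add: prod.remove mult.commute)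
    then show ?thesis using ha_mult[OF y, of "prod h (G - {y})" "h y"] h[OF that] by (simp add: ha_zero)
  qed
  have ha_lin: "ha F (finsum Q g X) = \<zero>\<^bsub>P\<^esub>" if "\<And>x. x \<in> X \<Longrightarrow> g x \<in> carrier P \<and> ha F (g x) = \<zero>\<^bsub>P\<^esub>" for g :: "'p \<Rightarrow> 'p" and X
    using that
  proof (induction X rule: infinite_finite_induct)
    case (insert x X)
    then have "g \<in> X \<rightarrow> carrier Q" "g x \<in> carrier Q" by auto
    moreover have "finsum Q g X \<in> carrier Q" using insert by (intro Qm.finsum_closed) auto
    ultimately show ?case using insert by (simp add: ha_sum)
  qed (simp_all add: Qm.finsum_infinite ha_zero)
  have Fall: "ha F y = \<zero>\<^bsub>P\<^esub>" if y: "y \<in> carrier P" for y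
  proof -
    obtain a A where a: "y = Qm.lincomb a A" "finite A" "A \<subseteq> G"
      using y G(3) unfolding Qm.span_def by blast
    show ?thesis unfolding a Qm.lincomb_def
    proof (rule ha_lin)
      fix x assume "x \<in> A"
      then have x: "x \<in> carrier P" "x \<in> G" using a G by auto
      have "ha F (ha (a x) x) = ha (a x) (ha F x)"
        using ha_mult[OF x(1), of F "a x"] ha_mult[OF x(1), of "a x" F] by (simp add: mult.commute)
      then show "a x \<odot>\<^bsub>Q\<^esub> x \<in> carrier P \<and> ha F (a x \<odot>\<^bsub>Q\<^esub> x) = \<zero>\<^bsub>P\<^esub>"
        using x FG by (simp add: Q_smult ha_closed ha_zero)
    qed
  qed
  define I where "I = {f. \<forall>y\<in>carrier P. ha f y = \<zero>\<^bsub>P\<^esub>}"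
  have "1 \<in> I"
  proof (rule shift_invariant_ideal[of UNIV I F])
    show "f + g \<in> I" if "f \<in> I" "g \<in> I" for f g using that by (auto simp: I_def ha_add)
    show "f * g \<in> I" if "g \<in> I" for f g using that by (auto simp: I_def ha_mult ha_zero)
    show "shift_poly (axis i 1) f \<in> I" if f: "f \<in> I" for i f
      unfolding I_def
    proof (rule CollectI, rule ballI)
      fix y assume y: "y \<in> carrier P"
      let ?r = "axis i 1 :: (int, 'd) vec"
      \<comment> \<open>Every \<open>y\<close> has the form \<open>x_i (x_i^(-1) y)\<close>, and
        \<open>f\<close> kills \<open>x_i^(-1) y\<close> too; moving \<open>x_i\<close> past
        \<open>f\<close> shifts it.\<close>
      have "ha (shift_poly ?r f) (xa ?r (xa (- ?r) y)) = xa ?r (ha f (xa (- ?r) y))"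
        using xa_ha[of "xa (- ?r) y" ?r f] y xa_closed by simp
      also have "\<dots> = \<zero>\<^bsub>P\<^esub>" using f y xa_closed by (simp add: I_def xa_zero)
      finally show "ha (shift_poly ?r f) y = \<zero>\<^bsub>P\<^esub>" using xa_xa[OF y, of ?r "- ?r"] y by (simp add: xa_0)
    qed
  qed (use F0 Fall in \<open>auto simp: I_def\<close>)
  then have "z = \<zero>\<^bsub>P\<^esub>" using assms(1) ha_one by (auto simp: I_def)
  then show False using z0 by simp
qed

end

text \<open>\<open>B\<close> is a basis up to the factor \<open>C\<close>: the coordinates of
  \<open>x\<close> are the coefficients of \<open>C x\<close>, which is why a vector of
  \<open>B\<close> gets \<open>C\<close> on the diagonal. With \<open>C = 1\<close> this is an
  honest basis, with general \<open>C\<close> it embeds a torsion-free module.\<close>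

lemma coords_of_basis:
  fixes Q :: "('a::idom, 'm, 'z) module_scheme" (structure)
  assumes Q: "Module.module type_ring Q" and B: "finite B" "B \<subseteq> carrier Q"
    and li: "\<not> module.lin_dep type_ring Q B"
    and C: "\<And>x. x \<in> carrier Q \<Longrightarrow> C \<odot>\<^bsub>Q\<^esub> x \<in> module.span type_ring Q B"
    and C0: "\<And>x. x \<in> carrier Q \<Longrightarrow> C \<odot>\<^bsub>Q\<^esub> x = \<zero> \<Longrightarrow> x = \<zero>"
  obtains \<phi> where "coord_module Q \<phi>" "\<And>x v. v \<notin> B \<Longrightarrow> \<phi> x v = 0"
    "\<And>v. v \<in> B \<Longrightarrow> \<phi> v = (\<lambda>w. if w = v then C else 0)"
proof -
  interpret Module.module type_ring Q by (rule Q)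
  have sp: "span B = {lincomb a B | a. a \<in> B \<rightarrow> carrier type_ring}" by (rule finite_span[OF B])
  have lc: "lincomb a B \<in> carrier Q" for a by (rule lincomb_closed[OF B(2)]) simp
  have lc_add: "lincomb (\<lambda>v. a v + b v) B = lincomb a B \<oplus> lincomb b B" for a b
    using lincomb_sum[OF B, of a b] by simp
  have lc_smult: "lincomb (\<lambda>v. c * a v) B = c \<odot>\<^bsub>Q\<^esub> lincomb a B" for a c
    using lincomb_smult[OF B(2), of a c] by simp
  have neg: "(- 1) \<odot>\<^bsub>Q\<^esub> x \<oplus> x = \<zero>" if "x \<in> carrier Q" for x
    using smult_l_distr[of "- 1" 1 x] smult_one[of x] smult_l_null[of x] that by simp
  have uniq: "a v = b v" if "lincomb a B = lincomb b B" "v \<in> B" for a b v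
  proof -
    have "lincomb (\<lambda>v. (- 1) * a v + b v) B = \<zero>"
      unfolding lc_add lc_smult that(1) by (rule neg[OF lc])
    moreover have "c v = 0" if "lincomb c B = \<zero>" for c
      using li B(1) that \<open>v \<in> B\<close> unfolding lin_dep_def by auto
    ultimately have "(- 1) * a v + b v = 0" by blast
    then show ?thesis by simp
  qed
  define \<phi> where "\<phi> x v = (if v \<in> B then (SOME a. C \<odot>\<^bsub>Q\<^esub> x = lincomb a B) v else 0)" for x v
  have \<phi>: "C \<odot>\<^bsub>Q\<^esub> x = lincomb (\<phi> x) B" if x: "x \<in> carrier Q" for x
  proof -
    have "\<exists>a. C \<odot>\<^bsub>Q\<^esub> x = lincomb a B" using C[OF x] sp by auto
    then have "C \<odot>\<^bsub>Q\<^esub> x = lincomb (SOME a. C \<odot>\<^bsub>Q\<^esub> x = lincomb a B) B" by (rule someI_ex)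
    also have "\<dots> = lincomb (\<phi> x) B" by (rule lincomb_cong) (use B in \<open>auto simp: \<phi>_def\<close>)
    finally show ?thesis .
  qed
  have \<phi>I: "\<phi> x = a" if "x \<in> carrier Q" "C \<odot>\<^bsub>Q\<^esub> x = lincomb a B" "\<And>v. v \<notin> B \<Longrightarrow> a v = 0" for x a
    using uniq[of "\<phi> x" a] \<phi>[OF that(1)] that by (auto simp: \<phi>_def)
  have C_comm: "C \<odot>\<^bsub>Q\<^esub> (f \<odot>\<^bsub>Q\<^esub> x) = f \<odot>\<^bsub>Q\<^esub> (C \<odot>\<^bsub>Q\<^esub> x)" if "x \<in> carrier Q" for f x
    using smult_assoc1[of C f x] smult_assoc1[of f C x] that by (simp add: mult.commute)
  have "coord_module Q \<phi>"
  proof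
    show "\<zero> \<in> carrier Q" by simp
    show "\<phi> \<zero> = 0"
      by (rule \<phi>I) (use lc_smult[of 0 "\<lambda>_. 0"] smult_l_null[OF lc, of "\<lambda>_. 0"] smult_r_null[of C] in \<open>auto simp: zero_fun_def\<close>)
    show "x \<oplus> y \<in> carrier Q" if "x \<in> carrier Q" "y \<in> carrier Q" for x y using that by simp
    show "f \<odot>\<^bsub>Q\<^esub> x \<in> carrier Q" if "x \<in> carrier Q" for f x using that by simp
    show "\<phi> (x \<oplus> y) = \<phi> x + \<phi> y" if "x \<in> carrier Q" "y \<in> carrier Q" for x y
      by (rule \<phi>I) (use that \<phi> lc_add[of "\<phi> x" "\<phi> y"] in \<open>auto simp: smult_r_distr plus_fun_def \<phi>_def\<close>)
    show "\<phi> (f \<odot>\<^bsub>Q\<^esub> x) = f \<star> \<phi> x" if "x \<in> carrier Q" for f x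
      by (rule \<phi>I) (use that \<phi> lc_smult[of f "\<phi> x"] C_comm in \<open>auto simp: fscale_def \<phi>_def\<close>)
    show "inj_on \<phi> (carrier Q)"
    proof (rule inj_onI)
      fix x y assume xy: "x \<in> carrier Q" "y \<in> carrier Q" "\<phi> x = \<phi> y"
      let ?z = "(- 1) \<odot>\<^bsub>Q\<^esub> x \<oplus> y"
      have "C \<odot>\<^bsub>Q\<^esub> ?z = (- 1) \<odot>\<^bsub>Q\<^esub> (C \<odot>\<^bsub>Q\<^esub> x) \<oplus> C \<odot>\<^bsub>Q\<^esub> y"
        using xy by (simp add: smult_r_distr C_comm)
      also have "C \<odot>\<^bsub>Q\<^esub> x = C \<odot>\<^bsub>Q\<^esub> y" using \<phi> xy by simp
      finally have "?z = \<zero>" using xy neg[of "C \<odot>\<^bsub>Q\<^esub> y"] C0[of ?z] by simp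
      then have "\<ominus> ((- 1) \<odot>\<^bsub>Q\<^esub> x) = y" using xy by (intro minus_equality) (auto simp: a_comm)
      moreover have "\<ominus> ((- 1) \<odot>\<^bsub>Q\<^esub> x) = x" using neg[OF xy(1)] xy by (intro minus_equality) (auto simp: a_comm)
      ultimately show "x = y" by simp
    qed
  qed
  moreover have "\<phi> v = (\<lambda>w. if w = v then C else 0)" if v: "v \<in> B" for v
  proof (rule \<phi>I)
    show "C \<odot>\<^bsub>Q\<^esub> v = lincomb (\<lambda>w. if w = v then C else 0) B"
    proof -
      have "lincomb (\<lambda>w. if w = v then C else 0) (B - {v}) = lincomb (\<lambda>w. 0 * 0) (B - {v})"
        by (rule lincomb_cong) (use B in auto)
      also have "\<dots> = 0 \<odot>\<^bsub>Q\<^esub> lincomb (\<lambda>w. 0) (B - {v})"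
        using lincomb_smult[of "B - {v}" "\<lambda>w. 0" 0] B by auto
      also have "\<dots> = \<zero>" using B by (intro smult_l_null[simplified] lincomb_closed) auto
      finally have "lincomb (\<lambda>w. if w = v then C else 0) (B - {v}) = \<zero>" .
      then show ?thesis using lincomb_del2[OF B, of "\<lambda>w. if w = v then C else 0" v] v B by auto
    qed
  qed (use v B in auto)
  ultimately show ?thesis using that \<phi>_def by auto
qed

text \<open>Let \<open>B\<close> be a maximal independent subset of the finitely many generators.
  Each generator has a nonzero multiple in the span of \<open>B\<close>. The product
  \<open>C\<close> of these multipliers maps the whole module into that span, injectively because
  there is no torsion.\<close>

lemma torsion_free_coords:
  fixes Q :: "('a::idom, 'm, 'z) module_scheme" (structure)
  assumes Q: "Module.module type_ring Q" and fg: "finitely_generated type_ring Q"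
    and tf: "\<And>f x. x \<in> carrier Q \<Longrightarrow> f \<noteq> 0 \<Longrightarrow> f \<odot>\<^bsub>Q\<^esub> x = \<zero> \<Longrightarrow> x = \<zero>"
  shows "\<exists>\<phi> :: 'm \<Rightarrow> 'm \<Rightarrow> 'a. coord_module Q \<phi>"
proof -
  interpret Module.module type_ring Q by (rule Q)
  obtain G where G: "finite G" "G \<subseteq> carrier Q" "span G = carrier Q"
    using fg by (auto simp: finitely_generated_def)
  define S where "S = {B. B \<subseteq> G \<and> \<not> lin_dep B}"
  have "finite S" using G(1) by (auto simp: S_def)
  moreover have "{} \<in> S" by (auto simp: S_def lin_dep_def)
  ultimately obtain B where B: "B \<in> S" "\<And>B'. B' \<in> S \<Longrightarrow> B \<subseteq> B' \<Longrightarrow> B = B'"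
    using finite_has_maximal[of S] by blast
  have B': "finite B" "B \<subseteq> carrier Q" "B \<subseteq> G" "\<not> lin_dep B"
    using B(1) G by (auto simp: S_def intro: finite_subset)
  have sub: "submodule type_ring (span B) Q" by (rule span_is_submodule[OF B'(2)])
  have "\<exists>c. c \<noteq> 0 \<and> c \<odot>\<^bsub>Q\<^esub> g \<in> span B" if g: "g \<in> G" for g
  proof (cases "g \<in> B")
    case True
    moreover have "1 \<odot>\<^bsub>Q\<^esub> g = g" using smult_one[of g] g G(2) by auto
    ultimately have "1 \<odot>\<^bsub>Q\<^esub> g \<in> span B" using in_own_span[OF B'(2)] by auto
    then show ?thesis by (intro exI[of _ 1]) simp
  next
    case False
    have gB: "insert g B \<subseteq> carrier Q" using g G B' by auto
    have "lin_dep (insert g B)" using B(2)[of "insert g B"] g False B' by (auto simp: S_def)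
    then obtain a v where a: "lincomb a (insert g B) = \<zero>" "v \<in> insert g B" "a v \<noteq> 0"
      using finite_lin_dep[of "insert g B"] B' gB by auto
    have eq: "a g \<odot>\<^bsub>Q\<^esub> g \<oplus> lincomb a B = \<zero>"
      using lincomb_insert[of B a g] B' gB False a by auto
    have lc: "lincomb a B \<in> carrier Q" by (rule lincomb_closed[OF B'(2)]) simp
    have "a g \<noteq> 0"
    proof
      assume a0: "a g = 0"
      then have "lincomb a B = \<zero>" using eq lc gB smult_l_null[of g] by auto
      then show False using a a0 B' unfolding lin_dep_def by auto
    qed
    moreover have "a g \<odot>\<^bsub>Q\<^esub> g \<in> span B"
    proof -
      have lB: "lincomb a B \<in> span B" using finite_span[OF B'(1,2)] by auto
      have "a g \<odot>\<^bsub>Q\<^esub> g = \<ominus> lincomb a B" using eq lc gB by (intro minus_equality[symmetric]) auto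
      also have "\<dots> = (- 1) \<odot>\<^bsub>Q\<^esub> lincomb a B"
        using smult_l_distr[of "- 1" 1 "lincomb a B"] smult_one[OF lc] smult_l_null[OF lc] lc
        by (intro minus_equality) auto
      also have "\<dots> \<in> span B" using LinearCombinations.submodule.smult_closed[OF sub _ lB] by simp
      finally show ?thesis .
    qed
    ultimately show ?thesis by blast
  qed
  then obtain c where c: "\<And>g. g \<in> G \<Longrightarrow> c g \<noteq> 0 \<and> c g \<odot>\<^bsub>Q\<^esub> g \<in> span B" by metis
  define C where "C = prod c G"
  have C0: "C \<noteq> 0" using G(1) c by (simp add: C_def prod_zero_iff)
  have CG: "C \<odot>\<^bsub>Q\<^esub> g \<in> span B" if g: "g \<in> G" for g
  proof -
    have "C = prod c (G - {g}) * c g" unfolding C_def using G(1) g by (simp add: prod.remove mult.commute)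
    then have "C \<odot>\<^bsub>Q\<^esub> g = prod c (G - {g}) \<odot>\<^bsub>Q\<^esub> (c g \<odot>\<^bsub>Q\<^esub> g)"
      using smult_assoc1[of "prod c (G - {g})" "c g" g] g G by auto
    then show ?thesis using LinearCombinations.submodule.smult_closed[OF sub] c[OF g] by simp
  qed
  have C_sum: "C \<odot>\<^bsub>Q\<^esub> finsum Q h X \<in> span B"
    if "\<And>x. x \<in> X \<Longrightarrow> h x \<in> carrier Q \<and> C \<odot>\<^bsub>Q\<^esub> h x \<in> span B" for h :: "'m \<Rightarrow> 'm" and X
    using that
  proof (induction X rule: infinite_finite_induct)
    case (insert x X)
    then have "h \<in> X \<rightarrow> carrier Q" "h x \<in> carrier Q" by auto
    then show ?case using insert LinearCombinations.submodule.m_closed[OF sub] by (simp add: smult_r_distr)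
  qed (use LinearCombinations.submodule.zero_closed[OF sub] in \<open>auto simp: finsum_infinite\<close>)
  have "C \<odot>\<^bsub>Q\<^esub> x \<in> span B" if x: "x \<in> carrier Q" for x
  proof -
    obtain a A where a: "x = lincomb a A" "A \<subseteq> G" using x G(3) unfolding span_def by blast
    show ?thesis unfolding a lincomb_def
    proof (rule C_sum)
      fix v assume "v \<in> A"
      then have v: "v \<in> carrier Q" "v \<in> G" using a G by auto
      have "C \<odot>\<^bsub>Q\<^esub> (a v \<odot>\<^bsub>Q\<^esub> v) = a v \<odot>\<^bsub>Q\<^esub> (C \<odot>\<^bsub>Q\<^esub> v)"
        using smult_assoc1[of C "a v" v] smult_assoc1[of "a v" C v] v by (simp add: mult.commute)
      then show "a v \<odot>\<^bsub>Q\<^esub> v \<in> carrier Q \<and> C \<odot>\<^bsub>Q\<^esub> (a v \<odot>\<^bsub>Q\<^esub> v) \<in> span B"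
        using v LinearCombinations.submodule.smult_closed[OF sub _ CG[OF v(2)]] by simp
    qed
  qed
  then show ?thesis using coords_of_basis[OF Q B'(1,2,4), of C] tf C0 by metis
qed

context simple_weyl_module
begin

text \<open>The coordinates from \<open>torsion_free_coords\<close> only embed \<open>P\<close> as a
  lattice \<open>M\<close>. The operators \<open>x_j\<close> make
  \<open>equivariant_module_free\<close> applicable to \<open>M\<close>, and coordinates in the
  resulting basis, now onto, replace the embedding.\<close>

theorem free_coords:
  obtains L :: "nat set" and \<kappa> :: "'p \<Rightarrow> nat \<Rightarrow> 'd Uh" where "finite L"
    "bij_betw \<kappa> (carrier P) {f. \<forall>l. l \<notin> L \<longrightarrow> f l = 0}"
    "\<And>y z. y \<in> carrier P \<Longrightarrow> z \<in> carrier P \<Longrightarrow> \<kappa> (y \<oplus>\<^bsub>P\<^esub> z) = \<kappa> y + \<kappa> z"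
    "\<And>f z. z \<in> carrier P \<Longrightarrow> \<kappa> (ha f z) = f \<star> \<kappa> z"
proof -
  obtain \<phi> :: "'p \<Rightarrow> 'p \<Rightarrow> 'd Uh" where "coord_module Q \<phi>"
    using torsion_free_coords[OF module_Q fg] torsion_free by (auto simp: Q_smult)
  then interpret c: coord_module Q \<phi> .
  interpret Qm: Module.module type_ring Q by (rule module_Q)
  define M where "M = \<phi> ` carrier P"
  have \<phi>_ha: "\<phi> (ha f z) = f \<star> \<phi> z" if "z \<in> carrier P" for f z
    using c.K_smult[of z f] that by (simp add: Q_smult)
  have \<phi>_add: "\<phi> (y \<oplus>\<^bsub>P\<^esub> z) = \<phi> y + \<phi> z" if "y \<in> carrier P" "z \<in> carrier P" for y z
    using c.K_add[of y z] that by simp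
  have bij: "bij_betw \<phi> (carrier P) M" unfolding M_def using c.K_inj by (simp add: bij_betw_def)
  have sub: "submod (vars_in UNIV) M"
    unfolding submod_def M_def
  proof (intro conjI ballI)
    show "0 \<in> \<phi> ` carrier P" using c.K_zero by (metis Uh_module_fields(2) W_fields(2) image_eqI zero_closed)
    show "x + y \<in> \<phi> ` carrier P" if "x \<in> \<phi> ` carrier P" "y \<in> \<phi> ` carrier P" for x y
      using that by (auto simp: \<phi>_add[symmetric])
    show "f \<star> x \<in> \<phi> ` carrier P" if "x \<in> \<phi> ` carrier P" for f x
      using that by (auto simp: \<phi>_ha[symmetric] ha_closed)
  qed
  obtain G where G: "finite G" "G \<subseteq> carrier P" "Qm.span G = carrier P"
    using fg by (auto simp: finitely_generated_def)
  obtain g where g: "bij_betw g {..<card G} G" using ex_bij_betw_nat_finite[OF G(1)] by (auto simp: atLeast0LessThan)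
  have spM: "spans (vars_in UNIV) M {..<card G} (\<phi> \<circ> g)"
    unfolding spans_def
  proof (intro conjI ballI)
    show "(\<phi> \<circ> g) ` {..<card G} \<subseteq> M" using g G(2) by (auto simp: M_def bij_betw_def)
    fix x assume "x \<in> M"
    then obtain z where z: "z \<in> carrier P" "x = \<phi> z" by (auto simp: M_def)
    have Gc: "G \<subseteq> carrier Q" using G by simp
    obtain a where "\<phi> z = (\<Sum>v\<in>G. a v \<star> \<phi> v)"
      using c.span_finite_iff[OF Gc G(1), of z] z G(3) by auto
    also have "\<dots> = (\<Sum>l<card G. a (g l) \<star> \<phi> (g l))"
      by (rule sum.reindex_bij_betw[OF g, symmetric])
    finally show "\<exists>f. (\<forall>l\<in>{..<card G}. f l \<in> vars_in UNIV) \<and> x = lcomb {..<card G} f (\<phi> \<circ> g)"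
      unfolding z(2) by (intro exI[of _ "\<lambda>l. a (g l)"]) (simp add: lcomb_def)
  qed simp
  \<comment> \<open>\<open>x_j\<close> transported to \<open>M\<close>. It is bijective with inverse
    \<open>x_j^(-1)\<close>, and semilinear over the shift by \<open>xa_ha\<close>.\<close>
  define X where "X j x = \<phi> (xa (axis j 1) (inv_into (carrier P) \<phi> x))" for j x
  have X: "X j (\<phi> z) = \<phi> (xa (axis j 1) z)" if "z \<in> carrier P" for j z
    unfolding X_def using that c.K_inj by (simp add: inv_into_f_f)
  have "bij_betw (X j) M M" for j
  proof (rule bij_betw_byWitness[of _ "\<lambda>x. \<phi> (xa (- axis j 1) (inv_into (carrier P) \<phi> x))"])
    have *: "inv_into (carrier P) \<phi> (\<phi> z) = z" if "z \<in> carrier P" for z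
      using that c.K_inj by (simp add: inv_into_f_f)
    show "\<forall>x\<in>M. \<phi> (xa (- axis j 1) (inv_into (carrier P) \<phi> (X j x))) = x"
      "\<forall>x\<in>M. X j (\<phi> (xa (- axis j 1) (inv_into (carrier P) \<phi> x))) = x"
      unfolding M_def by (auto simp: X * xa_closed xa_xa xa_0)
    show "X j ` M \<subseteq> M" "(\<lambda>x. \<phi> (xa (- axis j 1) (inv_into (carrier P) \<phi> x))) ` M \<subseteq> M"
      unfolding M_def by (auto simp: X * xa_closed)
  qed
  moreover have "X j (x + y) = X j x + X j y" if "x \<in> M" "y \<in> M" for j x y
    using that unfolding M_def by (auto simp: \<phi>_add[symmetric] X xa_sum xa_closed)
  moreover have "X j (f \<star> x) = shift_poly (axis j 1) f \<star> X j x" if "x \<in> M" for j f x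
    using that unfolding M_def by (auto simp: \<phi>_ha[symmetric] X xa_ha xa_closed ha_closed)
  ultimately obtain L m where Lm: "spans (vars_in UNIV) M L m" "indep (vars_in UNIV) L m"
    using equivariant_module_free[OF sub spM, of X] by blast
  have fin: "finite L" and mM: "m l \<in> M" if "l \<in> L" for l using Lm(1) that by (auto simp: spans_def)
  define co where "co x = (SOME f. x = lcomb L f m)" for x
  define \<kappa> where "\<kappa> z l = (if l \<in> L then co (\<phi> z) l else 0)" for z l
  have \<kappa>: "\<phi> z = lcomb L (\<kappa> z) m" if z: "z \<in> carrier P" for z
  proof -
    have "\<exists>f. \<phi> z = lcomb L f m" using Lm(1) z by (auto simp: spans_def M_def)
    then have "\<phi> z = lcomb L (co (\<phi> z)) m" unfolding co_def by (rule someI_ex)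
    also have "\<dots> = lcomb L (\<kappa> z) m" by (rule lcomb_cong) (simp add: \<kappa>_def)
    finally show ?thesis .
  qed
  have \<kappa>I: "\<kappa> z = f" if "z \<in> carrier P" "\<phi> z = lcomb L f m" "\<And>l. l \<notin> L \<Longrightarrow> f l = 0" for z f
  proof
    fix l
    have "lcomb L (\<lambda>l. \<kappa> z l - f l) m = 0" using \<kappa>[OF that(1)] that(2) by (simp add: lcomb_diff)
    then have "l \<in> L \<Longrightarrow> \<kappa> z l - f l = 0"
      using indepD[OF Lm(2), of "\<lambda>l. \<kappa> z l - f l" l] unfolding vars_in_UNIV by blast
    then show "\<kappa> z l = f l" using that(3) by (cases "l \<in> L") (auto simp: \<kappa>_def)
  qed
  show ?thesis
  proof (rule that)
    show "finite L" using Lm(1) by (simp add: spans_def)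
    show "\<kappa> (y \<oplus>\<^bsub>P\<^esub> z) = \<kappa> y + \<kappa> z" if "y \<in> carrier P" "z \<in> carrier P" for y z
    proof (rule \<kappa>I)
      show "\<phi> (y \<oplus>\<^bsub>P\<^esub> z) = lcomb L (\<kappa> y + \<kappa> z) m"
        unfolding \<phi>_add[OF that] \<kappa>[OF that(1)] \<kappa>[OF that(2)]
        by (simp add: lcomb_def plus_fun_apply[where f = "\<kappa> y"] sum.distrib)
    qed (use that in \<open>auto simp: \<kappa>_def plus_fun_apply\<close>)
    show "\<kappa> (ha f z) = f \<star> \<kappa> z" if "z \<in> carrier P" for f z
    proof (rule \<kappa>I)
      show "\<phi> (ha f z) = lcomb L (f \<star> \<kappa> z) m"
        unfolding \<phi>_ha[OF that] \<kappa>[OF that]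
        by (simp add: lcomb_def fscale_apply fscale_sum)
    qed (use that in \<open>auto simp: \<kappa>_def fscale_apply ha_closed\<close>)
    show "bij_betw \<kappa> (carrier P) {f. \<forall>l. l \<notin> L \<longrightarrow> f l = 0}"
      unfolding bij_betw_def
    proof
      show "inj_on \<kappa> (carrier P)"
      proof (rule inj_onI)
        fix y z assume yz: "y \<in> carrier P" "z \<in> carrier P" "\<kappa> y = \<kappa> z"
        then have "\<phi> y = \<phi> z" using \<kappa>[OF yz(1)] \<kappa>[OF yz(2)] by simp
        then show "y = z" using bij yz by (auto simp: bij_betw_def inj_on_def)
      qed
      show "\<kappa> ` carrier P = {f. \<forall>l. l \<notin> L \<longrightarrow> f l = 0}"
      proof (intro equalityI subsetI)
        fix f :: "nat \<Rightarrow> 'd Uh" assume f: "f \<in> {f. \<forall>l. l \<notin> L \<longrightarrow> f l = 0}"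
        have "lcomb L f m \<in> M" by (rule submod_lcomb[OF sub]) (use mM in auto)
        then obtain z where z: "z \<in> carrier P" "\<phi> z = lcomb L f m" by (auto simp: M_def)
        then show "f \<in> \<kappa> ` carrier P" using \<kappa>I[OF z] f by auto
      qed (auto simp: \<kappa>_def)
    qed
  qed
qed

end

section \<open>Exterior powers and the Koszul differential\<close>

text \<open>For \<open>j\<close> in \<open>S\<close> this is the sign in
  \<open>e_j \<and> e_(S - {j}) = esign j S * e_S\<close>: the number of transpositions that bring
  \<open>e_j\<close> to its place.\<close>

definition esign :: "'d::linorder \<Rightarrow> 'd set \<Rightarrow> complex" where
  "esign j S = (- 1) ^ card {u \<in> S. u < j}"

lemma esign_nonzero [simp]: "esign j S \<noteq> 0"
  by (simp add: esign_def)

lemma esign_single [simp]: "esign i {i} = 1"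
proof -
  have "{u \<in> {i}. u < i} = {}" by auto
  then show ?thesis by (simp only: esign_def card.empty power_0)
qed

text \<open>Deleting the smaller of two indices moves the larger one by a single place, deleting the
  larger leaves the smaller where it is. This is the anticommutativity
  \<open>e_i \<and> e_j = - e_j \<and> e_i\<close>.\<close>

lemma esign_swap:
  assumes "finite S" "i \<in> S" "j \<in> S" "i \<noteq> j"
  shows "esign j S * esign i (S - {j}) = - (esign i S * esign j (S - {i}))"
proof -
  have *: "esign j S * esign i (S - {j}) = - (esign i S * esign j (S - {i}))" if "i \<in> S" "i < j" for i j
  proof -
    have "{u \<in> S. u < j} = insert i {u \<in> S - {i}. u < j}" using that by auto
    then have "card {u \<in> S. u < j} = Suc (card {u \<in> S - {i}. u < j})" using assms(1) by simp
    moreover have "{u \<in> S - {j}. u < i} = {u \<in> S. u < i}" using that by auto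
    ultimately show ?thesis by (simp add: esign_def)
  qed
  show ?thesis
  proof (cases "i < j")
    case False
    then have "esign i S * esign j (S - {i}) = - (esign j S * esign i (S - {j}))"
      using *[of j i] assms by auto
    then show ?thesis by simp
  qed (use *[of i j] assms in auto)
qed

lemma ext_vec_single [simp]: "ext_vec v {j} = v $ j"
proof -
  have "ext_vec v {j} = (\<Sum>i\<in>UNIV. if i = j then v $ i else 0)"
    unfolding ext_vec_def by (rule sum.cong) auto
  then show ?thesis by simp
qed

lemma ext_vec_other: "(\<And>j. T \<noteq> {j}) \<Longrightarrow> ext_vec v T = 0"
  unfolding ext_vec_def by (rule sum.neutral) auto

lemma wedge_ext_vec: "wedge (ext_vec v) w S = (\<Sum>j\<in>S. esign j S * (v $ j) * w (S - {j}))"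
proof -
  have c: "card {(t, u). t \<in> {j} \<and> u \<in> S - {j} \<and> u < t} = card {u \<in> S. u < j}" for j
    by (rule bij_betw_same_card[of "\<lambda>(t, u). u"])
      (auto simp: bij_betw_def inj_on_def image_iff)
  have "wedge (ext_vec v) w S = (\<Sum>T\<in>(\<lambda>j. {j}) ` S. (-1) ^ card {(t, u). t \<in> T \<and> u \<in> S - T \<and> u < t} * ext_vec v T * w (S - T))"
    unfolding wedge_def
  proof (rule sum.mono_neutral_right)
    show "\<forall>T\<in>Pow S - (\<lambda>j. {j}) ` S. (-1) ^ card {(t, u). t \<in> T \<and> u \<in> S - T \<and> u < t} * ext_vec v T * w (S - T) = 0"
    proof
      fix T assume "T \<in> Pow S - (\<lambda>j. {j}) ` S"
      then have "ext_vec v T = 0" by (intro ext_vec_other) auto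
      then show "(-1) ^ card {(t, u). t \<in> T \<and> u \<in> S - T \<and> u < t} * ext_vec v T * w (S - T) = 0" by simp
    qed
  qed auto
  also have "\<dots> = (\<Sum>j\<in>S. esign j S * (v $ j) * w (S - {j}))"
    by (subst sum.reindex) (auto simp: esign_def c[simplified])
  finally show ?thesis .
qed

lemma wedge_axis:
  "wedge (ext_vec (axis j 1)) w S = (if j \<in> S then esign j S * w (S - {j}) else 0)"
proof -
  have "wedge (ext_vec (axis j 1)) w S = (\<Sum>i\<in>S. if i = j then esign i S * w (S - {i}) else 0)"
    unfolding wedge_ext_vec by (rule sum.cong) (auto simp: axis_def)
  then show ?thesis by simp
qed

lemma wedge_list_Nil [simp]: "wedge_list [] = ext_scalar 1"
  by (simp add: wedge_list_def)

lemma wedge_list_Cons [simp]: "wedge_list (v # vs) = wedge (ext_vec v) (wedge_list vs)"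
  by (simp add: wedge_list_def)

lemma wedge_list_card: "wedge_list vs T \<noteq> 0 \<Longrightarrow> card T = length vs"
proof (induction vs arbitrary: T)
  case Nil then show ?case by (auto simp: ext_scalar_def split: if_splits)
next
  case (Cons v vs)
  then obtain j where "j \<in> T" "wedge_list vs (T - {j}) \<noteq> 0"
    unfolding wedge_list_Cons wedge_ext_vec by (metis (no_types, lifting) mult_zero_right sum.neutral)
  then have "card (T - {j}) = length vs" using Cons.IH by blast
  then show ?case using \<open>j \<in> T\<close> by (metis card_Suc_Diff1 finite length_Cons)
qed

lemma wedge_list_zero: "0 \<in> set vs \<Longrightarrow> wedge_list vs T = 0"
proof (induction vs arbitrary: T)
  case (Cons v vs)
  show ?case
  proof (cases "v = 0")
    case False
    then have "0 \<in> set vs" using Cons.prems by auto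
    then show ?thesis using Cons.IH by (simp add: wedge_ext_vec)
  qed (simp add: wedge_ext_vec)
qed simp

text \<open>The matrix entry of the action of \<open>A\<close> on the exterior algebra, at the basis
  vectors \<open>e_S\<close> (source) and \<open>e_T\<close> (target).\<close>

definition gl_coeff :: "complex ^ ('d::{finite,linorder}) ^ ('d::{finite,linorder}) \<Rightarrow> 'd set \<Rightarrow> 'd set \<Rightarrow> complex" where
  "gl_coeff A S T = (let s = sorted_list_of_set S; es = map (\<lambda>i. axis i 1) s
     in \<Sum>m<length s. wedge_list (es[m := A *v (es ! m)]) T)"

lemma ext_gl_act_eq: "ext_gl_act A w T = (\<Sum>S\<in>UNIV. w S * gl_coeff A S T)"
  by (simp add: ext_gl_act_def gl_coeff_def)

lemma gl_coeff_card: "gl_coeff A S T \<noteq> 0 \<Longrightarrow> card T = card S"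
proof -
  assume "gl_coeff A S T \<noteq> 0"
  then obtain m where "wedge_list ((map (\<lambda>i. axis i 1) (sorted_list_of_set S))
      [m := A *v (map (\<lambda>i. axis i 1) (sorted_list_of_set S) ! m)]) T \<noteq> 0"
    unfolding gl_coeff_def Let_def by (metis (no_types, lifting) sum.neutral)
  then show ?thesis using wedge_list_card by fastforce
qed

lemma gl_coeff_zero: "gl_coeff 0 S T = 0"
  unfolding gl_coeff_def Let_def
  by (intro sum.neutral ballI wedge_list_zero) (auto simp: set_update_memI)

lemma gl_coeff_empty: "gl_coeff A {} T = 0"
  by (simp add: gl_coeff_def)

lemma gl_coeff_single: "gl_coeff A {j} {i} = A $ i $ j"
proof -
  have "(A *v axis j 1) $ i = A $ i $ j"
  proof -
    have "(\<Sum>k\<in>UNIV. A $ i $ k * axis j 1 $ k) = (\<Sum>k\<in>UNIV. if k = j then A $ i $ k else 0)"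
      by (rule sum.cong) (auto simp: axis_def)
    then show ?thesis by (simp add: matrix_vector_mult_def)
  qed
  then show ?thesis
    by (simp add: gl_coeff_def wedge_ext_vec ext_scalar_def)
qed

text \<open>With a basis of \<open>P\<close> indexed by \<open>L\<close>, the pair
  \<open>(S, l)\<close> stands for the \<open>l\<close>-th basis vector tensored with
  \<open>e_S\<close>; this is the coordinate space of \<open>F_ext P k\<close>.\<close>

definition forms :: "nat set \<Rightarrow> nat \<Rightarrow> ('d set \<times> nat \<Rightarrow> 'd::{finite,linorder} Uh) set" where
  "forms L k = {\<omega>. \<forall>S l. \<omega> (S, l) \<noteq> 0 \<longrightarrow> card S = k \<and> l \<in> L}"

definition koszul :: "('d set \<times> nat \<Rightarrow> 'd Uh) \<Rightarrow> 'd set \<times> nat \<Rightarrow> 'd::{finite,linorder} Uh" where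
  "koszul \<omega> = (\<lambda>(S, l). \<Sum>j\<in>S. hconst (esign j S) * hvar j * \<omega> (S - {j}, l))"

lemma koszul_apply: "koszul \<omega> (S, l) = (\<Sum>j\<in>S. hconst (esign j S) * hvar j * \<omega> (S - {j}, l))"
  by (simp add: koszul_def)

lemma koszul_add: "koszul (\<omega> + \<eta>) = koszul \<omega> + koszul \<eta>"
  by (rule ext) (auto simp: koszul_def plus_fun_apply distrib_left sum.distrib)

lemma koszul_diff: "koszul (\<omega> - \<eta>) = koszul \<omega> - koszul \<eta>"
  by (rule ext) (auto simp: koszul_def right_diff_distrib sum_subtractf)

lemma koszul_scale: "koszul (f \<star> \<omega>) = f \<star> koszul \<omega>"
  by (rule ext) (auto simp: koszul_def fscale_apply sum_distrib_left mult_ac intro!: sum.cong)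

lemma koszul_0 [simp]: "koszul 0 = 0"
  by (rule ext) (auto simp: koszul_def zero_fun_apply)

lemma koszul_forms: "\<omega> \<in> forms L k \<Longrightarrow> koszul \<omega> \<in> forms L (Suc k)"
proof -
  assume \<omega>: "\<omega> \<in> forms L k"
  have "card S = Suc k \<and> l \<in> L" if "koszul \<omega> (S, l) \<noteq> 0" for S l
  proof -
    have "\<exists>j\<in>S. \<omega> (S - {j}, l) \<noteq> 0"
      using that unfolding koszul_apply by (metis (no_types, lifting) mult_zero_right sum.neutral)
    then obtain j where "j \<in> S" "\<omega> (S - {j}, l) \<noteq> 0" by blast
    then have "card (S - {j}) = k" "l \<in> L" using \<omega> by (auto simp: forms_def)
    then show ?thesis using \<open>j \<in> S\<close> by (metis card_Suc_Diff1 finite)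
  qed
  then show ?thesis by (auto simp: forms_def)
qed

text \<open>The terms of the double sum are antisymmetric in the two removed indices, because the
  variables commute while the signs anticommute. After the diagonal is filled with zeros the sum
  equals its own negative.\<close>

lemma koszul_koszul: "koszul (koszul \<omega>) = 0"
proof (rule ext, clarify)
  fix S :: "'a set" and l
  define a where "a j i = hconst (esign j S * esign i (S - {j})) * (hvar j * hvar i) * \<omega> (S - {j} - {i}, l)" for j i
  have anti: "a j i = - a i j" if "i \<in> S" "j \<in> S" "i \<noteq> j" for i j
  proof -
    have neg: "hconst (- c) = - hconst c" for c
      by (metis hconst_def single_uminus)
    have "S - {j} - {i} = S - {i} - {j}" by auto
    then show ?thesis unfolding a_def esign_swap[OF finite that] neg by (simp add: mult_ac)
  qed
  define s where "s = (\<Sum>j\<in>S. \<Sum>i\<in>S. if i = j then 0 else a j i)"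
  have "koszul (koszul \<omega>) (S, l) = (\<Sum>j\<in>S. \<Sum>i\<in>S - {j}. a j i)"
    unfolding koszul_apply a_def by (auto simp: sum_distrib_left hconst_mult mult_ac intro!: sum.cong)
  also have "\<dots> = s" unfolding s_def
    by (rule sum.cong[OF refl], rule sum.mono_neutral_cong_left) auto
  finally have eq: "koszul (koszul \<omega>) (S, l) = s" .
  have "s = (\<Sum>i\<in>S. \<Sum>j\<in>S. if i = j then 0 else a j i)" unfolding s_def by (rule sum.swap)
  also have "\<dots> = (\<Sum>i\<in>S. \<Sum>j\<in>S. - (if j = i then 0 else a i j))"
  proof (intro sum.cong refl)
    show "(if i = j then 0 else a j i) = - (if j = i then 0 else a i j)" if "i \<in> S" "j \<in> S" for i j
      using anti[OF that] by (cases "i = j") simp_all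
  qed
  also have "\<dots> = - s" by (simp add: s_def sum_negf)
  finally have "s = - s" .
  then have "2 * s = 0" by (simp only: mult_2 eq_neg_iff_add_eq_0)
  moreover have "(2 :: 'a Uh) \<noteq> 0" using zero_neq_numeral[of num.One] by (metis zero_neq_numeral)
  ultimately have "s = 0" by simp
  then show "koszul (koszul \<omega>) (S, l) = 0 (S, l)" using eq by (simp add: zero_fun_apply)
qed

text \<open>A closed form is determined by its coefficients at the \<open>e\<^sub>S\<close> with \<open>i \<in> S\<close>.\<close>

lemma koszul_insert:
  assumes "i \<notin> S" "\<And>T. i \<in> T \<Longrightarrow> \<omega> (T, l) = 0"
  shows "koszul \<omega> (insert i S, l) = hconst (esign i (insert i S)) * hvar i * \<omega> (S, l)"
proof -
  have "koszul \<omega> (insert i S, l) = hconst (esign i (insert i S)) * hvar i * \<omega> (insert i S - {i}, l)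
     + (\<Sum>j\<in>insert i S - {i}. hconst (esign j (insert i S)) * hvar j * \<omega> (insert i S - {j}, l))"
    unfolding koszul_apply by (rule sum.remove) auto
  also have "(\<Sum>j\<in>insert i S - {i}. hconst (esign j (insert i S)) * hvar j * \<omega> (insert i S - {j}, l)) = 0"
    by (rule sum.neutral) (auto intro!: assms(2))
  also have "insert i S - {i} = S" using assms(1) by auto
  finally show ?thesis by simp
qed

abbreviation ev0 :: "'d::{finite,linorder} Uh \<Rightarrow> complex" where
  "ev0 \<equiv> heval (\<lambda>_. 0)"

text \<open>As \<open>k < d\<close>, some \<open>i\<close> lies outside \<open>S\<close>. In the
  component of \<open>koszul \<eta>\<close> at \<open>insert i S\<close> put all variables except
  \<open>t_i\<close> to zero: only \<open>t_i\<close> times \<open>\<eta> (S, l)\<close> survives,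
  up to sign. So \<open>\<eta> (S, l)\<close> vanishes on the whole \<open>t_i\<close>-axis, in
  particular at the origin.\<close>

lemma koszul_closed_ev0:
  assumes \<eta>: "\<eta> \<in> forms L k" and k: "k < CARD('d)" and closed: "koszul \<eta> = 0"
  shows "ev0 (\<eta> (S, l) :: 'd::{finite,linorder} Uh) = 0"
proof (cases "\<eta> (S, l) = 0")
  case False
  then have "card S = k" using \<eta> by (simp add: forms_def)
  then obtain i where i: "i \<notin> S" using k by (metis UNIV_eq_I less_irrefl)
  let ?\<pi> = "Uh_hom.peval (\<lambda>j. if j = i then hvar i else 0) :: 'd Uh \<Rightarrow> 'd Uh"
  let ?S = "insert i S"
  have "0 = ?\<pi> (koszul \<eta> (?S, l))" using closed by (simp add: zero_fun_apply)
  also have "\<dots> = (\<Sum>j\<in>?S. hconst (esign j ?S) * ?\<pi> (hvar j) * ?\<pi> (\<eta> (?S - {j}, l)))"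
    by (simp add: koszul_apply Uh_hom.peval_sum Uh_hom.peval_mult)
  also have "\<dots> = (\<Sum>j\<in>{i}. hconst (esign j ?S) * ?\<pi> (hvar j) * ?\<pi> (\<eta> (?S - {j}, l)))"
    by (rule sum.mono_neutral_right) auto
  also have "\<dots> = hconst (esign i ?S) * hvar i * ?\<pi> (\<eta> (S, l))" using i by simp
  finally have z: "?\<pi> (\<eta> (S, l)) = 0" by simp
  have "ev0 (?\<pi> f) = ev0 f" for f
    by (induction f rule: Uh_induct) (auto simp: Uh_hom.peval_add Uh_hom.peval_mult complex_hom.peval_add complex_hom.peval_mult)
  then show ?thesis using z by (metis complex_hom.peval_0)
qed simp

text \<open>If \<open>f(0) = 0\<close>, this displays \<open>f\<close> as an element of
  \<open>I0\<close>. Applied to all components, it shows that a form vanishing at the origin lies in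
  \<open>I0\<close> times the forms.\<close>

lemma ev0_decomposition:
  "\<exists>g. f = hconst (ev0 f) + (\<Sum>j\<in>UNIV. hvar j * g j)"
proof (induction f rule: Uh_induct)
  case (const c)
  show ?case by (rule exI[of _ "\<lambda>_. 0"]) simp
next
  case (var i)
  have "(\<Sum>j\<in>UNIV. hvar j * (if j = i then 1 else 0)) = hvar i" by (simp add: if_distrib cong: if_cong)
  then show ?case by (intro exI[of _ "\<lambda>j. if j = i then 1 else 0"]) simp
next
  case (add f f')
  then obtain g g' where g: "f = hconst (ev0 f) + (\<Sum>j\<in>UNIV. hvar j * g j)"
    "f' = hconst (ev0 f') + (\<Sum>j\<in>UNIV. hvar j * g' j)" by blast
  have "f + f' = (hconst (ev0 f) + (\<Sum>j\<in>UNIV. hvar j * g j)) + (hconst (ev0 f') + (\<Sum>j\<in>UNIV. hvar j * g' j))"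
    by (rule arg_cong2[where f = "(+)", OF g])
  also have "\<dots> = hconst (ev0 (f + f')) + (\<Sum>j\<in>UNIV. hvar j * (g j + g' j))"
    by (simp add: complex_hom.peval_add hconst_add distrib_left sum.distrib add_ac)
  finally have "f + f' = hconst (ev0 (f + f')) + (\<Sum>j\<in>UNIV. hvar j * (g j + g' j))" .
  then show ?case by (intro exI[of _ "\<lambda>j. g j + g' j"])
next
  case (mult f f')
  then obtain g g' where g: "f = hconst (ev0 f) + (\<Sum>j\<in>UNIV. hvar j * g j)"
    "f' = hconst (ev0 f') + (\<Sum>j\<in>UNIV. hvar j * g' j)" by blast
  have 1: "hconst (ev0 f) * f' = hconst (ev0 (f * f')) + (\<Sum>j\<in>UNIV. hvar j * (hconst (ev0 f) * g' j))"
    by (subst g(2)) (simp add: complex_hom.peval_mult hconst_mult distrib_left sum_distrib_left mult.left_commute)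
  have 2: "(\<Sum>j\<in>UNIV. hvar j * g j) * f' = (\<Sum>j\<in>UNIV. hvar j * (g j * f'))"
    by (simp add: sum_distrib_right mult.assoc)
  have "f * f' = (hconst (ev0 f) + (\<Sum>j\<in>UNIV. hvar j * g j)) * f'"
    by (rule arg_cong[where f = "\<lambda>h. h * f'", OF g(1)])
  also have "\<dots> = hconst (ev0 f) * f' + (\<Sum>j\<in>UNIV. hvar j * g j) * f'" by (rule distrib_right)
  also have "\<dots> = hconst (ev0 (f * f')) + (\<Sum>j\<in>UNIV. hvar j * (hconst (ev0 f) * g' j + g j * f'))"
    unfolding 1 2 by (simp only: distrib_left sum.distrib add.assoc)
  finally have "f * f' = hconst (ev0 (f * f')) + (\<Sum>j\<in>UNIV. hvar j * (hconst (ev0 f) * g' j + g j * f'))" .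
  then show ?case by (intro exI[of _ "\<lambda>j. hconst (ev0 f) * g' j + g j * f'"])
qed

section \<open>The complex $\mathcal F(P, \bigwedge^k)$ in coordinates\<close>

lemma ext_power_simps [simp]:
  "carrier (ext_power k) = {w. \<forall>S. w S \<noteq> 0 \<longrightarrow> card S = k}"
  "\<zero>\<^bsub>ext_power k\<^esub> = (\<lambda>_. 0)" "v \<oplus>\<^bsub>ext_power k\<^esub> w = (\<lambda>S. v S + w S)"
  "c \<odot>\<^bsub>ext_power k\<^esub> w = (\<lambda>S. c * w S)" "gl_act (ext_power k) = ext_gl_act"
  by (simp_all add: ext_power_def)

definition ext_unit :: "'d set \<Rightarrow> 'd exterior" where
  "ext_unit S = (\<lambda>T. if T = S then 1 else 0)"

section \<open>Coordinates on \<open>F(P, V)\<close> for exterior powers \<open>V\<close>, from a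
  basis of \<open>P\<close>\<close>

locale free_weyl_module = weyl_module P
  for P :: "('d::{finite,linorder} laurent \<Rightarrow> 'd laurent, 'p) module" +
  fixes L :: "nat set" and \<kappa> :: "'p \<Rightarrow> nat \<Rightarrow> 'd Uh"
  assumes L_finite: "finite L"
    and \<kappa>_bij: "bij_betw \<kappa> (carrier P) {f. \<forall>l. l \<notin> L \<longrightarrow> f l = 0}"
    and \<kappa>_add: "y \<in> carrier P \<Longrightarrow> z \<in> carrier P \<Longrightarrow> \<kappa> (y \<oplus>\<^bsub>P\<^esub> z) = \<kappa> y + \<kappa> z"
    and \<kappa>_ha: "z \<in> carrier P \<Longrightarrow> \<kappa> (ha f z) = f \<star> \<kappa> z"
begin

lemma \<kappa>_inj: "y \<in> carrier P \<Longrightarrow> z \<in> carrier P \<Longrightarrow> \<kappa> y = \<kappa> z \<Longrightarrow> y = z"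
  using \<kappa>_bij by (auto simp: bij_betw_def inj_on_def)

lemma \<kappa>_supp: "z \<in> carrier P \<Longrightarrow> l \<notin> L \<Longrightarrow> \<kappa> z l = 0"
  using \<kappa>_bij by (auto simp: bij_betw_def)

lemma \<kappa>_zero: "\<kappa> \<zero>\<^bsub>P\<^esub> = 0"
  using \<kappa>_ha[of "\<zero>\<^bsub>P\<^esub>" 0] by (simp add: ha_zero)

definition lift :: "(nat \<Rightarrow> 'd Uh) \<Rightarrow> 'p" where
  "lift = inv_into (carrier P) \<kappa>"

lemma lift_closed: "(\<And>l. l \<notin> L \<Longrightarrow> f l = 0) \<Longrightarrow> lift f \<in> carrier P"
  and \<kappa>_lift: "(\<And>l. l \<notin> L \<Longrightarrow> f l = 0) \<Longrightarrow> \<kappa> (lift f) = f"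
proof -
  assume "\<And>l. l \<notin> L \<Longrightarrow> f l = 0"
  then have "f \<in> \<kappa> ` carrier P" using \<kappa>_bij by (auto simp: bij_betw_def)
  then show "lift f \<in> carrier P" "\<kappa> (lift f) = f"
    unfolding lift_def by (auto intro: inv_into_into f_inv_into_f)
qed

lemma lift_\<kappa>: "z \<in> carrier P \<Longrightarrow> lift (\<kappa> z) = z"
  by (rule \<kappa>_inj) (auto intro!: lift_closed simp: \<kappa>_supp \<kappa>_lift)

lemma coord_module_Q: "coord_module Q \<kappa>"
proof
  show "inj_on \<kappa> (carrier Q)" using \<kappa>_bij by (simp add: bij_betw_def)
qed (simp_all add: \<kappa>_zero \<kappa>_add \<kappa>_ha Q_smult ha_closed)

lemma has_rank_Q: "has_rank Q (card L)"
proof (rule has_rank_coords[OF coord_module_Q L_finite])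
  show "\<kappa> x l = 0" if "x \<in> carrier Q" "l \<notin> L" for x l using that \<kappa>_supp by simp
  fix l assume "l \<in> L"
  then have "lift (\<lambda>k. if k = l then 1 else 0) \<in> carrier P"
    "\<kappa> (lift (\<lambda>k. if k = l then 1 else 0)) = (\<lambda>k. if k = l then 1 else 0)"
    by (auto intro!: lift_closed \<kappa>_lift)
  then show "\<exists>x\<in>carrier Q. \<exists>c. c \<noteq> 0 \<and> \<kappa> x = (\<lambda>k. if k = l then c else 0)"
    by (metis Uh_module_fields(1) W_fields(1) zero_neq_one)
qed

text \<open>Meant for \<open>T = x^r\<close> and its products with polynomials in the
  \<open>\<partial>_j\<close>. These operators are not linear over \<open>U(h)\<close>, so in
  coordinates additivity is the property that remains.\<close>

lemma \<kappa>_additive_lift_diff: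
  assumes T: "\<And>z. z \<in> carrier P \<Longrightarrow> T z \<in> carrier P"
    "\<And>y z. y \<in> carrier P \<Longrightarrow> z \<in> carrier P \<Longrightarrow> T (y \<oplus>\<^bsub>P\<^esub> z) = T y \<oplus>\<^bsub>P\<^esub> T z"
    and f: "\<And>l. l \<notin> L \<Longrightarrow> f l = 0" and g: "\<And>l. l \<notin> L \<Longrightarrow> g l = 0"
  shows "\<kappa> (T (lift (\<lambda>l. f l - g l))) l = \<kappa> (T (lift f)) l - \<kappa> (T (lift g)) l"
proof -
  have fg: "\<And>l. l \<notin> L \<Longrightarrow> f l - g l = 0" using f g by simp
  have "\<kappa> (lift (\<lambda>l. f l - g l) \<oplus>\<^bsub>P\<^esub> lift g) = \<kappa> (lift f)"
    using lift_closed[of "\<lambda>l. f l - g l", OF fg] lift_closed[of g, OF g]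
    by (simp add: \<kappa>_add \<kappa>_lift f g fun_eq_iff plus_fun_apply)
  then have "lift (\<lambda>l. f l - g l) \<oplus>\<^bsub>P\<^esub> lift g = lift f"
    using lift_closed[of "\<lambda>l. f l - g l", OF fg] lift_closed[of g, OF g] lift_closed[of f, OF f]
    by (intro \<kappa>_inj) auto
  then have "T (lift f) = T (lift (\<lambda>l. f l - g l)) \<oplus>\<^bsub>P\<^esub> T (lift g)"
    using T(2)[OF lift_closed[of "\<lambda>l. f l - g l", OF fg] lift_closed[of g, OF g]] by simp
  then show ?thesis
    using lift_closed[of "\<lambda>l. f l - g l", OF fg] lift_closed[of g, OF g] T(1)
    by (simp add: \<kappa>_add plus_fun_apply)
qed

definition ext_coord :: "'p \<times> 'd exterior \<Rightarrow> 'd set \<times> nat \<Rightarrow> 'd Uh" where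
  "ext_coord = (\<lambda>(z, w) (S, l). hconst (w S) * \<kappa> z l)"

lemma ext_coord_apply [simp]: "ext_coord (z, w) (S, l) = hconst (w S) * \<kappa> z l"
  by (simp add: ext_coord_def)

lemma tensor_ctx_ext: "tensor_ctx type_ring W (ext_power k :: ('d, 'd exterior) gl_module)"
proof unfold_locales
  fix v w :: "'d exterior"
  assume "v \<in> carrier (ext_power k)" "w \<in> carrier (ext_power k)"
  then show "v \<oplus>\<^bsub>ext_power k\<^esub> w \<in> carrier (ext_power k)" by simp (metis add_0)
qed (auto simp: ha_closed)

lemma tensor_bilinear_ext: "tensor_bilinear type_ring W (ext_power k) ext_coord"
proof (intro tensor_bilinear.intro tensor_ctx_ext tensor_bilinear_axioms.intro)
qed (auto simp: fun_eq_iff plus_fun_apply \<kappa>_add \<kappa>_ha hconst_add hconst_mult fscale_apply algebra_simps)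

text \<open>Expanding the second factor in the \<open>e_S\<close> and moving scalars to the left
  brings every element to a sum of terms \<open>\<zeta> S \<otimes> e_S\<close>. Its coordinate at
  \<open>(S, l)\<close> is the \<open>l\<close>-th coordinate of \<open>\<zeta> S\<close>, so
  vanishing coordinates force every \<open>\<zeta> S\<close> to be zero.\<close>

lemma tensor_coords_ext: "tensor_coords type_ring W (ext_power k) ext_coord"
proof -
  interpret T: tensor_bilinear type_ring W "ext_power k" ext_coord by (rule tensor_bilinear_ext)
  let ?E = "{S :: 'd set. card S = k}"
  have unit: "ext_unit S \<in> carrier (ext_power k)" if "S \<in> ?E" for S
    using that by (auto simp: ext_unit_def)
  have rel_l0: "frag_of (\<zero>\<^bsub>P\<^esub>, w) \<in> T.rel" if w: "w \<in> carrier (ext_power k)" for w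
    using T.rel_uminus[OF T.rel_left[of "\<zero>\<^bsub>P\<^esub>" "\<zero>\<^bsub>P\<^esub>" w]] w by simp
  have rel_r0: "frag_of (z, \<lambda>_. 0) \<in> T.rel" if z: "z \<in> carrier P" for z
    using T.rel_uminus[OF T.rel_right[of z "\<lambda>_. 0" "\<lambda>_. 0"]] z by simp
  have expand: "frag_of (z, \<lambda>T. if T \<in> X then w T else 0) - (\<Sum>S\<in>X. frag_of (ha (hconst (w S)) z, ext_unit S)) \<in> T.rel"
    if z: "z \<in> carrier P" and X: "finite X" "X \<subseteq> ?E" for z w X
    using X
  proof (induction X)
    case empty then show ?case using rel_r0[OF z] by simp
  next
    case (insert S X)
    let ?v = "\<lambda>T. if T \<in> X then w T else 0" and ?u = "\<lambda>T. w S * ext_unit S T"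
    have v: "?v \<in> carrier (ext_power k)" "?u \<in> carrier (ext_power k)"
      using insert.prems by (auto simp: ext_unit_def)
    have sum: "(\<lambda>T. if T \<in> insert S X then w T else 0) = (\<lambda>T. ?v T + ?u T)"
      using insert.hyps by (auto simp: ext_unit_def)
    have 1: "frag_of (z, \<lambda>T. ?v T + ?u T) - frag_of (z, ?v) - frag_of (z, ?u) \<in> T.rel"
      using T.rel_right[of z ?v ?u] v z by simp
    have 2: "frag_of (ha (hconst (w S)) z, ext_unit S) - frag_of (z, ?u) \<in> T.rel"
      using T.rel_smult[of "w S" z "ext_unit S"] unit[of S] insert.prems z by simp
    have 3: "frag_of (z, ?v) - (\<Sum>S\<in>X. frag_of (ha (hconst (w S)) z, ext_unit S)) \<in> T.rel"
      using insert by simp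
    have "(frag_of (z, \<lambda>T. ?v T + ?u T) - frag_of (z, ?v) - frag_of (z, ?u))
      - (frag_of (ha (hconst (w S)) z, ext_unit S) - frag_of (z, ?u))
      + (frag_of (z, ?v) - (\<Sum>S\<in>X. frag_of (ha (hconst (w S)) z, ext_unit S))) \<in> T.rel"
      by (intro T.rel_add T.rel_diff 1 2 3)
    then show ?case unfolding sum using insert.hyps by (simp add: algebra_simps)
  qed
  have normal_form: "\<exists>\<zeta>. (\<forall>S. \<zeta> S \<in> carrier P) \<and> c - (\<Sum>S\<in>?E. frag_of (\<zeta> S, ext_unit S)) \<in> T.rel"
    if "Poly_Mapping.keys c \<subseteq> carrier P \<times> carrier (ext_power k)" for c
    using that
  proof (induction c rule: frag_induction)
    case zero
    have "(\<Sum>S\<in>?E. frag_of (\<zero>\<^bsub>P\<^esub>, ext_unit S)) \<in> T.rel"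
      by (rule T.rel_sum) (use rel_l0 unit in blast)
    then show ?case using T.rel_uminus by (intro exI[of _ "\<lambda>_. \<zero>\<^bsub>P\<^esub>"]) simp
  next
    case (one p)
    obtain z w where p: "p = (z, w)" "z \<in> carrier P" "w \<in> carrier (ext_power k)" using one by (cases p) auto
    have "(\<lambda>T. if T \<in> ?E then w T else 0) = w" using p(3) by (auto simp: fun_eq_iff)
    then show ?case using expand[OF p(2), of ?E w] p(2) unfolding p(1)
      by (intro exI[of _ "\<lambda>S. ha (hconst (w S)) z"]) (simp add: ha_closed)
  next
    case (diff c d)
    then obtain \<zeta> \<xi> where 1: "\<And>S. \<zeta> S \<in> carrier P" "c - (\<Sum>S\<in>?E. frag_of (\<zeta> S, ext_unit S)) \<in> T.rel"
      and 2: "\<And>S. \<xi> S \<in> carrier P" "d - (\<Sum>S\<in>?E. frag_of (\<xi> S, ext_unit S)) \<in> T.rel" by blast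
    have "frag_of (\<zeta> S, ext_unit S) - frag_of (\<zeta> S \<ominus>\<^bsub>P\<^esub> \<xi> S, ext_unit S) - frag_of (\<xi> S, ext_unit S) \<in> T.rel"
      if "S \<in> ?E" for S
    proof -
      have "(\<zeta> S \<ominus>\<^bsub>P\<^esub> \<xi> S) \<oplus>\<^bsub>P\<^esub> \<xi> S = \<zeta> S" using 1(1) 2(1) by (simp add: a_minus_def a_assoc l_neg)
      then show ?thesis using T.rel_left[of "\<zeta> S \<ominus>\<^bsub>P\<^esub> \<xi> S" "\<xi> S" "ext_unit S"] 1(1) 2(1) unit[OF that] by simp
    qed
    then have 3: "(\<Sum>S\<in>?E. frag_of (\<zeta> S, ext_unit S) - frag_of (\<zeta> S \<ominus>\<^bsub>P\<^esub> \<xi> S, ext_unit S) - frag_of (\<xi> S, ext_unit S)) \<in> T.rel"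
      by (rule T.rel_sum)
    have "(c - (\<Sum>S\<in>?E. frag_of (\<zeta> S, ext_unit S))) - (d - (\<Sum>S\<in>?E. frag_of (\<xi> S, ext_unit S)))
      + (\<Sum>S\<in>?E. frag_of (\<zeta> S, ext_unit S) - frag_of (\<zeta> S \<ominus>\<^bsub>P\<^esub> \<xi> S, ext_unit S) - frag_of (\<xi> S, ext_unit S)) \<in> T.rel"
      by (intro T.rel_add T.rel_diff 1(2) 2(2) 3)
    then have "(c - d) - (\<Sum>S\<in>?E. frag_of (\<zeta> S \<ominus>\<^bsub>P\<^esub> \<xi> S, ext_unit S)) \<in> T.rel"
      by (simp add: sum_subtractf sum.distrib algebra_simps)
    then show ?case using 1(1) 2(1) by (intro exI[of _ "\<lambda>S. \<zeta> S \<ominus>\<^bsub>P\<^esub> \<xi> S"]) simp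
  qed
  show ?thesis
  proof
    fix c :: "'p \<times> 'd exterior \<Rightarrow>\<^sub>0 int"
    assume c: "c \<in> carrier T.G" "frag_eval ext_coord c = 0"
    obtain \<zeta> where \<zeta>: "\<And>S. \<zeta> S \<in> carrier P" "c - (\<Sum>S\<in>?E. frag_of (\<zeta> S, ext_unit S)) \<in> T.rel"
      using normal_form[of c] c(1) by auto
    have s0: "(\<Sum>S\<in>?E. ext_coord (\<zeta> S, ext_unit S)) = 0"
      using T.frag_eval_rel[OF \<zeta>(2)] c(2) by (simp add: frag_eval_diff frag_eval_sum del: minus_apply)
    have "\<zeta> S = \<zero>\<^bsub>P\<^esub>" if S: "S \<in> ?E" for S
    proof (rule \<kappa>_inj)
      show "\<kappa> (\<zeta> S) = \<kappa> \<zero>\<^bsub>P\<^esub>"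
      proof
        fix l
        have "0 = (\<Sum>T\<in>?E. ext_coord (\<zeta> T, ext_unit T) (S, l))"
          using fun_cong[OF s0, of "(S, l)"] by (simp add: sum_fun_apply zero_fun_apply)
        also have "\<dots> = (\<Sum>T\<in>?E. if T = S then \<kappa> (\<zeta> S) l else 0)"
          by (rule sum.cong) (auto simp: ext_unit_def)
        also have "\<dots> = \<kappa> (\<zeta> S) l" using S by simp
        finally show "\<kappa> (\<zeta> S) l = \<kappa> \<zero>\<^bsub>P\<^esub> l" by (simp add: \<kappa>_zero zero_fun_apply)
      qed
    qed (use \<zeta>(1) in auto)
    then have "(\<Sum>S\<in>?E. frag_of (\<zeta> S, ext_unit S)) \<in> T.rel"
      by (intro T.rel_sum) (use rel_l0 unit in auto)
    from T.rel_add[OF \<zeta>(2) this] show "c \<in> T.rel" by simp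
  qed
qed

sublocale T: tensor_coords type_ring W "ext_power k" ext_coord for k
  by (rule tensor_coords_ext)

abbreviation "KE \<equiv> T.KT"

lemma carrier_F: "carrier (F_ext P k) = carrier (tensor type_ring W (ext_power k))"
  and zero_F: "\<zero>\<^bsub>F_ext P k\<^esub> = \<zero>\<^bsub>tensor type_ring W (ext_power k)\<^esub>"
  and add_F: "(\<oplus>\<^bsub>F_ext P k\<^esub>) = (\<oplus>\<^bsub>tensor type_ring W (ext_power k)\<^esub>)"
  and smult_F: "c \<odot>\<^bsub>F_ext P k\<^esub> X = tensor_map type_ring W (ext_power k) (\<lambda>(x, y). frag_of (c \<odot>\<^bsub>W\<^esub> x, y)) X"
  and act_F: "act (F_ext P k) u r X = tensor_map type_ring W (ext_power k)
    (\<lambda>(z, y). frag_of (witt_D u r \<odot>\<^bsub>P\<^esub> z, y) + frag_of (lmul (x_pow r) \<odot>\<^bsub>P\<^esub> z, ext_gl_act (outer r u) y)) X"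
  by (simp_all add: F_ext_def F_module_def make_witt_module_def tensor_def lmul_def)

lemma ext_coord_forms: "z \<in> carrier P \<Longrightarrow> w \<in> carrier (ext_power k) \<Longrightarrow> ext_coord (z, w) \<in> forms L k"
  using \<kappa>_supp by (fastforce simp: forms_def)

lemma forms_lift: "\<omega> \<in> forms L k \<Longrightarrow> lift (\<lambda>l. \<omega> (S, l)) \<in> carrier P \<and> \<kappa> (lift (\<lambda>l. \<omega> (S, l))) = (\<lambda>l. \<omega> (S, l))"
  by (intro conjI lift_closed \<kappa>_lift) (auto simp: forms_def)

lemma KE_image: "KE ` carrier (F_ext P k) = forms L k"
  unfolding carrier_F T.KT_image
proof (intro equalityI subsetI)
  fix \<omega> assume "\<omega> \<in> frag_eval ext_coord ` carrier (T.G k)"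
  then obtain c where c: "Poly_Mapping.keys c \<subseteq> carrier P \<times> carrier (ext_power k)" "\<omega> = frag_eval ext_coord c" by auto
  have "\<omega> (S, l) = 0" if "\<not> (card S = k \<and> l \<in> L)" for S l
    unfolding c(2) frag_eval_def sum_fun_apply fscale_apply
  proof (intro sum.neutral ballI)
    fix p assume "p \<in> Poly_Mapping.keys c"
    then obtain z w where p: "p = (z, w)" "z \<in> carrier P" "w \<in> carrier (ext_power k)" using c(1) by (cases p) blast
    have "ext_coord p (S, l) = 0" using ext_coord_forms[OF p(2,3)] that unfolding p(1) forms_def by blast
    then show "of_int (Poly_Mapping.lookup c p) * ext_coord p (S, l) = 0" by simp
  qed
  then show "\<omega> \<in> forms L k" unfolding forms_def by blast
next
  fix \<omega> :: "'d set \<times> nat \<Rightarrow> 'd Uh" assume \<omega>: "\<omega> \<in> forms L k"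
  let ?E = "{S :: 'd set. card S = k}"
  define c where "c = (\<Sum>S\<in>?E. frag_of (lift (\<lambda>l. \<omega> (S, l)), ext_unit S))"
  have "c \<in> carrier (T.G k)" unfolding c_def
    by (rule T.carrier_G_sum) (use forms_lift[OF \<omega>] in \<open>auto simp: keys_frag_of ext_unit_def\<close>)
  moreover have "frag_eval ext_coord c = \<omega>"
  proof (rule ext, clarify)
    fix S l
    have "frag_eval ext_coord c (S, l) = (\<Sum>T\<in>?E. if T = S then \<omega> (S, l) else 0)"
      unfolding c_def frag_eval_sum sum_fun_apply frag_eval_of
      by (rule sum.cong) (use forms_lift[OF \<omega>] in \<open>auto simp: ext_unit_def\<close>)
    also have "\<dots> = \<omega> (S, l)" using \<omega> by (auto simp: forms_def)
    finally show "frag_eval ext_coord c (S, l) = \<omega> (S, l)" .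
  qed
  ultimately show "\<omega> \<in> frag_eval ext_coord ` carrier (T.G k)" by (metis image_eqI)
qed

text \<open>Reduces every operator on \<open>F_ext P k\<close> that is given on pure tensors to a
  coordinate formula \<open>\<Delta>\<close>, checked on pure tensors only.\<close>

lemma KE_tensor_map:
  assumes X: "X \<in> carrier (F_ext P k)"
    and b: "\<And>z w. z \<in> carrier P \<Longrightarrow> w \<in> carrier (ext_power k) \<Longrightarrow> b (z, w) \<in> carrier (T.G k')"
      "\<And>z w. z \<in> carrier P \<Longrightarrow> w \<in> carrier (ext_power k) \<Longrightarrow> frag_eval ext_coord (b (z, w)) = \<Delta> (ext_coord (z, w))"
    and \<Delta>: "\<And>\<omega> \<eta>. \<omega> \<in> forms L k \<Longrightarrow> \<eta> \<in> forms L k \<Longrightarrow> \<Delta> (\<omega> - \<eta>) = \<Delta> \<omega> - \<Delta> \<eta>"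
  shows "tensor_map type_ring W (ext_power k') b X \<in> carrier (F_ext P k')"
    "KE (tensor_map type_ring W (ext_power k') b X) = \<Delta> (KE X)"
proof -
  obtain c0 where c0: "c0 \<in> carrier (T.G k)" "X = T.cls k c0" using X unfolding carrier_F T.carrier_tensor by blast
  \<comment> \<open>The representative that \<open>tensor_map\<close> picks is the very one in the
    definition of \<open>KT\<close>, so two representatives never have to be compared.\<close>
  let ?c = "SOME c. c \<in> X"
  have c: "?c \<in> carrier (T.G k)" using T.some_in_cls(1)[OF c0(1)] c0(2) by simp
  have forms: "frag_eval ext_coord d \<in> forms L k" if "Poly_Mapping.keys d \<subseteq> carrier W \<times> carrier (ext_power k)" for d
  proof -
    have "d \<in> carrier (T.G k)" using that by simp
    then show ?thesis using KE_image[of k] unfolding carrier_F T.KT_image by blast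
  qed
  have "0 \<in> forms L k" by (simp add: forms_def zero_fun_apply)
  then have \<Delta>0: "\<Delta> 0 = 0" using \<Delta>[of 0 0] by simp
  have *: "frag_extend b ?c \<in> carrier (T.G k')" "frag_eval ext_coord (frag_extend b ?c) = \<Delta> (frag_eval ext_coord ?c)"
  proof -
    have kc: "Poly_Mapping.keys ?c \<subseteq> carrier W \<times> carrier (ext_power k)" using c by simp
    have b': "b y \<in> carrier (T.G k')" "frag_eval ext_coord (b y) = \<Delta> (ext_coord y)"
      if "y \<in> carrier W \<times> carrier (ext_power k)" for y
    proof -
      have "y \<in> carrier P \<times> carrier (ext_power k)" using that by (simp only: W_fields)
      then obtain z w where "z \<in> carrier P" "w \<in> carrier (ext_power k)" "y = (z, w)" by (rule SigmaE)
      then show "b y \<in> carrier (T.G k')" "frag_eval ext_coord (b y) = \<Delta> (ext_coord y)" using b by blast+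
    qed
    note r = T.KT_tensor_map[OF kc b' \<Delta>0 \<Delta>[OF forms forms]]
    show "frag_extend b ?c \<in> carrier (T.G k')" by (rule r(1))
    show "frag_eval ext_coord (frag_extend b ?c) = \<Delta> (frag_eval ext_coord ?c)" by (rule r(2))
  qed
  show "tensor_map type_ring W (ext_power k') b X \<in> carrier (F_ext P k')"
    unfolding tensor_map_def carrier_F T.carrier_tensor using *(1) by blast
  show "KE (tensor_map type_ring W (ext_power k') b X) = \<Delta> (KE X)"
    unfolding tensor_map_def T.KT_cls[OF *(1)] *(2) by (simp add: T.KT_def)
qed

end

text \<open>The polynomials whose multiplication preserves the image of \<open>K\<close> are closed
  under sums and products, so constants and variables suffice. Multiplication transported back along
  \<open>K\<close> is then a ring action, and \<open>Uh_module_smult\<close> identifies it with the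
  action of \<open>Uh_module M\<close>.\<close>

lemma coord_module_Uh:
  fixes M :: "('d::{finite,linorder}, 'm) witt_module" and K :: "'m \<Rightarrow> 'i \<Rightarrow> 'd Uh"
  assumes inj: "inj_on K (carrier M)" and zero: "\<zero>\<^bsub>M\<^esub> \<in> carrier M" "K \<zero>\<^bsub>M\<^esub> = 0"
    and add: "\<And>x y. x \<in> carrier M \<Longrightarrow> y \<in> carrier M \<Longrightarrow> x \<oplus>\<^bsub>M\<^esub> y \<in> carrier M \<and> K (x \<oplus>\<^bsub>M\<^esub> y) = K x + K y"
    and smult: "\<And>c x. x \<in> carrier M \<Longrightarrow> c \<odot>\<^bsub>M\<^esub> x \<in> carrier M \<and> K (c \<odot>\<^bsub>M\<^esub> x) = hconst c \<star> K x"
    and act: "\<And>i x. x \<in> carrier M \<Longrightarrow> act M (axis i 1) 0 x \<in> carrier M \<and> K (act M (axis i 1) 0 x) = hvar i \<star> K x"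
  shows "abelian_group M" "coord_module (Uh_module M) K"
    "\<And>c x. x \<in> carrier M \<Longrightarrow> c \<odot>\<^bsub>M\<^esub> x = hconst c \<odot>\<^bsub>Uh_module M\<^esub> x"
proof -
  have K_eq: "x = y" if "x \<in> carrier M" "y \<in> carrier M" "K x = K y" for x y
    using inj that by (auto simp: inj_on_def)
  show ab: "abelian_group M"
  proof (rule abelian_groupI)
    fix x assume x: "x \<in> carrier M"
    have "(- 1) \<odot>\<^bsub>M\<^esub> x \<oplus>\<^bsub>M\<^esub> x = \<zero>\<^bsub>M\<^esub>"
    proof (rule K_eq)
      have "hconst (- 1) = (- 1 :: 'd Uh)" using hconst_of_int[of "- 1"] by simp
      then show "K ((- 1) \<odot>\<^bsub>M\<^esub> x \<oplus>\<^bsub>M\<^esub> x) = K \<zero>\<^bsub>M\<^esub>" using x smult add zero by simp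
    qed (use x smult add zero in auto)
    then show "\<exists>y\<in>carrier M. y \<oplus>\<^bsub>M\<^esub> x = \<zero>\<^bsub>M\<^esub>" using x smult by blast
  qed (auto intro!: K_eq simp: zero add add_ac)
  define \<rho> where "\<rho> f x = inv_into (carrier M) K (f \<star> K x)" for f x
  have closed: "\<exists>y\<in>carrier M. K y = f \<star> K x" if "x \<in> carrier M" for f x
    using that
  proof (induction f arbitrary: x rule: Uh_induct)
    case (const c) then show ?case using smult by blast
  next
    case (var i) then show ?case using act by blast
  next
    case (add f g)
    then obtain y z where "y \<in> carrier M" "K y = f \<star> K x" "z \<in> carrier M" "K z = g \<star> K x" by metis
    then show ?case using assms(4)[of y z] by (intro bexI[of _ "y \<oplus>\<^bsub>M\<^esub> z"]) auto
  next
    case (mult f g)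
    then obtain y where y: "y \<in> carrier M" "K y = g \<star> K x" by metis
    then obtain z where "z \<in> carrier M" "K z = f \<star> K y" using mult(1) by metis
    then show ?case using y by (intro bexI[of _ z]) auto
  qed
  have \<rho>: "\<rho> f x \<in> carrier M" "K (\<rho> f x) = f \<star> K x" if "x \<in> carrier M" for f x
  proof -
    have "f \<star> K x \<in> K ` carrier M" using closed[OF that, of f] by (metis image_eqI)
    then show "\<rho> f x \<in> carrier M" "K (\<rho> f x) = f \<star> K x" unfolding \<rho>_def by (rule inv_into_into, rule f_inv_into_f)
  qed
  have sm: "f \<odot>\<^bsub>Uh_module M\<^esub> x = \<rho> f x" if "x \<in> carrier M" for f x
  proof (rule Uh_module_smult[OF ab _ _ _ _ _ _ that])
    show "\<rho> (f + g) z = \<rho> f z \<oplus>\<^bsub>M\<^esub> \<rho> g z" if "z \<in> carrier M" for f g z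
      by (rule K_eq) (use that in \<open>simp_all add: \<rho> add\<close>)
    show "\<rho> (f * g) z = \<rho> f (\<rho> g z)" if "z \<in> carrier M" for f g z
      by (rule K_eq) (use that in \<open>simp_all add: \<rho>\<close>)
    show "\<rho> (hconst c) z = c \<odot>\<^bsub>M\<^esub> z" if "z \<in> carrier M" for c z
      by (rule K_eq) (use that in \<open>simp_all add: \<rho> smult\<close>)
    show "\<rho> 1 z = z" if "z \<in> carrier M" for z
      by (rule K_eq) (use that in \<open>simp_all add: \<rho>\<close>)
    show "\<rho> (hvar i) z = act M (axis i 1) 0 z" if "z \<in> carrier M" for i z
      by (rule K_eq) (use that in \<open>simp_all add: \<rho> act\<close>)
  qed (simp add: \<rho>)
  show "coord_module (Uh_module M) K"
    by unfold_locales (use inj zero add \<rho> sm in auto)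
  show "c \<odot>\<^bsub>M\<^esub> x = hconst c \<odot>\<^bsub>Uh_module M\<^esub> x" if "x \<in> carrier M" for c x
    by (rule K_eq) (use that in \<open>simp_all add: \<rho> sm smult\<close>)
qed

lemma I0_ev0:
  assumes "f \<in> (I0 :: 'd::{finite,linorder} Uh set)"
  shows "ev0 f = 0"
proof -
  interpret cring "type_ring :: 'd Uh ring" by (rule cring_type_ring)
  have inv: "\<exists>y. y + x = 0" for x :: "'d Uh" by (metis left_minus)
  have neg: "\<ominus>\<^bsub>type_ring\<^esub> x = - x" for x :: "'d Uh"
    by (rule minus_equality) auto
  have "ideal {f. ev0 f = 0} (type_ring :: 'd Uh ring)"
  proof (rule idealI)
    show "ring (type_ring :: 'd Uh ring)" by (rule ring_axioms)
    show "subgroup {f. ev0 f = 0} (add_monoid (type_ring :: 'd Uh ring))"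
    proof (rule group.subgroupI[OF a_group])
      show "{f :: 'd Uh. ev0 f = 0} \<noteq> {}" by (auto intro: exI[of _ 0])
      show "inv\<^bsub>add_monoid type_ring\<^esub> a \<in> {f. ev0 f = 0}" if "a \<in> {f. ev0 f = 0}" for a :: "'d Uh"
        using that neg[of a] by (simp add: a_inv_def complex_hom.peval_uminus)
    qed (auto simp: complex_hom.peval_add)
  qed (auto simp: complex_hom.peval_mult)
  moreover have "range (\<lambda>i. Poly_Mapping.single (Poly_Mapping.single i 1) 1) \<subseteq> {f :: 'd Uh. ev0 f = 0}"
    using complex_hom.peval_hvar[of "\<lambda>_. 0"] unfolding hvar_def by auto
  ultimately have "I0 \<subseteq> {f :: 'd Uh. ev0 f = 0}" unfolding I0_def by (rule genideal_minimal)
  then show ?thesis using assms by blast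
qed

lemma hvar_I0: "hvar i \<in> (I0 :: 'd::{finite,linorder} Uh set)"
proof -
  interpret cring "type_ring :: 'd Uh ring" by (rule cring_type_ring)
  show ?thesis unfolding I0_def
    using genideal_self[of "range (\<lambda>i. Poly_Mapping.single (Poly_Mapping.single i 1) 1)"]
    by (auto simp: hvar_def)
qed

text \<open>\<open>\<xi>\<close> has kernel exactly \<open>I0 M\<close>: elements of
  \<open>I0\<close> vanish at the origin, which gives one inclusion, and \<open>ker\<close> gives
  the other. So \<open>\<xi>\<close> induces an isomorphism from the quotient onto the functions
  supported on \<open>I\<close>.\<close>

lemma has_dim_quotient_coords:
  fixes M :: "('d::{finite,linorder}, 'm) witt_module" and K :: "'m \<Rightarrow> 'j \<Rightarrow> 'd Uh"
    and \<xi> :: "'m \<Rightarrow> 'i \<Rightarrow> complex"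
  assumes M: "abelian_group M" and K: "coord_module (Uh_module M) K"
    and smult: "\<And>c x. x \<in> carrier M \<Longrightarrow> c \<odot>\<^bsub>M\<^esub> x = hconst c \<odot>\<^bsub>Uh_module M\<^esub> x"
    and \<xi>_add: "\<And>x y. x \<in> carrier M \<Longrightarrow> y \<in> carrier M \<Longrightarrow> \<xi> (x \<oplus>\<^bsub>M\<^esub> y) = \<xi> x + \<xi> y"
    and \<xi>_smult: "\<And>f x. x \<in> carrier M \<Longrightarrow> \<xi> (f \<odot>\<^bsub>Uh_module M\<^esub> x) = ev0 f \<star> \<xi> x"
    and I: "finite I" and supp: "\<And>x i. x \<in> carrier M \<Longrightarrow> i \<notin> I \<Longrightarrow> \<xi> x i = 0"
    and unit: "\<And>i. i \<in> I \<Longrightarrow> \<exists>x\<in>carrier M. \<xi> x = (\<lambda>k. if k = i then 1 else 0)"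
    and ker: "\<And>x. x \<in> carrier M \<Longrightarrow> \<xi> x = 0 \<Longrightarrow> \<exists>y. (\<forall>j. y j \<in> carrier M) \<and> K x = (\<Sum>j\<in>UNIV. hvar j \<star> K (y j))"
  shows "has_dim type_ring (quotient_module M (ideal_times I0 (Uh_module M))) (card I)"
proof -
  let ?U = "Uh_module M"
  interpret abelian_group M by (rule M)
  interpret K: coord_module ?U K by (rule K)
  define N where "N = ideal_times I0 ?U"
  have \<xi>_0: "\<xi> \<zero>\<^bsub>M\<^esub> = 0" using \<xi>_add[of "\<zero>\<^bsub>M\<^esub>" "\<zero>\<^bsub>M\<^esub>"] by simp
  have \<xi>_inv: "\<xi> (\<ominus>\<^bsub>M\<^esub> x) = - \<xi> x" if x: "x \<in> carrier M" for x
    using \<xi>_add[of "\<ominus>\<^bsub>M\<^esub> x" x] x by (simp add: l_neg \<xi>_0 eq_neg_iff_add_eq_0)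
  have sm_closed: "f \<odot>\<^bsub>?U\<^esub> x \<in> carrier M" if "x \<in> carrier M" for f x
    using K.smult_closed[of x f] that by simp
  interpret U: abelian_group ?U by (rule K.abelian_group)
  have \<xi>_invU: "\<xi> (\<ominus>\<^bsub>?U\<^esub> x) = - \<xi> x" if x: "x \<in> carrier M" for x
    using \<xi>_add[of "\<ominus>\<^bsub>?U\<^esub> x" x] U.l_neg[of x] U.a_inv_closed[of x] x by (simp add: \<xi>_0 eq_neg_iff_add_eq_0)
  have N_def': "N = generate (add_monoid ?U) {a \<odot>\<^bsub>?U\<^esub> x | a x. a \<in> I0 \<and> x \<in> carrier M}"
    unfolding N_def ideal_times_def by simp
  have N: "N = {x \<in> carrier M. \<xi> x = 0}"
  proof (intro equalityI subsetI)
    fix x assume "x \<in> N"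
    then show "x \<in> {x \<in> carrier M. \<xi> x = 0}" unfolding N_def'
    proof (induction rule: generate.induct)
      case one then show ?case by (simp add: \<xi>_0)
    next
      case (incl h) then show ?case using I0_ev0 by (auto simp: \<xi>_smult sm_closed)
    next
      case (inv h)
      then have "h \<in> carrier M" "\<xi> h = 0" using I0_ev0 by (auto simp: \<xi>_smult sm_closed)
      then show ?case unfolding a_inv_def[symmetric] using \<xi>_invU[of h] U.a_inv_closed[of h] by simp
    next
      case (eng g h) then show ?case by (auto simp: \<xi>_add)
    qed
  next
    fix x assume x: "x \<in> {x \<in> carrier M. \<xi> x = 0}"
    then obtain y where y: "\<And>j. y j \<in> carrier M" "K x = (\<Sum>j\<in>UNIV. hvar j \<star> K (y j))" using ker by blast
    have "\<exists>z\<in>N. z \<in> carrier M \<and> K z = (\<Sum>j\<in>J. hvar j \<star> K (y j))" if "finite J" for J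
      using that
    proof (induction J)
      case empty
      have "\<zero>\<^bsub>M\<^esub> \<in> N" unfolding N_def' using generate.one[of "add_monoid ?U"] by simp
      then show ?case using K.K_zero by (intro bexI[of _ "\<zero>\<^bsub>M\<^esub>"]) auto
    next
      case (insert j J)
      then obtain z where z: "z \<in> N" "z \<in> carrier M" "K z = (\<Sum>j\<in>J. hvar j \<star> K (y j))" by blast
      have w: "hvar j \<odot>\<^bsub>?U\<^esub> y j \<in> N" unfolding N_def' using y(1) hvar_I0 by (intro generate.incl) blast
      have "hvar j \<odot>\<^bsub>?U\<^esub> y j \<oplus>\<^bsub>M\<^esub> z \<in> N" using generate.eng[OF w[unfolded N_def'] z(1)[unfolded N_def']] by (simp add: N_def')
      moreover have "K (hvar j \<odot>\<^bsub>?U\<^esub> y j \<oplus>\<^bsub>M\<^esub> z) = (\<Sum>j\<in>insert j J. hvar j \<star> K (y j))"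
        using K.K_add[of "hvar j \<odot>\<^bsub>?U\<^esub> y j" z] K.K_smult[of "y j" "hvar j"] y(1) z insert.hyps by (simp add: sm_closed)
      ultimately show ?case using z y(1) by (intro bexI[of _ "hvar j \<odot>\<^bsub>?U\<^esub> y j \<oplus>\<^bsub>M\<^esub> z"]) (auto simp: sm_closed)
    qed
    then obtain z where z: "z \<in> N" "z \<in> carrier M" "K z = K x" using y(2) by (metis finite)
    then have "z = x" using x by (intro K.K_eq) auto
    then show "x \<in> N" using z by simp
  qed
  \<comment> \<open>The fibres of \<open>\<xi>\<close>; they turn out to be the cosets of
    \<open>N\<close>, and the operations on cosets become operations on the values
    \<open>v\<close>.\<close>
  define C where "C v = {y \<in> carrier M. \<xi> y = v}" for v
  have coset: "N +>\<^bsub>M\<^esub> x = C (\<xi> x)" if x: "x \<in> carrier M" for x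
  proof (intro equalityI subsetI)
    fix y assume "y \<in> C (\<xi> x)"
    then have y: "y \<in> carrier M" "\<xi> y = \<xi> x" by (auto simp: C_def)
    then have "y \<ominus>\<^bsub>M\<^esub> x \<in> N" using x by (simp add: N a_minus_def \<xi>_add \<xi>_inv)
    moreover have "y = (y \<ominus>\<^bsub>M\<^esub> x) \<oplus>\<^bsub>M\<^esub> x" using x y by (simp add: a_minus_def a_assoc l_neg)
    ultimately show "y \<in> N +>\<^bsub>M\<^esub> x" unfolding a_r_coset_def' by blast
  qed (auto simp: a_r_coset_def' N C_def \<xi>_add x)
  let ?Q = "quotient_module M N"
  have cQ: "carrier ?Q = (\<lambda>x. C (\<xi> x)) ` carrier M"
    by (auto simp: quotient_module_def A_RCOSETS_def' coset)
  have C_add: "C (\<xi> x) \<oplus>\<^bsub>?Q\<^esub> C (\<xi> y) = C (\<xi> (x \<oplus>\<^bsub>M\<^esub> y))" if x: "x \<in> carrier M" and y: "y \<in> carrier M" for x y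
  proof -
    have "set_add M (C (\<xi> x)) (C (\<xi> y)) = C (\<xi> (x \<oplus>\<^bsub>M\<^esub> y))"
    proof (intro equalityI subsetI)
      fix z assume "z \<in> C (\<xi> (x \<oplus>\<^bsub>M\<^esub> y))"
      then have z: "z \<in> carrier M" "\<xi> z = \<xi> x + \<xi> y" using x y by (auto simp: C_def \<xi>_add)
      then have "z \<ominus>\<^bsub>M\<^esub> y \<in> C (\<xi> x)" using y by (simp add: C_def a_minus_def \<xi>_add \<xi>_inv)
      moreover have "y \<in> C (\<xi> y)" using y by (simp add: C_def)
      moreover have "z = (z \<ominus>\<^bsub>M\<^esub> y) \<oplus>\<^bsub>M\<^esub> y" using z y by (simp add: a_minus_def a_assoc l_neg)
      ultimately show "z \<in> set_add M (C (\<xi> x)) (C (\<xi> y))" unfolding set_add_def' by blast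
    qed (auto simp: set_add_def' C_def \<xi>_add x y)
    then show ?thesis by (simp add: quotient_module_def)
  qed
  have \<xi>_smult': "\<xi> (c \<odot>\<^bsub>M\<^esub> x) = c \<star> \<xi> x" "c \<odot>\<^bsub>M\<^esub> x \<in> carrier M" if "x \<in> carrier M" for c x
    using that by (simp_all add: smult \<xi>_smult sm_closed)
  have C_smult: "c \<odot>\<^bsub>?Q\<^esub> C (\<xi> x) = C (\<xi> (c \<odot>\<^bsub>M\<^esub> x))" if x: "x \<in> carrier M" for c x
  proof -
    have "(\<Union>y\<in>C (\<xi> x). N +>\<^bsub>M\<^esub> (c \<odot>\<^bsub>M\<^esub> y)) = (\<Union>y\<in>C (\<xi> x). C (\<xi> (c \<odot>\<^bsub>M\<^esub> x)))"
      by (rule SUP_cong) (auto simp: C_def coset \<xi>_smult' x)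
    also have "\<dots> = C (\<xi> (c \<odot>\<^bsub>M\<^esub> x))" using x by (auto simp: C_def)
    finally show ?thesis by (simp add: quotient_module_def)
  qed
  define l where "l X = \<xi> (SOME x. x \<in> X)" for X
  have l: "l (C (\<xi> x)) = \<xi> x" if "x \<in> carrier M" for x
  proof -
    have "x \<in> C (\<xi> x)" using that by (simp add: C_def)
    then have "(SOME y. y \<in> C (\<xi> x)) \<in> C (\<xi> x)" by (rule someI)
    then show ?thesis by (simp add: l_def C_def)
  qed
  have zQ: "\<zero>\<^bsub>?Q\<^esub> = C (\<xi> \<zero>\<^bsub>M\<^esub>)" by (simp add: quotient_module_def N C_def \<xi>_0)
  have "coord_module ?Q l"
  proof
    show "inj_on l (carrier ?Q)" unfolding cQ by (rule inj_onI) (auto simp: l)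
    show "\<zero>\<^bsub>?Q\<^esub> \<in> carrier ?Q" "l \<zero>\<^bsub>?Q\<^esub> = 0"
      unfolding zQ cQ using l[OF zero_closed] \<xi>_0 by (blast intro: zero_closed, simp only:)
    show "X \<oplus>\<^bsub>?Q\<^esub> Y \<in> carrier ?Q" "l (X \<oplus>\<^bsub>?Q\<^esub> Y) = l X + l Y" if XY: "X \<in> carrier ?Q" "Y \<in> carrier ?Q" for X Y
    proof -
      obtain x y where x: "x \<in> carrier M" "X = C (\<xi> x)" "y \<in> carrier M" "Y = C (\<xi> y)" using XY unfolding cQ by blast
      show "X \<oplus>\<^bsub>?Q\<^esub> Y \<in> carrier ?Q" unfolding x(2,4) C_add[OF x(1,3)] cQ using x by blast
      show "l (X \<oplus>\<^bsub>?Q\<^esub> Y) = l X + l Y"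
        unfolding x(2,4) C_add[OF x(1,3)] l[OF a_closed[OF x(1,3)]] l[OF x(1)] l[OF x(3)] by (rule \<xi>_add[OF x(1,3)])
    qed
    show "c \<odot>\<^bsub>?Q\<^esub> X \<in> carrier ?Q" "l (c \<odot>\<^bsub>?Q\<^esub> X) = c \<star> l X" if X: "X \<in> carrier ?Q" for c X
    proof -
      obtain x where x: "x \<in> carrier M" "X = C (\<xi> x)" using X unfolding cQ by blast
      show "c \<odot>\<^bsub>?Q\<^esub> X \<in> carrier ?Q" unfolding x(2) C_smult[OF x(1)] cQ using \<xi>_smult'(2)[OF x(1)] by blast
      show "l (c \<odot>\<^bsub>?Q\<^esub> X) = c \<star> l X"
        unfolding x(2) C_smult[OF x(1)] l[OF \<xi>_smult'(2)[OF x(1)]] l[OF x(1)] by (rule \<xi>_smult'(1)[OF x(1)])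
    qed
  qed
  then have "has_dim type_ring ?Q (card I)"
  proof (rule has_dim_coords[OF _ I])
    show "l X i = 0" if "X \<in> carrier ?Q" "i \<notin> I" for X i using that supp unfolding cQ by (auto simp: l)
    show "\<exists>X\<in>carrier ?Q. l X = (\<lambda>k. if k = i then 1 else 0)" if i: "i \<in> I" for i
    proof -
      obtain x where x: "x \<in> carrier M" "\<xi> x = (\<lambda>k. if k = i then 1 else 0)" using unit[OF i] by blast
      have c: "C (\<xi> x) \<in> carrier ?Q" unfolding cQ using x(1) by blast
      have "l (C (\<xi> x)) = (\<lambda>k. if k = i then 1 else 0)" unfolding l[OF x(1)] by (rule x(2))
      then show ?thesis using c by blast
    qed
  qed
  then show ?thesis unfolding N_def .
qed

text \<open>A basis \<open>B\<close> computes the rank as well as the dimension of the fibre at the origin.\<close>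

lemma free_rank_eq_dim:
  fixes M :: "('d::{finite,linorder}, 'm) witt_module" and K :: "'m \<Rightarrow> 'j \<Rightarrow> 'd Uh"
  assumes M: "abelian_group M" and K: "coord_module (Uh_module M) K"
    and smult: "\<And>c x. x \<in> carrier M \<Longrightarrow> c \<odot>\<^bsub>M\<^esub> x = hconst c \<odot>\<^bsub>Uh_module M\<^esub> x"
    and fg: "finitely_generated type_ring (Uh_module M)" and free: "free_module type_ring (Uh_module M)"
    and rank: "has_rank (Uh_module M) n"
    and dim: "has_dim type_ring (quotient_module M (ideal_times I0 (Uh_module M))) n'"
  shows "n = n'"
proof -
  let ?U = "Uh_module M"
  interpret K: coord_module ?U K by (rule K)
  interpret Module.module type_ring ?U by (rule K.module)
  obtain B where B: "B \<subseteq> carrier ?U" "\<not> lin_dep B" "span B = carrier ?U"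
    using free by (auto simp: free_module_def)
  obtain G where G: "finite G" "G \<subseteq> carrier ?U" "span G = carrier ?U"
    using fg by (auto simp: finitely_generated_def)
  \<comment> \<open>\<open>free_module\<close> allows an infinite basis. The finitely many
    generators involve only a finite part of it, which already spans.\<close>
  have "\<exists>A. finite A \<and> A \<subseteq> B \<and> g \<in> span A" if "g \<in> G" for g
  proof -
    have "g \<in> span B" using that G B by auto
    then obtain a A where "finite A" "A \<subseteq> B" "g = lincomb a A" unfolding span_def by auto
    then show ?thesis unfolding span_def by (intro exI[of _ A]) auto
  qed
  then obtain A where A: "\<And>g. g \<in> G \<Longrightarrow> finite (A g) \<and> A g \<subseteq> B \<and> g \<in> span (A g)" by metis
  define B' where "B' = (\<Union>g\<in>G. A g)"
  have B': "finite B'" "B' \<subseteq> B" using A G(1) by (auto simp: B'_def)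
  have B'c: "B' \<subseteq> carrier ?U" using B' B by auto
  have "G \<subseteq> span B'"
  proof
    fix g assume g: "g \<in> G"
    have "span (A g) \<subseteq> span B'" by (rule span_is_monotone) (use g in \<open>auto simp: B'_def\<close>)
    then show "g \<in> span B'" using A[OF g] by blast
  qed
  then have "span G \<subseteq> span B'" by (rule span_is_subset[OF _ span_is_submodule[OF B'c]])
  then have sp: "span B' = carrier ?U" using G(3) span_is_subset2[OF B'c] by auto
  have li: "\<not> lin_dep B'" using B' B(2) unfolding lin_dep_def by blast
  obtain \<phi> where \<phi>: "coord_module ?U \<phi>" "\<And>x v. v \<notin> B' \<Longrightarrow> \<phi> x v = 0"
    "\<And>v. v \<in> B' \<Longrightarrow> \<phi> v = (\<lambda>w. if w = v then 1 else 0)"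
    by (rule coords_of_basis[OF K.module B'(1) B'c li, of 1]) (use sp smult_one in auto)
  interpret \<phi>: coord_module ?U \<phi> by (rule \<phi>(1))
  have unit: "\<exists>x\<in>carrier M. \<phi> x = (\<lambda>k. if k = v then 1 else 0)" if "v \<in> B'" for v
    using \<phi>(3)[OF that] that B'c by auto
  have "has_rank ?U (card B')"
  proof (rule has_rank_coords[OF \<phi>(1) B'(1)])
    show "\<exists>x\<in>carrier ?U. \<exists>c. c \<noteq> 0 \<and> \<phi> x = (\<lambda>k. if k = v then c else 0)" if "v \<in> B'" for v
      using unit[OF that] by (metis Uh_module_fields(1) zero_neq_one)
  qed (rule \<phi>(2))
  then have n: "n = card B'" using rank has_dim_unique unfolding has_rank_def by blast
  define \<xi> where "\<xi> x = (\<lambda>v. ev0 (\<phi> x v))" for x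
  have "has_dim type_ring (quotient_module M (ideal_times I0 ?U)) (card B')"
  proof (rule has_dim_quotient_coords[OF M \<phi>(1) smult])
    show "\<xi> (x \<oplus>\<^bsub>M\<^esub> y) = \<xi> x + \<xi> y" if "x \<in> carrier M" "y \<in> carrier M" for x y
      using \<phi>.K_add[of x y] that by (auto simp: \<xi>_def plus_fun_apply complex_hom.peval_add)
    show "\<xi> (f \<odot>\<^bsub>?U\<^esub> x) = ev0 f \<star> \<xi> x" if "x \<in> carrier M" for f x
      using \<phi>.K_smult[of x f] that by (auto simp: \<xi>_def fscale_apply complex_hom.peval_mult)
    show "\<xi> x v = 0" if "v \<notin> B'" for x v using \<phi>(2)[OF that] by (simp add: \<xi>_def)
    show "\<exists>x\<in>carrier M. \<xi> x = (\<lambda>k. if k = v then 1 else 0)" if "v \<in> B'" for v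
      using unit[OF that] by (auto simp: \<xi>_def fun_eq_iff intro!: bexI)
    show "\<exists>y. (\<forall>j. y j \<in> carrier M) \<and> \<phi> x = (\<Sum>j\<in>UNIV. hvar j \<star> \<phi> (y j))"
      if x: "x \<in> carrier M" "\<xi> x = 0" for x
    proof -
      have e0: "ev0 (\<phi> x v) = 0" for v using fun_cong[OF x(2), of v] by (simp add: \<xi>_def zero_fun_apply)
      have "\<exists>g. \<phi> x v = (\<Sum>j\<in>UNIV. hvar j * g j)" for v
        using ev0_decomposition[of "\<phi> x v"] unfolding e0 by simp
      then obtain g where g: "\<And>v. \<phi> x v = (\<Sum>j\<in>UNIV. hvar j * g v j)" by metis
      define y where "y j = finsum ?U (\<lambda>v. g v j \<odot>\<^bsub>?U\<^esub> v) B'" for j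
      have y: "y j \<in> carrier ?U \<and> \<phi> (y j) = (\<Sum>v\<in>B'. \<phi> (g v j \<odot>\<^bsub>?U\<^esub> v))" for j
        unfolding y_def by (rule \<phi>.finsum) (use B'c \<phi>.smult_closed in blast)
      have \<phi>y: "\<phi> (y j) = (\<lambda>v. if v \<in> B' then g v j else 0)" for j
      proof -
        have "\<phi> (y j) = (\<Sum>v\<in>B'. (if v \<in> B' then g v j else 0) \<star> (\<lambda>w. if w = v then 1 else 0))"
          using y[of j] B'c by (auto simp: \<phi>.K_smult \<phi>(3) intro!: sum.cong)
        also have "\<dots> = (\<lambda>v. if v \<in> B' then g v j else 0)" by (rule delta_sum[OF B'(1)]) simp
        finally show ?thesis .
      qed
      have "\<phi> x = (\<Sum>j\<in>UNIV. hvar j \<star> \<phi> (y j))"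
      proof
        fix v show "\<phi> x v = (\<Sum>j\<in>UNIV. hvar j \<star> \<phi> (y j)) v"
          by (cases "v \<in> B'") (simp_all add: sum_fun_apply fscale_apply \<phi>y g[symmetric] \<phi>(2))
      qed
      then show ?thesis using y by (intro exI[of _ y]) simp
    qed
  qed (use B'(1) in auto)
  then have "n' = card B'" using dim has_dim_unique by blast
  then show ?thesis using n by simp
qed

lemma pair_ext: "(\<And>x y. f (x, y) = g (x, y)) \<Longrightarrow> f = g"
  by auto

lemma (in coord_module) finitely_generated_family:
  assumes I: "finite I" and g: "\<And>i. i \<in> I \<Longrightarrow> g i \<in> carrier Q"
    and span: "\<And>x. x \<in> carrier Q \<Longrightarrow> \<exists>a. K x = (\<Sum>i\<in>I. a i \<star> K (g i))"
  shows "finitely_generated type_ring Q"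
proof -
  interpret Module.module type_ring Q by (rule module)
  have G: "g ` I \<subseteq> carrier Q" "finite (g ` I)" using g I by auto
  have "x \<in> span (g ` I)" if x: "x \<in> carrier Q" for x
  proof -
    obtain a where a: "K x = (\<Sum>i\<in>I. a i \<star> K (g i))" using span[OF x] by blast
    \<comment> \<open>Spans are taken over sets, so the coefficients of coinciding generators are
      added up.\<close>
    have "K x = (\<Sum>v\<in>g ` I. \<Sum>i\<in>{i \<in> I. g i = v}. a i \<star> K (g i))"
      unfolding a by (rule sum.image_gen[OF I])
    also have "\<dots> = (\<Sum>v\<in>g ` I. (\<Sum>i\<in>{i \<in> I. g i = v}. a i) \<star> K v)"
      unfolding sum_fscale by (intro sum.cong) auto
    finally show ?thesis unfolding span_finite_iff[OF G x] by (intro exI[of _ "\<lambda>v. \<Sum>i\<in>{i \<in> I. g i = v}. a i"])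
  qed
  then have "span (g ` I) = carrier Q" using span_is_subset2[OF G(1)] by blast
  then show ?thesis unfolding finitely_generated_def using G by blast
qed

lemma (in coord_module) free_module_coords:
  assumes "finite I" "\<And>x i. x \<in> carrier Q \<Longrightarrow> i \<notin> I \<Longrightarrow> K x i = 0"
    "\<And>i. i \<in> I \<Longrightarrow> \<exists>x\<in>carrier Q. K x = (\<lambda>k. if k = i then 1 else 0)"
  shows "free_module type_ring Q"
proof -
  obtain B where "B \<subseteq> carrier Q" "\<not> module.lin_dep type_ring Q B" "module.span type_ring Q B = carrier Q"
    using standard_basis[OF assms] .
  then show ?thesis unfolding free_module_def by blast
qed

lemma forms_submod: "submod UNIV (forms L k)"
  unfolding submod_def
proof (intro conjI ballI)
  show "\<omega> + \<eta> \<in> forms L k" if "\<omega> \<in> forms L k" "\<eta> \<in> forms L k" for \<omega> \<eta>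
    using that unfolding forms_def mem_Collect_eq plus_fun_apply by (metis add_0)
qed (auto simp: forms_def zero_fun_apply fscale_apply)

lemma forms_diff: "\<omega> \<in> forms L k \<Longrightarrow> \<eta> \<in> forms L k \<Longrightarrow> \<omega> - \<eta> \<in> forms L k"
  unfolding forms_def mem_Collect_eq minus_apply by (metis diff_zero)

lemma koszul_sum: "koszul (sum g X) = (\<Sum>x\<in>X. koszul (g x))"
  by (induction X rule: infinite_finite_induct) (simp_all add: koszul_add)

definition form_unit :: "'d set \<times> nat \<Rightarrow> 'd set \<times> nat \<Rightarrow> 'd::{finite,linorder} Uh" where
  "form_unit p = (\<lambda>k. if k = p then 1 else 0)"

lemma form_unit_forms: "card S = k \<Longrightarrow> l \<in> L \<Longrightarrow> form_unit (S, l) \<in> forms L k"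
  by (auto simp: form_unit_def forms_def)

lemma card_subsets_containing:
  assumes "k \<ge> 1"
  shows "card {S :: 'd::finite set. i \<in> S \<and> card S = k} = (CARD('d) - 1) choose (k - 1)"
proof -
  have "bij_betw (insert i) {T. T \<subseteq> UNIV - {i} \<and> card T = k - 1} {S. i \<in> S \<and> card S = k}"
  proof (rule bij_betw_byWitness[of _ "\<lambda>S. S - {i}"])
    show "insert i ` {T. T \<subseteq> UNIV - {i} \<and> card T = k - 1} \<subseteq> {S. i \<in> S \<and> card S = k}"
    proof (clarsimp)
      fix T :: "'d set" assume "T \<subseteq> UNIV - {i}" "card T = k - Suc 0"
      moreover have "i \<notin> T" using \<open>T \<subseteq> UNIV - {i}\<close> by auto
      ultimately show "card (insert i T) = k" using assms by simp
    qed
  qed auto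
  then have "card {S :: 'd set. i \<in> S \<and> card S = k} = card {T. T \<subseteq> UNIV - {i} \<and> card T = k - 1}"
    by (rule bij_betw_same_card[symmetric])
  also have "\<dots> = card (UNIV - {i}) choose (k - 1)" by (rule n_subsets) simp
  finally show ?thesis by (simp add: card_Diff_singleton)
qed

section \<open>The Witt action and the maps \<open>\<pi>_k\<close> in coordinates\<close>

context free_weyl_module
begin

lemma KE_smult:
  assumes "X \<in> carrier (F_ext P k)"
  shows "c \<odot>\<^bsub>F_ext P k\<^esub> X \<in> carrier (F_ext P k)" "KE (c \<odot>\<^bsub>F_ext P k\<^esub> X) = hconst c \<star> KE X"
proof -
  note r = KE_tensor_map[OF assms, where b = "\<lambda>(x, y). frag_of (c \<odot>\<^bsub>W\<^esub> x, y)" and \<Delta> = "\<lambda>\<omega>. hconst c \<star> \<omega>" and k' = k]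
  show "c \<odot>\<^bsub>F_ext P k\<^esub> X \<in> carrier (F_ext P k)" unfolding smult_F
    by (rule r(1)) (auto simp: keys_frag_of ha_closed fun_eq_iff fscale_apply \<kappa>_ha mult_ac)
  show "KE (c \<odot>\<^bsub>F_ext P k\<^esub> X) = hconst c \<star> KE X" unfolding smult_F
    by (rule r(2)) (auto simp: keys_frag_of ha_closed fun_eq_iff fscale_apply \<kappa>_ha mult_ac)
qed

text \<open>The formula for \<open>D(u,r)\<close> on \<open>F(P, V)\<close> read in coordinates.
  Since \<open>x^r\<close> is only semilinear over \<open>U(h)\<close>, no matrix over
  \<open>Uh\<close> describes it: each component is lifted to \<open>P\<close>, acted upon there and
  read off again.\<close>

definition act_coord :: "(complex, 'd) vec \<Rightarrow> (int, 'd) vec \<Rightarrow> ('d set \<times> nat \<Rightarrow> 'd Uh) \<Rightarrow> 'd set \<times> nat \<Rightarrow> 'd Uh" where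
  "act_coord u r \<omega> = (\<lambda>(S, l). \<kappa> (xa r (ha (witt_poly u) (lift (\<lambda>l. \<omega> (S, l))))) l
     + (\<Sum>S'\<in>UNIV. hconst (gl_coeff (outer r u) S' S) * \<kappa> (xa r (lift (\<lambda>l. \<omega> (S', l)))) l))"

lemma xa_hconst: "z \<in> carrier P \<Longrightarrow> xa r (ha (hconst c) z) = ha (hconst c) (xa r z)"
  by (simp add: xa_ha)

lemma ext_gl_act_closed: "w \<in> carrier (ext_power k) \<Longrightarrow> ext_gl_act A w \<in> carrier (ext_power k)"
proof -
  assume w: "w \<in> carrier (ext_power k)"
  have "card T = k" if T: "ext_gl_act A w T \<noteq> 0" for T
  proof -
    obtain S where "w S * gl_coeff A S T \<noteq> 0"
      using T sum.not_neutral_contains_not_neutral[of "\<lambda>S. w S * gl_coeff A S T" UNIV] unfolding ext_gl_act_eq by blast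
    then have "w S \<noteq> 0" "card T = card S" using gl_coeff_card by auto
    then show ?thesis using w by simp
  qed
  then show ?thesis by simp
qed

lemma KE_act:
  assumes "X \<in> carrier (F_ext P k)"
  shows "act (F_ext P k) u r X \<in> carrier (F_ext P k)" "KE (act (F_ext P k) u r X) = act_coord u r (KE X)"
proof -
  let ?b = "\<lambda>(z, y). frag_of (witt_D u r \<odot>\<^bsub>P\<^esub> z, y) + frag_of (lmul (x_pow r) \<odot>\<^bsub>P\<^esub> z, ext_gl_act (outer r u) y)"
  have b: "?b (z, w) = frag_of (xa r (ha (witt_poly u) z), w) + frag_of (xa r z, ext_gl_act (outer r u) w)"
    if "z \<in> carrier P" for z w using that by (simp add: witt_D_act xa_def)
  have b1: "?b (z, w) \<in> carrier (T.G k)" if z: "z \<in> carrier P" and w: "w \<in> carrier (ext_power k)" for z w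
    unfolding b[OF z]
    by (rule T.carrier_G_add) (use z w ext_gl_act_closed[OF w] in \<open>auto simp: keys_frag_of ha_closed xa_closed\<close>)
  have b2: "frag_eval ext_coord (?b (z, w)) = act_coord u r (ext_coord (z, w))"
    if z: "z \<in> carrier P" and w: "w \<in> carrier (ext_power k)" for z w
  proof (rule pair_ext)
    fix S l
    \<comment> \<open>The \<open>S\<close>-component of a pure tensor is a scalar multiple of
      \<open>z\<close>, and scalars pass through \<open>x^r\<close>.\<close>
    have lf: "lift (\<lambda>l. ext_coord (z, w) (S, l)) = ha (hconst (w S)) z" for S
    proof -
      have "(\<lambda>l. ext_coord (z, w) (S, l)) = \<kappa> (ha (hconst (w S)) z)" by (rule ext) (simp add: \<kappa>_ha z fscale_apply)
      then show ?thesis by (simp add: lift_\<kappa> ha_closed z)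
    qed
    have comm: "ha (witt_poly u) (ha (hconst c) z) = ha (hconst c) (ha (witt_poly u) z)" for c
      using ha_mult[OF z, of "witt_poly u" "hconst c"] ha_mult[OF z, of "hconst c" "witt_poly u"] by (simp add: mult.commute)
    have "act_coord u r (ext_coord (z, w)) (S, l) = hconst (w S) * \<kappa> (xa r (ha (witt_poly u) z)) l
      + (\<Sum>S'\<in>UNIV. hconst (gl_coeff (outer r u) S' S) * (hconst (w S') * \<kappa> (xa r z) l))"
      unfolding act_coord_def lf by (simp add: comm xa_hconst ha_closed xa_closed z \<kappa>_ha fscale_apply)
    also have "(\<Sum>S'\<in>UNIV. hconst (gl_coeff (outer r u) S' S) * (hconst (w S') * \<kappa> (xa r z) l))
      = hconst (ext_gl_act (outer r u) w S) * \<kappa> (xa r z) l"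
      unfolding ext_gl_act_eq hconst_sum sum_distrib_right by (rule sum.cong) (simp_all add: hconst_mult mult_ac)
    finally show "frag_eval ext_coord (?b (z, w)) (S, l) = act_coord u r (ext_coord (z, w)) (S, l)"
      unfolding b[OF z] by (simp add: frag_eval_add plus_fun_apply)
  qed
  have \<Delta>: "act_coord u r (\<omega> - \<eta>) = act_coord u r \<omega> - act_coord u r \<eta>" if \<omega>: "\<omega> \<in> forms L k" and \<eta>: "\<eta> \<in> forms L k" for \<omega> \<eta>
  proof (rule pair_ext)
    fix S l
    have s: "\<And>l. l \<notin> L \<Longrightarrow> \<omega> (S, l) = 0" "\<And>l. l \<notin> L \<Longrightarrow> \<eta> (S, l) = 0" for S
      using \<omega> \<eta> by (auto simp: forms_def)
    note d1 = \<kappa>_additive_lift_diff[where T = "\<lambda>z. xa r (ha (witt_poly u) z)", OF _ _ s]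
    note d2 = \<kappa>_additive_lift_diff[where T = "xa r", OF _ _ s]
    show "act_coord u r (\<omega> - \<eta>) (S, l) = (act_coord u r \<omega> - act_coord u r \<eta>) (S, l)"
      by (simp add: act_coord_def d1 d2 xa_closed ha_closed xa_sum ha_sum right_diff_distrib sum_subtractf)
  qed
  show "act (F_ext P k) u r X \<in> carrier (F_ext P k)" "KE (act (F_ext P k) u r X) = act_coord u r (KE X)"
    unfolding act_F using KE_tensor_map[OF assms b1 b2 \<Delta>] by blast+
qed

lemma KE_forms: "X \<in> carrier (F_ext P k) \<Longrightarrow> KE X \<in> forms L k"
  using KE_image[of k] by blast

text \<open>For \<open>r = 0\<close> the matrix \<open>outer r u\<close> is zero, so
  \<open>U(h)\<close> acts on the first tensor factor alone.\<close>

lemma KE_act_hvar: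
  assumes "X \<in> carrier (F_ext P k)"
  shows "KE (act (F_ext P k) (axis i 1) 0 X) = hvar i \<star> KE X"
proof -
  have o: "outer 0 (axis i 1 :: (complex, 'd) vec) = 0" by (simp add: outer_def vec_eq_iff)
  have "act_coord (axis i 1) 0 (KE X) (S, l) = hvar i * KE X (S, l)" for S l
    using forms_lift[OF KE_forms[OF assms]]
    by (simp add: act_coord_def o gl_coeff_zero witt_poly_axis xa_0 ha_closed \<kappa>_ha fscale_apply)
  then show ?thesis unfolding KE_act(2)[OF assms] by (intro ext) (auto simp: fscale_apply)
qed

lemma KE_diff_pi:
  assumes X: "X \<in> carrier (F_ext P k)"
  shows "diff_pi P k X \<in> carrier (F_ext P (Suc k))" "KE (diff_pi P k X) = koszul (KE X)"
proof -
  have "diff_pi P k X \<in> carrier (F_ext P (Suc k)) \<and> KE (diff_pi P k X) = koszul (KE X)"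
  proof (cases "k < CARD('d)")
    case True
    let ?b = "\<lambda>(y, v). \<Sum>j\<in>UNIV. frag_of (partial j \<odot>\<^bsub>P\<^esub> y, wedge (ext_vec (axis j 1)) v)"
    have b: "?b (z, w) = (\<Sum>j\<in>UNIV. frag_of (ha (hvar j) z, wedge (ext_vec (axis j 1)) w))" for z w
      by (simp add: ha_def h_op_hvar)
    have wc: "wedge (ext_vec (axis j 1)) w \<in> carrier (ext_power (Suc k))" if w: "w \<in> carrier (ext_power k)" for j w
    proof -
      have "card S = Suc k" if "j \<in> S" "w (S - {j}) \<noteq> 0" for S
      proof -
        have "card (S - {j}) = k" using w that by simp
        then show ?thesis using that by (metis card_Suc_Diff1 finite)
      qed
      then show ?thesis by (auto simp: wedge_axis split: if_splits)
    qed
    have b1: "?b (z, w) \<in> carrier (T.G (Suc k))" if z: "z \<in> carrier P" and w: "w \<in> carrier (ext_power k)" for z w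
      unfolding b
    proof (rule T.carrier_G_sum)
      show "frag_of (ha (hvar j) z, wedge (ext_vec (axis j 1)) w) \<in> carrier (T.G (Suc k))" for j
        using wc[OF w, of j] ha_closed[OF z, of "hvar j"] by (simp only: carrier_free_Abelian_group_iff keys_frag_of) simp
    qed
    have b2: "frag_eval ext_coord (?b (z, w)) = koszul (ext_coord (z, w))"
      if z: "z \<in> carrier P" and w: "w \<in> carrier (ext_power k)" for z w
    proof (rule pair_ext)
      fix S l
      have "(\<Sum>j\<in>UNIV. hconst (if j \<in> S then esign j S * w (S - {j}) else 0) * (hvar j * \<kappa> z l))
        = (\<Sum>j\<in>S. hconst (esign j S) * hvar j * (hconst (w (S - {j})) * \<kappa> z l))"
        by (rule sum.mono_neutral_cong_right) (auto simp: hconst_mult mult_ac)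
      then show "frag_eval ext_coord (?b (z, w)) (S, l) = koszul (ext_coord (z, w)) (S, l)"
        unfolding b by (simp add: frag_eval_sum sum_fun_apply wedge_axis \<kappa>_ha z fscale_apply koszul_apply)
    qed
    show ?thesis using True KE_tensor_map[OF X b1 b2 koszul_diff] unfolding diff_pi_def by simp
  next
    \<comment> \<open>From \<open>k = d\<close> on, no \<open>S\<close> has \<open>k + 1\<close>
      elements. The Koszul differential is therefore zero as well and agrees with the default value
      of \<open>diff_pi\<close>.\<close>
    case False
    have "koszul (KE X) \<in> forms L (Suc k)" by (rule koszul_forms[OF KE_forms[OF X]])
    moreover have "card S \<noteq> Suc k" for S :: "'d set"
      using False card_mono[of UNIV S] by auto
    ultimately have "koszul (KE X) (S, l) = 0" for S l by (auto simp: forms_def)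
    then have "koszul (KE X) = 0" by (auto simp: fun_eq_iff zero_fun_apply)
    then show ?thesis using False T.KT_zero[of "Suc k"] by (simp add: diff_pi_def zero_F carrier_F)
  qed
  then show "diff_pi P k X \<in> carrier (F_ext P (Suc k))" "KE (diff_pi P k X) = koszul (KE X)" by auto
qed

lemma KE_eq: "X \<in> carrier (F_ext P k) \<Longrightarrow> Y \<in> carrier (F_ext P k) \<Longrightarrow> KE X = KE Y \<Longrightarrow> X = Y"
  using T.KT_inj[of k] unfolding carrier_F by (auto simp: inj_on_def)

lemma KE_surj: "\<omega> \<in> forms L k \<Longrightarrow> \<exists>X\<in>carrier (F_ext P k). KE X = \<omega>"
  unfolding KE_image[of k, symmetric] by blast

text \<open>As \<open>KE\<close> is injective, membership in \<open>C\<close> can be tested on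
  coordinates, and the closure of \<open>C\<close> under the operations is inherited from its image.
  Images and kernels of the \<open>\<pi>_k\<close> are handled alike in this way.\<close>

lemma sub_coords:
  assumes C: "C \<subseteq> carrier (F_ext P k)" and V: "submod UNIV (KE ` C)"
  defines "M \<equiv> (F_ext P k)\<lparr>carrier := C\<rparr>"
  shows "abelian_group M" "coord_module (Uh_module M) KE"
    "\<And>c x. x \<in> carrier M \<Longrightarrow> c \<odot>\<^bsub>M\<^esub> x = hconst c \<odot>\<^bsub>Uh_module M\<^esub> x"
proof -
  have M: "carrier M = C" "\<zero>\<^bsub>M\<^esub> = \<zero>\<^bsub>F_ext P k\<^esub>" "(\<oplus>\<^bsub>M\<^esub>) = (\<oplus>\<^bsub>F_ext P k\<^esub>)"
    "c \<odot>\<^bsub>M\<^esub> x = c \<odot>\<^bsub>F_ext P k\<^esub> x" "act M = act (F_ext P k)" for c x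
    by (simp_all add: M_def)
  have mem: "X \<in> C" if X: "X \<in> carrier (F_ext P k)" "KE X \<in> KE ` C" for X
  proof -
    obtain Y where "Y \<in> C" "KE X = KE Y" using X(2) by blast
    then show ?thesis using KE_eq[OF X(1), of Y] C by auto
  qed
  have 1: "inj_on KE (carrier M)"
    unfolding M using KE_eq C by (intro inj_onI) blast
  have z: "\<zero>\<^bsub>F_ext P k\<^esub> \<in> carrier (F_ext P k)" "KE \<zero>\<^bsub>F_ext P k\<^esub> = 0"
    using T.KT_zero[of k] by (simp_all add: zero_F carrier_F)
  have 2: "\<zero>\<^bsub>M\<^esub> \<in> carrier M" "KE \<zero>\<^bsub>M\<^esub> = 0"
    unfolding M using mem[OF z(1)] z(2) submodD(1)[OF V] by simp_all
  have 3: "x \<oplus>\<^bsub>M\<^esub> y \<in> carrier M \<and> KE (x \<oplus>\<^bsub>M\<^esub> y) = KE x + KE y" if "x \<in> carrier M" "y \<in> carrier M" for x y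
  proof -
    have xy: "x \<in> C" "y \<in> C" using that by (simp_all add: M)
    have a: "x \<oplus>\<^bsub>F_ext P k\<^esub> y \<in> carrier (F_ext P k)" "KE (x \<oplus>\<^bsub>F_ext P k\<^esub> y) = KE x + KE y"
      using T.KT_add[of x k y] xy C by (auto simp: add_F carrier_F)
    then show ?thesis unfolding M using mem[OF a(1)] submodD(2)[OF V, of "KE x" "KE y"] xy by auto
  qed
  have 4: "c \<odot>\<^bsub>M\<^esub> x \<in> carrier M \<and> KE (c \<odot>\<^bsub>M\<^esub> x) = hconst c \<star> KE x" if "x \<in> carrier M" for c x
  proof -
    have x: "x \<in> C" "x \<in> carrier (F_ext P k)" using that C by (auto simp: M)
    show ?thesis unfolding M using mem[OF KE_smult(1)[OF x(2)], of c] KE_smult(2)[OF x(2), of c]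
      submodD(3)[OF V, of "hconst c" "KE x"] x(1) by auto
  qed
  have 5: "act M (axis i 1) 0 x \<in> carrier M \<and> KE (act M (axis i 1) 0 x) = hvar i \<star> KE x" if "x \<in> carrier M" for i x
  proof -
    have x: "x \<in> C" "x \<in> carrier (F_ext P k)" using that C by (auto simp: M)
    show ?thesis unfolding M using mem[OF KE_act(1)[OF x(2)], of "axis i 1" 0] KE_act_hvar[OF x(2), of i]
      submodD(3)[OF V, of "hvar i" "KE x"] x(1) by auto
  qed
  note r = coord_module_Uh[OF 1 2 3 4 5]
  show "abelian_group M" by (rule r(1))
  show "coord_module (Uh_module M) KE" by (rule r(2))
  show "c \<odot>\<^bsub>M\<^esub> x = hconst c \<odot>\<^bsub>Uh_module M\<^esub> x" if "x \<in> carrier M" for c x by (rule r(3)) (simp_all add: that)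
qed

text \<open>Boundaries and cycles are treated at once: \<open>C\<close> is any submodule between
  them. The components at the \<open>S\<close> containing a fixed \<open>i\<close> are injective
  coordinates on closed forms. All of them count towards the rank, since the differential of
  \<open>e_(S - {i})\<close> has a single such component, at \<open>S\<close>, equal to
  \<open>t_i\<close> up to sign.\<close>

lemma has_rank_sub:
  assumes C: "C \<subseteq> carrier (F_ext P k)" and V: "submod UNIV (KE ` C)" and k: "k \<ge> 1"
    and closed: "\<And>x. x \<in> C \<Longrightarrow> koszul (KE x) = 0" and exact: "koszul ` forms L (k - 1) \<subseteq> KE ` C"
  shows "has_rank (Uh_module ((F_ext P k)\<lparr>carrier := C\<rparr>)) (card L * ((CARD('d) - 1) choose (k - 1)))"
proof -
  let ?M = "(F_ext P k)\<lparr>carrier := C\<rparr>"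
  interpret c: coord_module "Uh_module ?M" KE by (rule sub_coords[OF C V])
  obtain i :: 'd where True by simp
  define I where "I = {S. i \<in> S \<and> card S = k} \<times> L"
  define \<rho> where "\<rho> \<omega> = (\<lambda>(S, l). if i \<in> S then \<omega> (S, l) else 0)" for \<omega> :: "'d set \<times> nat \<Rightarrow> 'd Uh"
  have \<rho>_ker: "\<omega> = 0" if \<omega>: "koszul \<omega> = 0" "\<rho> \<omega> = 0" for \<omega>
  proof (rule pair_ext)
    fix S l
    have z: "\<omega> (T, l) = 0" if "i \<in> T" for T
      using fun_cong[OF \<omega>(2), of "(T, l)"] that by (simp add: \<rho>_def zero_fun_apply)
    show "\<omega> (S, l) = 0 (S, l)"
    proof (cases "i \<in> S")
      case False
      have "hconst (esign i (insert i S)) * hvar i * \<omega> (S, l) = 0"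
        using koszul_insert[OF False, of \<omega> l] z \<omega>(1) by (simp add: zero_fun_apply)
      then show ?thesis by (simp add: zero_fun_apply)
    qed (simp add: z zero_fun_apply)
  qed
  have cm: "coord_module (Uh_module ?M) (\<lambda>x. \<rho> (KE x))"
  proof
    show "inj_on (\<lambda>x. \<rho> (KE x)) (carrier (Uh_module ?M))"
    proof (rule inj_onI)
      fix x y assume xy: "x \<in> carrier (Uh_module ?M)" "y \<in> carrier (Uh_module ?M)" "\<rho> (KE x) = \<rho> (KE y)"
      have "koszul (KE x - KE y) = 0" using xy closed by (simp add: koszul_diff)
      moreover have "\<rho> (KE x - KE y) = 0"
      proof (rule pair_ext)
        show "\<rho> (KE x - KE y) (S, l) = 0 (S, l)" for S l
          using fun_cong[OF xy(3), of "(S, l)"] by (cases "i \<in> S") (simp_all add: \<rho>_def zero_fun_apply)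
      qed
      ultimately have "KE x - KE y = 0" by (rule \<rho>_ker)
      then show "x = y" using xy by (intro c.K_eq) auto
    qed
    show "\<rho> (KE \<zero>\<^bsub>Uh_module ?M\<^esub>) = 0" unfolding c.K_zero by (auto simp: \<rho>_def zero_fun_apply fun_eq_iff)
    show "\<rho> (KE (x \<oplus>\<^bsub>Uh_module ?M\<^esub> y)) = \<rho> (KE x) + \<rho> (KE y)"
      if "x \<in> carrier (Uh_module ?M)" "y \<in> carrier (Uh_module ?M)" for x y
      unfolding c.K_add[OF that] by (auto simp: \<rho>_def plus_fun_apply fun_eq_iff)
    show "\<rho> (KE (f \<odot>\<^bsub>Uh_module ?M\<^esub> x)) = f \<star> \<rho> (KE x)" if "x \<in> carrier (Uh_module ?M)" for f x
      unfolding c.K_smult[OF that] by (auto simp: \<rho>_def fscale_apply fun_eq_iff)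
  qed (rule c.zero_closed c.add_closed c.smult_closed; assumption)+
  have "has_rank (Uh_module ?M) (card I)"
  proof (rule has_rank_coords[OF cm])
    show "finite I" using L_finite by (simp add: I_def)
    fix x p assume x: "x \<in> carrier (Uh_module ?M)" and p: "p \<notin> I"
    have "KE x \<in> forms L k" using x C by (intro KE_forms) auto
    then show "\<rho> (KE x) p = 0" using p by (cases p) (auto simp: \<rho>_def I_def forms_def)
  next
    fix p assume "p \<in> I"
    then obtain S l where p: "p = (S, l)" "i \<in> S" "card S = k" "l \<in> L" by (auto simp: I_def)
    let ?\<eta> = "form_unit (S - {i}, l) :: 'd set \<times> nat \<Rightarrow> 'd Uh"
    have "?\<eta> \<in> forms L (k - 1)" by (rule form_unit_forms) (use p in auto)
    then obtain x where x: "x \<in> C" "KE x = koszul ?\<eta>" using exact by (metis imageE image_subset_iff)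
    have "\<rho> (koszul ?\<eta>) = (\<lambda>q. if q = p then hconst (esign i S) * hvar i else 0)"
    proof (rule pair_ext)
      fix T m
      show "\<rho> (koszul ?\<eta>) (T, m) = (if (T, m) = p then hconst (esign i S) * hvar i else 0)"
      proof (cases "i \<in> T")
        case True
        have "koszul ?\<eta> (insert i (T - {i}), m) = hconst (esign i (insert i (T - {i}))) * hvar i * ?\<eta> (T - {i}, m)"
          by (rule koszul_insert) (auto simp: form_unit_def)
        moreover have "insert i (T - {i}) = T" using True by auto
        moreover have "T - {i} = S - {i} \<longleftrightarrow> T = S" using True p(2) by blast
        ultimately show ?thesis using True p(1) by (auto simp: \<rho>_def form_unit_def)
      qed (use p in \<open>auto simp: \<rho>_def\<close>)
    qed
    then show "\<exists>x\<in>carrier (Uh_module ?M). \<exists>c. c \<noteq> 0 \<and> \<rho> (KE x) = (\<lambda>q. if q = p then c else 0)"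
      using x by (intro bexI[of _ x] exI[of _ "hconst (esign i S) * hvar i"]) auto
  qed
  moreover have "card I = card L * ((CARD('d) - 1) choose (k - 1))"
    unfolding I_def using card_subsets_containing[OF k, of i] by (simp add: card_cartesian_product)
  ultimately show ?thesis by simp
qed

end

lemma submod_koszul_image: "submod UNIV (koszul ` forms L k)"
  unfolding submod_def
proof (intro conjI ballI)
  show "0 \<in> koszul ` forms L k" by (rule image_eqI[of _ _ 0]) (simp_all add: submodD(1)[OF forms_submod])
  show "x + y \<in> koszul ` forms L k" if "x \<in> koszul ` forms L k" "y \<in> koszul ` forms L k" for x y
    using that submodD(2)[OF forms_submod] by (auto simp: koszul_add[symmetric] intro!: imageI)
  show "f \<star> x \<in> koszul ` forms L k" if "x \<in> koszul ` forms L k" for f x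
    using that submodD(3)[OF forms_submod] by (auto simp: koszul_scale[symmetric] intro!: imageI)
qed

section \<open>Rank, fibre at the origin and non-freeness of \<open>L_d(P,i)\<close>\<close>

context free_weyl_module
begin

lemma L_mod_carrier:
  assumes "i \<ge> 1"
  shows "carrier (L_mod P i) = diff_pi P (i - 1) ` carrier (F_ext P (i - 1))"
    "carrier (L_mod P i) \<subseteq> carrier (F_ext P i)"
    "KE ` carrier (L_mod P i) = koszul ` forms L (i - 1)"
proof -
  show 1: "carrier (L_mod P i) = diff_pi P (i - 1) ` carrier (F_ext P (i - 1))"
    by (simp add: L_mod_def)
  show "carrier (L_mod P i) \<subseteq> carrier (F_ext P i)"
    unfolding 1 using KE_diff_pi(1)[of _ "i - 1"] assms by auto
  show "KE ` carrier (L_mod P i) = koszul ` forms L (i - 1)"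
    unfolding 1 KE_image[symmetric] image_image by (rule image_cong) (auto simp: KE_diff_pi)
qed

lemma L_mod_eq: "L_mod P i = (F_ext P i)\<lparr>carrier := carrier (L_mod P i)\<rparr>"
  by (simp add: L_mod_def)

lemma L_mod_coords:
  assumes "i \<ge> 1"
  shows "abelian_group (L_mod P i)" "coord_module (Uh_module (L_mod P i)) KE"
    "\<And>c x. x \<in> carrier (L_mod P i) \<Longrightarrow> c \<odot>\<^bsub>L_mod P i\<^esub> x = hconst c \<odot>\<^bsub>Uh_module (L_mod P i)\<^esub> x"
proof -
  have V: "submod UNIV (KE ` carrier (L_mod P i))"
    unfolding L_mod_carrier(3)[OF assms] by (rule submod_koszul_image)
  note r = sub_coords[OF L_mod_carrier(2)[OF assms] V, folded L_mod_eq]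
  show "abelian_group (L_mod P i)" "coord_module (Uh_module (L_mod P i)) KE" by (rule r)+
  show "c \<odot>\<^bsub>L_mod P i\<^esub> x = hconst c \<odot>\<^bsub>Uh_module (L_mod P i)\<^esub> x" if "x \<in> carrier (L_mod P i)" for c x
    by (rule r(3)[OF that])
qed

lemma has_rank_L_mod:
  assumes "i \<ge> 1"
  shows "has_rank (Uh_module (L_mod P i)) (card L * ((CARD('d) - 1) choose (i - 1)))"
proof (subst L_mod_eq, rule has_rank_sub[OF L_mod_carrier(2)[OF assms] _ assms])
  show "submod UNIV (KE ` carrier (L_mod P i))"
    unfolding L_mod_carrier(3)[OF assms] by (rule submod_koszul_image)
  show "koszul (KE x) = 0" if "x \<in> carrier (L_mod P i)" for x
  proof -
    have "KE x \<in> koszul ` forms L (i - 1)" using that L_mod_carrier(3)[OF assms] by blast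
    then show ?thesis using koszul_koszul by auto
  qed
qed (simp add: L_mod_carrier(3)[OF assms])

lemma has_rank_L_tilde_mod:
  assumes "i \<ge> 1"
  shows "has_rank (Uh_module (L_tilde_mod P i)) (card L * ((CARD('d) - 1) choose (i - 1)))"
proof -
  let ?C = "{X \<in> carrier (F_ext P i). diff_pi P i X = \<zero>\<^bsub>F_ext P (Suc i)\<^esub>}"
  let ?Z = "{\<omega> :: 'd set \<times> nat \<Rightarrow> 'd Uh. \<omega> \<in> forms L i \<and> koszul \<omega> = 0}"
  have z: "\<zero>\<^bsub>F_ext P (Suc i)\<^esub> \<in> carrier (F_ext P (Suc i))" "KE \<zero>\<^bsub>F_ext P (Suc i)\<^esub> = 0"
    using T.KT_zero[of "Suc i"] by (simp_all add: zero_F carrier_F)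
  have iff: "diff_pi P i X = \<zero>\<^bsub>F_ext P (Suc i)\<^esub> \<longleftrightarrow> koszul (KE X) = 0" if "X \<in> carrier (F_ext P i)" for X
    using KE_diff_pi[OF that] KE_eq[OF KE_diff_pi(1)[OF that] z(1)] z(2) by metis
  have im: "KE ` ?C = ?Z"
  proof (intro equalityI subsetI)
    fix \<omega> assume "\<omega> \<in> KE ` ?C"
    then obtain X where X: "X \<in> ?C" "\<omega> = KE X" by blast
    then show "\<omega> \<in> ?Z" using KE_forms[of X i] iff[of X] by simp
  next
    fix \<omega> assume \<omega>: "\<omega> \<in> ?Z"
    then obtain X where "X \<in> carrier (F_ext P i)" "KE X = \<omega>" using KE_surj[of \<omega> i] by blast
    then show "\<omega> \<in> KE ` ?C" using iff[of X] \<omega> by blast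
  qed
  have "submod UNIV ?Z"
    unfolding submod_def by (auto simp: koszul_add koszul_scale intro: submodD[OF forms_submod])
  then have V: "submod UNIV (KE ` ?C)" unfolding im .
  have ex: "koszul ` forms L (i - 1) \<subseteq> KE ` ?C"
    unfolding im
  proof (rule image_subsetI)
    fix \<eta> :: "'d set \<times> nat \<Rightarrow> 'd Uh" assume "\<eta> \<in> forms L (i - 1)"
    then have "koszul \<eta> \<in> forms L (Suc (i - 1))" by (rule koszul_forms)
    then show "koszul \<eta> \<in> ?Z" using assms koszul_koszul[of \<eta>] by simp
  qed
  have "has_rank (Uh_module ((F_ext P i)\<lparr>carrier := ?C\<rparr>)) (card L * ((CARD('d) - 1) choose (i - 1)))"
  proof (rule has_rank_sub[OF _ V assms _ ex])
    show "koszul (KE X) = 0" if "X \<in> ?C" for X using that iff[of X] by blast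
  qed blast
  then show ?thesis by (simp add: L_tilde_mod_def)
qed

lemma forms_expansion:
  assumes \<eta>: "\<eta> \<in> forms L k"
  shows "\<eta> = (\<Sum>p\<in>{S. card S = k} \<times> L. \<eta> p \<star> form_unit p)"
  unfolding form_unit_def
  by (rule delta_sum[symmetric]) (use L_finite \<eta> in \<open>auto simp: forms_def\<close>)

lemma finitely_generated_L_mod:
  assumes "i \<ge> 1"
  shows "finitely_generated type_ring (Uh_module (L_mod P i))"
proof -
  interpret c: coord_module "Uh_module (L_mod P i)" KE by (rule L_mod_coords(2)[OF assms])
  let ?I = "{S :: 'd set. card S = i - 1} \<times> L"
  have "\<exists>x. x \<in> carrier (L_mod P i) \<and> KE x = koszul (form_unit p)" if p: "p \<in> ?I" for p
  proof -
    have "form_unit p \<in> forms L (i - 1)" using p form_unit_forms by auto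
    then have "koszul (form_unit p) \<in> KE ` carrier (L_mod P i)" unfolding L_mod_carrier(3)[OF assms] by blast
    then show ?thesis by auto
  qed
  then obtain g where g: "\<And>p. p \<in> ?I \<Longrightarrow> g p \<in> carrier (L_mod P i) \<and> KE (g p) = koszul (form_unit p)" by metis
  show ?thesis
  proof (rule c.finitely_generated_family[of ?I g])
    fix x assume "x \<in> carrier (Uh_module (L_mod P i))"
    then have "KE x \<in> koszul ` forms L (i - 1)" unfolding L_mod_carrier(3)[OF assms, symmetric] by simp
    then obtain \<eta> where \<eta>: "\<eta> \<in> forms L (i - 1)" "KE x = koszul \<eta>" by blast
    have "koszul \<eta> = koszul (\<Sum>p\<in>?I. \<eta> p \<star> form_unit p)" using forms_expansion[OF \<eta>(1)] by simp
    also have "\<dots> = (\<Sum>p\<in>?I. \<eta> p \<star> KE (g p))"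
      unfolding koszul_sum by (rule sum.cong) (use g in \<open>auto simp: koszul_scale\<close>)
    finally show "\<exists>a. KE x = (\<Sum>p\<in>?I. a p \<star> KE (g p))" using \<eta>(2) by auto
  qed (use L_finite g in auto)
qed

lemma has_dim_L_mod:
  assumes i: "i \<ge> 1" "i \<le> CARD('d)"
  shows "has_dim type_ring (quotient_module (L_mod P i) (ideal_times I0 (Uh_module (L_mod P i))))
    (card L * (CARD('d) choose (i - 1)))"
proof -
  interpret c: coord_module "Uh_module (L_mod P i)" KE by (rule L_mod_coords(2)[OF i(1)])
  let ?M = "L_mod P i" and ?k = "i - 1"
  let ?I = "{S :: 'd set. card S = ?k} \<times> L"
  have k: "?k < CARD('d)" using i by simp
  \<comment> \<open>An arbitrary primitive. Two of them differ by a closed form of degree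
    \<open>i - 1 < d\<close>, so the value at the origin is independent of the choice.\<close>
  define prim where "prim x = (SOME \<eta>. \<eta> \<in> forms L ?k \<and> KE x = koszul \<eta>)" for x
  have prim: "prim x \<in> forms L ?k \<and> KE x = koszul (prim x)" if "x \<in> carrier ?M" for x
  proof -
    have "\<exists>\<eta>. \<eta> \<in> forms L ?k \<and> KE x = koszul \<eta>" using that L_mod_carrier(3)[OF i(1)] by auto
    then show ?thesis unfolding prim_def by (rule someI_ex)
  qed
  define \<xi> where "\<xi> x = (\<lambda>p. ev0 (prim x p))" for x
  have \<xi>: "\<xi> x = (\<lambda>p. ev0 (\<eta> p))" if x: "x \<in> carrier ?M" and \<eta>: "\<eta> \<in> forms L ?k" "KE x = koszul \<eta>" for x \<eta>
  proof (rule pair_ext)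
    fix S l
    have "koszul (prim x - \<eta>) = 0" using prim[OF x] \<eta> by (simp add: koszul_diff)
    from koszul_closed_ev0[OF forms_diff[OF _ \<eta>(1)] k this, of S l] prim[OF x]
    show "\<xi> x (S, l) = ev0 (\<eta> (S, l))" by (simp add: \<xi>_def complex_hom.peval_diff)
  qed
  have ex: "\<exists>x\<in>carrier ?M. KE x = koszul \<eta>" if "\<eta> \<in> forms L ?k" for \<eta>
  proof -
    have "koszul \<eta> \<in> KE ` carrier ?M" unfolding L_mod_carrier(3)[OF i(1)] using that by blast
    then show ?thesis by auto
  qed
  have "has_dim type_ring (quotient_module ?M (ideal_times I0 (Uh_module ?M))) (card ?I)"
  proof (rule has_dim_quotient_coords[OF L_mod_coords[OF i(1)], where \<xi> = \<xi>])
    fix x y assume xy: "x \<in> carrier ?M" "y \<in> carrier ?M"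
    have "\<xi> (x \<oplus>\<^bsub>?M\<^esub> y) = (\<lambda>p. ev0 ((prim x + prim y) p))"
    proof (rule \<xi>)
      show "x \<oplus>\<^bsub>?M\<^esub> y \<in> carrier ?M" using c.add_closed[of x y] xy by simp
      show "prim x + prim y \<in> forms L ?k" using prim xy submodD(2)[OF forms_submod] by blast
      show "KE (x \<oplus>\<^bsub>?M\<^esub> y) = koszul (prim x + prim y)"
        using c.K_add[of x y] xy prim by (simp add: koszul_add)
    qed
    then show "\<xi> (x \<oplus>\<^bsub>?M\<^esub> y) = \<xi> x + \<xi> y"
      by (auto simp: \<xi>_def fun_eq_iff plus_fun_apply complex_hom.peval_add)
  next
    fix f x assume x: "x \<in> carrier ?M"
    have "\<xi> (f \<odot>\<^bsub>Uh_module ?M\<^esub> x) = (\<lambda>p. ev0 ((f \<star> prim x) p))"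
    proof (rule \<xi>)
      show "f \<odot>\<^bsub>Uh_module ?M\<^esub> x \<in> carrier ?M" using c.smult_closed[of x f] x by simp
      show "f \<star> prim x \<in> forms L ?k" using prim[OF x] submodD(3)[OF forms_submod] by blast
      show "KE (f \<odot>\<^bsub>Uh_module ?M\<^esub> x) = koszul (f \<star> prim x)"
        using c.K_smult[of x f] x prim by (simp add: koszul_scale)
    qed
    then show "\<xi> (f \<odot>\<^bsub>Uh_module ?M\<^esub> x) = ev0 f \<star> \<xi> x"
      by (auto simp: \<xi>_def fun_eq_iff fscale_apply complex_hom.peval_mult)
  next
    show "finite ?I" using L_finite by simp
    show "\<xi> x p = 0" if "x \<in> carrier ?M" "p \<notin> ?I" for x p
    proof -
      have "prim x p = 0" using prim[OF that(1)] that(2) by (cases p) (auto simp: forms_def)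
      then show ?thesis by (simp add: \<xi>_def)
    qed
    fix p assume p: "p \<in> ?I"
    then have u: "form_unit p \<in> forms L ?k" using form_unit_forms by auto
    obtain x where x: "x \<in> carrier ?M" "KE x = koszul (form_unit p)" using ex[OF u] by blast
    show "\<exists>x\<in>carrier ?M. \<xi> x = (\<lambda>k. if k = p then 1 else 0)"
      using x(1) \<xi>[OF x(1) u x(2)] by (intro bexI[of _ x]) (auto simp: form_unit_def)
  next
    \<comment> \<open>A primitive that vanishes at the origin is a sum of terms
      \<open>t_j \<eta>_j\<close>. Applying the differential displays \<open>x\<close> as a sum of
      \<open>t_j\<close> times boundaries, hence as an element of
      \<open>I0 L_d(P,i)\<close>.\<close>
    fix x assume x: "x \<in> carrier ?M" "\<xi> x = 0"
    have e0: "ev0 (prim x p) = 0" for p using fun_cong[OF x(2), of p] by (simp add: \<xi>_def zero_fun_apply)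
    have "\<exists>g. prim x p = (\<Sum>j\<in>UNIV. hvar j * g j)" for p
      using ev0_decomposition[of "prim x p"] unfolding e0 by simp
    then obtain g where g: "\<And>p. prim x p = (\<Sum>j\<in>UNIV. hvar j * g p j)" by metis
    define \<eta> where "\<eta> j = (\<lambda>p. if p \<in> ?I then g p j else 0)" for j
    have \<eta>: "\<eta> j \<in> forms L ?k" for j by (auto simp: \<eta>_def forms_def)
    have eq: "prim x = (\<Sum>j\<in>UNIV. hvar j \<star> \<eta> j)"
    proof (rule pair_ext)
      fix S l
      show "prim x (S, l) = (\<Sum>j\<in>UNIV. hvar j \<star> \<eta> j) (S, l)"
      proof (cases "(S, l) \<in> ?I")
        case True then show ?thesis by (simp add: sum_fun_apply fscale_apply \<eta>_def g)
      next
        case False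
        then have "prim x (S, l) = 0" using prim[OF x(1)] by (auto simp: forms_def)
        moreover have "\<eta> j (S, l) = 0" for j using False unfolding \<eta>_def by (rule if_not_P)
        ultimately show ?thesis by (simp add: sum_fun_apply fscale_apply)
      qed
    qed
    obtain y where y: "\<And>j. y j \<in> carrier ?M \<and> KE (y j) = koszul (\<eta> j)" using ex[OF \<eta>] by metis
    have "KE x = (\<Sum>j\<in>UNIV. hvar j \<star> KE (y j))"
      using prim[OF x(1)] eq y by (simp add: koszul_sum koszul_scale)
    then show "\<exists>y. (\<forall>j. y j \<in> carrier ?M) \<and> KE x = (\<Sum>j\<in>UNIV. hvar j \<star> KE (y j))"
      using y by blast
  qed
  moreover have "card ?I = card L * (CARD('d) choose ?k)"
    using n_subsets[of "UNIV :: 'd set" ?k] by (simp add: card_cartesian_product)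
  ultimately show ?thesis by simp
qed

lemma L_mod_not_free:
  assumes i: "i \<ge> 2" "i \<le> CARD('d)" and L: "L \<noteq> {}"
  shows "\<not> free_module type_ring (Uh_module (L_mod P i))"
proof
  assume free: "free_module type_ring (Uh_module (L_mod P i))"
  have i1: "i \<ge> 1" using i by simp
  have "card L * ((CARD('d) - 1) choose (i - 1)) = card L * (CARD('d) choose (i - 1))"
    by (rule free_rank_eq_dim[OF L_mod_coords[OF i1] finitely_generated_L_mod[OF i1] free
          has_rank_L_mod[OF i1] has_dim_L_mod[OF i1 i(2)]])
  then have eq: "(CARD('d) - 1) choose (i - 1) = CARD('d) choose (i - 1)"
    using L L_finite by simp
  \<comment> \<open>By Pascal's rule the two binomial coefficients differ by
    \<open>(d - 1) choose (i - 2)\<close>, which is positive for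
    \<open>2 \<le> i \<le> d\<close>.\<close>
  obtain n m where nm: "CARD('d) = Suc n" "i - 1 = Suc m" "m \<le> n"
    using i by (cases "CARD('d)"; cases "i - 1") auto
  have "n choose m > 0" using nm by simp
  then show False using eq nm by simp
qed

lemma F0_free: "free_module type_ring (Uh_module (F_ext P 0))"
proof -
  have eq: "(F_ext P 0)\<lparr>carrier := carrier (F_ext P 0)\<rparr> = F_ext P 0" by simp
  have V: "submod UNIV (KE ` carrier (F_ext P 0))" unfolding KE_image by (rule forms_submod)
  interpret c: coord_module "Uh_module (F_ext P 0)" KE
    using sub_coords(2)[OF order_refl V] unfolding eq .
  show ?thesis
  proof (rule c.free_module_coords[of "{S :: 'd set. card S = 0} \<times> L"])
    fix p :: "'d set \<times> nat" assume "p \<in> {S. card S = 0} \<times> L"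
    then have "form_unit p \<in> forms L 0" by (auto intro!: form_unit_forms)
    from KE_surj[OF this] show "\<exists>x\<in>carrier (Uh_module (F_ext P 0)). KE x = (\<lambda>k. if k = p then 1 else 0)"
      by (simp add: form_unit_def)
  next
    fix x p assume x: "x \<in> carrier (Uh_module (F_ext P 0))" and p: "p \<notin> {S :: 'd set. card S = 0} \<times> L"
    have "KE x \<in> forms L 0" using x KE_forms by simp
    then show "KE x p = 0" using p by (cases p) (auto simp: forms_def)
  qed (use L_finite in simp)
qed

text \<open>In degree zero only \<open>S = {}\<close> occurs, and the component of the differential
  at \<open>{i}\<close> is \<open>t_i\<close> times the component there, which can be cancelled in a
  domain.\<close>

lemma koszul_inj_forms_0:
  fixes \<eta> \<theta> :: "'d set \<times> nat \<Rightarrow> 'd Uh"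
  assumes "\<eta> \<in> forms L 0" "\<theta> \<in> forms L 0" "koszul \<eta> = koszul \<theta>"
  shows "\<eta> = \<theta>"
proof (rule pair_ext)
  fix S :: "'d set" and l
  show "\<eta> (S, l) = \<theta> (S, l)"
  proof (cases "S = {}")
    case True
    obtain i :: 'd where True by simp
    have "koszul \<eta> ({i}, l) = koszul \<theta> ({i}, l)" using assms(3) by simp
    then show ?thesis using True by (simp add: koszul_apply)
  next
    case False
    then have "\<eta> (S, l) = 0" "\<theta> (S, l) = 0" using assms(1,2) by (auto simp: forms_def)
    then show ?thesis by simp
  qed
qed

section \<open>The isomorphism \<open>\<pi>_0\<close> and the free module
  \<open>L_d(P,1)\<close>\<close>

lemma diff_pi_0_bij: "bij_betw (diff_pi P 0) (carrier (F_ext P 0)) (carrier (L_mod P 1))"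
  unfolding bij_betw_def
proof
  show "inj_on (diff_pi P 0) (carrier (F_ext P 0))"
  proof (rule inj_onI)
    fix X Y assume XY: "X \<in> carrier (F_ext P 0)" "Y \<in> carrier (F_ext P 0)" "diff_pi P 0 X = diff_pi P 0 Y"
    then have "koszul (KE X) = koszul (KE Y)" using KE_diff_pi(2)[OF XY(1)] KE_diff_pi(2)[OF XY(2)] by simp
    then have "KE X = KE Y" using koszul_inj_forms_0 KE_forms XY by blast
    then show "X = Y" using KE_eq XY by blast
  qed
qed (simp add: L_mod_carrier(1))

definition pi_inv where "pi_inv = inv_into (carrier (F_ext P 0)) (diff_pi P 0)"

lemma pi_inv: 
  assumes "Y \<in> carrier (L_mod P 1)"
  shows "pi_inv Y \<in> carrier (F_ext P 0)" "diff_pi P 0 (pi_inv Y) = Y"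
  using assms diff_pi_0_bij inv_into_into[of Y "diff_pi P 0"] f_inv_into_f[of Y "diff_pi P 0"]
  unfolding pi_inv_def bij_betw_def by auto

lemma pi_invI: "X \<in> carrier (F_ext P 0) \<Longrightarrow> diff_pi P 0 X = Y \<Longrightarrow> pi_inv Y = X"
  using diff_pi_0_bij unfolding pi_inv_def by (auto simp: bij_betw_def inv_into_f_f)

lemma pi_inv_eqI:
  assumes "Y \<in> carrier (L_mod P 1)" "X \<in> carrier (F_ext P 0)" "koszul (KE X) = KE Y"
  shows "pi_inv Y = X"
proof (rule pi_invI[OF assms(2)])
  have "Y \<in> carrier (F_ext P (Suc 0))" using assms(1) L_mod_carrier(2)[of 1] by auto
  then show "diff_pi P 0 X = Y" using KE_eq[OF KE_diff_pi(1)[OF assms(2)]] KE_diff_pi(2)[OF assms(2)] assms(3) by simp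
qed

lemma KE_pi_inv: "Y \<in> carrier (L_mod P 1) \<Longrightarrow> koszul (KE (pi_inv Y)) = KE Y"
  using KE_diff_pi(2)[OF pi_inv(1)[of Y]] pi_inv(2)[of Y] by simp

text \<open>As a subspace of one-forms, \<open>L_d(P,1)\<close> has coordinates \<open>KE\<close>
  that do not exhibit a basis. The coordinates of the unique primitive \<open>pi_inv Y\<close> do,
  since every zero-form occurs.\<close>

lemma L1_free: "free_module type_ring (Uh_module (L_mod P 1))"
proof -
  interpret c: coord_module "Uh_module (L_mod P 1)" KE by (rule L_mod_coords(2)) simp
  let ?U = "Uh_module (L_mod P 1)"
  have kI: "KE (pi_inv Y) = \<eta>" if "Y \<in> carrier (L_mod P 1)" "\<eta> \<in> forms L 0" "KE Y = koszul \<eta>" for Y \<eta>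
    using koszul_inj_forms_0[OF KE_forms[OF pi_inv(1)[OF that(1)]] that(2)] KE_pi_inv[OF that(1)] that(3) by simp
  have f: "KE (pi_inv Y) \<in> forms L 0" if "Y \<in> carrier (L_mod P 1)" for Y
    using KE_forms[OF pi_inv(1)[OF that]] .
  interpret d: coord_module ?U "\<lambda>Y. KE (pi_inv Y)"
  proof
    show "inj_on (\<lambda>Y. KE (pi_inv Y)) (carrier ?U)"
    proof (rule inj_onI)
      fix Y Z assume YZ: "Y \<in> carrier ?U" "Z \<in> carrier ?U" "KE (pi_inv Y) = KE (pi_inv Z)"
      then show "Y = Z" using c.K_eq[OF YZ(1,2)] KE_pi_inv[of Y] KE_pi_inv[of Z] by simp
    qed
    show "KE (pi_inv \<zero>\<^bsub>?U\<^esub>) = 0"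
      by (rule kI) (use c.zero_closed c.K_zero submodD(1)[OF forms_submod] in auto)
    show "KE (pi_inv (x \<oplus>\<^bsub>?U\<^esub> y)) = KE (pi_inv x) + KE (pi_inv y)" if "x \<in> carrier ?U" "y \<in> carrier ?U" for x y
      by (rule kI) (use that c.add_closed[OF that] c.K_add[OF that] f in
          \<open>auto simp: koszul_add KE_pi_inv intro!: submodD(2)[OF forms_submod]\<close>)
    show "KE (pi_inv (g \<odot>\<^bsub>?U\<^esub> x)) = g \<star> KE (pi_inv x)" if "x \<in> carrier ?U" for g x
      by (rule kI) (use that c.smult_closed[OF that] c.K_smult[OF that] f in
          \<open>auto simp: koszul_scale KE_pi_inv intro!: submodD(3)[OF forms_submod]\<close>)
  qed (rule c.zero_closed c.add_closed c.smult_closed; assumption)+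
  show ?thesis
  proof (rule d.free_module_coords[of "{S :: 'd set. card S = 0} \<times> L"])
    fix p :: "'d set \<times> nat" assume "p \<in> {S. card S = 0} \<times> L"
    then have u: "form_unit p \<in> forms L 0" by (auto intro!: form_unit_forms)
    obtain X where X: "X \<in> carrier (F_ext P 0)" "KE X = form_unit p" using KE_surj[OF u] by blast
    have "diff_pi P 0 X \<in> carrier (L_mod P 1)" using X by (simp add: L_mod_carrier(1))
    moreover have "pi_inv (diff_pi P 0 X) = X" by (rule pi_invI[OF X(1) refl])
    ultimately show "\<exists>x\<in>carrier ?U. KE (pi_inv x) = (\<lambda>k. if k = p then 1 else 0)"
      using X(2) unfolding form_unit_def by (intro bexI[of _ "diff_pi P 0 X"]) auto
  next
    fix x p assume x: "x \<in> carrier ?U" and p: "p \<notin> {S :: 'd set. card S = 0} \<times> L"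
    then show "KE (pi_inv x) p = 0" using f[of x] by (cases p) (auto simp: forms_def)
  qed (use L_finite in simp)
qed

text \<open>With \<open>w = \<Sum> u_j t_j\<close> and \<open>\<sigma>\<close> the shift by
  \<open>r\<close>, the component at \<open>{i}\<close> reduces to
  \<open>t_i \<sigma>(w) = \<sigma>(w t_i) + r_i \<sigma>(w)\<close>, which holds because
  \<open>\<sigma>(t_i) = t_i - r_i\<close>. The correction \<open>r_i \<sigma>(w)\<close> comes from
  the matrix \<open>outer r u\<close> acting on one-forms; on zero-forms that matrix acts
  trivially.\<close>

lemma koszul_act_coord:
  assumes \<omega>: "\<omega> \<in> forms L 0"
  shows "koszul (act_coord u r \<omega>) = act_coord u r (koszul \<omega>)"
proof (rule pair_ext)
  fix S l
  define z where "z = lift (\<lambda>l. \<omega> ({}, l))"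
  define w where "w = witt_poly u"
  have z: "z \<in> carrier P" "\<kappa> z = (\<lambda>l. \<omega> ({}, l))" using forms_lift[OF \<omega>, of "{}"] by (simp_all add: z_def)
  have \<omega>0: "\<omega> (T, l) = 0" if "T \<noteq> {}" for T l using \<omega> that by (auto simp: forms_def)
  have lift0: "lift (\<lambda>l. 0) = \<zero>\<^bsub>P\<^esub>" using lift_\<kappa>[OF zero_closed] by (simp add: \<kappa>_zero zero_fun_def)
  have a0: "act_coord u r \<omega> (T, l) = (if T = {} then \<kappa> (xa r (ha w z)) l else 0)" for T l
  proof -
    have "(\<Sum>S'\<in>UNIV. hconst (gl_coeff (outer r u) S' T) * \<kappa> (xa r (lift (\<lambda>l. \<omega> (S', l)))) l) = 0"
    proof (rule sum.neutral, rule ballI)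
      fix S'
      show "hconst (gl_coeff (outer r u) S' T) * \<kappa> (xa r (lift (\<lambda>l. \<omega> (S', l)))) l = 0"
        by (cases "S' = {}") (simp_all add: gl_coeff_empty \<omega>0 lift0 xa_zero \<kappa>_zero zero_fun_apply)
    qed
    then show ?thesis
      by (cases "T = {}") (simp_all add: act_coord_def z_def w_def \<omega>0 lift0 ha_zero xa_zero \<kappa>_zero zero_fun_apply)
  qed
  have k0: "koszul \<omega> (T, l) = (\<Sum>j\<in>T. if T = {j} then hvar j * \<kappa> z l else 0)" for T l
    unfolding koszul_apply
  proof (rule sum.cong[OF refl])
    fix j assume j: "j \<in> T"
    show "hconst (esign j T) * hvar j * \<omega> (T - {j}, l) = (if T = {j} then hvar j * \<kappa> z l else 0)"
    proof (cases "T = {j}")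
      case True then show ?thesis by (simp add: z esign_single)
    next
      case False
      then have "T - {j} \<noteq> {}" using j by auto
      then show ?thesis using False by (simp add: \<omega>0)
    qed
  qed
  have k1: "koszul \<omega> ({j}, l) = hvar j * \<kappa> z l" for j l by (simp add: k0)
  have k2: "koszul \<omega> (T, l) = 0" if "\<And>j. T \<noteq> {j}" for T l unfolding k0 by (rule sum.neutral) (use that in auto)
  have lk: "lift (\<lambda>l. koszul \<omega> ({j}, l)) = ha (hvar j) z" for j
    using lift_\<kappa>[OF ha_closed[OF z(1)], of "hvar j"] by (simp add: k1 \<kappa>_ha z(1) fscale_def)
  have lk0: "lift (\<lambda>l. koszul \<omega> (T, l)) = \<zero>\<^bsub>P\<^esub>" if "\<And>j. T \<noteq> {j}" for T
    using that by (simp add: k2 lift0)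
  have sum1: "(\<Sum>S'\<in>UNIV. hconst (gl_coeff (outer r u) S' S) * \<kappa> (xa r (lift (\<lambda>l. koszul \<omega> (S', l)))) l)
    = (\<Sum>j\<in>UNIV. hconst (gl_coeff (outer r u) {j} S) * \<kappa> (xa r (ha (hvar j) z)) l)"
  proof -
    have "(\<Sum>S'\<in>UNIV. hconst (gl_coeff (outer r u) S' S) * \<kappa> (xa r (lift (\<lambda>l. koszul \<omega> (S', l)))) l)
      = (\<Sum>S'\<in>range (\<lambda>j. {j}). hconst (gl_coeff (outer r u) S' S) * \<kappa> (xa r (lift (\<lambda>l. koszul \<omega> (S', l)))) l)"
    proof (rule sum.mono_neutral_right)
      show "\<forall>S'\<in>UNIV - range (\<lambda>j. {j}). hconst (gl_coeff (outer r u) S' S) * \<kappa> (xa r (lift (\<lambda>l. koszul \<omega> (S', l)))) l = 0"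
      proof
        fix S' :: "'d set" assume "S' \<in> UNIV - range (\<lambda>j. {j})"
        then have "lift (\<lambda>l. koszul \<omega> (S', l)) = \<zero>\<^bsub>P\<^esub>" by (intro lk0) auto
        then show "hconst (gl_coeff (outer r u) S' S) * \<kappa> (xa r (lift (\<lambda>l. koszul \<omega> (S', l)))) l = 0"
          by (simp add: xa_zero \<kappa>_zero zero_fun_apply)
      qed
    qed auto
    also have "\<dots> = (\<Sum>j\<in>UNIV. hconst (gl_coeff (outer r u) {j} S) * \<kappa> (xa r (ha (hvar j) z)) l)"
      by (subst sum.reindex) (auto simp: lk)
    finally show ?thesis .
  qed
  show "koszul (act_coord u r \<omega>) (S, l) = act_coord u r (koszul \<omega>) (S, l)"
  proof (cases "\<exists>i. S = {i}")
    case True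
    then obtain i where S: "S = {i}" by blast
    let ?\<sigma> = "shift_poly r"
    have x: "\<kappa> (xa r (ha f z)) = ?\<sigma> f \<star> \<kappa> (xa r z)" for f
      by (simp add: xa_ha z(1) \<kappa>_ha xa_closed)
    have "koszul (act_coord u r \<omega>) (S, l) = hvar i * (?\<sigma> w * \<kappa> (xa r z) l)"
      unfolding S by (simp add: koszul_apply a0 x fscale_apply)
    moreover have "\<kappa> (xa r (ha w (lift (\<lambda>l. koszul \<omega> (S, l))))) l = ?\<sigma> (w * hvar i) * \<kappa> (xa r z) l"
      unfolding S lk ha_mult[OF z(1), symmetric] x by (simp add: fscale_apply)
    moreover have "(\<Sum>j\<in>UNIV. hconst (gl_coeff (outer r u) {j} S) * \<kappa> (xa r (ha (hvar j) z)) l)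
      = of_int (r $ i) * ?\<sigma> w * \<kappa> (xa r z) l"
    proof -
      have "(\<Sum>j\<in>UNIV. hconst (gl_coeff (outer r u) {j} S) * \<kappa> (xa r (ha (hvar j) z)) l)
        = (\<Sum>j\<in>UNIV. of_int (r $ i) * (?\<sigma> (hconst (u $ j) * hvar j) * \<kappa> (xa r z) l))"
        unfolding S gl_coeff_single x
        by (rule sum.cong) (simp_all add: outer_def hconst_mult hconst_of_int shift_poly_hom fscale_apply mult.assoc left_diff_distrib)
      also have "\<dots> = of_int (r $ i) * ?\<sigma> w * \<kappa> (xa r z) l"
        unfolding w_def witt_poly_def shift_poly_hom(5)
        by (simp add: sum_distrib_left sum_distrib_right mult.assoc)
      finally show ?thesis .
    qed
    ultimately show ?thesis unfolding act_coord_def case_prod_conv sum1 w_def[symmetric]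
      by (simp add: shift_poly_hom algebra_simps)
  next
    case False
    have "koszul (act_coord u r \<omega>) (S, l) = 0"
      unfolding koszul_apply a0 by (rule sum.neutral) (use False in auto)
    moreover have "gl_coeff (outer r u) {j} S = 0" for j
    proof (rule ccontr)
      assume "gl_coeff (outer r u) {j} S \<noteq> 0"
      then have "card S = 1" using gl_coeff_card by fastforce
      then show False using False by (auto simp: card_1_singleton_iff)
    qed
    moreover have "lift (\<lambda>l. koszul \<omega> (S, l)) = \<zero>\<^bsub>P\<^esub>" by (rule lk0) (use False in auto)
    ultimately show ?thesis unfolding act_coord_def case_prod_conv sum1
      by (simp add: ha_zero xa_zero \<kappa>_zero zero_fun_apply)
  qed
qed

lemma diff_pi_0_act:
  assumes "X \<in> carrier (F_ext P 0)"
  shows "diff_pi P 0 (act (F_ext P 0) u r X) = act (F_ext P 1) u r (diff_pi P 0 X)"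
proof -
  note a = KE_act[OF assms, of u r] and b = KE_diff_pi[OF assms]
  note c = KE_diff_pi[OF a(1)] and d = KE_act[OF b(1), of u r]
  have "KE (diff_pi P 0 (act (F_ext P 0) u r X)) = KE (act (F_ext P (Suc 0)) u r (diff_pi P 0 X))"
    unfolding c(2) d(2) a(2) b(2) by (rule koszul_act_coord[OF KE_forms[OF assms]])
  from KE_eq[OF c(1) d(1) this] show ?thesis by simp
qed

lemma L1_iso_F0: "witt_isomorphic (L_mod P 1) (F_ext P 0)"
proof -
  have LF: "\<And>Y. Y \<in> carrier (L_mod P 1) \<Longrightarrow> Y \<in> carrier (F_ext P 1)" using L_mod_carrier(2)[of 1] by auto
  have ops: "(\<oplus>\<^bsub>L_mod P 1\<^esub>) = (\<oplus>\<^bsub>F_ext P 1\<^esub>)" "c \<odot>\<^bsub>L_mod P 1\<^esub> x = c \<odot>\<^bsub>F_ext P 1\<^esub> x"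
    "act (L_mod P 1) = act (F_ext P 1)" for c x by (simp_all add: L_mod_def)
  interpret c: coord_module "Uh_module (L_mod P 1)" KE by (rule L_mod_coords(2)) simp
  have "pi_inv \<in> module_hom type_ring (L_mod P 1) (F_ext P 0)"
    unfolding module_hom_def mem_Collect_eq
  proof (intro conjI allI impI, rule funcsetI, rule pi_inv(1), assumption)
    fix x y assume "x \<in> carrier (L_mod P 1) \<and> y \<in> carrier (L_mod P 1)"
    then have x: "x \<in> carrier (L_mod P 1)" and y: "y \<in> carrier (L_mod P 1)" by auto
    note a = T.KT_add[of "pi_inv x" 0 "pi_inv y", folded carrier_F add_F, OF pi_inv(1)[OF x] pi_inv(1)[OF y]]
    show "pi_inv (x \<oplus>\<^bsub>L_mod P 1\<^esub> y) = pi_inv x \<oplus>\<^bsub>F_ext P 0\<^esub> pi_inv y"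
    proof (rule pi_inv_eqI)
      show "x \<oplus>\<^bsub>L_mod P 1\<^esub> y \<in> carrier (L_mod P 1)" using c.add_closed[of x y] x y by simp
      show "pi_inv x \<oplus>\<^bsub>F_ext P 0\<^esub> pi_inv y \<in> carrier (F_ext P 0)" by (rule a(1))
      show "koszul (KE (pi_inv x \<oplus>\<^bsub>F_ext P 0\<^esub> pi_inv y)) = KE (x \<oplus>\<^bsub>L_mod P 1\<^esub> y)"
        using c.K_add[of x y] x y by (simp add: a(2) koszul_add KE_pi_inv)
    qed
  next
    fix s :: complex and x assume "s \<in> carrier type_ring \<and> x \<in> carrier (L_mod P 1)"
    then have x: "x \<in> carrier (L_mod P 1)" by auto
    note a = KE_smult[OF pi_inv(1)[OF x], of s]
    have sx: "s \<odot>\<^bsub>L_mod P 1\<^esub> x = hconst s \<odot>\<^bsub>Uh_module (L_mod P 1)\<^esub> x" by (rule L_mod_coords(3)[OF _ x]) simp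
    show "pi_inv (s \<odot>\<^bsub>L_mod P 1\<^esub> x) = s \<odot>\<^bsub>F_ext P 0\<^esub> pi_inv x"
    proof (rule pi_inv_eqI)
      show "s \<odot>\<^bsub>L_mod P 1\<^esub> x \<in> carrier (L_mod P 1)" unfolding sx using c.smult_closed[of x] x by simp
      show "koszul (KE (s \<odot>\<^bsub>F_ext P 0\<^esub> pi_inv x)) = KE (s \<odot>\<^bsub>L_mod P 1\<^esub> x)"
        unfolding sx using c.K_smult[of x "hconst s"] x by (simp add: a(2) koszul_scale KE_pi_inv)
    qed (rule a(1))
  qed
  moreover have "bij_betw pi_inv (carrier (L_mod P 1)) (carrier (F_ext P 0))"
    unfolding pi_inv_def by (rule bij_betw_inv_into[OF diff_pi_0_bij])
  moreover have "pi_inv (act (L_mod P 1) u r x) = act (F_ext P 0) u r (pi_inv x)" if x: "x \<in> carrier (L_mod P 1)" for u r x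
  proof (rule pi_invI)
    show "act (F_ext P 0) u r (pi_inv x) \<in> carrier (F_ext P 0)" by (rule KE_act(1)[OF pi_inv(1)[OF x]])
    show "diff_pi P 0 (act (F_ext P 0) u r (pi_inv x)) = act (L_mod P 1) u r x"
      unfolding diff_pi_0_act[OF pi_inv(1)[OF x]] pi_inv(2)[OF x] ops ..
  qed
  ultimately show ?thesis unfolding witt_isomorphic_def by blast
qed

end

theorem lemma5p9:
  fixes P :: "('d::{finite,linorder} laurent \<Rightarrow> 'd laurent, 'p) module"
    and r :: nat
  assumes "simple_left_module weyl_algebra P"
    and "finitely_generated type_ring (Uh_module (weyl_to_witt P))"
    and "has_rank (Uh_module (weyl_to_witt P)) r"
  shows "(\<forall>i\<in>{1..CARD('d)}.
            has_rank (Uh_module (L_mod P i)) (r * ((CARD('d) - 1) choose (i - 1))) \<and>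
            has_rank (Uh_module (L_tilde_mod P i)) (r * ((CARD('d) - 1) choose (i - 1)))) \<and>
         (\<forall>i\<in>{1..CARD('d)}.
            has_dim type_ring
              (quotient_module (L_mod P i) (ideal_times I0 (Uh_module (L_mod P i))))
              (r * (CARD('d) choose (i - 1)))) \<and>
         (witt_isomorphic (L_mod P 1) (F_ext P 0) \<and>
          free_module type_ring (Uh_module (L_mod P 1)) \<and>
          free_module type_ring (Uh_module (F_ext P 0))) \<and>
         (\<forall>i\<in>{2..CARD('d)}. \<not> free_module type_ring (Uh_module (L_mod P i)))"
proof -
  interpret simple_weyl_module P
    by (intro simple_weyl_module.intro weyl_module.intro simple_weyl_module_axioms.intro)
      (use assms in \<open>simp_all add: simple_left_module_def\<close>)
  obtain L and \<kappa> :: "'p \<Rightarrow> nat \<Rightarrow> 'd Uh" where "finite L" "bij_betw \<kappa> (carrier P) {f. \<forall>l. l \<notin> L \<longrightarrow> f l = 0}"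
    "\<And>y z. y \<in> carrier P \<Longrightarrow> z \<in> carrier P \<Longrightarrow> \<kappa> (y \<oplus>\<^bsub>P\<^esub> z) = \<kappa> y + \<kappa> z"
    "\<And>f z. z \<in> carrier P \<Longrightarrow> \<kappa> (ha f z) = f \<star> \<kappa> z"
    using free_coords by blast
  then interpret free_weyl_module P L \<kappa>
    by (intro free_weyl_module.intro free_weyl_module_axioms.intro weyl_module_axioms)
  \<comment> \<open>The basis found by \<open>free_coords\<close> computes the rank, and the
    dimension over the fraction field is unique.\<close>
  have r: "r = card L"
    using has_rank_Q assms(3) has_dim_unique unfolding has_rank_def by blast
  \<comment> \<open>A simple module is nonzero, so \<open>r > 0\<close>. This allows
    \<open>r\<close> to be cancelled when rank and fibre dimension are compared in part (4).\<close>
  have "L \<noteq> {}"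
  proof
    assume "L = {}"
    then have "z = \<zero>\<^bsub>P\<^esub>" if "z \<in> carrier P" for z
      using \<kappa>_inj[OF that zero_closed] \<kappa>_supp[OF that] \<kappa>_zero by (auto simp: fun_eq_iff zero_fun_apply)
    then have "carrier P = {\<zero>\<^bsub>P\<^esub>}" by auto
    then show False using assms(1) by (simp add: simple_left_module_def)
  qed
  then show ?thesis unfolding r
    using has_rank_L_mod has_rank_L_tilde_mod has_dim_L_mod L1_iso_F0 L1_free F0_free L_mod_not_free by auto
qed

end
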